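(* Let $d\ge2$, let $\beta>0$ be fixed independently of $N$, put $\theta=\beta N^{2/d}$, and let $V$ satisfy $\int_{\mathbb R^d}e^{-\min(1,\theta)V}<\infty$ and $V+\mathsf g\to+\infty$ as $|x|\to\infty$. For each $N$ let $\mu(x)=\mu_\theta(N^{-1/d}x)$ be the blown-up thermal equilibrium measure and $\Sigma$ (depending on $N$) a set in which $0<m\le\mu\le\Lambda$, with $m,\Lambda$ independent of $N$. If $d=2$, assume also that for some constant $C_1$ independent of $N$: $\mu(\Sigma^c)\le C_1N/\log N$, $\iint\mathsf g(x-y)d\mu(x)d\mu(y)\ge-C_1N^2\log N$, and $\int\log|z|\,d\mu(z)<\infty$. Then there is a constant $C>0$ (independent of $N$) such that for every point $x\in\Sigma$ ($x$ may depend on $N$) with $$\operatorname{dist}(x,\partial\Sigma)\ge C N^{\frac1{d+2}},$$ the law under $\mathbb P_{N,\beta}$ of the point configuration $\{x_1'-x,\dots,x_N'-x\}$, where $x_i'=N^{1/d}x_i$, converges as $N\to\infty$, up to extraction of a subsequence, to a limiting point process with simple points and finite correlation functions of all orders.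
   Context: Coulomb kernel: $\mathsf g(x)=-\log|x|$ if $d=2$, $\mathsf g(x)=|x|^{2-d}$ if $d\ge3$. Gibbs measure: $\mathcal H_N(X_N)=\frac12\sum_{i\ne j}\mathsf g(x_i-x_j)+N\sum_{i=1}^NV(x_i)$ for $X_N=(x_1,\dots,x_N)\in(\mathbb R^d)^N$, and $d\mathbb P_{N,\beta}(X_N)=\frac1{Z_{N,\beta}}\exp(-\beta N^{\frac2d-1}\mathcal H_N(X_N))\,dX_N$, with $Z_{N,\beta}$ the normalizing constant. Thermal equilibrium measure: $\mu_\theta$ is the minimizer among probability densities on $\mathbb R^d$ of $\frac12\iint\mathsf g(x-y)d\mu(x)d\mu(y)+\int V\,d\mu+\frac1\theta\int\mu\log\mu$. The measure and its density are denoted by the same letter. Convergence is weak convergence of probability measures on the space $\mathcal X(\mathbb R^d)$ of locally finite point configurations (purely atomic Radon measures with integer masses), endowed with the vague topology (convergence against compactly supported continuous functions). "Simple points" means almost surely no multiple points. *)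

theory Defs
  imports "HOL-Probability.Probability"
begin

section \<open>Coulomb gas\<close>

text \<open>The junk value of the kernel at the origin is irrelevant: in the Hamiltonian and in the
  interaction energy it only matters on a Lebesgue null set.\<close>

definition coulomb_kernel :: "'a::euclidean_space \<Rightarrow> real" where
  "coulomb_kernel x =
     (if DIM('a) = 2 then - ln (norm x) else norm x powr (2 - real DIM('a)))"

definition hamiltonian :: "('a::euclidean_space \<Rightarrow> real) \<Rightarrow> nat \<Rightarrow> (nat \<Rightarrow> 'a) \<Rightarrow> real" where
  "hamiltonian V N X =
     1/2 * (\<Sum>i<N. \<Sum>j\<in>{..<N} - {i}. coulomb_kernel (X i - X j)) + real N * (\<Sum>i<N. V (X i))"

definition gibbs_weight ::
    "('a::euclidean_space \<Rightarrow> real) \<Rightarrow> real \<Rightarrow> nat \<Rightarrow> (nat \<Rightarrow> 'a) \<Rightarrow> real" where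
  "gibbs_weight V \<beta> N X =
     exp (- \<beta> * real N powr (2 / real DIM('a) - 1) * hamiltonian V N X)"

definition partition_function :: "('a::euclidean_space \<Rightarrow> real) \<Rightarrow> real \<Rightarrow> nat \<Rightarrow> ennreal" where
  "partition_function V \<beta> N =
     (\<integral>\<^sup>+X. ennreal (gibbs_weight V \<beta> N X) \<partial>(\<Pi>\<^sub>M i\<in>{..<N}. lborel))"

definition gibbs_measure ::
    "('a::euclidean_space \<Rightarrow> real) \<Rightarrow> real \<Rightarrow> nat \<Rightarrow> (nat \<Rightarrow> 'a) measure" where
  "gibbs_measure V \<beta> N =
     density (\<Pi>\<^sub>M i\<in>{..<N}. lborel)
       (\<lambda>X. ennreal (gibbs_weight V \<beta> N X) / partition_function V \<beta> N)"


section \<open>Thermal equilibrium measure\<close>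

definition prob_density :: "('a::euclidean_space \<Rightarrow> real) \<Rightarrow> bool" where
  "prob_density \<rho> \<longleftrightarrow>
     \<rho> \<in> borel_measurable borel \<and> (\<forall>x. 0 \<le> \<rho> x) \<and> (\<integral>\<^sup>+x. ennreal (\<rho> x) \<partial>lborel) = 1"

definition interaction_energy :: "('a::euclidean_space \<Rightarrow> real) \<Rightarrow> real" where
  "interaction_energy \<rho> =
     (\<integral>(x, y). coulomb_kernel (x - y) * \<rho> x * \<rho> y \<partial>(lborel \<Otimes>\<^sub>M lborel))"

text \<open>The potential and the entropy terms are kept under one integral sign. The functional is then
  also meaningful for densities for which the two terms separately are infinite with opposite
  signs, as happens for slowly growing potentials, e.g. for
  \<open>\<theta> = 1\<close> and \<open>V x = d * ln (norm x) + 2 * ln (ln (norm x))\<close> near infinity.\<close>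

definition free_energy :: "real \<Rightarrow> ('a::euclidean_space \<Rightarrow> real) \<Rightarrow> ('a \<Rightarrow> real) \<Rightarrow> real" where
  "free_energy \<theta> V \<rho> =
     1/2 * interaction_energy \<rho> + (\<integral>x. V x * \<rho> x + 1/\<theta> * (\<rho> x * ln (\<rho> x)) \<partial>lborel)"

text \<open>Densities at which the functional is a well-defined real number. Where it is \<open>+\<infinity>\<close>, a
  density does not matter for minimization; and if it is \<open>-\<infinity>\<close> somewhere, then truncation
  shows that it is unbounded below on the densities considered here.\<close>

definition finite_free_energy :: "real \<Rightarrow> ('a::euclidean_space \<Rightarrow> real) \<Rightarrow> ('a \<Rightarrow> real) \<Rightarrow> bool" where
  "finite_free_energy \<theta> V \<rho> \<longleftrightarrow>
     integrable (lborel \<Otimes>\<^sub>M lborel) (\<lambda>(x, y). coulomb_kernel (x - y) * \<rho> x * \<rho> y) \<and>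
     integrable lborel (\<lambda>x. V x * \<rho> x + 1/\<theta> * (\<rho> x * ln (\<rho> x)))"

definition thermal_equilibrium ::
    "real \<Rightarrow> ('a::euclidean_space \<Rightarrow> real) \<Rightarrow> ('a \<Rightarrow> real) \<Rightarrow> bool" where
  "thermal_equilibrium \<theta> V \<mu> \<longleftrightarrow>
     prob_density \<mu> \<and> finite_free_energy \<theta> V \<mu> \<and>
     (\<forall>\<rho>. prob_density \<rho> \<and> finite_free_energy \<theta> V \<rho> \<longrightarrow>
        free_energy \<theta> V \<mu> \<le> free_energy \<theta> V \<rho>)"

text \<open>No Jacobian factor: the blown-up density has total mass \<open>N\<close>.\<close>

definition blown_up :: "nat \<Rightarrow> ('a::euclidean_space \<Rightarrow> real) \<Rightarrow> 'a \<Rightarrow> real" where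
  "blown_up N \<rho> x = \<rho> (real N powr (- 1 / real DIM('a)) *\<^sub>R x)"


section \<open>Point configurations with the vague topology\<close>

text \<open>On a Euclidean space, the Radon measures are the Borel measures that are finite on compact
  sets.\<close>

typedef (overloaded) ('a::euclidean_space) configuration =
  "{M :: 'a measure. sets M = sets borel \<and>
      (\<forall>K. compact K \<longrightarrow> emeasure M K < \<infinity>) \<and>
      (\<exists>m :: 'a \<Rightarrow> nat. \<forall>A\<in>sets borel.
         emeasure M A = (\<integral>\<^sup>+x. of_nat (m x) * indicator A x \<partial>count_space UNIV))}"
proof
  show "null_measure borel \<in> {M :: 'a measure. sets M = sets borel \<and>
      (\<forall>K. compact K \<longrightarrow> emeasure M K < \<infinity>) \<and>
      (\<exists>m :: 'a \<Rightarrow> nat. \<forall>A\<in>sets borel.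
         emeasure M A = (\<integral>\<^sup>+x. of_nat (m x) * indicator A x \<partial>count_space UNIV))}"
    by (auto intro!: exI[of _ "\<lambda>_. 0"])
qed

instantiation configuration :: (euclidean_space) topological_space
begin

definition open_configuration :: "'a configuration set \<Rightarrow> bool" where
  "open_configuration =
     generate_topology
       {{\<xi>. (\<integral>x. f x \<partial>Rep_configuration \<xi>) \<in> U} | (f :: 'a \<Rightarrow> real) U.
          continuous_on UNIV f \<and> (\<exists>K. compact K \<and> (\<forall>x. x \<notin> K \<longrightarrow> f x = 0)) \<and> open U}"

instance
  by standard
    (auto simp: open_configuration_def
      intro: generate_topology.UNIV generate_topology.Int generate_topology.UN)

end

text \<open>The sum of the Dirac masses at \<open>p i\<close>, \<open>i < N\<close>, points being counted with multiplicity.\<close>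

definition configuration_of :: "nat \<Rightarrow> (nat \<Rightarrow> 'a::euclidean_space) \<Rightarrow> 'a configuration" where
  "configuration_of N p = Abs_configuration (distr (count_space {..<N}) borel p)"

lemma Rep_configuration_of:
  "Rep_configuration (configuration_of N p) = distr (count_space {..<N}) borel p"
proof -
  let ?M = "distr (count_space {..<N}) borel p"
  have em: "emeasure ?M A = of_nat (card {i\<in>{..<N}. p i \<in> A})" if "A \<in> sets borel" for A
  proof -
    have "emeasure ?M A = emeasure (count_space {..<N}) (p -` A \<inter> {..<N})"
      using that by (simp add: emeasure_distr)
    also have "p -` A \<inter> {..<N} = {i\<in>{..<N}. p i \<in> A}" by auto
    also have "emeasure (count_space {..<N}) \<dots> = of_nat (card {i\<in>{..<N}. p i \<in> A})"
      by (subst emeasure_count_space) auto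
    finally show ?thesis .
  qed
  have "emeasure ?M A =
      (\<integral>\<^sup>+x. of_nat (card {i\<in>{..<N}. p i = x}) * indicator A x \<partial>count_space UNIV)"
    if "A \<in> sets borel" for A
  proof -
    have "(\<integral>\<^sup>+x. of_nat (card {i\<in>{..<N}. p i = x}) * indicator A x \<partial>count_space UNIV) =
        (\<Sum>x\<in>p ` {..<N}. (of_nat (card {i\<in>{..<N}. p i = x}) * indicator A x :: ennreal))"
      by (rule nn_integral_count_space') auto
    also have "\<dots> = (\<Sum>x\<in>p ` {..<N}. (of_nat (card {i\<in>{i\<in>{..<N}. p i \<in> A}. p i = x})))"
    proof (rule sum.cong[OF refl])
      fix x
      have "{i\<in>{i\<in>{..<N}. p i \<in> A}. p i = x} = (if x \<in> A then {i\<in>{..<N}. p i = x} else {})"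
        by auto
      then show "(of_nat (card {i\<in>{..<N}. p i = x}) * indicator A x :: ennreal) =
          of_nat (card {i\<in>{i\<in>{..<N}. p i \<in> A}. p i = x})"
        by (auto simp: indicator_def)
    qed
    also have "\<dots> = of_nat (\<Sum>x\<in>p ` {..<N}. card {i\<in>{i\<in>{..<N}. p i \<in> A}. p i = x})"
      by simp
    also have "(\<Sum>x\<in>p ` {..<N}. card {i\<in>{i\<in>{..<N}. p i \<in> A}. p i = x}) =
        card {i\<in>{..<N}. p i \<in> A}"
      using sum.group[of "{i\<in>{..<N}. p i \<in> A}" "p ` {..<N}" p "\<lambda>_. 1::nat"] by auto
    finally show ?thesis using em[OF that] by simp
  qed
  moreover have "emeasure ?M K < \<infinity>" if "compact K" for K
    using em[of K] that by (simp add: borel_compact of_nat_less_top)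
  ultimately show ?thesis
    unfolding configuration_of_def by (subst Abs_configuration_inverse) (auto intro: exI)
qed


section \<open>Point processes\<close>

definition point_process :: "'a::euclidean_space configuration measure \<Rightarrow> bool" where
  "point_process P \<longleftrightarrow> prob_space P \<and> sets P = sets borel"

definition weakly_converges ::
    "(nat \<Rightarrow> 'b::topological_space measure) \<Rightarrow> 'b measure \<Rightarrow> bool" where
  "weakly_converges P Q \<longleftrightarrow>
     (\<forall>\<Phi> :: 'b \<Rightarrow> real. continuous_on UNIV \<Phi> \<and> bounded (range \<Phi>) \<longrightarrow>
        (\<lambda>n. \<integral>\<xi>. \<Phi> \<xi> \<partial>P n) \<longlonglongrightarrow> (\<integral>\<xi>. \<Phi> \<xi> \<partial>Q))"

definition simple_process :: "'a::euclidean_space configuration measure \<Rightarrow> bool" where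
  "simple_process P \<longleftrightarrow> (AE \<xi> in P. \<forall>y. emeasure (Rep_configuration \<xi>) {y} \<le> 1)"

text \<open>The sum of \<open>\<phi>\<close> over all \<open>k\<close>-tuples of distinct points of the configuration, a
  point of multiplicity \<open>m\<close> counting as \<open>m\<close> distinct points: the product is the number of
  ways to realize the tuple \<open>y\<close> of locations. Here \<open>-\<close> is truncated subtraction.\<close>

definition sum_over_tuples ::
    "nat \<Rightarrow> ((nat \<Rightarrow> 'a) \<Rightarrow> ennreal) \<Rightarrow> 'a::euclidean_space configuration \<Rightarrow> ennreal" where
  "sum_over_tuples k \<phi> \<xi> =
     (\<integral>\<^sup>+y. (\<Prod>j<k. emeasure (Rep_configuration \<xi>) {y j} - of_nat (card {i. i < j \<and> y i = y j})) * \<phi> y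
        \<partial>count_space ({..<k} \<rightarrow>\<^sub>E UNIV))"

definition correlation_function ::
    "'a::euclidean_space configuration measure \<Rightarrow> nat \<Rightarrow> ((nat \<Rightarrow> 'a) \<Rightarrow> ennreal) \<Rightarrow> bool" where
  "correlation_function P k \<rho> \<longleftrightarrow>
     \<rho> \<in> borel_measurable (\<Pi>\<^sub>M i\<in>{..<k}. lborel) \<and>
     (\<forall>\<phi> \<in> borel_measurable (\<Pi>\<^sub>M i\<in>{..<k}. lborel).
        (\<integral>\<^sup>+\<xi>. sum_over_tuples k \<phi> \<xi> \<partial>P) = (\<integral>\<^sup>+y. \<phi> y * \<rho> y \<partial>(\<Pi>\<^sub>M i\<in>{..<k}. lborel)))"

text \<open>Finiteness is meant both for the values and for the integrals over compact sets, which
  are the factorial moments of the numbers of points.\<close>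

definition finite_correlation_functions :: "'a::euclidean_space configuration measure \<Rightarrow> bool" where
  "finite_correlation_functions P \<longleftrightarrow>
     (\<forall>k\<ge>1. \<exists>\<rho>. correlation_function P k \<rho> \<and> (\<forall>y. \<rho> y < \<infinity>) \<and>
        (\<forall>K. compact K \<longrightarrow>
           (\<integral>\<^sup>+y. \<rho> y * indicator ({..<k} \<rightarrow>\<^sub>E K) y \<partial>(\<Pi>\<^sub>M i\<in>{..<k}. lborel)) < \<infinity>))"

text \<open>The law under the Gibbs measure of the blown-up configuration seen from \<open>x\<close>.\<close>

definition local_law ::
    "('a::euclidean_space \<Rightarrow> real) \<Rightarrow> real \<Rightarrow> nat \<Rightarrow> 'a \<Rightarrow> 'a configuration measure" where
  "local_law V \<beta> N x =
     distr (gibbs_measure V \<beta> N) borel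
       (\<lambda>X. configuration_of N (\<lambda>i. real N powr (1 / real DIM('a)) *\<^sub>R X i - x))"

end

theory Submission
  imports Defs "HOL-Real_Asymp.Real_Asymp"
begin

text \<open>Convolving the kernel isotropically at scale \<open>s = N powr (- 1/d)\<close> lowers every pair
  interaction by a nonnegative function, a rescaling of \<open>excess\<close>, which is integrable and tends to
  infinity at the origin. The Euler--Lagrange equation of the thermal equilibrium measure shows that
  the same convolution raises the potential by only \<open>O(1 / \<theta>)\<close> inside \<open>\<Sigma>\<close>. Averaging the Gibbs weight
  over the displacements of one point therefore costs a bounded factor, and gains a large one when
  the point has a close neighbour. Hence a moment of the number of points in a small ball is at most
  a constant plus half of its supremum over neighbouring balls, and iterating this away from the
  boundary bounds it uniformly in \<open>N\<close>.

  Moving the points of a tuple one after the other bounds the correlation functions as well. The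
  moment bounds give tightness, and the bounds on correlation functions pass to the limit, where
  they show that the factorial moment measures have densities; in particular there is almost surely
  no multiple point.\<close>

section \<open>Lebesgue integration\<close>

text \<open>The scale is dictated by two identities for \<open>s = N powr (- 1/d)\<close>: the
  prefactor of the energy satisfies
  \<open>\<beta> * N powr (2/d - 1) * s powr (2 - d) = \<beta>\<close>, and
  \<open>\<theta> * s\<^sup>2 = \<beta>\<close>. Both the gain from the pairs and the loss from the
  potential are therefore independent of \<open>N\<close>. The loss is controlled only where the
  density is pinched between \<open>m\<close> and \<open>\<Lambda>\<close>, so every displaced point
  has to stay inside \<open>\<Sigma>\<close>; each round of the moment iteration uses up a distance
  \<open>3\<close> and halves what is left of the trivial bound \<open>N^k\<close>, which is how the
  distance to the boundary enters. No metric on the space of configurations is used. A configuration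
  is coded by a sequence of points with flags in a countable product of bounded sets. Along a
  subsequence the codes are realized on one probability space so that they converge almost surely,
  and weak convergence follows because decoding is continuous on admissible codes. Bounds on
  correlation functions are tested against continuous functions of the codes only, and survive the
  limit by Fatou's lemma.\<close>

lemma nn_integral_lborel_affine:
  fixes f :: "'a::euclidean_space \<Rightarrow> ennreal"
  assumes [measurable]: "f \<in> borel_measurable borel" and c: "c \<noteq> 0"
  shows "(\<integral>\<^sup>+x. f x \<partial>lborel) = ennreal (\<bar>c\<bar> ^ DIM('a)) * (\<integral>\<^sup>+x. f (t + c *\<^sub>R x) \<partial>lborel)"
  by (subst lborel_affine[OF c, of t]) (simp add: nn_integral_density nn_integral_distr nn_integral_cmult)

lemma integral_lborel_affine:
  fixes f :: "'a::euclidean_space \<Rightarrow> real"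
  assumes [measurable]: "f \<in> borel_measurable borel" and c: "c \<noteq> 0"
  shows "(\<integral>x. f x \<partial>lborel) = \<bar>c\<bar> ^ DIM('a) * (\<integral>x. f (t + c *\<^sub>R x) \<partial>lborel)"
  by (subst lborel_affine[OF c, of t]) (simp add: integral_density integral_distr)

lemma integrable_lborel_affine_iff:
  fixes f :: "'a::euclidean_space \<Rightarrow> real"
  assumes [measurable]: "f \<in> borel_measurable borel" and c: "c \<noteq> 0"
  shows "integrable lborel (\<lambda>x. f (t + c *\<^sub>R x)) \<longleftrightarrow> integrable lborel f"
proof -
  have "integrable lborel f \<longleftrightarrow> integrable (density (distr lborel borel (\<lambda>x. t + c *\<^sub>R x)) (\<lambda>_. ennreal (\<bar>c\<bar>^DIM('a)))) f"
    by (subst lborel_affine[OF c, of t]) (simp add: ennreal_power)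
  also have "\<dots> \<longleftrightarrow> integrable lborel (\<lambda>x. \<bar>c\<bar>^DIM('a) *\<^sub>R f (t + c *\<^sub>R x))"
    by (subst integrable_density) (auto simp: integrable_distr_eq)
  also have "\<dots> \<longleftrightarrow> integrable lborel (\<lambda>x. f (t + c *\<^sub>R x))"
    using c by (simp add: integrable_mult_right_iff)
  finally show ?thesis ..
qed

lemma AE_lborel_affine:
  fixes P :: "'a::euclidean_space \<Rightarrow> bool"
  assumes c: "c \<noteq> 0" and P: "AE x in lborel. P x"
  shows "AE x in lborel. P (t + c *\<^sub>R x)"
proof -
  obtain N where N: "N \<in> null_sets lborel" "{x. \<not> P x} \<subseteq> N"
    using P by (auto simp: eventually_ae_filter)
  have [measurable]: "N \<in> sets borel" using N(1) by auto
  have "(\<integral>\<^sup>+x. indicator N x \<partial>lborel) = 0" using N(1) by (simp add: null_setsD1)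
  then have "(\<integral>\<^sup>+x. indicator N (t + c *\<^sub>R x) \<partial>lborel) = 0"
    using nn_integral_lborel_affine[of "indicator N" c t] c by auto
  then have "AE x in lborel. indicator N (t + c *\<^sub>R x) = (0::ennreal)"
    by (subst (asm) nn_integral_0_iff_AE) auto
  then show ?thesis
    by eventually_elim (use N(2) in \<open>auto simp: indicator_def split: if_splits\<close>)
qed

lemma compact_support_integrable:
  fixes f :: "'a::euclidean_space \<Rightarrow> real"
  assumes f: "continuous_on UNIV f" and z: "\<And>u. R < norm u \<Longrightarrow> f u = 0"
  shows "integrable lborel f"
proof -
  have "set_integrable lborel (cball 0 R) f"
    unfolding set_integrable_def
    by (rule borel_integrable_compact) (auto intro: continuous_on_subset[OF f])
  moreover have "(\<lambda>x. indicator (cball 0 R) x *\<^sub>R f x) = f"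
    using z by (fastforce simp: indicator_def)
  ultimately show ?thesis by (simp add: set_integrable_def)
qed

text \<open>A fixed box that contains the support gives access to the calculus of integrals over
  \<open>cbox\<close>, in particular to the Leibniz rule.\<close>

lemma LBINT_eq_integral_cbox:
  fixes f :: "'a::euclidean_space \<Rightarrow> real"
  assumes f: "continuous_on UNIV f" and z: "\<And>u. R < norm u \<Longrightarrow> f u = 0"
    and a: "cball 0 R \<subseteq> cbox (-a) a"
  shows "(\<integral>x. f x \<partial>lborel) = integral (cbox (-a) a) f"
proof -
  have "set_integrable lborel (cbox (-a) a) f"
    unfolding set_integrable_def
    by (rule borel_integrable_compact) (auto intro: continuous_on_subset[OF f])
  then have "(\<integral>x. indicator (cbox (-a) a) x *\<^sub>R f x \<partial>lborel) = integral (cbox (-a) a) f"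
    using set_borel_integral_eq_integral(2) by (fastforce simp: set_lebesgue_integral_def)
  moreover have "(\<lambda>x. indicator (cbox (-a) a) x *\<^sub>R f x) = f"
  proof
    fix x show "indicator (cbox (-a) a) x *\<^sub>R f x = f x"
      using z[of x] a by (cases "norm x \<le> R") (auto simp: indicator_def)
  qed
  ultimately show ?thesis by simp
qed

text \<open>The common radius \<open>R\<close> of the supports puts all integrals on one box that
  does not depend on \<open>s\<close>, where the Leibniz rule applies.\<close>

lemma LBINT_has_derivative:
  fixes f fx :: "real \<Rightarrow> 'a::euclidean_space \<Rightarrow> real"
  assumes d: "\<And>s u. s \<in> U \<Longrightarrow> ((\<lambda>s. f s u) has_real_derivative fx s u) (at s within U)"
    and c: "continuous_on (U \<times> UNIV) (\<lambda>(s, u). fx s u)"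
    and cf: "\<And>s. s \<in> U \<Longrightarrow> continuous_on UNIV (f s)"
    and z: "\<And>s u. s \<in> U \<Longrightarrow> R < norm u \<Longrightarrow> f s u = 0" "\<And>s u. s \<in> U \<Longrightarrow> R < norm u \<Longrightarrow> fx s u = 0"
    and U: "s0 \<in> U" "convex U"
  shows "((\<lambda>s. \<integral>u. f s u \<partial>lborel) has_real_derivative (\<integral>u. fx s0 u \<partial>lborel)) (at s0 within U)"
proof -
  obtain a :: 'a where a: "cball 0 R \<subseteq> cbox (-a) a"
    using bounded_subset_cbox_symmetric[of "cball (0::'a) R"] by auto
  have "continuous_on UNIV (\<lambda>u. case (s0, u) of (s, u) \<Rightarrow> fx s u)"
    using U(1) by (intro continuous_on_compose2[OF c] continuous_on_Pair continuous_on_const continuous_on_id) auto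
  then have cfx: "continuous_on UNIV (fx s0)" by simp
  have "((\<lambda>s. integral (cbox (-a) a) (f s)) has_real_derivative integral (cbox (-a) a) (fx s0)) (at s0 within U)"
    using U
    by (intro leibniz_rule_field_derivative)
      (auto intro!: d integrable_continuous continuous_on_subset[OF cf] continuous_on_subset[OF c])
  also have "integral (cbox (-a) a) (fx s0) = (\<integral>u. fx s0 u \<partial>lborel)"
    by (rule LBINT_eq_integral_cbox[symmetric, OF cfx _ a]) (use z U in auto)
  finally show ?thesis
    by (rule has_field_derivative_transform_within[OF _ zero_less_one U(1)])
      (rule LBINT_eq_integral_cbox[symmetric, OF cf z(1) a])
qed

text \<open>The integral of \<open>F\<close> is invariant under translation along \<open>b\<close>,
  and its derivative in the translation parameter is the integral of \<open>F'\<close>. Summed over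
  a basis, this is the divergence theorem for fields of compact support, without boundary
  terms.\<close>

lemma LBINT_directional_derivative:
  fixes F F' :: "'a::euclidean_space \<Rightarrow> real"
  assumes d: "\<And>u t. ((\<lambda>t. F (u + t *\<^sub>R b)) has_real_derivative F' (u + t *\<^sub>R b)) (at t)"
    and c: "continuous_on UNIV F'" and cF: "continuous_on UNIV F"
    and z: "\<And>u. R < norm u \<Longrightarrow> F u = 0" "\<And>u. R < norm u \<Longrightarrow> F' u = 0"
  shows "(\<integral>u. F' u \<partial>lborel) = 0"
proof -
  \<comment> \<open>Only translations with \<open>|s| <= 1\<close> are considered, so that the
    single radius \<open>R + norm b\<close> serves for all of them.\<close>
  have far: "R < norm (u + s *\<^sub>R b)" if "s \<in> {-1..1}" "R + norm b < norm u" for s u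
  proof -
    have "norm u \<le> norm (u + s *\<^sub>R b) + norm (s *\<^sub>R b)"
      using norm_triangle_ineq4[of "u + s *\<^sub>R b" "s *\<^sub>R b"] by simp
    moreover have "norm (s *\<^sub>R b) \<le> norm b"
      using that by (simp add: mult_left_le_one_le abs_le_iff)
    ultimately show ?thesis using that by linarith
  qed
  have "((\<lambda>s. \<integral>u. F (u + s *\<^sub>R b) \<partial>lborel) has_real_derivative (\<integral>u. F' (u + 0 *\<^sub>R b) \<partial>lborel)) (at 0 within {-1..1})"
    by (rule LBINT_has_derivative[where R="R + norm b"])
      (auto intro!: continuous_intros continuous_on_compose2[OF c] continuous_on_compose2[OF cF] z far
          has_field_derivative_at_within[OF d] simp: split_beta)
  moreover have "(\<integral>u. F (u + s *\<^sub>R b) \<partial>lborel) = (\<integral>u. F u \<partial>lborel)" for s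
    using integral_lborel_affine[of F 1 "s *\<^sub>R b"] borel_measurable_continuous_onI[OF cF]
    by (simp add: add.commute)
  ultimately have "((\<lambda>s. (\<integral>u. F u \<partial>lborel)) has_real_derivative (\<integral>u. F' u \<partial>lborel)) (at 0 within {-1..1})"
    by simp
  then have "((\<lambda>s. (\<integral>u. F u \<partial>lborel)) has_real_derivative (\<integral>u. F' u \<partial>lborel)) (at 0 within {-1<..<1})"
    by (rule has_field_derivative_subset) auto
  then have "((\<lambda>s. (\<integral>u. F u \<partial>lborel)) has_real_derivative (\<integral>u. F' u \<partial>lborel)) (at 0)"
    by (simp add: at_within_open[of 0 "{-1<..<1}"])
  then show ?thesis by (rule DERIV_unique[OF _ DERIV_const])
qed

section \<open>The mollified Coulomb kernel\<close>

text \<open>Any radial profile averages isotropically. For this one the vector field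
  \<open>bump u *\<^sub>R u\<close> has an explicit potential that is continuously differentiable
  across the unit sphere, which is the smoothness needed in \<open>bump_flux\<close>.\<close>

definition bump :: "'a::euclidean_space \<Rightarrow> real" where
  "bump u = max 0 (1 - u \<bullet> u)"

text \<open>The Coulomb kernel with \<open>|x|^2\<close> replaced by \<open>|x|^2 + e\<close>:
  smooth for \<open>e > 0\<close>, still superharmonic, and increasing to the kernel as
  \<open>e\<close> decreases to \<open>0\<close>.\<close>

definition reg_kernel :: "real \<Rightarrow> 'a::euclidean_space \<Rightarrow> real" where
  "reg_kernel e x =
     (if DIM('a) = 2 then - (1/2) * ln (x \<bullet> x + e) else (x \<bullet> x + e) powr (1 - real DIM('a) / 2))"

text \<open>The constant in the gradient \<open>- flux_const * (|y|^2 + e) powr (- d/2) * y\<close>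
  of \<open>reg_kernel e\<close> at \<open>y\<close>. It absorbs the distinction between the
  logarithm and the powers.\<close>

definition flux_const :: "'a::euclidean_space itself \<Rightarrow> real" where
  "flux_const _ = (if DIM('a) = 2 then 1 else real DIM('a) - 2)"

lemma coulomb_kernel_eq_reg_kernel: "coulomb_kernel x = reg_kernel 0 x"
proof (cases "x = 0")
  case True
  then show ?thesis by (simp add: coulomb_kernel_def reg_kernel_def)
next
  case False
  then have "x \<bullet> x = norm x powr 2"
    by (simp add: power2_norm_eq_inner powr_numeral)
  then show ?thesis using False
    by (simp add: coulomb_kernel_def reg_kernel_def ln_powr powr_powr right_diff_distrib del: powr_numeral)
qed

lemma reg_kernel_quadratic_pos: "0 < e \<Longrightarrow> 0 < x \<bullet> x + (e::real)"
  by (simp add: add_nonneg_pos)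

lemma bump_nonneg: "0 \<le> bump u" by (simp add: bump_def)

lemma bump_le_one: "bump u \<le> 1" by (simp add: bump_def)

lemma bump_eq_0: "1 \<le> norm u \<Longrightarrow> bump u = 0"
  by (auto simp: bump_def dot_square_norm)

lemma continuous_on_bump: "continuous_on A bump"
  unfolding bump_def by (intro continuous_intros)

lemma borel_measurable_bump [measurable]: "bump \<in> borel_measurable borel"
  by (rule borel_measurable_continuous_onI[OF continuous_on_bump])

lemma reg_kernel_has_derivative:
  fixes x u :: "'a::euclidean_space"
  assumes e: "0 < e" and d: "2 \<le> DIM('a)"
  shows "((\<lambda>s. reg_kernel e (x + s *\<^sub>R u)) has_real_derivative
     - flux_const TYPE('a) * (((x + s *\<^sub>R u) \<bullet> (x + s *\<^sub>R u) + e) powr (- (real DIM('a) / 2)) *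
        ((x + s *\<^sub>R u) \<bullet> u))) (at s)"
proof -
  let ?q = "\<lambda>s. (x + s *\<^sub>R u) \<bullet> (x + s *\<^sub>R u) + e"
  have q: "?q = (\<lambda>s. x \<bullet> x + 2 * s * (x \<bullet> u) + s\<^sup>2 * (u \<bullet> u) + e)"
    by (auto simp: inner_add inner_commute power2_eq_square algebra_simps)
  have dq: "(?q has_real_derivative 2 * ((x + s *\<^sub>R u) \<bullet> u)) (at s)"
    unfolding q by (auto intro!: derivative_eq_intros simp: inner_add algebra_simps)
  have pos: "0 < ?q s" using e by (rule reg_kernel_quadratic_pos)
  show ?thesis
  proof (cases "DIM('a) = 2")
    case True
    have "((\<lambda>s. - (1/2) * ln (?q s)) has_real_derivative - (1/2) * (2 * ((x + s *\<^sub>R u) \<bullet> u) / ?q s)) (at s)"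
      by (rule DERIV_cong[OF DERIV_cmult[OF DERIV_chain2[OF DERIV_ln_divide[OF pos] dq]]]) simp
    moreover have "?q s powr (- 1) = 1 / ?q s"
      by (rule trans[OF powr_minus_divide]) (simp only: powr_one[OF less_imp_le[OF pos]])
    ultimately show ?thesis using True
      by (simp only: reg_kernel_def flux_const_def if_True simp_thms) (simp add: divide_simps abs_of_pos[OF pos])
  next
    case False
    have "((\<lambda>s. ?q s powr (1 - real DIM('a) / 2)) has_real_derivative
        (1 - real DIM('a) / 2) * ?q s powr (1 - real DIM('a) / 2 - 1) * (2 * ((x + s *\<^sub>R u) \<bullet> u))) (at s)"
      using DERIV_fun_powr[OF dq pos, of "1 - real DIM('a) / 2"] by simp
    then show ?thesis using False
      by (simp only: reg_kernel_def flux_const_def if_False simp_thms) (erule DERIV_cong, simp add: field_simps)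
  qed
qed

text \<open>Squaring removes the kink of \<open>max 0\<close> at the origin; hence
  \<open>(bump u)^2\<close> is differentiable also on the unit sphere.\<close>

lemma DERIV_max_0_square:
  "((\<lambda>t. (max 0 t)\<^sup>2) has_real_derivative 2 * max 0 t) (at (t::real))"
proof -
  consider "t < 0" | "t = 0" | "t > 0" by linarith
  then show ?thesis
  proof cases
    case 1
    have "((\<lambda>t. (max 0 t)\<^sup>2) has_real_derivative 0) (at t)"
      by (rule has_field_derivative_transform_within_open[OF DERIV_const, where S="{..<0}"]) (use 1 in auto)
    then show ?thesis using 1 by simp
  next
    case 2
    have "(\<lambda>h. (max 0 h)\<^sup>2 / h) = (\<lambda>h::real. max 0 h)"
      by (auto simp: max_def power2_eq_square)
    moreover have "((\<lambda>h::real. max 0 h) \<longlongrightarrow> max 0 0) (at 0)"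
      by (intro tendsto_intros)
    ultimately show ?thesis using 2 by (simp add: has_field_derivative_iff)
  next
    case 3
    have d: "((\<lambda>t. t\<^sup>2) has_real_derivative 2 * t) (at t)"
      by (auto intro!: derivative_eq_intros)
    have "((\<lambda>t. (max 0 t)\<^sup>2) has_real_derivative 2 * t) (at t)"
      by (rule has_field_derivative_transform_within_open[OF d, of "{0<..}"]) (use 3 in auto)
    then show ?thesis using 3 by simp
  qed
qed

lemma DERIV_bump_square:
  fixes u b :: "'a::euclidean_space"
  shows "((\<lambda>t. (bump (u + t *\<^sub>R b))\<^sup>2 / 4) has_real_derivative
     - bump (u + t *\<^sub>R b) * ((u + t *\<^sub>R b) \<bullet> b)) (at t)"
proof -
  have q: "(\<lambda>t. 1 - (u + t *\<^sub>R b) \<bullet> (u + t *\<^sub>R b)) = (\<lambda>t. 1 - (u \<bullet> u + 2 * t * (u \<bullet> b) + t\<^sup>2 * (b \<bullet> b)))"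
    by (auto simp: inner_add inner_commute power2_eq_square algebra_simps)
  have dq: "((\<lambda>t. 1 - (u + t *\<^sub>R b) \<bullet> (u + t *\<^sub>R b)) has_real_derivative - 2 * ((u + t *\<^sub>R b) \<bullet> b)) (at t)"
    unfolding q by (auto intro!: derivative_eq_intros simp: inner_add algebra_simps)
  show ?thesis
    unfolding bump_def
    by (rule DERIV_cong[OF DERIV_cdivide[OF DERIV_chain2[OF DERIV_max_0_square dq], of 4]]) (simp add: field_simps)
qed

text \<open>The divergence theorem for the vector field \<open>u \<mapsto> (bump u)\<^sup>2 / 4 * q powr (- d/2) * (x + s u)\<close> with
  \<open>q = norm (x + s u)\<^sup>2 + e\<close>; here \<open>bump u * u\<close> is minus the gradient of \<open>(bump u)\<^sup>2 / 4\<close>.\<close>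

lemma bump_flux:
  fixes x :: "'a::euclidean_space"
  assumes e: "0 < e"
  defines "q \<equiv> \<lambda>s u. (x + s *\<^sub>R u) \<bullet> (x + s *\<^sub>R u) + e"
  shows "(\<integral>u. q s u powr (- (real DIM('a) / 2)) * ((x + s *\<^sub>R u) \<bullet> u) * bump u \<partial>lborel) =
    s * real DIM('a) * e * (\<integral>u. (bump u)\<^sup>2 / 4 * q s u powr (- (real DIM('a) / 2) - 1) \<partial>lborel)"
proof -
  let ?d = "real DIM('a)"
  have pos: "0 < q s u" for s u
    unfolding q_def using e by (rule reg_kernel_quadratic_pos)
  have cq: "continuous_on A (\<lambda>u. q s u)" for A
    unfolding q_def by (intro continuous_intros)
  have nz: "q s u \<noteq> 0" for s u
    by (rule less_imp_neq[OF pos, symmetric])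
  have cqp: "continuous_on A (\<lambda>u. q s u powr c)" for A c
    by (rule continuous_on_powr[OF cq continuous_on_const]) (rule ballI, rule nz)
  have cb4: "continuous_on A (\<lambda>u::'a. (bump u)\<^sup>2 / 4)" for A
    unfolding divide_inverse by (intro continuous_on_mult continuous_on_power continuous_on_bump continuous_on_const)
  note ci = continuous_on_add continuous_on_diff continuous_on_mult continuous_on_power continuous_on_inner
    continuous_on_scaleR continuous_on_minus cb4 cqp continuous_on_bump continuous_on_const continuous_on_id
  \<comment> \<open>By the product rule, \<open>W b\<close> is the derivative in direction
    \<open>b\<close> of the \<open>b\<close>-component of the vector field, so that its sum over the
    basis is the divergence.\<close>
  define W where "W b u = - bump u * (u \<bullet> b) * (q s u powr (- (?d / 2)) * ((x + s *\<^sub>R u) \<bullet> b)) +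
      (bump u)\<^sup>2 / 4 * (- ?d * q s u powr (- (?d / 2) - 1) * s * ((x + s *\<^sub>R u) \<bullet> b)\<^sup>2 + q s u powr (- (?d / 2)) * s)"
    for b u :: 'a
  have cW: "continuous_on UNIV (\<lambda>u. W b u)" for b
    unfolding W_def by (rule ci)+
  have W0: "W b u = 0" if "1 < norm u" for b u
    using bump_eq_0[of u] that by (simp add: W_def)
  have int_W: "integrable lborel (W b)" for b
    by (rule compact_support_integrable[OF cW W0])
  have "(\<integral>u. W b u \<partial>lborel) = 0" if b: "b \<in> Basis" for b
  proof (rule LBINT_directional_derivative[where b=b and R=1 and
        F="\<lambda>u. (bump u)\<^sup>2 / 4 * (q s u powr (- (?d / 2)) * ((x + s *\<^sub>R u) \<bullet> b))"])
    fix u t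
    have qt: "(\<lambda>t. q s (u + t *\<^sub>R b)) = (\<lambda>t. (x + s *\<^sub>R u) \<bullet> (x + s *\<^sub>R u) + 2 * (s * t) * ((x + s *\<^sub>R u) \<bullet> b) + (s * t)\<^sup>2 + e)"
      using b unfolding q_def
      by (auto simp: inner_add inner_commute power2_eq_square algebra_simps)
    have dq: "((\<lambda>t. q s (u + t *\<^sub>R b)) has_real_derivative 2 * s * ((x + s *\<^sub>R (u + t *\<^sub>R b)) \<bullet> b)) (at t)"
      unfolding qt using b by (auto intro!: derivative_eq_intros simp: inner_add power2_eq_square algebra_simps)
    have dp: "((\<lambda>t. q s (u + t *\<^sub>R b) powr (- (?d / 2))) has_real_derivative
       (- (?d / 2)) * q s (u + t *\<^sub>R b) powr (- (?d / 2) - 1) * (2 * s * ((x + s *\<^sub>R (u + t *\<^sub>R b)) \<bullet> b))) (at t)"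
      using DERIV_fun_powr[OF dq pos, of "- (?d / 2)"] by simp
    have "(\<lambda>t. (x + s *\<^sub>R (u + t *\<^sub>R b)) \<bullet> b) = (\<lambda>t. (x + s *\<^sub>R u) \<bullet> b + s * t)"
      using b by (auto simp: inner_add algebra_simps)
    then have dx: "((\<lambda>t. (x + s *\<^sub>R (u + t *\<^sub>R b)) \<bullet> b) has_real_derivative s) (at t)"
      by (auto intro!: derivative_eq_intros)
    show "((\<lambda>t. (bump (u + t *\<^sub>R b))\<^sup>2 / 4 * (q s (u + t *\<^sub>R b) powr (- (?d / 2)) *
        ((x + s *\<^sub>R (u + t *\<^sub>R b)) \<bullet> b))) has_real_derivative W b (u + t *\<^sub>R b)) (at t)"
      by (rule DERIV_cong[OF DERIV_mult[OF DERIV_bump_square DERIV_mult[OF dp dx]]])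
        (simp add: W_def power2_eq_square algebra_simps)
  next
    show "continuous_on UNIV (\<lambda>u. (bump u)\<^sup>2 / 4 * (q s u powr (- (?d / 2)) * ((x + s *\<^sub>R u) \<bullet> b)))"
      by (rule ci)+
  qed (simp_all add: cW W0 bump_eq_0)
  then have "0 = (\<Sum>b\<in>Basis. \<integral>u. W b u \<partial>lborel)" by simp
  also have "\<dots> = (\<integral>u. (\<Sum>b\<in>Basis. W b u) \<partial>lborel)"
    by (rule Bochner_Integration.integral_sum[symmetric]) (rule int_W)
  also have "\<dots> = (\<integral>u. s * ?d * e * ((bump u)\<^sup>2 / 4 * q s u powr (- (?d / 2) - 1)) -
      q s u powr (- (?d / 2)) * ((x + s *\<^sub>R u) \<bullet> u) * bump u \<partial>lborel)"
  proof (rule Bochner_Integration.integral_cong[OF refl])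
    fix u
    \<comment> \<open>As \<open>|x + s u|^2 = q - e\<close>, the two terms of order
      \<open>q powr (- d/2)\<close> with the factor \<open>(bump u)^2 / 4\<close> cancel and only a
      multiple of \<open>e\<close> remains: the field \<open>q powr (- d/2) * (x + s u)\<close> is
      divergence free up to \<open>e\<close>.\<close>
    have p: "q s u powr (- (?d / 2)) = q s u * q s u powr (- (?d / 2) - 1)"
      using powr_mult_base[OF less_imp_le[OF pos], of s u "- (?d / 2) - 1"] by simp
    have "(\<Sum>b\<in>Basis. W b u) =
       - bump u * q s u powr (- (?d / 2)) * (\<Sum>b\<in>Basis. (u \<bullet> b) * ((x + s *\<^sub>R u) \<bullet> b)) +
       (bump u)\<^sup>2 / 4 * s * (- ?d * q s u powr (- (?d / 2) - 1) * (\<Sum>b\<in>Basis. ((x + s *\<^sub>R u) \<bullet> b)\<^sup>2)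
          + q s u powr (- (?d / 2)) * ?d)"
      unfolding W_def
      by (simp add: sum.distrib sum_distrib_left sum_distrib_right algebra_simps sum_subtractf sum_negf)
    also have "(\<Sum>b\<in>Basis. (u \<bullet> b) * ((x + s *\<^sub>R u) \<bullet> b)) = (x + s *\<^sub>R u) \<bullet> u"
      by (subst inner_commute, rule euclidean_inner[symmetric])
    also have "(\<Sum>b\<in>Basis. ((x + s *\<^sub>R u) \<bullet> b)\<^sup>2) = q s u - e"
      unfolding q_def by (simp add: power2_eq_square euclidean_inner[of "x + s *\<^sub>R u" "x + s *\<^sub>R u"])
    finally show "(\<Sum>b\<in>Basis. W b u) = s * ?d * e * ((bump u)\<^sup>2 / 4 * q s u powr (- (?d / 2) - 1)) -
      q s u powr (- (?d / 2)) * ((x + s *\<^sub>R u) \<bullet> u) * bump u"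
      by (simp add: p algebra_simps)
  qed
  also have "\<dots> = (\<integral>u. s * ?d * e * ((bump u)\<^sup>2 / 4 * q s u powr (- (?d / 2) - 1)) \<partial>lborel) -
      (\<integral>u. q s u powr (- (?d / 2)) * ((x + s *\<^sub>R u) \<bullet> u) * bump u \<partial>lborel)"
  proof (rule Bochner_Integration.integral_diff)
    show "integrable lborel (\<lambda>u. s * ?d * e * ((bump u)\<^sup>2 / 4 * q s u powr (- (?d / 2) - 1)))"
      by (rule compact_support_integrable[where R=1], (rule ci)+, simp add: bump_eq_0)
    show "integrable lborel (\<lambda>u. q s u powr (- (?d / 2)) * ((x + s *\<^sub>R u) \<bullet> u) * bump u)"
      by (rule compact_support_integrable[where R=1], (rule ci)+, simp add: bump_eq_0)
  qed
  finally show ?thesis by simp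
qed

text \<open>Both features of this derivative are used. Its sign makes the mean decrease with the
  radius, which is superharmonicity; its factor \<open>e\<close> makes it vanish in the limit as
  long as the averaging ball avoids the origin, which is the mean value property.\<close>

lemma reg_mean_has_derivative:
  fixes x :: "'a::euclidean_space"
  assumes e: "0 < e" and d: "2 \<le> DIM('a)"
  shows "((\<lambda>s. \<integral>u. reg_kernel e (x + s *\<^sub>R u) * bump u \<partial>lborel) has_real_derivative
    - flux_const TYPE('a) * (s * real DIM('a) * e *
      (\<integral>u. (bump u)\<^sup>2 / 4 * ((x + s *\<^sub>R u) \<bullet> (x + s *\<^sub>R u) + e) powr (- (real DIM('a) / 2) - 1) \<partial>lborel))) (at s)"
proof -
  let ?q = "\<lambda>s u. (x + s *\<^sub>R u) \<bullet> (x + s *\<^sub>R u) + e"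
  have pos: "0 < ?q s u" for s u
    using e by (rule reg_kernel_quadratic_pos)
  have cq: "continuous_on UNIV (\<lambda>u. ?q s u)" for s
    by (intro continuous_intros)
  have nz': "\<forall>u\<in>UNIV. ?q s u \<noteq> 0" for s
    using pos less_imp_neq by metis
  have cr: "continuous_on UNIV (\<lambda>u. reg_kernel e (x + s *\<^sub>R u))" for s
    unfolding reg_kernel_def
    using continuous_on_mult_left[OF continuous_on_ln[OF cq[of s] nz'[of s]], of "- (1/2)"]
      continuous_on_powr[OF cq[of s] continuous_on_const nz'[of s], of "1 - real DIM('a) / 2"]
    by (cases "DIM('a) = 2") (simp_all only: simp_thms if_True if_False)
  have "((\<lambda>s. \<integral>u. reg_kernel e (x + s *\<^sub>R u) * bump u \<partial>lborel) has_real_derivative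
    (\<integral>u. - flux_const TYPE('a) * (?q s u powr (- (real DIM('a) / 2)) * ((x + s *\<^sub>R u) \<bullet> u)) * bump u \<partial>lborel)) (at s)"
  proof (rule LBINT_has_derivative[where R=1 and U=UNIV])
    show "continuous_on (UNIV \<times> UNIV) (\<lambda>(s, u). - flux_const TYPE('a) *
        (?q s u powr (- (real DIM('a) / 2)) * ((x + s *\<^sub>R u) \<bullet> u)) * bump u)"
    proof -
      have c1: "continuous_on UNIV (\<lambda>z::real \<times> 'a. ?q (fst z) (snd z))"
        by (intro continuous_intros)
      have c2: "continuous_on UNIV (\<lambda>z::real \<times> 'a. bump (snd z))"
        by (rule continuous_on_compose2[OF continuous_on_bump[of UNIV] continuous_on_snd[OF continuous_on_id]]) simp
      have c3: "continuous_on UNIV (\<lambda>z::real \<times> 'a. ?q (fst z) (snd z) powr (- (real DIM('a) / 2)))"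
        by (rule continuous_on_powr[OF c1 continuous_on_const]) (use nz' in blast)
      show ?thesis
        unfolding split_beta UNIV_Times_UNIV
        by (rule continuous_on_mult[OF continuous_on_mult[OF continuous_on_const continuous_on_mult[OF c3]] c2])
          (intro continuous_intros)
    qed
    show "continuous_on UNIV (\<lambda>u. reg_kernel e (x + s *\<^sub>R u) * bump u)" for s
      by (intro continuous_intros cr continuous_on_bump)
    show "((\<lambda>s. reg_kernel e (x + s *\<^sub>R u) * bump u) has_real_derivative
        - flux_const TYPE('a) * (?q s u powr (- (real DIM('a) / 2)) * ((x + s *\<^sub>R u) \<bullet> u)) * bump u) (at s)" for s u
      by (rule DERIV_cmult_right) (rule reg_kernel_has_derivative[OF e d])
  qed (simp_all add: bump_eq_0)
  also have "(\<integral>u. - flux_const TYPE('a) * (?q s u powr (- (real DIM('a) / 2)) * ((x + s *\<^sub>R u) \<bullet> u)) * bump u \<partial>lborel) =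
    - flux_const TYPE('a) * (\<integral>u. ?q s u powr (- (real DIM('a) / 2)) * ((x + s *\<^sub>R u) \<bullet> u) * bump u \<partial>lborel)"
    by (simp add: mult.assoc)
  finally show ?thesis
    unfolding bump_flux[OF e] .
qed

section \<open>Averages of the kernel: superharmonicity and Newton's theorem\<close>

definition moll :: "'a::euclidean_space \<Rightarrow> real" where
  "moll u = bump u / (\<integral>v. bump (v::'a) \<partial>lborel)"

definition smear :: "real \<Rightarrow> ('a::euclidean_space \<Rightarrow> real) \<Rightarrow> 'a \<Rightarrow> real" where
  "smear s f x = (\<integral>u. f (x + s *\<^sub>R u) * moll u \<partial>lborel)"

text \<open>The potential of a unit charge at the origin minus that of the same charge spread with
  density \<open>moll\<close>. By Newton's theorem the two agree outside the support of
  \<open>moll\<close>.\<close>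

definition excess :: "'a::euclidean_space \<Rightarrow> real" where
  "excess x = coulomb_kernel x - smear 1 coulomb_kernel x"

lemma integrable_bump: "integrable lborel (bump :: 'a::euclidean_space \<Rightarrow> real)"
  by (rule compact_support_integrable[where R=1]) (auto intro: continuous_on_bump simp: bump_eq_0)

lemma bump_mass_pos: "0 < (\<integral>u. bump (u::'a::euclidean_space) \<partial>lborel)"
proof -
  have "0 < 3/4 * measure lborel (ball (0::'a) (1/2))"
    by (simp add: content_ball_pos)
  also have "\<dots> = (\<integral>u. 3/4 * indicator (ball (0::'a) (1/2)) u \<partial>lborel)"
    by simp
  also have "\<dots> \<le> (\<integral>u. bump (u::'a) \<partial>lborel)"
  proof (rule integral_mono)
    show "3/4 * indicator (ball 0 (1/2)) u \<le> bump u" for u :: 'a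
    proof (cases "norm u < 1/2")
      case True
      then have "norm u * norm u \<le> 1/2 * (1/2)"
        by (intro mult_mono) auto
      then show ?thesis by (auto simp: bump_def indicator_def dot_square_norm power2_eq_square)
    qed (auto simp: bump_nonneg indicator_def)
    show "integrable lborel (\<lambda>u. 3/4 * indicator (ball (0::'a) (1/2)) u :: real)"
      by (intro integrable_mult_right integrable_real_indicator emeasure_lborel_ball_finite) simp
  qed (rule integrable_bump)
  finally show ?thesis .
qed

lemma moll_nonneg: "0 \<le> moll u"
  using bump_mass_pos[where 'a='a] by (simp add: moll_def bump_nonneg)

lemma moll_eq_0: "1 \<le> norm u \<Longrightarrow> moll u = 0"
  by (simp add: moll_def bump_eq_0)

lemma borel_measurable_moll [measurable]: "moll \<in> borel_measurable borel"
  unfolding moll_def by measurable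

lemma moll_le: "moll (u::'a::euclidean_space) \<le> 1 / (\<integral>v. bump (v::'a) \<partial>lborel)"
  using bump_mass_pos[where 'a='a] by (simp add: moll_def divide_right_mono bump_le_one)

lemma integrable_moll: "integrable lborel moll"
  unfolding moll_def by (intro integrable_divide integrable_bump)

lemma integral_moll: "(\<integral>u. moll u \<partial>lborel) = 1"
  using bump_mass_pos[where 'a='a] by (simp add: moll_def)

lemma integrable_mult_moll_iff:
  fixes f :: "'a::euclidean_space \<Rightarrow> real"
  shows "integrable lborel (\<lambda>u. f u * moll u) \<longleftrightarrow> integrable lborel (\<lambda>u. f u * bump u)"
proof
  assume "integrable lborel (\<lambda>u. f u * moll u)"
  from integrable_mult_right[OF this, of "\<integral>v. bump (v::'a) \<partial>lborel"]
  show "integrable lborel (\<lambda>u. f u * bump u)"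
    using bump_mass_pos[where 'a='a] by (simp add: moll_def)
next
  assume "integrable lborel (\<lambda>u. f u * bump u)"
  from integrable_mult_right[OF this, of "1 / (\<integral>v. bump (v::'a) \<partial>lborel)"]
  show "integrable lborel (\<lambda>u. f u * moll u)"
    by (simp add: moll_def)
qed

lemma borel_measurable_coulomb_kernel [measurable]:
  "(coulomb_kernel :: 'a::euclidean_space \<Rightarrow> real) \<in> borel_measurable borel"
  unfolding coulomb_kernel_def by measurable

lemma coulomb_kernel_minus: "coulomb_kernel (- x) = coulomb_kernel x"
  by (simp add: coulomb_kernel_def)

lemma borel_measurable_smear [measurable]:
  assumes [measurable]: "f \<in> borel_measurable borel"
  shows "smear s f \<in> borel_measurable borel"
  unfolding smear_def by measurable

lemma borel_measurable_excess [measurable]: "excess \<in> borel_measurable borel"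
  unfolding excess_def by measurable

lemma reg_kernel_antimono:
  fixes x :: "'a::euclidean_space"
  assumes d: "2 \<le> DIM('a)" and e: "e \<le> e'" and pos: "0 < x \<bullet> x + e"
  shows "reg_kernel e' x \<le> reg_kernel e x"
proof (cases "DIM('a) = 2")
  case True
  then show ?thesis using e pos by (simp add: reg_kernel_def)
next
  case False
  with d have "1 - real DIM('a) / 2 \<le> 0" by simp
  then show ?thesis using False e pos
    by (simp add: reg_kernel_def powr_mono2')
qed

lemma reg_kernel_tendsto:
  fixes x :: "'a::euclidean_space"
  assumes x: "x \<noteq> 0"
  shows "(\<lambda>n. reg_kernel (1 / real (Suc n)) x) \<longlonglongrightarrow> coulomb_kernel x"
proof -
  have *: "(\<lambda>n. x \<bullet> x + 1 / real (Suc n)) \<longlonglongrightarrow> x \<bullet> x + 0"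
    using LIMSEQ_inverse_real_of_nat by (intro tendsto_add tendsto_const) (simp add: divide_inverse)
  have "x \<bullet> x + 0 \<noteq> 0" using x by simp
  show ?thesis
    unfolding coulomb_kernel_eq_reg_kernel reg_kernel_def
    using tendsto_mult_left[OF tendsto_ln[OF * \<open>x \<bullet> x + 0 \<noteq> 0\<close>], of "- (1/2)"]
      tendsto_powr[OF * tendsto_const \<open>x \<bullet> x + 0 \<noteq> 0\<close>, of "1 - real DIM('a) / 2"]
    by (cases "DIM('a) = 2") (simp_all only: simp_thms if_True if_False)
qed

lemma flux_const_nonneg: "2 \<le> DIM('a) \<Longrightarrow> 0 \<le> flux_const TYPE('a::euclidean_space)"
  by (simp add: flux_const_def)

text \<open>At radius \<open>0\<close> the mean is the value at the centre, and the derivative in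
  the radius is nonpositive.\<close>

lemma reg_mean_le:
  fixes x :: "'a::euclidean_space"
  assumes d: "2 \<le> DIM('a)" and e: "0 < e" and s: "0 \<le> s"
  shows "(\<integral>u. reg_kernel e (x + s *\<^sub>R u) * bump u \<partial>lborel) \<le> reg_kernel e x * (\<integral>u. bump (u::'a) \<partial>lborel)"
proof -
  have "(\<integral>u. reg_kernel e (x + s *\<^sub>R u) * bump u \<partial>lborel) \<le> (\<integral>u. reg_kernel e (x + 0 *\<^sub>R u) * bump u \<partial>lborel)"
  proof (rule DERIV_nonpos_imp_nonincreasing[OF s])
    fix t :: real assume t: "0 \<le> t"
    have "0 \<le> flux_const TYPE('a) * (t * real DIM('a) * e *
      (\<integral>u. (bump u)\<^sup>2 / 4 * ((x + t *\<^sub>R u) \<bullet> (x + t *\<^sub>R u) + e) powr (- (real DIM('a) / 2) - 1) \<partial>lborel))"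
      using t e d by (intro mult_nonneg_nonneg integral_nonneg flux_const_nonneg) auto
    then show "\<exists>y. ((\<lambda>s. \<integral>u. reg_kernel e (x + s *\<^sub>R u) * bump u \<partial>lborel) has_real_derivative y) (at t) \<and> y \<le> 0"
      using reg_mean_has_derivative[OF e d, of x t] by (intro exI conjI) (assumption, simp)
  qed
  then show ?thesis by simp
qed

text \<open>While the ball of radius \<open>s\<close> avoids the origin, the integral in the
  derivative is bounded uniformly in \<open>e\<close>, so that the mean loses at most a multiple of
  \<open>e\<close>.\<close>

lemma reg_mean_ge:
  fixes x :: "'a::euclidean_space"
  assumes d: "2 \<le> DIM('a)" and s: "0 \<le> s" "s < norm x"
  shows "\<exists>C. \<forall>e>0. reg_kernel e x * (\<integral>u. bump (u::'a) \<partial>lborel) \<le>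
    (\<integral>u. reg_kernel e (x + s *\<^sub>R u) * bump u \<partial>lborel) + C * e"
proof -
  let ?p = "- (real DIM('a) / 2) - 1"
  let ?I = "\<integral>u. (bump (u::'a))\<^sup>2 / 4 \<partial>lborel"
  \<comment> \<open>For \<open>t <= s\<close> and \<open>norm u < 1\<close> the norm of
    \<open>x + t u\<close> is at least \<open>norm x - s\<close>, and the exponent is
    negative.\<close>
  define B where "B = ((norm x - s)\<^sup>2) powr ?p"
  define C where "C = flux_const TYPE('a) * (s * real DIM('a) * (?I * B))"
  have int_sq: "integrable lborel (\<lambda>u::'a. (bump u)\<^sup>2 / 4)"
    by (rule compact_support_integrable[where R=1])
      (auto intro!: continuous_intros continuous_on_bump simp: bump_eq_0)
  have "reg_kernel e x * (\<integral>u. bump (u::'a) \<partial>lborel) \<le>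
    (\<integral>u. reg_kernel e (x + s *\<^sub>R u) * bump u \<partial>lborel) + s * C * e" if e: "0 < e" for e
  proof -
    let ?M = "\<lambda>s. \<integral>u. reg_kernel e (x + s *\<^sub>R u) * bump u \<partial>lborel"
    have "?M 0 + 0 * C * e \<le> ?M s + s * C * e"
    proof (rule DERIV_nonneg_imp_nondecreasing[OF s(1)])
      fix t :: real assume t: "0 \<le> t" "t \<le> s"
      let ?J = "\<integral>u. (bump u)\<^sup>2 / 4 * ((x + t *\<^sub>R u) \<bullet> (x + t *\<^sub>R u) + e) powr ?p \<partial>lborel"
      have "?J \<le> (\<integral>u. (bump (u::'a))\<^sup>2 / 4 * B \<partial>lborel)"
      proof (rule integral_mono')
        show "integrable lborel (\<lambda>u::'a. (bump u)\<^sup>2 / 4 * B)"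
          using int_sq by (rule integrable_mult_left)
        fix u :: 'a
        show "(bump u)\<^sup>2 / 4 * ((x + t *\<^sub>R u) \<bullet> (x + t *\<^sub>R u) + e) powr ?p \<le> (bump u)\<^sup>2 / 4 * B"
        proof (cases "norm u < 1")
          case True
          have "norm x - s \<le> norm x - t * norm u"
            using t True mult_left_le[of "norm u" t] by linarith
          also have "\<dots> \<le> norm (x + t *\<^sub>R u)"
            using norm_diff_ineq[of x "t *\<^sub>R u"] t by simp
          finally have "(norm x - s)\<^sup>2 \<le> (norm (x + t *\<^sub>R u))\<^sup>2"
            using s by (intro power_mono) auto
          also have "\<dots> \<le> (x + t *\<^sub>R u) \<bullet> (x + t *\<^sub>R u) + e"
            using e by (simp add: dot_square_norm)
          finally show ?thesis unfolding B_def
            using s by (intro mult_left_mono powr_mono2') auto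
        qed (simp add: bump_eq_0)
        show "0 \<le> (bump u)\<^sup>2 / 4 * B" by (simp add: B_def)
      qed
      also have "\<dots> = ?I * B" by simp
      finally have "t * real DIM('a) * e * ?J \<le> s * real DIM('a) * e * (?I * B)"
        using t e by (intro mult_mono) (auto intro!: integral_nonneg)
      then have "flux_const TYPE('a) * (t * real DIM('a) * e * ?J) \<le>
          flux_const TYPE('a) * (s * real DIM('a) * e * (?I * B))"
        using flux_const_nonneg[OF d] by (rule mult_left_mono)
      then have "0 \<le> - flux_const TYPE('a) * (t * real DIM('a) * e * ?J) + 1 * C * e"
        by (simp add: C_def mult_ac)
      moreover have "((\<lambda>t. ?M t + t * C * e) has_real_derivative
          - flux_const TYPE('a) * (t * real DIM('a) * e * ?J) + 1 * C * e) (at t)"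
        by (intro DERIV_add reg_mean_has_derivative e d DERIV_cmult_right DERIV_ident)
      ultimately show "\<exists>y. ((\<lambda>t. ?M t + t * C * e) has_real_derivative y) (at t) \<and> 0 \<le> y"
        by blast
    qed
    then show ?thesis by simp
  qed
  then show ?thesis by blast
qed

lemma AE_affine_neq_0:
  fixes x :: "'a::euclidean_space"
  assumes "s \<noteq> 0"
  shows "AE u in lborel. x + s *\<^sub>R u \<noteq> 0"
  using assms by (intro AE_lborel_affine AE_lborel_singleton)

text \<open>Monotone convergence as \<open>e\<close> decreases to \<open>0\<close>, with
  \<open>reg_mean_le\<close> bounding the integrals. Integrability of the singular kernel comes out
  of the same argument, without polar coordinates.\<close>

lemma
  fixes x :: "'a::euclidean_space"
  assumes d: "2 \<le> DIM('a)" and s: "0 < s" and x: "x \<noteq> 0"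
  shows integrable_coulomb_bump: "integrable lborel (\<lambda>u. coulomb_kernel (x + s *\<^sub>R u) * bump u)"
    and reg_mean_tendsto: "(\<lambda>n. \<integral>u. reg_kernel (1 / real (Suc n)) (x + s *\<^sub>R u) * bump u \<partial>lborel)
      \<longlonglongrightarrow> (\<integral>u. coulomb_kernel (x + s *\<^sub>R u) * bump u \<partial>lborel)"
proof -
  let ?f = "\<lambda>n u. reg_kernel (1 / real (Suc n)) (x + s *\<^sub>R u) * bump u"
  have mono: "mono (\<lambda>n. ?f n u)" for u
    by (intro monoI mult_right_mono bump_nonneg reg_kernel_antimono d reg_kernel_quadratic_pos)
      (auto simp: divide_simps)
  have int: "integrable lborel (?f n)" for n
  proof (rule compact_support_integrable[where R=1])
    have q: "(x + s *\<^sub>R u) \<bullet> (x + s *\<^sub>R u) + 1 / real (Suc n) \<noteq> 0" for u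
      using reg_kernel_quadratic_pos[of "1 / real (Suc n)" "x + s *\<^sub>R u"] by simp
    have c: "continuous_on UNIV (\<lambda>u. (x + s *\<^sub>R u) \<bullet> (x + s *\<^sub>R u) + 1 / real (Suc n))"
      by (intro continuous_intros) simp
    have "continuous_on UNIV (\<lambda>u. reg_kernel (1 / real (Suc n)) (x + s *\<^sub>R u))"
      unfolding reg_kernel_def
      using continuous_on_mult_left[OF continuous_on_ln[OF c ballI[OF q]], of "- (1/2)"]
        continuous_on_powr[OF c continuous_on_const ballI[OF q], of "1 - real DIM('a) / 2"]
      by (cases "DIM('a) = 2") (simp_all only: simp_thms if_True if_False)
    then show "continuous_on UNIV (?f n)"
      by (intro continuous_on_mult continuous_on_bump)
  qed (simp add: bump_eq_0)
  have bound: "integral\<^sup>L lborel (?f n) \<le> coulomb_kernel x * (\<integral>u. bump (u::'a) \<partial>lborel)" for n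
  proof -
    have "integral\<^sup>L lborel (?f n) \<le> reg_kernel (1 / real (Suc n)) x * (\<integral>u. bump (u::'a) \<partial>lborel)"
      using s by (intro reg_mean_le d) auto
    also have "\<dots> \<le> coulomb_kernel x * (\<integral>u. bump (u::'a) \<partial>lborel)"
      unfolding coulomb_kernel_eq_reg_kernel
      using bump_mass_pos[where 'a='a] x by (intro mult_right_mono reg_kernel_antimono d) auto
    finally show ?thesis .
  qed
  have "incseq (\<lambda>n. integral\<^sup>L lborel (?f n))"
    by (intro incseq_SucI integral_mono int monoD[OF mono]) simp
  then obtain L where L: "(\<lambda>n. integral\<^sup>L lborel (?f n)) \<longlonglongrightarrow> L"
    using incseq_convergent[of "\<lambda>n. integral\<^sup>L lborel (?f n)"] bound by blast
  have lim: "AE u in lborel. (\<lambda>n. ?f n u) \<longlonglongrightarrow> coulomb_kernel (x + s *\<^sub>R u) * bump u"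
    using AE_affine_neq_0[of s x] s
    by (auto elim!: eventually_mono intro!: tendsto_mult_right reg_kernel_tendsto simp del: of_nat_Suc)
  show "integrable lborel (\<lambda>u. coulomb_kernel (x + s *\<^sub>R u) * bump u)"
    by (rule integrable_monotone_convergence[OF int _ lim L]) (use mono in auto)
  have "(\<integral>u. coulomb_kernel (x + s *\<^sub>R u) * bump u \<partial>lborel) = L"
    by (rule integral_monotone_convergence[OF int _ lim L]) (use mono in auto)
  then show "(\<lambda>n. integral\<^sup>L lborel (?f n)) \<longlonglongrightarrow> (\<integral>u. coulomb_kernel (x + s *\<^sub>R u) * bump u \<partial>lborel)"
    using L by simp
qed

lemma smear_eq_bump: "smear s f (x::'a::euclidean_space) = (\<integral>u. f (x + s *\<^sub>R u) * bump u \<partial>lborel) / (\<integral>u. bump (u::'a) \<partial>lborel)"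
  unfolding smear_def moll_def by simp

lemma smear_coulomb_le:
  fixes x :: "'a::euclidean_space"
  assumes d: "2 \<le> DIM('a)" and s: "0 < s" and x: "x \<noteq> 0"
  shows "smear s coulomb_kernel x \<le> coulomb_kernel x"
proof -
  have "(\<integral>u. coulomb_kernel (x + s *\<^sub>R u) * bump u \<partial>lborel) \<le> coulomb_kernel x * (\<integral>u. bump (u::'a) \<partial>lborel)"
  proof (rule LIMSEQ_le[OF reg_mean_tendsto[OF d s x] tendsto_mult_right[OF reg_kernel_tendsto[OF x]]])
    show "\<exists>N. \<forall>n\<ge>N. (\<integral>u. reg_kernel (1 / real (Suc n)) (x + s *\<^sub>R u) * bump u \<partial>lborel)
        \<le> reg_kernel (1 / real (Suc n)) x * (\<integral>u. bump (u::'a) \<partial>lborel)"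
      using s by (intro exI allI impI reg_mean_le d) auto
  qed
  then show ?thesis
    using bump_mass_pos[where 'a='a] by (simp add: smear_eq_bump divide_simps)
qed

text \<open>The mean value property away from the singularity: the error \<open>C * e\<close> in
  \<open>reg_mean_ge\<close> disappears in the limit, and the other inequality is
  superharmonicity.\<close>

lemma smear_coulomb_eq:
  fixes x :: "'a::euclidean_space"
  assumes d: "2 \<le> DIM('a)" and s: "0 < s" "s < norm x"
  shows "smear s coulomb_kernel x = coulomb_kernel x"
proof (rule antisym)
  from s have x: "x \<noteq> 0" by auto
  show "smear s coulomb_kernel x \<le> coulomb_kernel x"
    by (rule smear_coulomb_le[OF d s(1) x])
  obtain C where C: "\<And>e. 0 < e \<Longrightarrow> reg_kernel e x * (\<integral>u. bump (u::'a) \<partial>lborel) \<le>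
    (\<integral>u. reg_kernel e (x + s *\<^sub>R u) * bump u \<partial>lborel) + C * e"
    using reg_mean_ge[OF d, of s x] s by auto
  have "(\<lambda>n. C * (1 / real (Suc n))) \<longlonglongrightarrow> C * 0"
    using LIMSEQ_inverse_real_of_nat by (intro tendsto_mult tendsto_const) (simp add: divide_inverse)
  note lim = tendsto_add[OF reg_mean_tendsto[OF d s(1) x] this]
  have "coulomb_kernel x * (\<integral>u. bump (u::'a) \<partial>lborel) \<le> (\<integral>u. coulomb_kernel (x + s *\<^sub>R u) * bump u \<partial>lborel) + C * 0"
    by (rule LIMSEQ_le[OF tendsto_mult_right[OF reg_kernel_tendsto[OF x]] lim])
      (intro exI allI impI C, simp)
  then show "coulomb_kernel x \<le> smear s coulomb_kernel x"
    using bump_mass_pos[where 'a='a] by (simp add: smear_eq_bump divide_simps)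
qed

lemma integrable_coulomb_moll:
  fixes x :: "'a::euclidean_space"
  assumes "2 \<le> DIM('a)" and "0 < s" and "x \<noteq> 0"
  shows "integrable lborel (\<lambda>u. coulomb_kernel (x + s *\<^sub>R u) * moll u)"
  unfolding integrable_mult_moll_iff by (rule integrable_coulomb_bump[OF assms])

lemma excess_nonneg:
  fixes x :: "'a::euclidean_space"
  shows "2 \<le> DIM('a) \<Longrightarrow> x \<noteq> 0 \<Longrightarrow> 0 \<le> excess x"
  using smear_coulomb_le[of 1 x] by (simp add: excess_def)

lemma excess_eq_0:
  fixes x :: "'a::euclidean_space"
  shows "2 \<le> DIM('a) \<Longrightarrow> 1 < norm x \<Longrightarrow> excess x = 0"
  using smear_coulomb_eq[of 1 x] by (simp add: excess_def)

lemma coulomb_kernel_scale: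
  fixes x :: "'a::euclidean_space"
  assumes s: "0 < s" and x: "x \<noteq> 0"
  shows "coulomb_kernel (s *\<^sub>R x) = s powr (2 - real DIM('a)) * coulomb_kernel x - (if DIM('a) = 2 then ln s else 0)"
  using s x by (auto simp: coulomb_kernel_def ln_mult powr_mult)

text \<open>In dimension 2 the kernel is homogeneous only up to the additive constant
  \<open>ln s\<close>; the constant cancels because \<open>moll\<close> has mass one.\<close>

lemma coulomb_minus_smear_scale:
  fixes x :: "'a::euclidean_space"
  assumes d: "2 \<le> DIM('a)" and s: "0 < s" and x: "x \<noteq> 0"
  shows "coulomb_kernel (s *\<^sub>R x) - smear s coulomb_kernel (s *\<^sub>R x) = s powr (2 - real DIM('a)) * excess x"
proof -
  let ?c = "if DIM('a) = 2 then ln s else 0"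
  have "smear s coulomb_kernel (s *\<^sub>R x) =
      (\<integral>u. s powr (2 - real DIM('a)) * (coulomb_kernel (x + 1 *\<^sub>R u) * moll u) - ?c * moll u \<partial>lborel)"
    unfolding smear_def
  proof (rule integral_cong_AE)
    show "AE u in lborel. coulomb_kernel (s *\<^sub>R x + s *\<^sub>R u) * moll u =
       s powr (2 - real DIM('a)) * (coulomb_kernel (x + 1 *\<^sub>R u) * moll u) - ?c * moll u"
      using AE_affine_neq_0[of 1 x, simplified]
    proof eventually_elim
      case (elim u)
      show ?case
        using coulomb_kernel_scale[OF s elim] s
        by (simp only: scaleR_add_right scaleR_one) (simp add: algebra_simps)
    qed
  qed measurable
  also have "\<dots> = s powr (2 - real DIM('a)) * smear 1 coulomb_kernel x - ?c"
    unfolding smear_def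
    by (subst Bochner_Integration.integral_diff)
      (use integrable_coulomb_moll[OF d zero_less_one x] in \<open>auto simp: integrable_moll integral_moll\<close>)
  finally show ?thesis
    using coulomb_kernel_scale[OF s x] by (simp add: excess_def algebra_simps)
qed

section \<open>Integrability and size of the excess\<close>

lemma integrable_coulomb_ball:
  fixes z :: "'a::euclidean_space"
  assumes d: "2 \<le> DIM('a)"
  shows "integrable lborel (\<lambda>x::'a. indicator (ball z R) x * coulomb_kernel x)"
proof -
  have [measurable]: "ball z R \<in> sets borel" by simp
  obtain x0 :: 'a where x0: "norm x0 = 1"
    using vector_choose_size[of 1] by auto
  \<comment> \<open>A large bump is centred at the unit vector \<open>x0\<close>, away from the
    singularity. The radius is such that every point of \<open>ball z R\<close> has the form
    \<open>x0 + s u\<close> with \<open>norm u <= 1/2\<close>, where the profile is at least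
    \<open>1/2\<close>; so the bump controls the indicator of the ball.\<close>
  define s where "s = 2 * (\<bar>R\<bar> + norm z + 2)"
  have s: "0 < s" by (simp add: s_def add_nonneg_pos)
  have "integrable lborel (\<lambda>u. coulomb_kernel (x0 + s *\<^sub>R u) * bump u)"
    using x0 by (intro integrable_coulomb_bump d s) auto
  then have i: "integrable lborel (\<lambda>u. 2 * (coulomb_kernel (x0 + s *\<^sub>R u) * bump u))" by simp
  have "integrable lborel (\<lambda>u. indicator (ball z R) (x0 + s *\<^sub>R u) * coulomb_kernel (x0 + s *\<^sub>R u))"
  proof (rule Bochner_Integration.integrable_bound[OF i])
    show "AE u in lborel. norm (indicator (ball z R) (x0 + s *\<^sub>R u) * coulomb_kernel (x0 + s *\<^sub>R u))
        \<le> norm (2 * (coulomb_kernel (x0 + s *\<^sub>R u) * bump u))"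
    proof (rule AE_I2)
      fix u
      show "norm (indicator (ball z R) (x0 + s *\<^sub>R u) * coulomb_kernel (x0 + s *\<^sub>R u))
          \<le> norm (2 * (coulomb_kernel (x0 + s *\<^sub>R u) * bump u))"
      proof (cases "x0 + s *\<^sub>R u \<in> ball z R")
        case True
        have "norm (s *\<^sub>R u) \<le> norm (x0 + s *\<^sub>R u - z) + norm z + norm x0"
          using norm_triangle_ineq4[of "x0 + s *\<^sub>R u - z + z" x0] norm_triangle_ineq[of "x0 + s *\<^sub>R u - z" z] by simp
        moreover have "norm (x0 + s *\<^sub>R u - z) < R"
          using True by (simp add: dist_norm norm_minus_commute)
        moreover have "norm (s *\<^sub>R u) = s * norm u"
          using s by simp
        ultimately have "s * norm u < R + norm z + 1"
          using x0 by linarith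
        also have "\<dots> \<le> s * (1/2)"
          by (simp add: s_def)
        finally have "s * norm u \<le> s * (1/2)" by simp
        then have "norm u \<le> 1/2" using s by simp
        then have "norm u * norm u \<le> 1/2 * (1/2)"
          by (intro mult_mono) auto
        then have "1/2 \<le> bump u" by (simp add: bump_def dot_square_norm power2_eq_square)
        then have "\<bar>coulomb_kernel (x0 + s *\<^sub>R u)\<bar> * (1/2) \<le> \<bar>coulomb_kernel (x0 + s *\<^sub>R u)\<bar> * bump u"
          by (intro mult_left_mono) auto
        then show ?thesis using True bump_nonneg[of u] by (simp add: abs_mult)
      qed simp
    qed
  qed measurable
  then show ?thesis
    using s by (subst (asm) integrable_lborel_affine_iff) auto
qed

text \<open>For \<open>norm x <= 1\<close> the average sees the kernel only inside
  \<open>ball 0 3\<close>, where it is integrable, and the averaging density is bounded.\<close>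

lemma ex_smear_coulomb_bound:
  assumes d: "2 \<le> DIM('a::euclidean_space)"
  shows "\<exists>c. \<forall>x::'a. norm x \<le> 1 \<longrightarrow> \<bar>smear 1 coulomb_kernel x\<bar> \<le> c"
proof (intro exI allI impI)
  fix x :: 'a assume x: "norm x \<le> 1"
  have [measurable]: "ball 0 3 \<in> sets (borel :: 'a measure)" by simp
  let ?m = "1 / (\<integral>v. bump (v::'a) \<partial>lborel)"
  let ?g = "\<lambda>x::'a. indicator (ball 0 3) x * \<bar>coulomb_kernel x\<bar> * ?m"
  have gm: "?g \<in> borel_measurable borel"
    by (intro borel_measurable_times borel_measurable_indicator borel_measurable_abs
        borel_measurable_coulomb_kernel borel_measurable_const) simp
  have int: "integrable lborel ?g"
    using integrable_abs[OF integrable_coulomb_ball[OF d, of 0 3]] by (simp add: abs_mult)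
  then have int': "integrable lborel (\<lambda>u. ?g (x + 1 *\<^sub>R u))"
    by (subst integrable_lborel_affine_iff) auto
  have "\<bar>smear 1 coulomb_kernel x\<bar> \<le> (\<integral>u. \<bar>coulomb_kernel (x + 1 *\<^sub>R u) * moll u\<bar> \<partial>lborel)"
    unfolding smear_def by (rule integral_abs_bound)
  also have "\<dots> \<le> (\<integral>u. ?g (x + 1 *\<^sub>R u) \<partial>lborel)"
  proof (rule integral_mono'[OF int'])
    fix u :: 'a
    show "\<bar>coulomb_kernel (x + 1 *\<^sub>R u) * moll u\<bar> \<le> ?g (x + 1 *\<^sub>R u)"
    proof (cases "norm u < 1")
      case True
      then have "norm (x + u) < 3" using x norm_triangle_ineq[of x u] by linarith
      then show ?thesis
        using moll_nonneg[of u] mult_left_mono[OF moll_le[of u], of "\<bar>coulomb_kernel (x + u)\<bar>"]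
        by (simp add: abs_mult)
    next
      case False
      then show ?thesis using bump_mass_pos[where 'a='a] by (simp add: moll_eq_0)
    qed
  next
    show "0 \<le> ?g (x + 1 *\<^sub>R u)" for u
      using bump_mass_pos[where 'a='a] by simp
  qed
  also have "\<dots> = (\<integral>u. ?g u \<partial>lborel)"
    by (rule trans[OF _ integral_lborel_affine[OF gm, of 1 x, symmetric]]) simp_all
  finally show "\<bar>smear 1 coulomb_kernel x\<bar> \<le> (\<integral>u. ?g u \<partial>lborel)" .
qed

lemma integrable_excess:
  assumes d: "2 \<le> DIM('a::euclidean_space)"
  shows "integrable lborel (excess :: 'a \<Rightarrow> real)"
proof -
  obtain c where c: "\<And>x::'a. norm x \<le> 1 \<Longrightarrow> \<bar>smear 1 coulomb_kernel x\<bar> \<le> c"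
    using ex_smear_coulomb_bound[OF d] by auto
  have "integrable lborel (\<lambda>x::'a. \<bar>indicator (ball 0 2) x * coulomb_kernel x\<bar> + indicator (ball 0 2) x * c)"
    using integrable_coulomb_ball[OF d, of 0 2]
    by (intro Bochner_Integration.integrable_add integrable_abs integrable_mult_left integrable_real_indicator
        emeasure_lborel_ball_finite) auto
  then show ?thesis
  proof (rule Bochner_Integration.integrable_bound)
    show "AE x::'a in lborel. norm (excess x) \<le> norm (\<bar>indicator (ball 0 2) x * coulomb_kernel x\<bar> + indicator (ball 0 2) x * c)"
    proof (rule AE_I2)
      fix x :: 'a
      show "norm (excess x) \<le> norm (\<bar>indicator (ball 0 2) x * coulomb_kernel x\<bar> + indicator (ball 0 2) x * c)"
      proof (cases "norm x \<le> 1")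
        case True
        then show ?thesis using c[OF True] by (auto simp: excess_def)
      next
        case False
        then show ?thesis by (simp add: excess_eq_0[OF d])
      qed
    qed
  qed measurable
qed

lemma coulomb_kernel_large:
  assumes d: "2 \<le> DIM('a::euclidean_space)"
  shows "\<exists>r>0. \<forall>x::'a. 0 < norm x \<and> norm x < r \<longrightarrow> T \<le> coulomb_kernel x"
proof (intro exI conjI allI impI)
  \<comment> \<open>In dimension at least 3 the kernel is at least \<open>1 / norm x\<close> for
    \<open>norm x <= 1\<close>; \<open>T' >= 1\<close> ensures that the radius \<open>1 / T'\<close>
    satisfies this restriction.\<close>
  define T' where "T' = max 1 T"
  have T': "1 \<le> T'" "T \<le> T'" by (auto simp: T'_def)
  show "0 < min (exp (- T)) (1 / T')" using T' by simp
  fix x :: 'a assume "0 < norm x \<and> norm x < min (exp (- T)) (1 / T')"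
  then have x: "0 < norm x" "norm x < exp (- T)" "norm x < 1 / T'" by auto
  show "T \<le> coulomb_kernel x"
  proof (cases "DIM('a) = 2")
    case True
    have "ln (norm x) < - T" using x by (metis ln_exp ln_less_cancel_iff exp_gt_zero)
    then show ?thesis using True by (simp add: coulomb_kernel_def)
  next
    case False
    have "norm x \<le> 1" using x(3) T' divide_le_eq_1_pos[of T' 1] by linarith
    have "T \<le> T'" by (rule T')
    also have "\<dots> \<le> norm x powr (- 1)" using x T' by (simp add: powr_minus_divide field_simps)
    also have "\<dots> \<le> norm x powr (2 - real DIM('a))"
      using \<open>norm x \<le> 1\<close> x d False by (intro powr_mono') auto
    finally show ?thesis using False by (simp add: coulomb_kernel_def)
  qed
qed

text \<open>The repulsion gained by separating a close pair. The level \<open>T\<close> is fixed in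
  \<open>ex_tuple_sum_constant\<close>, high enough to beat all losses.\<close>

lemma excess_large:
  assumes d: "2 \<le> DIM('a::euclidean_space)"
  shows "\<exists>r>0. r \<le> 1 \<and> (\<forall>x::'a. 0 < norm x \<and> norm x < r \<longrightarrow> T \<le> excess x)"
proof -
  obtain c where c: "\<And>x::'a. norm x \<le> 1 \<Longrightarrow> \<bar>smear 1 coulomb_kernel x\<bar> \<le> c"
    using ex_smear_coulomb_bound[OF d] by auto
  obtain r where r: "0 < r" "\<And>x::'a. 0 < norm x \<and> norm x < r \<Longrightarrow> T + c \<le> coulomb_kernel x"
    using coulomb_kernel_large[OF d, of "T + c"] by auto
  have "T \<le> excess x" if "0 < norm x \<and> norm x < min r 1" for x :: 'a
    using c[of x] r(2)[of x] that by (auto simp: excess_def abs_le_iff)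
  then show ?thesis using r(1) by (intro exI[of _ "min r 1"]) auto
qed

section \<open>The Euler--Lagrange equation\<close>

lemma zero_if_quadratic_nonneg:
  fixes A B :: real
  assumes "\<And>t. \<bar>t\<bar> \<le> 1 \<Longrightarrow> 0 \<le> t * A + t\<^sup>2 * B"
  shows "A = 0"
proof (rule ccontr)
  assume A: "A \<noteq> 0"
  \<comment> \<open>The sign is opposite to that of \<open>A\<close>, and the size makes
    \<open>|t| * |B|\<close> at most \<open>|A| / 2\<close>, so that the linear term dominates the
    quadratic one.\<close>
  define t where "t = - sgn A * (\<bar>A\<bar> / (2 * (\<bar>A\<bar> + \<bar>B\<bar>)))"
  have pos: "0 < \<bar>A\<bar> + \<bar>B\<bar>" using A by simp
  have t: "\<bar>t\<bar> = \<bar>A\<bar> / (2 * (\<bar>A\<bar> + \<bar>B\<bar>))"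
    using A pos by (simp add: t_def abs_mult sgn_if)
  have "\<bar>A\<bar> \<le> 2 * (\<bar>A\<bar> + \<bar>B\<bar>)" by simp
  then have "\<bar>t\<bar> \<le> 1" unfolding t using pos by (subst divide_le_eq_1_pos) auto
  moreover have "0 < \<bar>t\<bar>" unfolding t using A pos by simp
  ultimately have "\<bar>t\<bar> \<le> 1" "0 < \<bar>t\<bar>" by auto
  then have "0 \<le> t * A + t\<^sup>2 * B" using assms by blast
  moreover have "t * A = - (\<bar>t\<bar> * \<bar>A\<bar>)"
    unfolding t by (simp add: t_def sgn_if)
  moreover have "t\<^sup>2 * B \<le> \<bar>t\<bar> * (\<bar>t\<bar> * \<bar>B\<bar>)"
    by (metis abs_ge_self abs_ge_zero abs_mult abs_power2 mult.assoc mult_left_mono power2_abs power2_eq_square)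
  moreover have "\<bar>t\<bar> * (\<bar>t\<bar> * \<bar>B\<bar>) < \<bar>t\<bar> * \<bar>A\<bar>"
  proof (rule mult_strict_left_mono)
    have "\<bar>t\<bar> * \<bar>B\<bar> \<le> \<bar>A\<bar> / 2"
      unfolding t using A pos by (simp add: divide_simps mult_left_mono)
    then show "\<bar>t\<bar> * \<bar>B\<bar> < \<bar>A\<bar>" using A by simp
  qed fact
  ultimately show False by linarith
qed

text \<open>The inequality \<open>ln y <= y - 1\<close> gives the exact first-order term and a
  quadratic remainder. An upper bound is what is needed, since it estimates the free energy of a
  competitor of the minimizer.\<close>

lemma xlnx_increment_le:
  fixes a b :: real
  assumes "0 < a" "0 < a + b"
  shows "(a + b) * ln (a + b) - a * ln a \<le> b * ln a + b + b\<^sup>2 / a"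
proof -
  have "ln (a + b) - ln a = ln ((a + b) / a)"
    using assms by (simp add: ln_div)
  also have "\<dots> \<le> (a + b) / a - 1"
    using assms by (intro ln_le_minus_one) simp
  also have "\<dots> = b / a" using assms by (simp add: divide_simps)
  finally have "(a + b) * (ln (a + b) - ln a) \<le> (a + b) * (b / a)"
    using assms by (intro mult_left_mono) auto
  also have "\<dots> = b + b\<^sup>2 / a"
    using assms by (simp add: divide_simps power2_eq_square algebra_simps)
  finally show ?thesis by (simp add: algebra_simps)
qed

lemma abs_ln_le:
  fixes a p q :: real
  assumes "0 < p" "p \<le> a" "a \<le> q"
  shows "\<bar>ln a\<bar> \<le> \<bar>ln p\<bar> + \<bar>ln q\<bar>"
proof -
  have "ln p \<le> ln a" "ln a \<le> ln q" using assms by auto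
  then show ?thesis by linarith
qed

lemma integrable_bounded_on_finite:
  fixes f :: "'a::euclidean_space \<Rightarrow> real"
  assumes [measurable]: "f \<in> borel_measurable borel" "E \<in> sets borel" and fin: "emeasure lborel E < \<infinity>"
    and b: "\<And>x. x \<in> E \<Longrightarrow> \<bar>f x\<bar> \<le> B" and z: "\<And>x. x \<notin> E \<Longrightarrow> f x = 0"
  shows "integrable lborel f"
proof (rule Bochner_Integration.integrable_bound[where f="\<lambda>x. indicator E x * B"])
  show "integrable lborel (\<lambda>x. indicator E x * B)"
    using fin by (intro integrable_mult_left integrable_real_indicator) auto
  show "AE x in lborel. norm (f x) \<le> norm (indicator E x * B)"
  proof (rule AE_I2)
    fix x show "norm (f x) \<le> norm (indicator E x * B)"
      using b[of x] z[of x] by (cases "x \<in> E") auto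
  qed
qed simp

text \<open>Perturbations of the density are supported in \<open>E\<close>. There the lower bound
  keeps the perturbed density nonnegative, and the two bounds together keep all entropies finite.
  Later \<open>E\<close> is a ball.\<close>

locale equilibrium_on =
  fixes \<theta> m \<Lambda> :: real and V \<mu> :: "'a::euclidean_space \<Rightarrow> real" and E :: "'a set"
  assumes dim: "2 \<le> DIM('a)" and \<theta>: "0 < \<theta>" and m: "0 < m"
    and V [measurable]: "V \<in> borel_measurable borel"
    and eq: "thermal_equilibrium \<theta> V \<mu>"
    and E [measurable]: "E \<in> sets borel" and E_finite: "emeasure lborel E < \<infinity>" and E_pos: "0 < measure lborel E"
    and bounds: "\<And>x. x \<in> E \<Longrightarrow> m \<le> \<mu> x \<and> \<mu> x \<le> \<Lambda>"
begin

abbreviation potential :: "'a \<Rightarrow> real" where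
  "potential x \<equiv> \<integral>y. coulomb_kernel (x - y) * \<mu> y \<partial>lborel"

text \<open>The first variation of the free energy, up to the additive constant
  \<open>1/\<theta>\<close>, which does not matter against perturbations of mean zero.\<close>

abbreviation chem :: "'a \<Rightarrow> real" where
  "chem x \<equiv> V x + potential x + 1/\<theta> * ln (\<mu> x)"

lemma \<mu> [measurable]: "\<mu> \<in> borel_measurable borel"
  and \<mu>_nonneg: "0 \<le> \<mu> x" and \<mu>_nn_integral: "(\<integral>\<^sup>+x. ennreal (\<mu> x) \<partial>lborel) = 1"
  and \<mu>_finite: "finite_free_energy \<theta> V \<mu>"
  using eq by (auto simp: thermal_equilibrium_def prob_density_def)

lemma integrable_\<mu>: "integrable lborel \<mu>" and integral_\<mu>: "(\<integral>x. \<mu> x \<partial>lborel) = 1"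
proof -
  show "integrable lborel \<mu>"
    using \<mu>_nn_integral \<mu>_nonneg by (intro integrableI_nonneg) auto
  show "(\<integral>x. \<mu> x \<partial>lborel) = 1"
    using \<mu>_nn_integral \<mu>_nonneg by (subst integral_eq_nn_integral) auto
qed

lemma int_kernel: "integrable (lborel \<Otimes>\<^sub>M lborel) (\<lambda>(x, y). coulomb_kernel (x - y) * \<mu> x * \<mu> y)"
  and int_one_body: "integrable lborel (\<lambda>x. V x * \<mu> x + 1/\<theta> * (\<mu> x * ln (\<mu> x)))"
  using \<mu>_finite by (auto simp: finite_free_energy_def)

lemma \<Lambda>_nonneg: "0 \<le> \<Lambda>"
proof -
  have "E \<noteq> {}" using E_pos by auto
  then show ?thesis using bounds m by fastforce
qed

text \<open>Finite free energy gives integrability against the kernel for the density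
  \<open>\<mu>\<close> only; other functions inherit it through pointwise domination by multiples of
  \<open>\<mu>\<close>.\<close>

lemma int_kernel_dominated:
  fixes f g :: "'a \<Rightarrow> real"
  assumes [measurable]: "f \<in> borel_measurable borel" "g \<in> borel_measurable borel"
    and b: "\<And>x. \<bar>f x\<bar> \<le> c * \<mu> x" "\<And>x. \<bar>g x\<bar> \<le> c' * \<mu> x"
  shows "integrable (lborel \<Otimes>\<^sub>M lborel) (\<lambda>(x, y). coulomb_kernel (x - y) * f x * g y)"
proof (rule Bochner_Integration.integrable_bound[OF integrable_mult_right[OF int_kernel, of "c * c'"]])
  show "AE z in lborel \<Otimes>\<^sub>M lborel. norm (case z of (x, y) \<Rightarrow> coulomb_kernel (x - y) * f x * g y)
      \<le> norm (c * c' * (case z of (x, y) \<Rightarrow> coulomb_kernel (x - y) * \<mu> x * \<mu> y))"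
  proof (rule AE_I2, clarify)
    fix x y
    have "\<bar>f x\<bar> * \<bar>g y\<bar> \<le> (c * \<mu> x) * (c' * \<mu> y)"
      by (intro mult_mono b order_trans[OF abs_ge_zero b(1)]) auto
    then have "\<bar>coulomb_kernel (x - y)\<bar> * (\<bar>f x\<bar> * \<bar>g y\<bar>) \<le> \<bar>coulomb_kernel (x - y)\<bar> * ((c * \<mu> x) * (c' * \<mu> y))"
      by (intro mult_left_mono) auto
    also have "\<dots> = (c * c') * (\<bar>coulomb_kernel (x - y)\<bar> * (\<mu> x * \<mu> y))"
      by (simp add: mult_ac)
    also have "\<dots> \<le> \<bar>c * c'\<bar> * (\<bar>coulomb_kernel (x - y)\<bar> * (\<mu> x * \<mu> y))"
      by (intro mult_right_mono) (auto simp: \<mu>_nonneg)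
    also have "\<dots> = \<bar>c * c' * (coulomb_kernel (x - y) * \<mu> x * \<mu> y)\<bar>"
      by (simp add: abs_mult mult_ac \<mu>_nonneg)
    finally show "norm (coulomb_kernel (x - y) * f x * g y) \<le> norm (c * c' * (coulomb_kernel (x - y) * \<mu> x * \<mu> y))"
      by (simp add: abs_mult mult_ac)
  qed
qed measurable

lemma bounded_by_\<mu>:
  assumes "\<And>x. \<bar>f x\<bar> \<le> b" "\<And>x. x \<notin> E \<Longrightarrow> f x = 0"
  shows "\<bar>f x\<bar> \<le> b / m * \<mu> x"
proof (cases "x \<in> E")
  case True
  have "0 \<le> b" using assms(1)[of x] by linarith
  then have "b \<le> b / m * \<mu> x"
    using bounds[OF True] m by (simp add: divide_simps mult_left_mono)
  then show ?thesis using assms(1)[of x] by linarith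
next
  case False
  have "0 \<le> b" using assms(1)[of x] by linarith
  then show ?thesis using False assms(2) m \<mu>_nonneg[of x] by simp
qed

lemma int_kernel_E: "integrable (lborel \<Otimes>\<^sub>M lborel) (\<lambda>(x, y). indicator E x * coulomb_kernel (x - y) * \<mu> y)"
proof -
  have "integrable (lborel \<Otimes>\<^sub>M lborel) (\<lambda>(x, y). coulomb_kernel (x - y) * indicator E x * \<mu> y)"
  proof (rule int_kernel_dominated[where c="1/m" and c'=1])
    show "\<bar>indicator E x\<bar> \<le> 1 / m * \<mu> x" for x
      by (rule bounded_by_\<mu>) (auto simp: indicator_def)
  qed (auto simp: \<mu>_nonneg)
  then show ?thesis by (simp add: mult_ac)
qed

lemma int_E_\<mu>_ln: "integrable lborel (\<lambda>x. indicator E x * (\<mu> x * ln (\<mu> x)))"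
proof (rule integrable_bounded_on_finite[OF _ E E_finite, where B="\<Lambda> * (\<bar>ln m\<bar> + \<bar>ln \<Lambda>\<bar>)"])
  fix x assume x: "x \<in> E"
  then show "\<bar>indicator E x * (\<mu> x * ln (\<mu> x))\<bar> \<le> \<Lambda> * (\<bar>ln m\<bar> + \<bar>ln \<Lambda>\<bar>)"
    using bounds[OF x] abs_ln_le[OF m, of "\<mu> x" \<Lambda>] \<mu>_nonneg[of x]
    by (auto simp: abs_mult intro!: mult_mono)
qed auto

lemma int_E_ln: "integrable lborel (\<lambda>x. indicator E x * ln (\<mu> x))"
proof (rule integrable_bounded_on_finite[OF _ E E_finite, where B="\<bar>ln m\<bar> + \<bar>ln \<Lambda>\<bar>"])
  fix x assume x: "x \<in> E"
  then show "\<bar>indicator E x * ln (\<mu> x)\<bar> \<le> \<bar>ln m\<bar> + \<bar>ln \<Lambda>\<bar>"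
    using bounds[OF x] abs_ln_le[OF m, of "\<mu> x" \<Lambda>] by simp
qed auto

text \<open>The potential term is known to be integrable only together with the entropy term. On
  \<open>E\<close> the entropy term is bounded and can be subtracted, and the factor
  \<open>\<mu>\<close> can be removed because it is at least \<open>m\<close>.\<close>

lemma int_E_V: "integrable lborel (\<lambda>x. indicator E x * V x)"
proof -
  have "integrable lborel (\<lambda>x. indicator E x * (V x * \<mu> x + 1/\<theta> * (\<mu> x * ln (\<mu> x))))"
    using integrable_mult_indicator[OF _ int_one_body, of E] by simp
  then have "integrable lborel (\<lambda>x. indicator E x * (V x * \<mu> x + 1/\<theta> * (\<mu> x * ln (\<mu> x))) - 1/\<theta> * (indicator E x * (\<mu> x * ln (\<mu> x))))"
    by (intro Bochner_Integration.integrable_diff integrable_mult_right int_E_\<mu>_ln)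
  then have "integrable lborel (\<lambda>x. 1/m * (indicator E x * (V x * \<mu> x + 1/\<theta> * (\<mu> x * ln (\<mu> x))) - 1/\<theta> * (indicator E x * (\<mu> x * ln (\<mu> x)))))"
    by (rule integrable_mult_right)
  then show ?thesis
  proof (rule Bochner_Integration.integrable_bound)
    show "AE x in lborel. norm (indicator E x * V x)
       \<le> norm (1/m * (indicator E x * (V x * \<mu> x + 1/\<theta> * (\<mu> x * ln (\<mu> x))) - 1/\<theta> * (indicator E x * (\<mu> x * ln (\<mu> x)))))"
    proof (rule AE_I2)
      fix x
      have "\<bar>V x\<bar> * m \<le> \<bar>V x\<bar> * \<mu> x" if "x \<in> E"
        using bounds[OF that] by (intro mult_left_mono) auto
      then show "norm (indicator E x * V x)
        \<le> norm (1/m * (indicator E x * (V x * \<mu> x + 1/\<theta> * (\<mu> x * ln (\<mu> x))) - 1/\<theta> * (indicator E x * (\<mu> x * ln (\<mu> x)))))"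
        using m \<mu>_nonneg[of x] by (cases "x \<in> E") (auto simp: abs_mult divide_simps)
    qed
  qed measurable
qed

lemma int_E_potential: "integrable lborel (\<lambda>x. indicator E x * potential x)"
  using lborel_pair.integrable_fst[OF int_kernel_E] by (simp add: mult.assoc)

lemma int_E_chem: "integrable lborel (\<lambda>x. indicator E x * chem x)"
proof -
  have "integrable lborel (\<lambda>x. indicator E x * V x + indicator E x * potential x + 1/\<theta> * (indicator E x * ln (\<mu> x)))"
    by (intro Bochner_Integration.integrable_add integrable_mult_right int_E_V int_E_potential int_E_ln)
  then show ?thesis by (simp add: algebra_simps)
qed

text \<open>For \<open>|t| <= 1\<close> the competitor \<open>\<mu> + t * \<phi>\<close> is a
  probability density, since \<open>|\<phi>|\<close> is at most half of \<open>\<mu>\<close>. Its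
  free energy exceeds that of \<open>\<mu>\<close> by at most a quadratic polynomial in
  \<open>t\<close> without constant term: the interaction is bilinear, and
  \<open>xlnx_increment_le\<close> treats the entropy. Minimality forces the linear coefficient to
  vanish.\<close>

lemma first_variation:
  assumes [measurable]: "\<phi> \<in> borel_measurable borel"
    and b: "\<And>x. \<bar>\<phi> x\<bar> \<le> m / 2" and z: "\<And>x. x \<notin> E \<Longrightarrow> \<phi> x = 0" and mean: "(\<integral>x. \<phi> x \<partial>lborel) = 0"
  shows "(\<integral>x. chem x * \<phi> x \<partial>lborel) = 0"
proof -
  have \<phi>_le: "\<bar>\<phi> x\<bar> \<le> 1/2 * \<mu> x" for x
    using bounded_by_\<mu>[OF b z] m by simp
  have int_\<phi>: "integrable lborel \<phi>"
    by (rule integrable_bounded_on_finite[OF _ E E_finite b z]) auto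
  have int_mult: "integrable lborel (\<lambda>x. f x * \<phi> x)" if "integrable lborel (\<lambda>x. indicator E x * f x)"
      "f \<in> borel_measurable borel" for f :: "'a \<Rightarrow> real"
  proof (rule Bochner_Integration.integrable_bound[OF integrable_mult_right[OF that(1), of "m/2"]])
    show "AE x in lborel. norm (f x * \<phi> x) \<le> norm (m / 2 * (indicator E x * f x))"
    proof (rule AE_I2)
      fix x
      show "norm (f x * \<phi> x) \<le> norm (m / 2 * (indicator E x * f x))"
        using z[of x] mult_left_mono[OF b[of x], of "\<bar>f x\<bar>"] m
        by (cases "x \<in> E") (auto simp: abs_mult mult_ac)
    qed
  qed (use that(2) in measurable)
  define K1 where "K1 = (\<integral>z. (case z of (x, y) \<Rightarrow> coulomb_kernel (x - y) * \<phi> x * \<mu> y) \<partial>(lborel \<Otimes>\<^sub>M lborel))"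
  define K2 where "K2 = (\<integral>z. (case z of (x, y) \<Rightarrow> coulomb_kernel (x - y) * \<phi> x * \<phi> y) \<partial>(lborel \<Otimes>\<^sub>M lborel))"
  \<comment> \<open>The quadratic remainder of the entropy; it is finite because
    \<open>\<phi>\<close> is bounded and supported in \<open>E\<close>, which has finite measure and
    on which \<open>\<mu>\<close> is at least \<open>m\<close>.\<close>
  define Q where "Q = (\<integral>x. (\<phi> x)\<^sup>2 / \<mu> x \<partial>lborel)"
  have int_\<phi>\<mu>: "integrable (lborel \<Otimes>\<^sub>M lborel) (\<lambda>(x, y). coulomb_kernel (x - y) * \<phi> x * \<mu> y)"
    by (rule int_kernel_dominated[where c="1/2" and c'=1]) (auto simp: \<mu>_nonneg intro: \<phi>_le[simplified])
  have int_\<mu>\<phi>: "integrable (lborel \<Otimes>\<^sub>M lborel) (\<lambda>(x, y). coulomb_kernel (x - y) * \<mu> x * \<phi> y)"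
    by (rule int_kernel_dominated[where c=1 and c'="1/2"]) (auto simp: \<mu>_nonneg intro: \<phi>_le[simplified])
  have int_\<phi>\<phi>: "integrable (lborel \<Otimes>\<^sub>M lborel) (\<lambda>(x, y). coulomb_kernel (x - y) * \<phi> x * \<phi> y)"
    by (rule int_kernel_dominated[where c="1/2" and c'="1/2"]) (auto intro: \<phi>_le[simplified])
  \<comment> \<open>The two cross terms of the interaction agree because the kernel is even;
    together they cancel the factor \<open>1/2\<close> of the energy.\<close>
  have K1': "(\<integral>z. (case z of (x, y) \<Rightarrow> coulomb_kernel (x - y) * \<mu> x * \<phi> y) \<partial>(lborel \<Otimes>\<^sub>M lborel)) = K1"
    unfolding K1_def
    by (subst lborel_pair.integral_product_swap[symmetric])
      (auto intro!: Bochner_Integration.integral_cong simp: coulomb_kernel_minus[of "_ - _", simplified] mult_ac split_beta)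
  have K1_eq: "K1 = (\<integral>x. potential x * \<phi> x \<partial>lborel)"
    unfolding K1_def lborel_pair.integral_fst[OF int_\<phi>\<mu>, symmetric]
    by (intro Bochner_Integration.integral_cong) (auto simp: mult_ac simp flip: integral_mult_right_zero)
  have int_V: "integrable lborel (\<lambda>x. V x * \<phi> x)" by (rule int_mult[OF int_E_V V])
  have int_h: "integrable lborel (\<lambda>x. potential x * \<phi> x)" by (rule int_mult[OF int_E_potential]) measurable
  have int_ln: "integrable lborel (\<lambda>x. ln (\<mu> x) * \<phi> x)" by (rule int_mult[OF int_E_ln]) measurable
  have int_Q: "integrable lborel (\<lambda>x. (\<phi> x)\<^sup>2 / \<mu> x)"
  proof (rule integrable_bounded_on_finite[OF _ E E_finite, where B="(m/2)\<^sup>2 / m"])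
    fix x assume x: "x \<in> E"
    have "(\<phi> x)\<^sup>2 / \<mu> x \<le> (m/2)\<^sup>2 / m"
      using bounds[OF x] m b[of x] by (intro frac_le) (auto simp: abs_le_square_iff[symmetric])
    then show "\<bar>(\<phi> x)\<^sup>2 / \<mu> x\<bar> \<le> (m/2)\<^sup>2 / m" using \<mu>_nonneg[of x] by simp
  qed (auto simp: z)
  have "0 \<le> t * (\<integral>x. chem x * \<phi> x \<partial>lborel) + t\<^sup>2 * (1/2 * K2 + 1/\<theta> * Q)" if t: "\<bar>t\<bar> \<le> 1" for t
  proof -
    define \<rho> where "\<rho> x = \<mu> x + t * \<phi> x" for x
    have \<rho>_meas [measurable]: "\<rho> \<in> borel_measurable borel"
      unfolding \<rho>_def by measurable
    have t\<phi>: "\<bar>t * \<phi> x\<bar> \<le> 1/2 * \<mu> x" for x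
      using \<phi>_le[of x] t mult_right_mono[OF t, of "\<bar>\<phi> x\<bar>"] by (simp add: abs_mult)
    have \<rho>_ge: "1/2 * \<mu> x \<le> \<rho> x" and \<rho>_le: "\<rho> x \<le> 3/2 * \<mu> x" for x
      using t\<phi>[of x] unfolding \<rho>_def abs_le_iff by linarith+
    have \<rho>_nonneg: "0 \<le> \<rho> x" for x
      using \<rho>_ge[of x] \<mu>_nonneg[of x] by linarith
    have int_\<rho>: "integrable lborel \<rho>"
      unfolding \<rho>_def by (intro Bochner_Integration.integrable_add integrable_mult_right integrable_\<mu> int_\<phi>)
    have "(\<integral>x. \<rho> x \<partial>lborel) = 1"
      unfolding \<rho>_def using integrable_\<mu> int_\<phi> by (simp add: integral_\<mu> mean)
    then have pd: "prob_density \<rho>"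
      using int_\<rho> \<rho>_nonneg by (simp add: prob_density_def nn_integral_eq_integral)
    \<comment> \<open>Since the entropy of \<open>\<mu>\<close> need not be integrable by itself,
      only its increment, which is supported in \<open>E\<close>, is separated from the potential
      term.\<close>
    let ?L = "\<lambda>x. \<rho> x * ln (\<rho> x) - \<mu> x * ln (\<mu> x)"
    have int_L: "integrable lborel ?L"
    proof -
      have "integrable lborel (\<lambda>x. indicator E x * (\<rho> x * ln (\<rho> x)))"
      proof (rule integrable_bounded_on_finite[OF _ E E_finite, where B="3/2 * \<Lambda> * (\<bar>ln (m/2)\<bar> + \<bar>ln (3/2 * \<Lambda>)\<bar>)"])
        fix x assume x: "x \<in> E"
        have "m/2 \<le> \<rho> x" "\<rho> x \<le> 3/2 * \<Lambda>"
          using bounds[OF x] \<rho>_ge[of x] \<rho>_le[of x] by linarith+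
        then have "\<bar>\<rho> x\<bar> * \<bar>ln (\<rho> x)\<bar> \<le> 3/2 * \<Lambda> * (\<bar>ln (m/2)\<bar> + \<bar>ln (3/2 * \<Lambda>)\<bar>)"
          using abs_ln_le[of "m/2" "\<rho> x" "3/2 * \<Lambda>"] \<rho>_nonneg[of x] m \<Lambda>_nonneg
          by (intro mult_mono) auto
        then show "\<bar>indicator E x * (\<rho> x * ln (\<rho> x))\<bar> \<le> 3/2 * \<Lambda> * (\<bar>ln (m/2)\<bar> + \<bar>ln (3/2 * \<Lambda>)\<bar>)"
          using x by (simp add: abs_mult)
      qed auto
      then have "integrable lborel (\<lambda>x. indicator E x * (\<rho> x * ln (\<rho> x)) - indicator E x * (\<mu> x * ln (\<mu> x)))"
        by (intro Bochner_Integration.integrable_diff int_E_\<mu>_ln)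
      also have "(\<lambda>x. indicator E x * (\<rho> x * ln (\<rho> x)) - indicator E x * (\<mu> x * ln (\<mu> x))) = ?L"
        by (auto simp: indicator_def \<rho>_def z)
      finally show ?thesis .
    qed
    have one_body: "(\<lambda>x. V x * \<rho> x + 1/\<theta> * (\<rho> x * ln (\<rho> x))) =
        (\<lambda>x. (V x * \<mu> x + 1/\<theta> * (\<mu> x * ln (\<mu> x))) + (t * (V x * \<phi> x) + 1/\<theta> * ?L x))"
      by (auto simp: \<rho>_def algebra_simps)
    have two_body: "(\<lambda>(x, y). coulomb_kernel (x - y) * \<rho> x * \<rho> y) =
        (\<lambda>z. (case z of (x, y) \<Rightarrow> coulomb_kernel (x - y) * \<mu> x * \<mu> y) +
           (t * (case z of (x, y) \<Rightarrow> coulomb_kernel (x - y) * \<phi> x * \<mu> y) +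
            (t * (case z of (x, y) \<Rightarrow> coulomb_kernel (x - y) * \<mu> x * \<phi> y) +
             t\<^sup>2 * (case z of (x, y) \<Rightarrow> coulomb_kernel (x - y) * \<phi> x * \<phi> y))))"
      by (auto simp: \<rho>_def algebra_simps power2_eq_square)
    have ffe: "finite_free_energy \<theta> V \<rho>"
      unfolding finite_free_energy_def one_body two_body
      by (intro conjI Bochner_Integration.integrable_add integrable_mult_right int_kernel int_one_body int_\<phi>\<mu> int_\<mu>\<phi> int_\<phi>\<phi> int_V int_L)
    have "free_energy \<theta> V \<mu> \<le> free_energy \<theta> V \<rho>"
      using eq pd ffe by (auto simp: thermal_equilibrium_def)
    also have "free_energy \<theta> V \<rho> = free_energy \<theta> V \<mu> + (t * K1 + 1/2 * (t\<^sup>2 * K2)) +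
        (t * (\<integral>x. V x * \<phi> x \<partial>lborel) + 1/\<theta> * (\<integral>x. ?L x \<partial>lborel))"
    proof -
      have "interaction_energy \<rho> = interaction_energy \<mu> + (t * K1 + (t * K1 + t\<^sup>2 * K2))"
        unfolding interaction_energy_def two_body
        using int_kernel int_\<phi>\<mu> int_\<mu>\<phi> int_\<phi>\<phi>
        by (simp add: K1' flip: K1_def K2_def)
      moreover have "(\<integral>x. V x * \<rho> x + 1/\<theta> * (\<rho> x * ln (\<rho> x)) \<partial>lborel) =
          (\<integral>x. V x * \<mu> x + 1/\<theta> * (\<mu> x * ln (\<mu> x)) \<partial>lborel) +
          (t * (\<integral>x. V x * \<phi> x \<partial>lborel) + 1/\<theta> * (\<integral>x. ?L x \<partial>lborel))"
        unfolding one_body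
        by (subst Bochner_Integration.integral_add[OF int_one_body])
          (use int_V int_L in \<open>auto intro!: Bochner_Integration.integrable_add integrable_mult_right\<close>)
      ultimately show ?thesis by (simp add: free_energy_def algebra_simps)
    qed
    finally have "0 \<le> (t * K1 + 1/2 * (t\<^sup>2 * K2)) + (t * (\<integral>x. V x * \<phi> x \<partial>lborel) + 1/\<theta> * (\<integral>x. ?L x \<partial>lborel))"
      by linarith
    also have "(\<integral>x. ?L x \<partial>lborel) \<le> (\<integral>x. t * (ln (\<mu> x) * \<phi> x) + (t * \<phi> x + t\<^sup>2 * ((\<phi> x)\<^sup>2 / \<mu> x)) \<partial>lborel)"
    proof (rule integral_mono[OF int_L])
      show "integrable lborel (\<lambda>x. t * (ln (\<mu> x) * \<phi> x) + (t * \<phi> x + t\<^sup>2 * ((\<phi> x)\<^sup>2 / \<mu> x)))"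
        by (intro Bochner_Integration.integrable_add integrable_mult_right int_ln int_\<phi> int_Q)
      fix x
      show "?L x \<le> t * (ln (\<mu> x) * \<phi> x) + (t * \<phi> x + t\<^sup>2 * ((\<phi> x)\<^sup>2 / \<mu> x))"
      proof (cases "x \<in> E")
        case True
        then have "0 < \<mu> x" using bounds m by fastforce
        then show ?thesis
          using xlnx_increment_le[of "\<mu> x" "t * \<phi> x"] \<rho>_ge[of x]
          by (simp add: \<rho>_def power_mult_distrib algebra_simps)
      qed (simp add: \<rho>_def z)
    qed
    also have "(\<integral>x. t * (ln (\<mu> x) * \<phi> x) + (t * \<phi> x + t\<^sup>2 * ((\<phi> x)\<^sup>2 / \<mu> x)) \<partial>lborel) =
        t * (\<integral>x. ln (\<mu> x) * \<phi> x \<partial>lborel) + t\<^sup>2 * Q"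
      by (simp only: Bochner_Integration.integral_add Bochner_Integration.integrable_add integrable_mult_right
          int_ln int_\<phi> int_Q integral_mult_right_zero mean flip: Q_def)
    also have "(t * K1 + 1/2 * (t\<^sup>2 * K2)) + (t * (\<integral>x. V x * \<phi> x \<partial>lborel) + 1/\<theta> *
        (t * (\<integral>x. ln (\<mu> x) * \<phi> x \<partial>lborel) + t\<^sup>2 * Q)) =
        t * ((\<integral>x. V x * \<phi> x \<partial>lborel) + (\<integral>x. potential x * \<phi> x \<partial>lborel) + 1/\<theta> * (\<integral>x. ln (\<mu> x) * \<phi> x \<partial>lborel))
        + t\<^sup>2 * (1/2 * K2 + 1/\<theta> * Q)"
      by (simp add: K1_eq algebra_simps)
    also have "(\<integral>x. V x * \<phi> x \<partial>lborel) + (\<integral>x. potential x * \<phi> x \<partial>lborel) + 1/\<theta> * (\<integral>x. ln (\<mu> x) * \<phi> x \<partial>lborel) =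
        (\<integral>x. V x * \<phi> x + potential x * \<phi> x + 1/\<theta> * (ln (\<mu> x) * \<phi> x) \<partial>lborel)"
      using int_V int_h int_ln by simp
    also have "\<dots> = (\<integral>x. chem x * \<phi> x \<partial>lborel)"
      by (simp add: algebra_simps)
    finally show ?thesis using \<theta> by (simp add: divide_right_mono)
  qed
  then show ?thesis by (rule zero_if_quadratic_nonneg)
qed

text \<open>The test function is the sign \<open>g\<close> of \<open>chem - a\<close>, with
  \<open>a\<close> the mean of \<open>chem\<close> over \<open>E\<close>, shifted by its own mean
  \<open>b\<close> to integrate to zero. The first variation then becomes a multiple of the integral
  of \<open>|chem - a|\<close> over \<open>E\<close>.\<close>

lemma euler_lagrange: "\<exists>c. AE x in lborel. x \<in> E \<longrightarrow> chem x = c"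
proof -
  define M where "M = measure lborel E"
  define a where "a = (\<integral>x. indicator E x * chem x \<partial>lborel) / M"
  define g where "g x = sgn (chem x - a)" for x
  define b where "b = (\<integral>x. indicator E x * g x \<partial>lborel) / M"
  define \<phi> where "\<phi> x = m / 4 * (indicator E x * (g x - b))" for x
  have M: "0 < M" using E_pos by (simp add: M_def)
  have g_meas [measurable]: "g \<in> borel_measurable borel" unfolding g_def by measurable
  have g_le: "\<bar>g x\<bar> \<le> 1" for x by (simp add: g_def sgn_if)
  have int_E: "integrable lborel (\<lambda>x. indicator E x :: real)"
    using E_finite by (intro integrable_real_indicator) auto
  have int_g: "integrable lborel (\<lambda>x. indicator E x * g x)"
    by (rule integrable_bounded_on_finite[OF _ E E_finite, where B=1]) (auto simp: g_le)
  have "\<bar>\<integral>x. indicator E x * g x \<partial>lborel\<bar> \<le> (\<integral>x. indicator E x \<partial>lborel)"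
    by (rule integral_abs_bound_integral[OF int_g int_E]) (auto simp: g_le indicator_def)
  then have b: "\<bar>b\<bar> \<le> 1" using M by (simp add: b_def M_def)
  have int_fg: "integrable lborel (\<lambda>x. indicator E x * chem x * g x)"
  proof (rule Bochner_Integration.integrable_bound[OF int_E_chem])
    show "AE x in lborel. norm (indicator E x * chem x * g x) \<le> norm (indicator E x * chem x)"
      using g_le by (intro AE_I2) (simp add: abs_mult mult_left_le)
  qed measurable
  have "(\<integral>x. chem x * \<phi> x \<partial>lborel) = 0"
  proof (rule first_variation)
    show "\<phi> \<in> borel_measurable borel" unfolding \<phi>_def by measurable
    show "\<bar>\<phi> x\<bar> \<le> m / 2" for x
      using b g_le[of x] m by (auto simp: \<phi>_def indicator_def abs_mult)
    show "\<phi> x = 0" if "x \<notin> E" for x using that by (simp add: \<phi>_def)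
    have "(\<integral>x. \<phi> x \<partial>lborel) = (\<integral>x. m/4 * (indicator E x * g x - b * indicator E x) \<partial>lborel)"
      unfolding \<phi>_def by (simp add: algebra_simps)
    also have "\<dots> = m/4 * ((\<integral>x. indicator E x * g x \<partial>lborel) - b * M)"
      using int_g int_E by (simp add: M_def)
    also have "\<dots> = 0" using M by (simp add: b_def)
    finally show "(\<integral>x. \<phi> x \<partial>lborel) = 0" .
  qed
  moreover have "(\<integral>x. chem x * \<phi> x \<partial>lborel) = (\<integral>x. m/4 * (indicator E x * chem x * g x - b * (indicator E x * chem x)) \<partial>lborel)"
    unfolding \<phi>_def by (simp add: algebra_simps)
  also have "\<dots> = m/4 * ((\<integral>x. indicator E x * chem x * g x \<partial>lborel) - b * (\<integral>x. indicator E x * chem x \<partial>lborel))"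
    using int_fg int_E_chem by simp
  \<comment> \<open>Both sides are the product of the two integrals divided by \<open>M\<close>.
    This moves the correction by the mean from \<open>g\<close> to \<open>chem\<close>.\<close>
  also have "b * (\<integral>x. indicator E x * chem x \<partial>lborel) = a * (\<integral>x. indicator E x * g x \<partial>lborel)"
    using M by (simp add: a_def b_def)
  also have "m/4 * ((\<integral>x. indicator E x * chem x * g x \<partial>lborel) - a * (\<integral>x. indicator E x * g x \<partial>lborel)) =
      m/4 * (\<integral>x. indicator E x * chem x * g x - a * (indicator E x * g x) \<partial>lborel)"
    using int_fg int_g by simp
  also have "(\<integral>x. indicator E x * chem x * g x - a * (indicator E x * g x) \<partial>lborel) = (\<integral>x. indicator E x * \<bar>chem x - a\<bar> \<partial>lborel)"
    by (intro Bochner_Integration.integral_cong) (auto simp: g_def sgn_if indicator_def algebra_simps abs_if)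
  finally have "(\<integral>x. indicator E x * \<bar>chem x - a\<bar> \<partial>lborel) = 0" using m by simp
  moreover have "integrable lborel (\<lambda>x. indicator E x * \<bar>chem x - a\<bar>)"
  proof -
    have "integrable lborel (\<lambda>x. \<bar>indicator E x * chem x - a * indicator E x\<bar>)"
      using int_E_chem int_E by (intro integrable_abs Bochner_Integration.integrable_diff integrable_mult_right)
    also have "(\<lambda>x. \<bar>indicator E x * chem x - a * indicator E x\<bar>) = (\<lambda>x. indicator E x * \<bar>chem x - a\<bar>)"
      by (auto simp: indicator_def)
    finally show ?thesis .
  qed
  ultimately have "AE x in lborel. indicator E x * \<bar>chem x - a\<bar> = 0"
    by (subst (asm) integral_nonneg_eq_0_iff_AE) auto
  then show ?thesis
    by (intro exI[of _ a]) (auto elim!: eventually_mono)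
qed

end

section \<open>Averages of the potentials over small balls\<close>

lemma ball_shrink:
  fixes y :: "'a::euclidean_space"
  assumes s: "0 < s" and y: "y \<in> ball z (\<rho> - s)" and u: "norm u < 1"
  shows "y + s *\<^sub>R u \<in> ball z \<rho>"
proof -
  have "dist z (y + s *\<^sub>R u) \<le> dist z y + s * norm u"
    using dist_triangle[of z "y + s *\<^sub>R u" y] s by (simp add: dist_norm)
  also have "\<dots> < \<rho> - s + s * 1"
    using y s u by (intro add_strict_mono) auto
  finally show ?thesis by simp
qed

lemma integrable_smear:
  fixes f :: "'a::euclidean_space \<Rightarrow> real"
  assumes [measurable]: "f \<in> borel_measurable borel"
    and f: "integrable lborel (\<lambda>x. indicator (ball z \<rho>) x * f x)" and s: "0 < s" and y: "y \<in> ball z (\<rho> - s)"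
  shows "integrable lborel (\<lambda>u. f (y + s *\<^sub>R u) * moll u)"
proof -
  have [measurable]: "ball z \<rho> \<in> sets borel" by simp
  let ?g = "\<lambda>x. indicator (ball z \<rho>) x * f x"
  have "integrable lborel (\<lambda>u. ?g (y + s *\<^sub>R u))"
    using f s by (subst integrable_lborel_affine_iff) auto
  then have "integrable lborel (\<lambda>u. 1 / (\<integral>v. bump (v::'a) \<partial>lborel) * ?g (y + s *\<^sub>R u))"
    by (rule integrable_mult_right)
  then show ?thesis
  proof (rule Bochner_Integration.integrable_bound)
    show "AE u in lborel. norm (f (y + s *\<^sub>R u) * moll u) \<le> norm (1 / (\<integral>v. bump (v::'a) \<partial>lborel) * ?g (y + s *\<^sub>R u))"
    proof (rule AE_I2)
      fix u :: 'a
      show "norm (f (y + s *\<^sub>R u) * moll u) \<le> norm (1 / (\<integral>v. bump (v::'a) \<partial>lborel) * ?g (y + s *\<^sub>R u))"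
      proof (cases "norm u < 1")
        case True
        then have "y + s *\<^sub>R u \<in> ball z \<rho>" by (rule ball_shrink[OF s y])
        then show ?thesis
          using mult_left_mono[OF moll_le[of u], of "\<bar>f (y + s *\<^sub>R u)\<bar>"] moll_nonneg[of u] bump_mass_pos[where 'a='a]
          by (simp add: abs_mult mult.commute)
      qed (simp add: moll_eq_0)
    qed
  qed measurable
qed

locale equilibrium_on_ball = equilibrium_on \<theta> m \<Lambda> V \<mu> "ball z \<rho>"
  for \<theta> m \<Lambda> :: real and V \<mu> :: "'a::euclidean_space \<Rightarrow> real" and z \<rho>
begin

lemma AE_potential_integrable: "AE x in lborel. x \<in> ball z \<rho> \<longrightarrow> integrable lborel (\<lambda>w. coulomb_kernel (x - w) * \<mu> w)"
  using lborel_pair.AE_integrable_fst[OF int_kernel_E]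
  by eventually_elim (auto simp: mult.assoc)

text \<open>The rescaled excess vanishes beyond distance \<open>s\<close>, so only charge within
  distance \<open>s\<close> of \<open>y\<close> contributes. It lies in
  \<open>ball z \<rho>\<close>, where the density is at most \<open>\<Lambda>\<close>; the power of
  \<open>s\<close> is the Jacobian.\<close>

lemma excess_convolution:
  assumes s: "0 < s" and y: "y \<in> ball z (\<rho> - s)"
  shows "integrable lborel (\<lambda>w. \<mu> w * excess ((1/s) *\<^sub>R (y - w)))" (is ?int)
    and "(\<integral>w. \<mu> w * excess ((1/s) *\<^sub>R (y - w)) \<partial>lborel) \<le> \<Lambda> * s ^ DIM('a) * (\<integral>x. excess (x::'a) \<partial>lborel)" (is ?le)
proof -
  let ?T = "\<lambda>w. (1/s) *\<^sub>R y + (- 1/s) *\<^sub>R w"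
  have T: "(1/s) *\<^sub>R (y - w) = ?T w" for w
    by (simp add: scaleR_diff_right)
  have int_e: "integrable lborel (\<lambda>w. excess (?T w))"
    using s by (subst integrable_lborel_affine_iff) (auto intro: integrable_excess dim)
  have ne: "AE w in lborel. w \<noteq> y"
    by (rule AE_lborel_singleton)
  have le: "\<mu> w * excess ((1/s) *\<^sub>R (y - w)) \<le> \<Lambda> * excess (?T w)" "0 \<le> \<mu> w * excess ((1/s) *\<^sub>R (y - w))"
    if "w \<noteq> y" for w
  proof -
    have nn: "0 \<le> excess ((1/s) *\<^sub>R (y - w))" using s that by (intro excess_nonneg[OF dim]) simp
    then show "0 \<le> \<mu> w * excess ((1/s) *\<^sub>R (y - w))" using \<mu>_nonneg by simp
    show "\<mu> w * excess ((1/s) *\<^sub>R (y - w)) \<le> \<Lambda> * excess (?T w)"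
    proof (cases "norm ((1/s) *\<^sub>R (y - w)) \<le> 1")
      case True
      then have "norm (y - w) \<le> s" using s by (simp add: divide_simps)
      then have "w \<in> ball z \<rho>"
        using y dist_triangle[of z w y] by (simp add: dist_norm)
      then show ?thesis unfolding T[symmetric]
        using bounds nn by (intro mult_right_mono) auto
    next
      case False
      then show ?thesis unfolding T[symmetric] using excess_eq_0[OF dim] by simp
    qed
  qed
  show ?int
  proof (rule Bochner_Integration.integrable_bound[OF integrable_mult_right[OF int_e, of \<Lambda>]])
    show "AE w in lborel. norm (\<mu> w * excess ((1/s) *\<^sub>R (y - w))) \<le> norm (\<Lambda> * excess (?T w))"
      using ne
    proof eventually_elim
      case (elim w)
      show ?case using le[OF elim] unfolding real_norm_def by linarith
    qed
  qed measurable
  have "(\<integral>w. \<mu> w * excess ((1/s) *\<^sub>R (y - w)) \<partial>lborel) \<le> (\<integral>w. \<Lambda> * excess (?T w) \<partial>lborel)"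
    by (rule integral_mono_AE[OF \<open>?int\<close> integrable_mult_right[OF int_e]])
      (use ne in eventually_elim, rule le)
  also have "\<dots> = \<Lambda> * (s ^ DIM('a) * (\<integral>x. excess (x::'a) \<partial>lborel))"
    using s integral_lborel_affine[of "excess :: 'a \<Rightarrow> real" "- 1/s" "(1/s) *\<^sub>R y"]
    by (simp add: power_divide)
  finally show ?le by (simp add: mult.assoc)
qed

text \<open>By Fubini the average of the potential is the potential for the averaged kernel, and the
  two kernels differ by the rescaled excess. The powers combine to
  \<open>s powr (2 - d) * s^d = s^2\<close>. Absolute convergence at the point \<open>y\<close>
  itself is assumed because it is available almost everywhere only.\<close>

lemma smear_potential:
  assumes s: "0 < s" and y: "y \<in> ball z (\<rho> - s)"
    and int_y: "integrable lborel (\<lambda>w. coulomb_kernel (y - w) * \<mu> w)"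
  shows "potential y \<le> smear s potential y + \<Lambda> * s\<^sup>2 * (\<integral>x. excess (x::'a) \<partial>lborel)"
proof -
  have [measurable]: "ball z \<rho> \<in> sets borel" by simp
  let ?F = "\<lambda>u w. coulomb_kernel (y + s *\<^sub>R u - w) * \<mu> w * moll u"
  let ?H = "\<lambda>x. \<integral>w. \<bar>coulomb_kernel (x - w) * \<mu> w\<bar> \<partial>lborel"
  have "integrable lborel (\<lambda>x. indicator (ball z \<rho>) x * ?H x)"
  proof -
    have "integrable (lborel \<Otimes>\<^sub>M lborel) (\<lambda>(x, w). \<bar>indicator (ball z \<rho>) x * coulomb_kernel (x - w) * \<mu> w\<bar>)"
      using integrable_abs[OF int_kernel_E] by (simp add: split_beta')
    from lborel_pair.integrable_fst[OF this] show ?thesis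
      by (simp add: abs_mult mult.assoc)
  qed
  then have int_H: "integrable lborel (\<lambda>u. ?H (y + s *\<^sub>R u) * moll u)"
    using s y by (intro integrable_smear[where z=z and \<rho>=\<rho>]) auto
  have int_F: "integrable (lborel \<Otimes>\<^sub>M lborel) (\<lambda>(u, w). ?F u w)"
  proof (rule lborel_pair.Fubini_integrable)
    show "integrable lborel (\<lambda>u. \<integral>w. norm (case (u, w) of (u, w) \<Rightarrow> ?F u w) \<partial>lborel)"
      using int_H by (simp add: abs_mult moll_nonneg)
    show "AE u in lborel. integrable lborel (\<lambda>w. case (u, w) of (u, w) \<Rightarrow> ?F u w)"
      using AE_lborel_affine[OF less_imp_neq[OF s, symmetric] AE_potential_integrable, of y]
    proof eventually_elim
      case (elim u)
      show ?case
      proof (cases "norm u < 1")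
        case True
        then show ?thesis using elim ball_shrink[OF s y True] by auto
      qed (simp add: moll_eq_0)
    qed
  qed measurable
  have "smear s potential y = (\<integral>u. (\<integral>w. ?F u w \<partial>lborel) \<partial>lborel)"
    unfolding smear_def by simp
  also have "\<dots> = (\<integral>w. (\<integral>u. ?F u w \<partial>lborel) \<partial>lborel)"
    using lborel_pair.Fubini_integral[OF int_F] by simp
  also have "\<dots> = (\<integral>w. coulomb_kernel (y - w) * \<mu> w - s powr (2 - real DIM('a)) * (\<mu> w * excess ((1/s) *\<^sub>R (y - w))) \<partial>lborel)"
  proof (rule integral_cong_AE)
    show "AE w in lborel. (\<integral>u. ?F u w \<partial>lborel) =
        coulomb_kernel (y - w) * \<mu> w - s powr (2 - real DIM('a)) * (\<mu> w * excess ((1/s) *\<^sub>R (y - w)))"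
      using AE_lborel_singleton[of y]
    proof eventually_elim
      case (elim w)
      have "(\<integral>u. ?F u w \<partial>lborel) = \<mu> w * smear s coulomb_kernel (y - w)"
        unfolding smear_def
        by (subst integral_mult_right_zero[symmetric])
          (auto intro!: Bochner_Integration.integral_cong simp: algebra_simps)
      moreover have "coulomb_kernel (y - w) - smear s coulomb_kernel (y - w) = s powr (2 - real DIM('a)) * excess ((1/s) *\<^sub>R (y - w))"
        using coulomb_minus_smear_scale[OF dim s, of "(1/s) *\<^sub>R (y - w)"] elim s by simp
      ultimately show ?case by (simp add: algebra_simps)
    qed
  qed measurable
  also have "\<dots> = potential y - s powr (2 - real DIM('a)) * (\<integral>w. \<mu> w * excess ((1/s) *\<^sub>R (y - w)) \<partial>lborel)"
    using int_y excess_convolution(1)[OF s y] by simp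
  finally have "potential y = smear s potential y + s powr (2 - real DIM('a)) * (\<integral>w. \<mu> w * excess ((1/s) *\<^sub>R (y - w)) \<partial>lborel)"
    by simp
  also have "s powr (2 - real DIM('a)) * (\<integral>w. \<mu> w * excess ((1/s) *\<^sub>R (y - w)) \<partial>lborel) \<le>
      s powr (2 - real DIM('a)) * (\<Lambda> * s ^ DIM('a) * (\<integral>x. excess (x::'a) \<partial>lborel))"
    using s by (intro mult_left_mono excess_convolution(2)[OF s y]) auto
  also have "s powr (2 - real DIM('a)) * (\<Lambda> * s ^ DIM('a) * (\<integral>x. excess (x::'a) \<partial>lborel)) =
      \<Lambda> * (s powr (2 - real DIM('a)) * s powr real DIM('a)) * (\<integral>x. excess (x::'a) \<partial>lborel)"
    using s by (simp add: powr_realpow)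
  also have "s powr (2 - real DIM('a)) * s powr real DIM('a) = s\<^sup>2"
    using s by (simp add: powr_numeral flip: powr_add)
  finally show ?thesis by simp
qed

text \<open>On the ball the Euler-Lagrange equation expresses \<open>V\<close> by the potential of
  \<open>\<mu>\<close> and \<open>ln \<mu>\<close>. Averaging lowers the former by at most
  \<open>\<Lambda> * s^2\<close> times the integral of \<open>excess\<close>, and changes the latter
  by at most \<open>ln (\<Lambda> / m)\<close>. The conclusion holds almost everywhere because the
  equation does.\<close>

lemma smear_V:
  assumes s: "0 < s"
  shows "AE y in lborel. y \<in> ball z (\<rho> - s) \<longrightarrow>
    integrable lborel (\<lambda>u. V (y + s *\<^sub>R u) * moll u) \<and>
    \<theta> * smear s V y \<le> \<theta> * V y + ln (\<Lambda> / m) + \<theta> * \<Lambda> * s\<^sup>2 * (\<integral>x. excess (x::'a) \<partial>lborel)"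
proof -
  obtain c where c: "AE x in lborel. x \<in> ball z \<rho> \<longrightarrow> chem x = c"
    using euler_lagrange by blast
  show ?thesis
    using c AE_potential_integrable
  proof eventually_elim
    case (elim y)
    show ?case
    proof (intro impI)
      assume y: "y \<in> ball z (\<rho> - s)"
      then have y': "y \<in> ball z \<rho>" using s by auto
      have pos: "0 < m" "m \<le> \<Lambda>" using m bounds[OF y'] by auto
      have iV: "integrable lborel (\<lambda>u. V (y + s *\<^sub>R u) * moll u)"
        by (rule integrable_smear[OF V int_E_V s y])
      have ih: "integrable lborel (\<lambda>u. potential (y + s *\<^sub>R u) * moll u)"
        by (rule integrable_smear[OF _ int_E_potential s y]) measurable
      have il: "integrable lborel (\<lambda>u. ln (\<mu> (y + s *\<^sub>R u)) * moll u)"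
        by (rule integrable_smear[OF _ int_E_ln s y]) measurable
      have "smear s V y = (\<integral>u. c * moll u - potential (y + s *\<^sub>R u) * moll u - 1/\<theta> * (ln (\<mu> (y + s *\<^sub>R u)) * moll u) \<partial>lborel)"
        unfolding smear_def
      proof (rule integral_cong_AE)
        show "AE u in lborel. V (y + s *\<^sub>R u) * moll u =
            c * moll u - potential (y + s *\<^sub>R u) * moll u - 1/\<theta> * (ln (\<mu> (y + s *\<^sub>R u)) * moll u)"
          using AE_lborel_affine[OF less_imp_neq[OF s, symmetric] c, of y]
        proof eventually_elim
          case (elim u)
          show ?case
          proof (cases "norm u < 1")
            case True
            with elim have "V (y + s *\<^sub>R u) = c - potential (y + s *\<^sub>R u) - 1/\<theta> * ln (\<mu> (y + s *\<^sub>R u))"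
              using ball_shrink[OF s y True] by simp
            then show ?thesis by (simp only: left_diff_distrib mult.assoc)
          qed (simp add: moll_eq_0)
        qed
      qed measurable
      also have "\<dots> = c - smear s potential y - 1/\<theta> * (\<integral>u. ln (\<mu> (y + s *\<^sub>R u)) * moll u \<partial>lborel)"
        by (simp only: smear_def Bochner_Integration.integral_diff Bochner_Integration.integrable_diff
            integrable_mult_right ih il integrable_moll integral_mult_right_zero integral_moll mult_1_right)
      finally have eq: "smear s V y = c - smear s potential y - 1/\<theta> * (\<integral>u. ln (\<mu> (y + s *\<^sub>R u)) * moll u \<partial>lborel)" .
      have "(\<integral>u. ln m * moll (u::'a) \<partial>lborel) \<le> (\<integral>u. ln (\<mu> (y + s *\<^sub>R u)) * moll u \<partial>lborel)"
      proof (rule integral_mono[OF _ il])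
        show "integrable lborel (\<lambda>u::'a. ln m * moll u)" by (intro integrable_mult_right integrable_moll)
        fix u :: 'a
        show "ln m * moll u \<le> ln (\<mu> (y + s *\<^sub>R u)) * moll u"
        proof (cases "norm u < 1")
          case True
          have "m \<le> \<mu> (y + s *\<^sub>R u)" using bounds[OF ball_shrink[OF s y True]] by simp
          then show ?thesis using pos by (intro mult_right_mono moll_nonneg) auto
        qed (simp add: moll_eq_0)
      qed
      then have "smear s V y \<le> c - smear s potential y - 1/\<theta> * ln m"
        unfolding eq using \<theta> by (simp add: integral_moll divide_right_mono)
      also have "\<dots> \<le> c - potential y + \<Lambda> * s\<^sup>2 * (\<integral>x. excess (x::'a) \<partial>lborel) - 1/\<theta> * ln m"
        using smear_potential[OF s y] elim(2) y' by simp
      also have "c = chem y" using elim(1) y' by simp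
      also have "chem y - potential y + \<Lambda> * s\<^sup>2 * (\<integral>x. excess (x::'a) \<partial>lborel) - 1/\<theta> * ln m
          \<le> V y + 1/\<theta> * (ln \<Lambda> - ln m) + \<Lambda> * s\<^sup>2 * (\<integral>x. excess (x::'a) \<partial>lborel)"
      proof -
        have "ln (\<mu> y) \<le> ln \<Lambda>" using bounds[OF y'] pos by auto
        then have "1/\<theta> * ln (\<mu> y) \<le> 1/\<theta> * ln \<Lambda>" using \<theta> by (intro mult_left_mono) auto
        then show ?thesis by (simp add: right_diff_distrib diff_divide_distrib)
      qed
      finally have "\<theta> * smear s V y \<le> \<theta> * (V y + 1/\<theta> * (ln \<Lambda> - ln m) + \<Lambda> * s\<^sup>2 * (\<integral>x. excess (x::'a) \<partial>lborel))"
        using \<theta> by (intro mult_left_mono) auto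
      also have "\<dots> = \<theta> * V y + ln (\<Lambda> / m) + \<theta> * \<Lambda> * s\<^sup>2 * (\<integral>x. excess (x::'a) \<partial>lborel)"
        using \<theta> pos by (simp add: ln_div distrib_left)
      finally show "integrable lborel (\<lambda>u. V (y + s *\<^sub>R u) * moll u) \<and>
        \<theta> * smear s V y \<le> \<theta> * V y + ln (\<Lambda> / m) + \<theta> * \<Lambda> * s\<^sup>2 * (\<integral>x. excess (x::'a) \<partial>lborel)"
        using iV by blast
    qed
  qed
qed

end

section \<open>Moving one point\<close>

lemma pair_sum_remove:
  fixes g :: "nat \<Rightarrow> nat \<Rightarrow> real"
  assumes "finite A" "i \<in> A" and sym: "\<And>k j. g k j = g j k"
  shows "(\<Sum>k\<in>A. \<Sum>j\<in>A - {k}. g k j) = 2 * (\<Sum>j\<in>A - {i}. g i j) + (\<Sum>k\<in>A - {i}. \<Sum>j\<in>A - {i} - {k}. g k j)"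
proof -
  have "(\<Sum>k\<in>A. \<Sum>j\<in>A - {k}. g k j) = (\<Sum>j\<in>A - {i}. g i j) + (\<Sum>k\<in>A - {i}. \<Sum>j\<in>A - {k}. g k j)"
    using assms(1,2) by (rule sum.remove)
  also have "(\<Sum>k\<in>A - {i}. \<Sum>j\<in>A - {k}. g k j) = (\<Sum>k\<in>A - {i}. g i k + (\<Sum>j\<in>A - {i} - {k}. g k j))"
  proof (rule sum.cong[OF refl])
    fix k assume "k \<in> A - {i}"
    then have "(\<Sum>j\<in>A - {k}. g k j) = g k i + (\<Sum>j\<in>A - {k} - {i}. g k j)"
      using assms(1,2) by (intro sum.remove) auto
    then show "(\<Sum>j\<in>A - {k}. g k j) = g i k + (\<Sum>j\<in>A - {i} - {k}. g k j)"
      by (simp only: sym[of k i] Diff_insert2[symmetric, of A] insert_commute[of k i])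
  qed
  finally show ?thesis by (simp add: sum.distrib)
qed

lemma coulomb_kernel_commute: "coulomb_kernel (x - y) = coulomb_kernel (y - x)"
  using coulomb_kernel_minus[of "x - y"] by simp

text \<open>Every pair containing \<open>i\<close> occurs twice in the double sum, which the factor
  \<open>1/2\<close> in the energy compensates.\<close>

lemma hamiltonian_update:
  fixes X :: "nat \<Rightarrow> 'a::euclidean_space"
  assumes i: "i < N"
  shows "hamiltonian V N (X(i := y)) = hamiltonian V N X +
    ((\<Sum>j\<in>{..<N} - {i}. coulomb_kernel (y - X j) - coulomb_kernel (X i - X j)) + real N * (V y - V (X i)))"
proof -
  let ?g = "\<lambda>X k j. coulomb_kernel (X k - X j :: 'a)"
  have split: "(\<Sum>k<N. \<Sum>j\<in>{..<N} - {k}. ?g X k j) = 2 * (\<Sum>j\<in>{..<N} - {i}. ?g X i j) +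
      (\<Sum>k\<in>{..<N} - {i}. \<Sum>j\<in>{..<N} - {i} - {k}. ?g X k j)" for X
    using i by (intro pair_sum_remove) (auto intro: coulomb_kernel_commute)
  have splitV: "(\<Sum>k<N. V (X k)) = V (X i) + (\<Sum>k\<in>{..<N} - {i}. V (X k))" for X
    using i by (intro sum.remove) auto
  show ?thesis
    unfolding hamiltonian_def split splitV by (simp add: sum_subtractf algebra_simps)
qed

lemma ennreal_integral_le_nn_integral:
  fixes f :: "'b \<Rightarrow> real"
  assumes f: "integrable M f"
  shows "ennreal (\<integral>x. f x \<partial>M) \<le> (\<integral>\<^sup>+x. ennreal (f x) \<partial>M)"
proof -
  have "(\<integral>x. f x \<partial>M) \<le> (\<integral>x. max 0 (f x) \<partial>M)"
    using f by (intro integral_mono integrable_max) auto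
  then have "ennreal (\<integral>x. f x \<partial>M) \<le> ennreal (\<integral>x. max 0 (f x) \<partial>M)"
    by (rule ennreal_leI)
  also have "\<dots> = (\<integral>\<^sup>+x. ennreal (max 0 (f x)) \<partial>M)"
    using f by (intro nn_integral_eq_integral[symmetric] integrable_max) auto
  also have "\<dots> = (\<integral>\<^sup>+x. ennreal (f x) \<partial>M)"
    by (intro nn_integral_cong) (simp add: max_def ennreal_neg)
  finally show ?thesis .
qed

text \<open>Jensen's inequality, obtained by integrating the tangent of \<open>exp\<close> at the
  mean. The right-hand side may be infinite.\<close>

lemma exp_mean_le:
  fixes e :: "'a::euclidean_space \<Rightarrow> real"
  assumes int: "integrable lborel (\<lambda>u. e u * moll u)"
  shows "ennreal (exp (\<integral>u. e u * moll u \<partial>lborel)) \<le> (\<integral>\<^sup>+u. ennreal (exp (e u)) * ennreal (moll u) \<partial>lborel)"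
proof -
  let ?t = "\<integral>u. e u * moll u \<partial>lborel"
  let ?f = "\<lambda>u. exp ?t * (e u * moll u + (1 - ?t) * moll u)"
  have int_f: "integrable lborel ?f"
    using int by (intro integrable_mult_right Bochner_Integration.integrable_add integrable_moll)
  have "integral\<^sup>L lborel ?f = exp ?t * (?t + (1 - ?t) * 1)"
    by (simp only: integral_mult_right_zero integral_moll
        Bochner_Integration.integral_add[OF int integrable_mult_right[OF integrable_moll]])
  then have "ennreal (exp ?t) = ennreal (integral\<^sup>L lborel ?f)" by simp
  also have "\<dots> \<le> (\<integral>\<^sup>+u. ennreal (?f u) \<partial>lborel)"
    by (rule ennreal_integral_le_nn_integral[OF int_f])
  also have "\<dots> \<le> (\<integral>\<^sup>+u. ennreal (exp (e u)) * ennreal (moll u) \<partial>lborel)"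
  proof (rule nn_integral_mono)
    fix u :: 'a
    have "exp ?t * (1 + (e u - ?t)) \<le> exp ?t * exp (e u - ?t)"
      by (intro mult_left_mono exp_ge_add_one_self) simp
    then have "exp ?t * (1 + (e u - ?t)) * moll u \<le> exp (e u) * moll u"
      by (intro mult_right_mono moll_nonneg) (simp flip: exp_add)
    then show "ennreal (?f u) \<le> ennreal (exp (e u)) * ennreal (moll u)"
      by (simp add: ennreal_mult'[symmetric] moll_nonneg algebra_simps ennreal_leI)
  qed
  finally show ?thesis .
qed

text \<open>The only trace of the equilibrium measure is the last assumption: in the window of
  blown-up radius \<open>R - 1\<close> about \<open>x\<close>, averaging the potential over a ball
  of radius \<open>s\<close> costs at most \<open>K0\<close>. Constants that depend on
  \<open>\<beta>\<close>, \<open>K0\<close> and the dimension alone are uniform in \<open>N\<close>,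
  \<open>V\<close> and \<open>x\<close>.\<close>

locale gas_window =
  fixes V :: "'a::euclidean_space \<Rightarrow> real" and \<beta> s R K0 :: real and N :: nat and x :: 'a
  assumes dim: "2 \<le> DIM('a)" and \<beta>: "0 < \<beta>" and N: "1 \<le> N"
    and s_def: "s = real N powr (- 1 / real DIM('a))"
    and V [measurable]: "V \<in> borel_measurable borel"
    and Z_finite: "partition_function V \<beta> N < \<infinity>"
    and smear_V_le: "AE y in lborel. y \<in> ball (s *\<^sub>R x) (s * (R - 1)) \<longrightarrow>
      integrable lborel (\<lambda>u. V (y + s *\<^sub>R u) * moll u) \<and>
      \<beta> * real N powr (2 / real DIM('a)) * smear s V y \<le> \<beta> * real N powr (2 / real DIM('a)) * V y + K0"
begin

abbreviation "P \<equiv> (\<Pi>\<^sub>M i\<in>{..<N}. lborel :: 'a measure)"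
abbreviation "G \<equiv> gibbs_measure V \<beta> N"

text \<open>The points as they occur in \<open>local_law\<close>, since
  \<open>1 / s = N powr (1/d)\<close>. In these coordinates all lengths are of order one.\<close>

definition Y :: "(nat \<Rightarrow> 'a) \<Rightarrow> nat \<Rightarrow> 'a" where
  "Y X i = (1 / s) *\<^sub>R X i - x"

lemma s: "0 < s" using N by (simp add: s_def)

lemma Y_update: "Y (X(i := X i - s *\<^sub>R u)) j = (if j = i then Y X i - u else Y X j)"
  using s by (simp add: Y_def scaleR_diff_right)

lemma Y_in_ball_iff: "Y X i \<in> ball 0 \<rho> \<longleftrightarrow> X i \<in> ball (s *\<^sub>R x) (s * \<rho>)"
proof -
  have "norm (s *\<^sub>R x - X i) = s * norm (Y X i)"
  proof -
    have "s *\<^sub>R x - X i = - (s *\<^sub>R Y X i)" using s by (simp add: Y_def scaleR_diff_right)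
    then show ?thesis using s by simp
  qed
  then show ?thesis using s by (simp add: dist_norm)
qed

sublocale product: product_sigma_finite "\<lambda>_::nat. lborel :: 'a measure"
  by standard

lemma borel_measurable_gibbs_weight [measurable]: "gibbs_weight V \<beta> N \<in> borel_measurable P"
proof -
  have "(\<lambda>X. coulomb_kernel (X i - X j)) \<in> borel_measurable P" if "i < N" "j \<in> {..<N} - {i}" for i j
    using that by (auto intro!: measurable_compose[OF _ borel_measurable_coulomb_kernel] borel_measurable_diff)
  moreover have "(\<lambda>X. V (X i)) \<in> borel_measurable P" if "i < N" for i
    using that by (auto intro!: measurable_compose[OF _ V])
  ultimately show ?thesis
    unfolding gibbs_weight_def hamiltonian_def
    by (intro borel_measurable_exp measurable_compose[OF _ borel_measurable_exp] borel_measurable_times borel_measurable_add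
        borel_measurable_const borel_measurable_sum) auto
qed

lemma gibbs_weight_pos: "0 < gibbs_weight V \<beta> N X"
  by (simp add: gibbs_weight_def)

lemma Z_pos: "partition_function V \<beta> N \<noteq> 0"
proof
  assume "partition_function V \<beta> N = 0"
  then have "AE X in P. ennreal (gibbs_weight V \<beta> N X) = 0"
    unfolding partition_function_def by (subst (asm) nn_integral_0_iff_AE) auto
  then have "AE X in P. False"
    by eventually_elim (metis gibbs_weight_pos ennreal_eq_0_iff not_le)
  then have "emeasure P (space P) = 0"
    by (simp add: AE_iff_measurable[OF sets.top])
  then have "emeasure P ({..<N} \<rightarrow>\<^sub>E UNIV) = 0"
    by (simp add: space_PiM)
  then show False
    by (subst (asm) product.emeasure_PiM) (auto simp: emeasure_lborel_UNIV)
qed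

lemma sets_G [measurable_cong]: "sets G = sets P"
  by (simp add: gibbs_measure_def)

lemma space_G: "space G = space P"
  by (simp add: gibbs_measure_def)

lemma prob_space_G: "prob_space G"
proof
  have "emeasure G (space G) = (\<integral>\<^sup>+X. ennreal (gibbs_weight V \<beta> N X) / partition_function V \<beta> N \<partial>P)"
    unfolding gibbs_measure_def by (simp add: emeasure_density space_density cong: nn_integral_cong)
  also have "\<dots> = partition_function V \<beta> N / partition_function V \<beta> N"
    by (subst nn_integral_divide) (auto simp: partition_function_def)
  also have "\<dots> = 1"
    using Z_pos Z_finite by (intro ennreal_divide_self) auto
  finally show "emeasure G (space G) = 1" .
qed

sublocale G: prob_space G by (rule prob_space_G)

lemma nn_integral_G:
  assumes [measurable]: "F \<in> borel_measurable P"
  shows "(\<integral>\<^sup>+X. F X \<partial>G) = (\<integral>\<^sup>+X. F X * ennreal (gibbs_weight V \<beta> N X) \<partial>P) / partition_function V \<beta> N"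
proof -
  have "(\<integral>\<^sup>+X. F X \<partial>G) = (\<integral>\<^sup>+X. ennreal (gibbs_weight V \<beta> N X) / partition_function V \<beta> N * F X \<partial>P)"
    unfolding gibbs_measure_def by (rule nn_integral_density) measurable
  also have "\<dots> = (\<integral>\<^sup>+X. F X * ennreal (gibbs_weight V \<beta> N X) / partition_function V \<beta> N \<partial>P)"
    by (rule nn_integral_cong) (simp only: ennreal_times_divide mult.commute[of _ "F _"])
  also have "\<dots> = (\<integral>\<^sup>+X. F X * ennreal (gibbs_weight V \<beta> N X) \<partial>P) / partition_function V \<beta> N"
    by (rule nn_integral_divide) measurable
  finally show ?thesis .
qed

lemma insert_index: "i < N \<Longrightarrow> insert i ({..<N} - {i}) = {..<N}" by auto

lemma nn_integral_P_split:
  assumes i: "i < N" and f: "f \<in> borel_measurable P"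
  shows "(\<integral>\<^sup>+X. f X \<partial>P) = (\<integral>\<^sup>+X. (\<integral>\<^sup>+y. f (X(i := y)) \<partial>lborel) \<partial>(\<Pi>\<^sub>M j\<in>{..<N} - {i}. lborel))"
  using product.product_nn_integral_insert[of "{..<N} - {i}" i f] f insert_index[OF i] by simp

lemma measurable_update:
  assumes "i < N" "f \<in> measurable M P" "g \<in> borel_measurable M"
  shows "(\<lambda>z. (f z)(i := g z)) \<in> measurable M P"
proof -
  have "(\<lambda>z. (f z)(i := g z)) \<in> measurable M (\<Pi>\<^sub>M i\<in>insert i {..<N}. lborel)"
    using assms by (intro measurable_fun_upd[where J="{..<N}"]) auto
  then show ?thesis using assms(1) by (simp add: insert_absorb)
qed

lemma measurable_coord:
  "i < N \<Longrightarrow> (\<lambda>X. X i) \<in> borel_measurable P"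
  by measurable

lemma borel_measurable_Y [measurable]: "i < N \<Longrightarrow> (\<lambda>X. Y X i) \<in> borel_measurable P"
  unfolding Y_def by measurable

lemma nn_integral_P_translate:
  assumes i: "i < N" and f [measurable]: "f \<in> borel_measurable P"
  shows "(\<integral>\<^sup>+X. f (X(i := X i + v)) \<partial>P) = (\<integral>\<^sup>+X. f X \<partial>P)"
proof -
  note [measurable] = measurable_update[OF i] measurable_coord[OF i]
  have "(\<integral>\<^sup>+X. f (X(i := X i + v)) \<partial>P) =
      (\<integral>\<^sup>+X. (\<integral>\<^sup>+y. f (X(i := y + v)) \<partial>lborel) \<partial>(\<Pi>\<^sub>M j\<in>{..<N} - {i}. lborel))"
    using i by (subst nn_integral_P_split[OF i]) auto
  also have "\<dots> = (\<integral>\<^sup>+X. (\<integral>\<^sup>+y. f (X(i := y)) \<partial>lborel) \<partial>(\<Pi>\<^sub>M j\<in>{..<N} - {i}. lborel))"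
  proof (rule nn_integral_cong)
    fix X assume X: "X \<in> space (\<Pi>\<^sub>M j\<in>{..<N} - {i}. lborel :: 'a measure)"
    have "(\<lambda>y. X(i := y)) \<in> measurable borel (\<Pi>\<^sub>M i\<in>insert i ({..<N} - {i}). lborel :: 'a measure)"
      using X by (intro measurable_fun_upd[where J="{..<N} - {i}"]) auto
    then have [measurable]: "(\<lambda>y. X(i := y)) \<in> measurable borel P"
      using insert_index[OF i] by simp
    show "(\<integral>\<^sup>+y. f (X(i := y + v)) \<partial>lborel) = (\<integral>\<^sup>+y. f (X(i := y)) \<partial>lborel)"
      using nn_integral_lborel_affine[of "\<lambda>y. f (X(i := y))" 1 v] by (simp add: add.commute)
  qed
  also have "\<dots> = (\<integral>\<^sup>+X. f X \<partial>P)"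
    by (rule nn_integral_P_split[OF i f, symmetric])
  finally show ?thesis .
qed

text \<open>Fubini in the coordinate \<open>i\<close>, applied to a function that counts the
  violations. Exceptional sets have to be avoided because the bound on the averaged potential holds
  almost everywhere only and the kernel is singular at coincidences.\<close>

lemma AE_P_coord:
  fixes Q :: "'a \<Rightarrow> bool"
  assumes i: "i < N" and Q: "AE y in lborel. Q y"
  shows "AE X in P. Q (X i) \<and> (\<forall>j\<in>{..<N} - {i}. X j \<noteq> X i)"
proof -
  obtain A where A: "A \<in> null_sets lborel" "{y. \<not> Q y} \<subseteq> A"
    using Q by (auto simp: eventually_ae_filter)
  have [measurable]: "A \<in> sets borel" using A(1) by auto
  note [measurable] = measurable_coord[OF i]
  let ?f = "\<lambda>X. indicator A (X i) + (\<Sum>j\<in>{..<N} - {i}. indicator {0} (X i - X j)) :: ennreal"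
  have [measurable]: "(\<lambda>X. indicator A (X i) :: ennreal) \<in> borel_measurable P"
    using i by measurable
  have m: "(\<lambda>X. indicator {0} (X i - X j) :: ennreal) \<in> borel_measurable P" if "j \<in> {..<N} - {i}" for j
  proof -
    from that have "j < N" by simp
    note [measurable] = measurable_coord[OF i] measurable_coord[OF this]
    show ?thesis by measurable
  qed
  have f_meas [measurable]: "?f \<in> borel_measurable P"
    using m by (intro borel_measurable_add borel_measurable_sum) auto
  have "(\<integral>\<^sup>+X. ?f X \<partial>P) = (\<integral>\<^sup>+X. (\<integral>\<^sup>+y. ?f (X(i := y)) \<partial>lborel) \<partial>(\<Pi>\<^sub>M j\<in>{..<N} - {i}. lborel))"
    by (rule nn_integral_P_split[OF i f_meas])
  also have "\<dots> = (\<integral>\<^sup>+X. 0 \<partial>(\<Pi>\<^sub>M j\<in>{..<N} - {i}. lborel :: 'a measure))"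
  proof (rule nn_integral_cong)
    fix X :: "nat \<Rightarrow> 'a"
    have "AE y in lborel. y \<notin> A" using A(1) by (rule AE_not_in)
    moreover have "AE y in lborel. \<forall>j\<in>{..<N} - {i}. y \<noteq> X j"
      by (intro AE_finite_allI AE_lborel_singleton) auto
    ultimately have "AE y in lborel. ?f (X(i := y)) = 0"
      by eventually_elim (auto simp: indicator_def intro!: sum.neutral)
    then have "(\<integral>\<^sup>+y. ?f (X(i := y)) \<partial>lborel) = (\<integral>\<^sup>+y. 0 \<partial>(lborel :: 'a measure))"
      by (rule nn_integral_cong_AE)
    then show "(\<integral>\<^sup>+y. ?f (X(i := y)) \<partial>lborel) = 0" by simp
  qed
  finally have "(\<integral>\<^sup>+X. ?f X \<partial>P) = 0" by simp
  then have "AE X in P. ?f X = 0"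
    by (subst (asm) nn_integral_0_iff_AE) auto
  then show ?thesis
  proof (rule eventually_mono)
    fix X assume "?f X = 0"
    then show "Q (X i) \<and> (\<forall>j\<in>{..<N} - {i}. X j \<noteq> X i)"
      using A(2) by (auto simp: indicator_def split: if_splits)
  qed
qed

text \<open>Isotropic averaging of the \<open>i\<close>-th point over the ball of radius \<open>s\<close>: by superharmonicity of the
  kernel no pair interaction increases, and Jensen's inequality passes from energies to weights.\<close>

lemma gibbs_weight_le_average:
  assumes i: "i < N" and X: "X i \<in> ball (s *\<^sub>R x) (s * (R - 1))"
    and V_avg: "integrable lborel (\<lambda>u. V (X i + s *\<^sub>R u) * moll u)"
      "\<beta> * real N powr (2 / real DIM('a)) * smear s V (X i) \<le> \<beta> * real N powr (2 / real DIM('a)) * V (X i) + K0"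
    and ne: "\<And>j. j \<in> {..<N} - {i} \<Longrightarrow> X j \<noteq> X i"
  shows "ennreal (exp (\<beta> * (\<Sum>j\<in>{..<N} - {i}. excess (Y X i - Y X j)))) * ennreal (gibbs_weight V \<beta> N X) \<le>
    ennreal (exp K0) * (\<integral>\<^sup>+u. ennreal (gibbs_weight V \<beta> N (X(i := X i + s *\<^sub>R u))) * ennreal (moll u) \<partial>lborel)"
proof -
  let ?J = "{..<N} - {i}"
  define a where "a = \<beta> * real N powr (2 / real DIM('a) - 1)"
  have aN: "a * real N = \<beta> * real N powr (2 / real DIM('a))"
    using N powr_mult_base[of "real N" "2 / real DIM('a) - 1"] by (simp add: a_def mult_ac)
  have a_s: "a * s powr (2 - real DIM('a)) = \<beta>"
  proof -
    have "- 1 / real DIM('a) * (2 - real DIM('a)) = 1 - 2 / real DIM('a)"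
      using dim by (simp add: field_simps)
    then have "s powr (2 - real DIM('a)) = real N powr (1 - 2 / real DIM('a))"
      by (simp only: s_def powr_powr)
    then show ?thesis using N by (simp add: a_def flip: powr_add)
  qed
  \<comment> \<open>The change of the exponent of the Gibbs weight when the point \<open>i\<close>
    moves by \<open>s u\<close>; its mean is the quantity that superharmonicity controls.\<close>
  define e where "e u = - a * ((\<Sum>j\<in>?J. coulomb_kernel (X i + s *\<^sub>R u - X j) - coulomb_kernel (X i - X j)) +
      real N * (V (X i + s *\<^sub>R u) - V (X i)))" for u
  have w: "gibbs_weight V \<beta> N (X(i := X i + s *\<^sub>R u)) = gibbs_weight V \<beta> N X * exp (e u)" for u
    unfolding gibbs_weight_def hamiltonian_update[OF i] e_def a_def by (simp add: algebra_simps flip: exp_add)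
  have e_moll: "(\<lambda>u. e u * moll u) = (\<lambda>u. - a * ((\<Sum>j\<in>?J. coulomb_kernel (X i - X j + s *\<^sub>R u) * moll u -
      coulomb_kernel (X i - X j) * moll u) + (real N * (V (X i + s *\<^sub>R u) * moll u) - real N * (V (X i) * moll u))))"
    unfolding e_def by (auto simp: sum_distrib_left sum_distrib_right algebra_simps sum_subtractf)
  have int_g: "integrable lborel (\<lambda>u. coulomb_kernel (X i - X j + s *\<^sub>R u) * moll u)" if "j \<in> ?J" for j
    using ne[OF that] by (intro integrable_coulomb_moll dim s) auto
  have int_e: "integrable lborel (\<lambda>u. e u * moll u)"
    unfolding e_moll
    by (intro integrable_mult_right Bochner_Integration.integrable_add Bochner_Integration.integrable_sum
        Bochner_Integration.integrable_diff V_avg(1) integrable_moll int_g)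
  have "(\<integral>u. e u * moll u \<partial>lborel) = - a * ((\<Sum>j\<in>?J. smear s coulomb_kernel (X i - X j) - coulomb_kernel (X i - X j)) +
      (real N * smear s V (X i) - real N * V (X i)))"
  proof -
    have g: "(\<integral>u. (\<Sum>j\<in>?J. coulomb_kernel (X i - X j + s *\<^sub>R u) * moll u - coulomb_kernel (X i - X j) * moll u) \<partial>lborel) =
        (\<Sum>j\<in>?J. smear s coulomb_kernel (X i - X j) - coulomb_kernel (X i - X j))"
    proof (subst Bochner_Integration.integral_sum)
      show "integrable lborel (\<lambda>u. coulomb_kernel (X i - X j + s *\<^sub>R u) * moll u - coulomb_kernel (X i - X j) * moll u)"
        if "j \<in> ?J" for j
        by (intro Bochner_Integration.integrable_diff integrable_mult_right integrable_moll int_g that)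
      show "(\<Sum>j\<in>?J. \<integral>u. coulomb_kernel (X i - X j + s *\<^sub>R u) * moll u - coulomb_kernel (X i - X j) * moll u \<partial>lborel) =
        (\<Sum>j\<in>?J. smear s coulomb_kernel (X i - X j) - coulomb_kernel (X i - X j))"
        by (rule sum.cong[OF refl], subst Bochner_Integration.integral_diff[OF int_g])
          (simp_all add: smear_def integrable_moll integral_moll)
    qed
    have v: "(\<integral>u. real N * (V (X i + s *\<^sub>R u) * moll u) - real N * (V (X i) * moll u) \<partial>lborel) =
        real N * smear s V (X i) - real N * V (X i)"
      by (subst Bochner_Integration.integral_diff)
        (simp_all add: V_avg(1) integrable_moll integral_moll smear_def)
    have ig: "integrable lborel (\<lambda>u. \<Sum>j\<in>?J. coulomb_kernel (X i - X j + s *\<^sub>R u) * moll u - coulomb_kernel (X i - X j) * moll u)"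
      by (intro Bochner_Integration.integrable_sum Bochner_Integration.integrable_diff integrable_mult_right
          integrable_moll int_g)
    have iv: "integrable lborel (\<lambda>u. real N * (V (X i + s *\<^sub>R u) * moll u) - real N * (V (X i) * moll u))"
      by (intro Bochner_Integration.integrable_diff integrable_mult_right integrable_moll V_avg(1))
    show ?thesis
      unfolding e_moll integral_mult_right_zero Bochner_Integration.integral_add[OF ig iv] g v ..
  qed
  also have "(\<Sum>j\<in>?J. smear s coulomb_kernel (X i - X j) - coulomb_kernel (X i - X j)) =
      - (s powr (2 - real DIM('a)) * (\<Sum>j\<in>?J. excess (Y X i - Y X j)))"
  proof -
    have "smear s coulomb_kernel (X i - X j) - coulomb_kernel (X i - X j) = - (s powr (2 - real DIM('a)) * excess (Y X i - Y X j))"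
      if "j \<in> ?J" for j
    proof -
      have *: "X i - X j = s *\<^sub>R (Y X i - Y X j)"
        using s by (simp add: Y_def scaleR_diff_right)
      with ne[OF that] have "Y X i - Y X j \<noteq> 0" by auto
      then show ?thesis unfolding * using coulomb_minus_smear_scale[OF dim s, of "Y X i - Y X j"] by linarith
    qed
    then show ?thesis by (simp add: sum_distrib_left sum_negf)
  qed
  also have "- a * (- (s powr (2 - real DIM('a)) * (\<Sum>j\<in>?J. excess (Y X i - Y X j))) + (real N * smear s V (X i) - real N * V (X i))) =
      (a * s powr (2 - real DIM('a))) * (\<Sum>j\<in>?J. excess (Y X i - Y X j)) - (a * real N * smear s V (X i) - a * real N * V (X i))"
    by (simp add: algebra_simps)
  finally have "\<beta> * (\<Sum>j\<in>?J. excess (Y X i - Y X j)) \<le> K0 + (\<integral>u. e u * moll u \<partial>lborel)"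
    unfolding a_s aN using V_avg(2) by linarith
  then have "ennreal (exp (\<beta> * (\<Sum>j\<in>?J. excess (Y X i - Y X j)))) \<le> ennreal (exp K0) * ennreal (exp (\<integral>u. e u * moll u \<partial>lborel))"
    by (simp add: ennreal_mult'[symmetric] flip: exp_add)
  also have "\<dots> \<le> ennreal (exp K0) * (\<integral>\<^sup>+u. ennreal (exp (e u)) * ennreal (moll u) \<partial>lborel)"
    by (intro mult_left_mono exp_mean_le int_e) auto
  finally have "ennreal (exp (\<beta> * (\<Sum>j\<in>?J. excess (Y X i - Y X j)))) * ennreal (gibbs_weight V \<beta> N X) \<le>
      ennreal (exp K0) * (\<integral>\<^sup>+u. ennreal (exp (e u)) * ennreal (moll u) \<partial>lborel) * ennreal (gibbs_weight V \<beta> N X)"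
    by (rule mult_right_mono) simp
  also have "\<dots> = ennreal (exp K0) * (\<integral>\<^sup>+u. ennreal (gibbs_weight V \<beta> N X) * (ennreal (exp (e u)) * ennreal (moll u)) \<partial>lborel)"
  proof (subst nn_integral_cmult)
    show "(\<lambda>u. ennreal (exp (e u)) * ennreal (moll u)) \<in> borel_measurable lborel"
      unfolding e_def by measurable
  qed (simp add: mult_ac)
  also have "\<dots> = ennreal (exp K0) * (\<integral>\<^sup>+u. ennreal (gibbs_weight V \<beta> N (X(i := X i + s *\<^sub>R u))) * ennreal (moll u) \<partial>lborel)"
    unfolding w using gibbs_weight_pos[of X] by (simp add: ennreal_mult' less_imp_le mult_ac)
  finally show ?thesis .
qed

text \<open>\<open>gibbs_weight_le_average\<close> is integrated against \<open>F\<close>;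
  translation invariance of the Lebesgue measure then shifts the displacement from the weight to
  \<open>F\<close>, so that both sides become expectations. The number \<open>c\<close> is the gain
  guaranteed on the support of \<open>F\<close> when no other point coincides with the point
  \<open>i\<close>.\<close>

lemma move_one_point:
  assumes i: "i < N" and F [measurable]: "F \<in> borel_measurable P"
    and supp: "\<And>X. F X \<noteq> 0 \<Longrightarrow> Y X i \<in> ball 0 (R - 1)"
    and gain: "\<And>X. F X \<noteq> 0 \<Longrightarrow> (\<And>j. j \<in> {..<N} - {i} \<Longrightarrow> X j \<noteq> X i) \<Longrightarrow>
      c \<le> \<beta> * (\<Sum>j\<in>{..<N} - {i}. excess (Y X i - Y X j))"
  shows "ennreal (exp c) * (\<integral>\<^sup>+X. F X \<partial>G) \<le>
    ennreal (exp K0) * (\<integral>\<^sup>+X. (\<integral>\<^sup>+u. F (X(i := X i - s *\<^sub>R u)) * ennreal (moll u) \<partial>lborel) \<partial>G)"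
proof -
  note [measurable] = measurable_update[OF i] measurable_coord[OF i]
  let ?w = "\<lambda>X. ennreal (gibbs_weight V \<beta> N X)"
  have "ennreal (exp c) * (\<integral>\<^sup>+X. F X * ?w X \<partial>P) = (\<integral>\<^sup>+X. ennreal (exp c) * (F X * ?w X) \<partial>P)"
    by (rule nn_integral_cmult[symmetric]) measurable
  also have "\<dots> \<le> (\<integral>\<^sup>+X. F X * (ennreal (exp K0) * (\<integral>\<^sup>+u. ?w (X(i := X i + s *\<^sub>R u)) * ennreal (moll u) \<partial>lborel)) \<partial>P)"
  proof (rule nn_integral_mono_AE)
    show "AE X in P. ennreal (exp c) * (F X * ?w X) \<le>
        F X * (ennreal (exp K0) * (\<integral>\<^sup>+u. ?w (X(i := X i + s *\<^sub>R u)) * ennreal (moll u) \<partial>lborel))"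
      using AE_P_coord[OF i smear_V_le]
    proof eventually_elim
      case (elim X)
      show ?case
      proof (cases "F X = 0")
        case False
        have Xi: "X i \<in> ball (s *\<^sub>R x) (s * (R - 1))"
          using supp[OF False] by (simp only: Y_in_ball_iff)
        have "exp c \<le> exp (\<beta> * (\<Sum>j\<in>{..<N} - {i}. excess (Y X i - Y X j)))"
          using gain[OF False] elim by simp
        then have "ennreal (exp c) * ?w X \<le> ennreal (exp (\<beta> * (\<Sum>j\<in>{..<N} - {i}. excess (Y X i - Y X j)))) * ?w X"
          by (intro mult_right_mono ennreal_leI) auto
        also have "\<dots> \<le> ennreal (exp K0) * (\<integral>\<^sup>+u. ?w (X(i := X i + s *\<^sub>R u)) * ennreal (moll u) \<partial>lborel)"
          using Xi elim by (intro gibbs_weight_le_average[OF i]) auto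
        finally have "F X * (ennreal (exp c) * ?w X) \<le> F X * (ennreal (exp K0) * (\<integral>\<^sup>+u. ?w (X(i := X i + s *\<^sub>R u)) * ennreal (moll u) \<partial>lborel))"
          by (rule mult_left_mono) simp
        then show ?thesis by (simp add: mult_ac)
      qed simp
    qed
  qed
  also have "\<dots> = (\<integral>\<^sup>+X. (\<integral>\<^sup>+u. ennreal (exp K0) * (ennreal (moll u) * (F X * ?w (X(i := X i + s *\<^sub>R u)))) \<partial>lborel) \<partial>P)"
  proof (rule nn_integral_cong)
    fix X assume "X \<in> space P"
    then have upd: "(\<lambda>u. X(i := X i + s *\<^sub>R u)) \<in> measurable borel P"
      using i by (intro measurable_update) auto
    have "(\<integral>\<^sup>+u. (ennreal (exp K0) * F X) * (?w (X(i := X i + s *\<^sub>R u)) * ennreal (moll u)) \<partial>lborel) =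
        (ennreal (exp K0) * F X) * (\<integral>\<^sup>+u. ?w (X(i := X i + s *\<^sub>R u)) * ennreal (moll u) \<partial>lborel)"
    proof (rule nn_integral_cmult)
      have [measurable]: "(\<lambda>u. gibbs_weight V \<beta> N (X(i := X i + s *\<^sub>R u))) \<in> borel_measurable borel"
        by (rule measurable_compose[OF upd borel_measurable_gibbs_weight])
      show "(\<lambda>u. ?w (X(i := X i + s *\<^sub>R u)) * ennreal (moll u)) \<in> borel_measurable lborel"
        by simp
    qed
    then show "F X * (ennreal (exp K0) * (\<integral>\<^sup>+u. ?w (X(i := X i + s *\<^sub>R u)) * ennreal (moll u) \<partial>lborel)) =
        (\<integral>\<^sup>+u. ennreal (exp K0) * (ennreal (moll u) * (F X * ?w (X(i := X i + s *\<^sub>R u)))) \<partial>lborel)"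
      by (simp add: mult_ac)
  qed
  also have "\<dots> = (\<integral>\<^sup>+u. (\<integral>\<^sup>+X. ennreal (exp K0) * (ennreal (moll u) * (F X * ?w (X(i := X i + s *\<^sub>R u)))) \<partial>P) \<partial>lborel)"
  proof (rule pair_sigma_finite.Fubini')
    show "pair_sigma_finite lborel P"
      by (intro pair_sigma_finite.intro product.sigma_finite sigma_finite_lborel) auto
    show "(\<lambda>(u, X). ennreal (exp K0) * (ennreal (moll u) * (F X * ?w (X(i := X i + s *\<^sub>R u))))) \<in> borel_measurable (lborel \<Otimes>\<^sub>M P)"
      using i by measurable
  qed
  also have "\<dots> = (\<integral>\<^sup>+u. (\<integral>\<^sup>+X. ennreal (exp K0) * (ennreal (moll u) * (F (X(i := X i - s *\<^sub>R u)) * ?w X)) \<partial>P) \<partial>lborel)"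
  proof (rule nn_integral_cong)
    fix u :: 'a
    have "(\<integral>\<^sup>+X. ennreal (exp K0) * (ennreal (moll u) * (F X * ?w (X(i := X i + s *\<^sub>R u)))) \<partial>P) =
      (\<integral>\<^sup>+X. ennreal (exp K0) * (ennreal (moll u) * (F (X(i := X i + (- (s *\<^sub>R u)))) *
         ?w ((X(i := X i + (- (s *\<^sub>R u))))(i := (X(i := X i + (- (s *\<^sub>R u)))) i + s *\<^sub>R u)))) \<partial>P)"
      using i by (intro nn_integral_P_translate[OF i, symmetric]) measurable
    then show "(\<integral>\<^sup>+X. ennreal (exp K0) * (ennreal (moll u) * (F X * ?w (X(i := X i + s *\<^sub>R u)))) \<partial>P) =
      (\<integral>\<^sup>+X. ennreal (exp K0) * (ennreal (moll u) * (F (X(i := X i - s *\<^sub>R u)) * ?w X)) \<partial>P)"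
      by simp
  qed
  also have "\<dots> = (\<integral>\<^sup>+X. (\<integral>\<^sup>+u. ennreal (exp K0) * (ennreal (moll u) * (F (X(i := X i - s *\<^sub>R u)) * ?w X)) \<partial>lborel) \<partial>P)"
  proof (rule pair_sigma_finite.Fubini'[symmetric])
    show "pair_sigma_finite lborel P"
      by (intro pair_sigma_finite.intro product.sigma_finite sigma_finite_lborel) auto
    show "(\<lambda>(u, X). ennreal (exp K0) * (ennreal (moll u) * (F (X(i := X i - s *\<^sub>R u)) * ?w X))) \<in> borel_measurable (lborel \<Otimes>\<^sub>M P)"
      using i by measurable
  qed
  also have "\<dots> = (\<integral>\<^sup>+X. ennreal (exp K0) * ((\<integral>\<^sup>+u. F (X(i := X i - s *\<^sub>R u)) * ennreal (moll u) \<partial>lborel) * ?w X) \<partial>P)"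
  proof (rule nn_integral_cong)
    fix X assume "X \<in> space P"
    then have upd: "(\<lambda>u. X(i := X i - s *\<^sub>R u)) \<in> measurable borel P"
      using i by (intro measurable_update) auto
    have "(\<integral>\<^sup>+u. (ennreal (exp K0) * ?w X) * (F (X(i := X i - s *\<^sub>R u)) * ennreal (moll u)) \<partial>lborel) =
        (ennreal (exp K0) * ?w X) * (\<integral>\<^sup>+u. F (X(i := X i - s *\<^sub>R u)) * ennreal (moll u) \<partial>lborel)"
    proof (rule nn_integral_cmult)
      have [measurable]: "(\<lambda>u. F (X(i := X i - s *\<^sub>R u))) \<in> borel_measurable borel"
        by (rule measurable_compose[OF upd F])
      show "(\<lambda>u. F (X(i := X i - s *\<^sub>R u)) * ennreal (moll u)) \<in> borel_measurable lborel"
        by simp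
    qed
    then show "(\<integral>\<^sup>+u. ennreal (exp K0) * (ennreal (moll u) * (F (X(i := X i - s *\<^sub>R u)) * ?w X)) \<partial>lborel) =
      ennreal (exp K0) * ((\<integral>\<^sup>+u. F (X(i := X i - s *\<^sub>R u)) * ennreal (moll u) \<partial>lborel) * ?w X)"
      by (simp add: mult_ac)
  qed
  also have "\<dots> = ennreal (exp K0) * (\<integral>\<^sup>+X. (\<integral>\<^sup>+u. F (X(i := X i - s *\<^sub>R u)) * ennreal (moll u) \<partial>lborel) * ?w X \<partial>P)"
    using i by (intro nn_integral_cmult) measurable
  finally have *: "ennreal (exp c) * (\<integral>\<^sup>+X. F X * ?w X \<partial>P) \<le>
    ennreal (exp K0) * (\<integral>\<^sup>+X. (\<integral>\<^sup>+u. F (X(i := X i - s *\<^sub>R u)) * ennreal (moll u) \<partial>lborel) * ?w X \<partial>P)" .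
  have m: "(\<lambda>X. \<integral>\<^sup>+u. F (X(i := X i - s *\<^sub>R u)) * ennreal (moll u) \<partial>lborel) \<in> borel_measurable P"
    using i by measurable
  show ?thesis
    unfolding nn_integral_G[OF F] nn_integral_G[OF m] ennreal_times_divide by (rule divide_right_mono_ennreal[OF *])
qed

end

section \<open>Local moments\<close>

definition tuples :: "nat \<Rightarrow> 'i set \<Rightarrow> (nat \<Rightarrow> 'i) set" where
  "tuples k A = {\<tau> \<in> {..<k} \<rightarrow>\<^sub>E A. inj_on \<tau> {..<k}}"

text \<open>A crude form of Young's inequality: the product is at most the power
  \<open>Suc p\<close> of the larger factor.\<close>

lemma ennreal_mult_power_le_sum:
  fixes a b :: ennreal
  shows "a * b ^ p \<le> a ^ Suc p + b ^ Suc p"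
proof (cases "a \<le> b")
  case True
  then have "a * b ^ p \<le> b * b ^ p" by (rule mult_right_mono) simp
  then show ?thesis by (simp add: add_increasing)
next
  case False
  then have "a * b ^ p \<le> a * a ^ p" by (intro mult_left_mono power_mono) auto
  then show ?thesis by (simp add: add_increasing2)
qed

text \<open>Each summand is at most the maximum, and the power of the maximum is one of the summands
  on the right. The last term covers the empty sum with \<open>0 ^ 0 = 1\<close>.\<close>

lemma ennreal_sum_power_le:
  fixes f :: "'b \<Rightarrow> ennreal"
  assumes "finite A"
  shows "(\<Sum>a\<in>A. f a) ^ k \<le> of_nat (card A) ^ k * (\<Sum>a\<in>A. f a ^ k) + (if A = {} then 1 else 0)"
proof (cases "A = {}")
  case False
  define m where "m = Max (f ` A)"
  have "m \<in> f ` A" using assms False by (auto simp: m_def)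
  then obtain a where a: "a \<in> A" "m = f a" by auto
  have "(\<Sum>a\<in>A. f a) \<le> of_nat (card A) * m"
    using assms by (intro sum_bounded_above) (auto simp: m_def)
  then have "(\<Sum>a\<in>A. f a) ^ k \<le> (of_nat (card A) * m) ^ k"
    by (rule power_mono) simp
  also have "\<dots> = of_nat (card A) ^ k * f a ^ k"
    by (simp add: power_mult_distrib a)
  also have "\<dots> \<le> of_nat (card A) ^ k * (\<Sum>a\<in>A. f a ^ k)"
    using assms a by (intro mult_left_mono member_le_sum) auto
  finally show ?thesis using False by simp
qed (cases k; simp)

context gas_window
begin

definition count :: "'a set \<Rightarrow> (nat \<Rightarrow> 'a) \<Rightarrow> ennreal" where
  "count A X = (\<Sum>j<N. indicator A (Y X j))"

text \<open>Leaving out the point \<open>i\<close> makes the count insensitive to displacements of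
  that point.\<close>

definition count_but :: "nat \<Rightarrow> 'a set \<Rightarrow> (nat \<Rightarrow> 'a) \<Rightarrow> ennreal" where
  "count_but i A X = (\<Sum>j\<in>{..<N} - {i}. indicator A (Y X j))"

definition moment :: "nat \<Rightarrow> real \<Rightarrow> 'a \<Rightarrow> ennreal" where
  "moment k r w = (\<integral>\<^sup>+X. count (ball w r) X ^ k \<partial>G)"

definition moll_max :: real where
  "moll_max = 1 / (\<integral>v. bump (v::'a) \<partial>lborel)"

lemma moll_max_nonneg: "0 \<le> moll_max"
  using bump_mass_pos[where 'a='a] by (simp add: moll_max_def)

lemma ennreal_moll_le: "ennreal (moll u) \<le> ennreal moll_max * indicator (ball 0 1) (u::'a)"
  using moll_le[of u] moll_eq_0[of u] by (cases "norm u < 1") (auto simp: moll_max_def ennreal_leI)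

lemma borel_measurable_ind_Y [measurable]:
  "A \<in> sets borel \<Longrightarrow> i < N \<Longrightarrow> (\<lambda>X. indicator A (Y X i) :: ennreal) \<in> borel_measurable P"
  by (rule measurable_compose[OF borel_measurable_Y borel_measurable_indicator])

lemma borel_measurable_G: "f \<in> borel_measurable P \<Longrightarrow> f \<in> borel_measurable G"
  by (simp cong: measurable_cong_sets add: sets_G)

lemma borel_measurable_count [measurable]:
  "A \<in> sets borel \<Longrightarrow> count A \<in> borel_measurable P"
  unfolding count_def by (intro borel_measurable_sum borel_measurable_ind_Y) auto

lemma borel_measurable_count_but [measurable]:
  "A \<in> sets borel \<Longrightarrow> count_but i A \<in> borel_measurable P"
  unfolding count_but_def by (intro borel_measurable_sum borel_measurable_ind_Y) auto

lemma count_remove: "i < N \<Longrightarrow> count A X = indicator A (Y X i) + count_but i A X"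
  unfolding count_def count_but_def by (intro sum.remove) auto

lemma count_le: "count A X \<le> of_nat N"
proof -
  have "count A X \<le> (\<Sum>j<N. 1)" unfolding count_def by (intro sum_mono) (auto simp: indicator_def)
  then show ?thesis by simp
qed

lemma count_but_update: "count_but i A (X(i := X i - s *\<^sub>R u)) = count_but i A X"
  unfolding count_but_def by (intro sum.cong) (auto simp: Y_update)

lemma count_but_cases:
  "count_but i A X = 0 \<or> (1 \<le> count_but i A X \<and> (\<exists>j\<in>{..<N} - {i}. Y X j \<in> A))"
proof (cases "\<exists>j\<in>{..<N} - {i}. Y X j \<in> A")
  case True
  then obtain j where j: "j \<in> {..<N} - {i}" "Y X j \<in> A" by auto
  then have "indicator A (Y X j) \<le> count_but i A X"
    unfolding count_but_def by (intro member_le_sum) auto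
  then show ?thesis using j by auto
next
  case False
  then have "count_but i A X = 0"
    unfolding count_but_def by (intro sum.neutral) auto
  then show ?thesis ..
qed

text \<open>If some point of \<open>A\<close> is alone in \<open>A\<close>, the count is \<open>1\<close>; otherwise every point of \<open>A\<close> sees at
  least half of the count.\<close>

lemma count_power_le:
  "count A X ^ Suc p \<le> 1 + 2 ^ p * (\<Sum>i<N. indicator A (Y X i) * (if count_but i A X = 0 then 0 else count_but i A X ^ p))"
proof (cases "\<exists>i<N. Y X i \<in> A \<and> count_but i A X = 0")
  case True
  then obtain i where "i < N" "Y X i \<in> A" "count_but i A X = 0" by auto
  then have "count A X = 1" by (simp add: count_remove[of i])
  then show ?thesis by simp
next
  case False
  have "count A X ^ Suc p = (\<Sum>i<N. indicator A (Y X i) * count A X ^ p)"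
    by (simp add: sum_distrib_right[symmetric] count_def)
  also have "\<dots> \<le> (\<Sum>i<N. 2 ^ p * (indicator A (Y X i) * (if count_but i A X = 0 then 0 else count_but i A X ^ p)))"
  proof (rule sum_mono)
    fix i assume i: "i \<in> {..<N}"
    show "indicator A (Y X i) * count A X ^ p \<le>
      2 ^ p * (indicator A (Y X i) * (if count_but i A X = 0 then 0 else count_but i A X ^ p))"
    proof (cases "Y X i \<in> A")
      case True
      with False i have ne: "count_but i A X \<noteq> 0" by auto
      then have "1 \<le> count_but i A X" using count_but_cases[of i A X] by auto
      then have "count A X \<le> count_but i A X + count_but i A X"
        using i True by (simp add: count_remove[of i] add_right_mono)
      then have "count A X ^ p \<le> (2 * count_but i A X) ^ p"
        by (intro power_mono) (auto simp: mult_2)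
      then show ?thesis using True ne by (simp add: power_mult_distrib)
    qed simp
  qed
  also have "\<dots> = 2 ^ p * (\<Sum>i<N. indicator A (Y X i) * (if count_but i A X = 0 then 0 else count_but i A X ^ p))"
    by (simp only: sum_distrib_left)
  also have "\<dots> \<le> 1 + \<dots>"
    by (rule add_increasing) simp_all
  finally show ?thesis .
qed

text \<open>A displacement of length less than \<open>1\<close> leads into \<open>ball w r\<close>
  only from \<open>ball w (1 + r)\<close>, and does so with probability at most
  \<open>moll_max\<close> times the volume of the small ball. This volume factor is what makes small
  \<open>r\<close> affordable.\<close>

lemma smear_indicator_le:
  fixes w y :: 'a
  assumes r: "0 < r"
  shows "(\<integral>\<^sup>+u. indicator (ball w r) (y - u) * ennreal (moll u) \<partial>lborel) \<le>
    ennreal moll_max * emeasure lborel (ball (0::'a) r) * indicator (ball w (1 + r)) y"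
proof -
  have [measurable]: "ball w r \<in> sets borel" by simp
  have "(\<integral>\<^sup>+u. indicator (ball w r) (y - u) * ennreal (moll u) \<partial>lborel) \<le>
      (\<integral>\<^sup>+u. ennreal moll_max * indicator (ball w (1 + r)) y * indicator (ball w r) (y + (- 1) *\<^sub>R u) \<partial>lborel)"
  proof (rule nn_integral_mono)
    fix u :: 'a
    show "indicator (ball w r) (y - u) * ennreal (moll u) \<le>
        ennreal moll_max * indicator (ball w (1 + r)) y * indicator (ball w r) (y + (- 1) *\<^sub>R u)"
    proof (cases "y - u \<in> ball w r \<and> norm u < 1")
      case True
      then have "y \<in> ball w (1 + r)"
        using dist_triangle[of w y "y - u"] by (simp add: dist_norm)
      then show ?thesis using True ennreal_moll_le[of u] by simp
    next
      case False
      then show ?thesis using moll_eq_0[of u] by (auto simp: indicator_def)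
    qed
  qed
  also have "\<dots> = ennreal moll_max * indicator (ball w (1 + r)) y * (\<integral>\<^sup>+u. indicator (ball w r) (y + (- 1) *\<^sub>R u) \<partial>lborel)"
    by (rule nn_integral_cmult) measurable
  also have "(\<integral>\<^sup>+u. indicator (ball w r) (y + (- 1) *\<^sub>R u) \<partial>lborel) = (\<integral>\<^sup>+u. indicator (ball w r) u \<partial>(lborel :: 'a measure))"
    using nn_integral_lborel_affine[of "indicator (ball w r)" "-1" y] by simp
  also have "\<dots> = emeasure lborel (ball (0::'a) r)"
    using r by (simp add: emeasure_ball)
  finally show ?thesis by (simp add: mult_ac)
qed

text \<open>A point of \<open>ball w (1 + r)\<close> lies in \<open>ball v r\<close> for all centres
  \<open>v\<close> within distance \<open>r\<close> of it, and as \<open>r <= 1\<close> these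
  centres are in \<open>ball w 3\<close>. In contrast to a covering by balls of radius
  \<open>r\<close>, the average costs exactly the volume factor provided by
  \<open>smear_indicator_le\<close>.\<close>

lemma ball_count_le_average:
  assumes r: "0 < r" "r \<le> 1"
  shows "emeasure lborel (ball (0::'a) r) * count (ball w (1 + r)) X \<le>
    (\<integral>\<^sup>+v. indicator (ball w 3) v * count (ball v r) X \<partial>lborel)"
proof -
  have m: "(\<lambda>v. indicator (ball w 3) v * indicator (ball v r) y :: ennreal) \<in> borel_measurable lborel" for y
  proof -
    have eq: "(indicator (ball v r) y :: ennreal) = indicator (ball y r) v" for v
      by (auto simp: indicator_def dist_commute)
    show ?thesis
      unfolding eq by (intro borel_measurable_times_ennreal borel_measurable_indicator) auto
  qed
  have "emeasure lborel (ball (0::'a) r) * count (ball w (1 + r)) X =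
      (\<Sum>j<N. emeasure lborel (ball (0::'a) r) * indicator (ball w (1 + r)) (Y X j))"
    by (simp add: count_def sum_distrib_left)
  also have "\<dots> \<le> (\<Sum>j<N. \<integral>\<^sup>+v. indicator (ball w 3) v * indicator (ball v r) (Y X j) \<partial>lborel)"
  proof (rule sum_mono)
    fix j
    show "emeasure lborel (ball (0::'a) r) * indicator (ball w (1 + r)) (Y X j) \<le>
        (\<integral>\<^sup>+v. indicator (ball w 3) v * indicator (ball v r) (Y X j) \<partial>lborel)"
    proof (cases "Y X j \<in> ball w (1 + r)")
      case True
      have "emeasure lborel (ball (0::'a) r) = (\<integral>\<^sup>+v. indicator (ball (Y X j) r) v \<partial>lborel)"
        using r by (simp add: emeasure_ball)
      also have "\<dots> \<le> (\<integral>\<^sup>+v. indicator (ball w 3) v * indicator (ball v r) (Y X j) \<partial>lborel)"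
      proof (rule nn_integral_mono)
        fix v
        show "indicator (ball (Y X j) r) v \<le> (indicator (ball w 3) v * indicator (ball v r) (Y X j) :: ennreal)"
        proof (cases "v \<in> ball (Y X j) r")
          case v: True
          have "dist w v < 3" using True v r dist_triangle[of w v "Y X j"] by simp
          then show ?thesis using v by (simp add: dist_commute)
        qed simp
      qed
      finally show ?thesis using True by simp
    qed simp
  qed
  also have "\<dots> = (\<integral>\<^sup>+v. (\<Sum>j<N. indicator (ball w 3) v * indicator (ball v r) (Y X j)) \<partial>lborel)"
    by (rule nn_integral_sum[symmetric]) (rule m)
  also have "\<dots> = (\<integral>\<^sup>+v. indicator (ball w 3) v * count (ball v r) X \<partial>lborel)"
    by (simp add: count_def sum_distrib_left)
  finally show ?thesis .
qed

lemma borel_measurable_ball_count [measurable]: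
  "(\<lambda>(X, v). count (ball v r) X) \<in> borel_measurable (P \<Otimes>\<^sub>M lborel)"
proof -
  have "(\<lambda>(X, v). indicator (ball v r) (Y X j) :: ennreal) \<in> borel_measurable (P \<Otimes>\<^sub>M lborel)" if j: "j < N" for j
  proof -
    have "(\<lambda>(X, v). indicator (ball v r) (Y X j) :: ennreal) = (\<lambda>z. indicator {d. d < r} (dist (snd z) (Y (fst z) j)))"
      by (auto simp: indicator_def)
    moreover note [measurable] = borel_measurable_Y[OF j]
    have "(\<lambda>z. indicator {d. d < r} (dist (snd z) (Y (fst z) j)) :: ennreal) \<in> borel_measurable (P \<Otimes>\<^sub>M lborel)"
      by measurable
    ultimately show ?thesis by simp
  qed
  then show ?thesis
    unfolding count_def split_beta' by (intro borel_measurable_sum) (auto simp: split_beta')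
qed

text \<open>By \<open>count_power_le\<close> only points of the ball with another point in it
  matter, and two points of the ball are closer than \<open>2 * r\<close>. Moving such a point gains
  \<open>exp (\<beta> * T)\<close>, costs \<open>exp K0\<close>, and leaves a mixed moment on the
  ball of radius \<open>1 + r\<close>, multiplied by the volume of the ball of radius
  \<open>r\<close>. Averaging over centres consumes that volume, so the constant in the contraction
  condition does not depend on \<open>r\<close>: first \<open>T\<close> can be taken large, and then
  \<open>r\<close> small.\<close>

lemma moment_le_neighbours:
  assumes r: "0 < r" "r \<le> 1" and w: "norm w + 2 \<le> R"
    and T: "0 \<le> T" "\<And>x::'a. 0 < norm x \<Longrightarrow> norm x < 2 * r \<Longrightarrow> T \<le> excess x"
    and q: "2 ^ p * exp K0 * moll_max * (2 * measure lborel (ball (0::'a) 3)) \<le> exp (\<beta> * T) / 2"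
    and B: "\<And>v. v \<in> ball w 3 \<Longrightarrow> moment (Suc p) r v \<le> ennreal B" and B0: "0 \<le> B"
  shows "moment (Suc p) r w \<le> ennreal (1 + B / 2)"
proof -
  have [measurable]: "\<And>v r. ball v r \<in> sets (borel :: 'a measure)" by simp
  let ?A = "ball w r"
  let ?v = "emeasure lborel (ball (0::'a) r)"
  let ?Q = "\<integral>\<^sup>+X. count (ball w (1 + r)) X * count ?A X ^ p \<partial>G"
  \<comment> \<open>The case distinction matters for \<open>p = 0\<close>, where
    \<open>0 ^ 0 = 1\<close> would admit isolated points.\<close>
  define F where "F i X = indicator ?A (Y X i) * (if count_but i ?A X = 0 then 0 else count_but i ?A X ^ p)" for i X
  have F_meas [measurable]: "F i \<in> borel_measurable P" if "i < N" for i
    unfolding F_def using that by measurable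
  have F_bound: "ennreal (exp (\<beta> * T)) * (\<integral>\<^sup>+X. F i X \<partial>G) \<le>
      ennreal (exp K0) * (ennreal moll_max * ?v * (\<integral>\<^sup>+X. indicator (ball w (1 + r)) (Y X i) * count ?A X ^ p \<partial>G))"
    if i: "i < N" for i
  proof -
    have "ennreal (exp (\<beta> * T)) * (\<integral>\<^sup>+X. F i X \<partial>G) \<le>
      ennreal (exp K0) * (\<integral>\<^sup>+X. (\<integral>\<^sup>+u. F i (X(i := X i - s *\<^sub>R u)) * ennreal (moll u) \<partial>lborel) \<partial>G)"
    proof (rule move_one_point[OF i F_meas[OF i]])
      fix X assume F: "F i X \<noteq> 0"
      then have Yi: "Y X i \<in> ?A" and nz: "count_but i ?A X \<noteq> 0"
        by (auto simp: F_def indicator_def split: if_splits)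
      show "Y X i \<in> ball 0 (R - 1)"
        using Yi w r norm_triangle_ineq2[of "Y X i" w] by (simp add: dist_norm norm_minus_commute)
      assume ne: "\<And>j. j \<in> {..<N} - {i} \<Longrightarrow> X j \<noteq> X i"
      have neY: "Y X i - Y X j \<noteq> 0" if "j \<in> {..<N} - {i}" for j
        using ne[OF that] s by (auto simp: Y_def)
      obtain j where j: "j \<in> {..<N} - {i}" "Y X j \<in> ?A"
        using count_but_cases[of i ?A X] nz by auto
      have "norm (Y X i - Y X j) < 2 * r"
        using Yi j(2) dist_triangle[of "Y X i" "Y X j" w] by (simp add: dist_norm norm_minus_commute)
      then have "T \<le> excess (Y X i - Y X j)"
        using neY[OF j(1)] by (intro T(2)) auto
      also have "\<dots> \<le> (\<Sum>j\<in>{..<N} - {i}. excess (Y X i - Y X j))"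
        using j(1) neY by (intro member_le_sum excess_nonneg[OF dim]) auto
      finally show "\<beta> * T \<le> \<beta> * (\<Sum>j\<in>{..<N} - {i}. excess (Y X i - Y X j))"
        using \<beta> by (intro mult_left_mono) auto
    qed
    also have "(\<integral>\<^sup>+X. (\<integral>\<^sup>+u. F i (X(i := X i - s *\<^sub>R u)) * ennreal (moll u) \<partial>lborel) \<partial>G) \<le>
        (\<integral>\<^sup>+X. ennreal moll_max * ?v * (indicator (ball w (1 + r)) (Y X i) * count ?A X ^ p) \<partial>G)"
    proof (rule nn_integral_mono)
      fix X
      let ?c = "if count_but i ?A X = 0 then 0 else count_but i ?A X ^ p"
      have "(\<integral>\<^sup>+u. F i (X(i := X i - s *\<^sub>R u)) * ennreal (moll u) \<partial>lborel) =
          (\<integral>\<^sup>+u. ?c * (indicator ?A (Y X i - u) * ennreal (moll u)) \<partial>lborel)"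
        by (rule nn_integral_cong) (simp add: F_def count_but_update Y_update mult_ac)
      also have "\<dots> = ?c * (\<integral>\<^sup>+u. indicator ?A (Y X i - u) * ennreal (moll u) \<partial>lborel)"
        by (rule nn_integral_cmult) measurable
      also have "\<dots> \<le> count ?A X ^ p * (ennreal moll_max * ?v * indicator (ball w (1 + r)) (Y X i))"
      proof (rule mult_mono[OF _ smear_indicator_le[OF r(1)]])
        have "count_but i ?A X \<le> count ?A X" using i by (simp add: count_remove)
        then show "?c \<le> count ?A X ^ p" by (auto intro: power_mono)
      qed auto
      finally show "(\<integral>\<^sup>+u. F i (X(i := X i - s *\<^sub>R u)) * ennreal (moll u) \<partial>lborel) \<le>
        ennreal moll_max * ?v * (indicator (ball w (1 + r)) (Y X i) * count ?A X ^ p)"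
        by (simp add: mult_ac)
    qed
    also have "(\<integral>\<^sup>+X. ennreal moll_max * ?v * (indicator (ball w (1 + r)) (Y X i) * count ?A X ^ p) \<partial>G) =
        ennreal moll_max * ?v * (\<integral>\<^sup>+X. indicator (ball w (1 + r)) (Y X i) * count ?A X ^ p \<partial>G)"
      using i by (intro nn_integral_cmult) measurable
    finally show ?thesis by (simp add: mult_left_mono)
  qed
  have "ennreal (exp (\<beta> * T)) * (\<Sum>i<N. \<integral>\<^sup>+X. F i X \<partial>G) \<le>
      (\<Sum>i<N. ennreal (exp K0) * (ennreal moll_max * ?v * (\<integral>\<^sup>+X. indicator (ball w (1 + r)) (Y X i) * count ?A X ^ p \<partial>G)))"
    unfolding sum_distrib_left by (intro sum_mono F_bound) auto
  also have "\<dots> = ennreal (exp K0) * (ennreal moll_max * ?v * ?Q)"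
  proof -
    have "?Q = (\<Sum>i<N. \<integral>\<^sup>+X. indicator (ball w (1 + r)) (Y X i) * count ?A X ^ p \<partial>G)"
      unfolding count_def[of "ball w (1 + r)"] sum_distrib_right
      by (rule nn_integral_sum) measurable
    then show ?thesis by (simp add: sum_distrib_left)
  qed
  also have "?v * ?Q \<le> ennreal (2 * measure lborel (ball (0::'a) 3) * B)"
  proof -
    have "?v * ?Q = (\<integral>\<^sup>+X. ?v * count (ball w (1 + r)) X * count ?A X ^ p \<partial>G)"
      by (subst nn_integral_cmult[symmetric]) (auto simp: mult.assoc)
    also have "\<dots> \<le> (\<integral>\<^sup>+X. (\<integral>\<^sup>+v. indicator (ball w 3) v * count (ball v r) X \<partial>lborel) * count ?A X ^ p \<partial>G)"
      by (intro nn_integral_mono mult_right_mono ball_count_le_average r) auto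
    \<comment> \<open>The mixed moment is split into pure moments of balls of the same radius
      \<open>r\<close>, which are the quantities of the recursion.\<close>
    also have "\<dots> \<le> (\<integral>\<^sup>+X. (\<integral>\<^sup>+v. indicator (ball w 3) v * (count (ball v r) X ^ Suc p + count ?A X ^ Suc p) \<partial>lborel) \<partial>G)"
    proof (rule nn_integral_mono)
      fix X assume X: "X \<in> space G"
      have m: "(\<lambda>v. count (ball v r) X) \<in> borel_measurable lborel"
        using measurable_compose_Pair1[OF _ borel_measurable_ball_count, of X r] X by (simp add: space_G)
      have "(\<integral>\<^sup>+v. indicator (ball w 3) v * count (ball v r) X \<partial>lborel) * count ?A X ^ p =
          (\<integral>\<^sup>+v. indicator (ball w 3) v * count (ball v r) X * count ?A X ^ p \<partial>lborel)"
        by (rule nn_integral_multc[symmetric], rule borel_measurable_times_ennreal[OF borel_measurable_indicator m]) simp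
      also have "\<dots> \<le> (\<integral>\<^sup>+v. indicator (ball w 3) v * (count (ball v r) X ^ Suc p + count ?A X ^ Suc p) \<partial>lborel)"
        unfolding mult.assoc by (intro nn_integral_mono mult_left_mono ennreal_mult_power_le_sum) simp
      finally show "(\<integral>\<^sup>+v. indicator (ball w 3) v * count (ball v r) X \<partial>lborel) * count ?A X ^ p \<le>
          (\<integral>\<^sup>+v. indicator (ball w 3) v * (count (ball v r) X ^ Suc p + count ?A X ^ Suc p) \<partial>lborel)" .
    qed
    also have "\<dots> = (\<integral>\<^sup>+v. (\<integral>\<^sup>+X. indicator (ball w 3) v * (count (ball v r) X ^ Suc p + count ?A X ^ Suc p) \<partial>G) \<partial>lborel)"
    proof (rule pair_sigma_finite.Fubini'[symmetric])
      show "pair_sigma_finite G (lborel :: 'a measure)"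
        by (intro pair_sigma_finite.intro G.sigma_finite_measure_axioms sigma_finite_lborel)
      have [measurable]: "(\<lambda>(X, v). count (ball v r) X) \<in> borel_measurable (G \<Otimes>\<^sub>M lborel)"
        using borel_measurable_ball_count by (simp cong: measurable_cong_sets add: sets_G sets_pair_measure_cong[OF sets_G refl])
      have [measurable]: "count ?A \<in> borel_measurable G"
        using borel_measurable_count[of ?A] by (simp cong: measurable_cong_sets add: sets_G)
      show "(\<lambda>(X, v). indicator (ball w 3) v * (count (ball v r) X ^ Suc p + count ?A X ^ Suc p)) \<in> borel_measurable (G \<Otimes>\<^sub>M lborel)"
        by measurable
    qed
    also have "\<dots> \<le> (\<integral>\<^sup>+v. indicator (ball w 3) v * ennreal (2 * B) \<partial>(lborel :: 'a measure))"
    proof (rule nn_integral_mono)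
      fix v :: 'a
      show "(\<integral>\<^sup>+X. indicator (ball w 3) v * (count (ball v r) X ^ Suc p + count ?A X ^ Suc p) \<partial>G) \<le> indicator (ball w 3) v * ennreal (2 * B)"
      proof (cases "v \<in> ball w 3")
        case True
        have "(\<integral>\<^sup>+X. (count (ball v r) X ^ Suc p + count ?A X ^ Suc p) \<partial>G) = moment (Suc p) r v + moment (Suc p) r w"
          unfolding moment_def by (rule nn_integral_add) measurable
        also have "\<dots> \<le> ennreal B + ennreal B"
          using True by (intro add_mono B) auto
        also have "\<dots> = ennreal (2 * B)" using B0 by (simp flip: ennreal_plus)
        finally show ?thesis using True by simp
      qed simp
    qed
    also have "\<dots> = emeasure lborel (ball (0::'a) 3) * ennreal (2 * B)"
      by (subst nn_integral_multc) (auto simp: emeasure_ball)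
    also have "\<dots> = ennreal (2 * measure lborel (ball (0::'a) 3) * B)"
      using B0 by (subst emeasure_eq_ennreal_measure) (use emeasure_lborel_ball_finite[of "0::'a" 3] in \<open>auto simp: ennreal_mult'[symmetric] mult_ac\<close>)
    finally show ?thesis .
  qed
  then have "ennreal (exp K0) * (ennreal moll_max * (?v * ?Q)) \<le>
      ennreal (exp K0) * (ennreal moll_max * ennreal (2 * measure lborel (ball (0::'a) 3) * B))"
    by (intro mult_left_mono) auto
  then have "ennreal (exp K0) * (ennreal moll_max * ?v * ?Q) \<le>
      ennreal (exp K0) * (ennreal moll_max * ennreal (2 * measure lborel (ball (0::'a) 3) * B))"
    by (simp add: mult.assoc)
  finally have sum_F: "ennreal (exp (\<beta> * T)) * (\<Sum>i<N. \<integral>\<^sup>+X. F i X \<partial>G) \<le>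
      ennreal (exp K0 * moll_max * (2 * measure lborel (ball (0::'a) 3)) * B)"
    using moll_max_nonneg B0 by (simp add: ennreal_mult'[symmetric] mult_ac)
  have "ennreal (exp (\<beta> * T)) * (2 ^ p * (\<Sum>i<N. \<integral>\<^sup>+X. F i X \<partial>G)) \<le>
      2 ^ p * ennreal (exp K0 * moll_max * (2 * measure lborel (ball (0::'a) 3)) * B)"
    using mult_left_mono[OF sum_F, of "2 ^ p"] by (simp add: mult_ac)
  also have "\<dots> = ennreal (2 ^ p * exp K0 * moll_max * (2 * measure lborel (ball (0::'a) 3)) * B)"
    using moll_max_nonneg B0 by (simp add: ennreal_mult' ennreal_power[symmetric] mult_ac ennreal_numeral)
  also have "\<dots> \<le> ennreal (exp (\<beta> * T) / 2 * B)"
    using q B0 by (intro ennreal_leI mult_right_mono)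
  also have "\<dots> = ennreal (exp (\<beta> * T)) * ennreal (B / 2)"
    using B0 by (simp add: ennreal_mult'[symmetric])
  finally have "2 ^ p * (\<Sum>i<N. \<integral>\<^sup>+X. F i X \<partial>G) \<le> ennreal (B / 2)"
    by (simp add: ennreal_mult_le_mult_iff ennreal_eq_0_iff)
  moreover have "moment (Suc p) r w \<le> 1 + 2 ^ p * (\<Sum>i<N. \<integral>\<^sup>+X. F i X \<partial>G)"
  proof -
    have FG: "F i \<in> borel_measurable G" if "i \<in> {..<N}" for i
      using F_meas[of i] that by (simp cong: measurable_cong_sets add: sets_G)
    have "moment (Suc p) r w \<le> (\<integral>\<^sup>+X. 1 + 2 ^ p * (\<Sum>i<N. F i X) \<partial>G)"
      unfolding moment_def F_def by (intro nn_integral_mono count_power_le)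
    also have "\<dots> = 1 + 2 ^ p * (\<Sum>i<N. \<integral>\<^sup>+X. F i X \<partial>G)"
    proof -
      have "(\<integral>\<^sup>+X. (\<Sum>i<N. F i X) \<partial>G) = (\<Sum>i<N. \<integral>\<^sup>+X. F i X \<partial>G)"
        by (rule nn_integral_sum[OF FG])
      then show ?thesis
        using FG by (simp add: nn_integral_add nn_integral_cmult G.emeasure_space_1)
    qed
    finally show ?thesis .
  qed
  ultimately have "moment (Suc p) r w \<le> 1 + ennreal (B / 2)"
    by (meson add_left_mono order_trans)
  then show ?thesis using B0 by (simp add: ennreal_plus)
qed

lemma moment_trivial: "moment k r w \<le> ennreal (real N ^ k)"
proof -
  have "moment k r w \<le> (\<integral>\<^sup>+X. of_nat N ^ k \<partial>G)"
    unfolding moment_def by (intro nn_integral_mono power_mono count_le) auto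
  also have "\<dots> = ennreal (real N ^ k)"
    by (simp add: G.emeasure_space_1 ennreal_power[symmetric] ennreal_of_nat_eq_real_of_nat)
  finally show ?thesis .
qed

text \<open>The map \<open>B \<mapsto> 1 + B / 2\<close> has the fixed point \<open>2\<close> and
  halves the distance to it. The iteration starts from the trivial moment bound, and each round
  needs balls with centres at distance up to \<open>3\<close>.\<close>

lemma moment_iterate:
  assumes r: "0 < r" "r \<le> 1"
    and T: "0 \<le> T" "\<And>x::'a. 0 < norm x \<Longrightarrow> norm x < 2 * r \<Longrightarrow> T \<le> excess x"
    and q: "2 ^ p * exp K0 * moll_max * (2 * measure lborel (ball (0::'a) 3)) \<le> exp (\<beta> * T) / 2"
    and w: "norm w + 3 * real J + 2 \<le> R"
  shows "moment (Suc p) r w \<le> ennreal (2 + real N ^ Suc p / 2 ^ J)"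
  using w
proof (induction J arbitrary: w)
  case 0
  show ?case
    by (rule order_trans[OF moment_trivial]) (simp add: ennreal_leI)
next
  case (Suc J)
  have "moment (Suc p) r w \<le> ennreal (1 + (2 + real N ^ Suc p / 2 ^ J) / 2)"
  proof (rule moment_le_neighbours[OF r _ T q])
    show "norm w + 2 \<le> R" using Suc.prems by simp
    fix v assume "v \<in> ball w 3"
    then have "norm v \<le> norm w + 3"
      using norm_triangle_ineq2[of v w] by (simp add: dist_norm norm_minus_commute)
    then show "moment (Suc p) r v \<le> ennreal (2 + real N ^ Suc p / 2 ^ J)"
      using Suc.prems by (intro Suc.IH) simp
  qed (auto intro!: add_nonneg_nonneg divide_nonneg_nonneg)
  then show ?case by (simp add: add_divide_distrib mult.commute)
qed

lemma moment_bound_of_cover: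
  assumes F: "finite F" "F \<noteq> {}" "A \<subseteq> (\<Union>c\<in>F. ball c r)" "A \<in> sets borel"
    and B: "\<And>c. c \<in> F \<Longrightarrow> moment k r c \<le> B"
  shows "(\<integral>\<^sup>+X. count A X ^ k \<partial>G) \<le> of_nat (card F) ^ k * (of_nat (card F) * B)"
proof -
  have "(\<integral>\<^sup>+X. count A X ^ k \<partial>G) \<le> (\<integral>\<^sup>+X. of_nat (card F) ^ k * (\<Sum>c\<in>F. count (ball c r) X ^ k) \<partial>G)"
  proof (rule nn_integral_mono)
    fix X
    have "count A X \<le> (\<Sum>c\<in>F. count (ball c r) X)"
      unfolding count_def
    proof (subst sum.swap, rule sum_mono)
      fix j
      show "(indicator A (Y X j) :: ennreal) \<le> (\<Sum>c\<in>F. indicator (ball c r) (Y X j))"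
      proof (cases "Y X j \<in> A")
        case True
        then obtain c where c: "c \<in> F" "Y X j \<in> ball c r" using F(3) by auto
        then have "(indicator (ball c r) (Y X j) :: ennreal) \<le> (\<Sum>c\<in>F. indicator (ball c r) (Y X j))"
          using F(1) by (intro member_le_sum) auto
        then show ?thesis using c True by simp
      qed simp
    qed
    then have "count A X ^ k \<le> (\<Sum>c\<in>F. count (ball c r) X) ^ k"
      by (rule power_mono) simp
    also have "\<dots> \<le> of_nat (card F) ^ k * (\<Sum>c\<in>F. count (ball c r) X ^ k)"
      using ennreal_sum_power_le[OF F(1), of "\<lambda>c. count (ball c r) X" k] F(2) by simp
    finally show "count A X ^ k \<le> of_nat (card F) ^ k * (\<Sum>c\<in>F. count (ball c r) X ^ k)" .
  qed
  also have "\<dots> = of_nat (card F) ^ k * (\<Sum>c\<in>F. moment k r c)"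
  proof -
    have "(\<lambda>X. count (ball c r) X ^ k) \<in> borel_measurable G" for c
      by (intro borel_measurable_G borel_measurable_power borel_measurable_count) simp
    then show ?thesis
      by (simp add: nn_integral_cmult nn_integral_sum moment_def)
  qed
  also have "\<dots> \<le> of_nat (card F) ^ k * (of_nat (card F) * B)"
    using B by (intro mult_left_mono sum_bounded_above) auto
  finally show ?thesis .
qed

text \<open>The points of the tuple are moved one after the other, beginning with the last. Moving a
  point replaces its coordinate in \<open>\<psi>\<close> by an integral against the Lebesgue
  measure, because the displacement has density at most \<open>moll_max\<close>. What remains of the
  point is the condition that it was within distance \<open>1\<close> of the support, and this is
  handed over to \<open>H\<close>. The factor \<open>H\<close> is thus there for the induction, and
  it must ignore the points that are still to be moved.\<close>

lemma tuple_bound: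
  assumes "inj_on \<sigma> {..<k}" "\<And>j. j < k \<Longrightarrow> \<sigma> j < N"
    and "\<psi> \<in> borel_measurable (\<Pi>\<^sub>M j\<in>{..<k}. lborel :: 'a measure)" and "H \<in> borel_measurable P"
    and "\<And>X j y. j < k \<Longrightarrow> H (X(\<sigma> j := y)) = H X"
    and "\<And>z. \<psi> z \<noteq> 0 \<Longrightarrow> \<forall>j<k. z j \<in> ball 0 \<rho>" and \<rho>: "0 < \<rho>" "\<rho> + 1 \<le> R"
  shows "(\<integral>\<^sup>+X. \<psi> (\<lambda>j\<in>{..<k}. Y X (\<sigma> j)) * H X \<partial>G) \<le>
    ennreal (exp K0 * moll_max) ^ k * (\<integral>\<^sup>+z. \<psi> z \<partial>(\<Pi>\<^sub>M j\<in>{..<k}. lborel)) *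
    (\<integral>\<^sup>+X. (\<Prod>j<k. indicator (ball 0 (\<rho> + 1)) (Y X (\<sigma> j))) * H X \<partial>G)"
  using assms(1-6)
proof (induction k arbitrary: \<psi> H)
  case 0
  have r0: "(\<lambda>j\<in>{..<0}. Y X (\<sigma> j)) = (\<lambda>j. undefined)" for X by (auto simp: restrict_def)
  have HG: "H \<in> borel_measurable G"
    using 0(4) by (simp cong: measurable_cong_sets add: sets_G)
  show ?case
    unfolding r0 by (simp add: product.nn_integral_empty nn_integral_cmult[OF HG])
next
  case (Suc k)
  let ?B = "ball (0::'a) (\<rho> + 1)"
  let ?i = "\<sigma> k"
  let ?Y = "\<lambda>X. (\<lambda>j\<in>{..<k}. Y X (\<sigma> j))"
  note \<psi>[measurable] = Suc.prems(3)
  note H[measurable] = Suc.prems(4)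
  have i: "?i < N" using Suc.prems(2) by simp
  have ne: "\<sigma> j \<noteq> ?i" if "j < k" for j
    using Suc.prems(1) that by (auto simp: inj_on_def)
  have YM [measurable]: "?Y \<in> measurable P (\<Pi>\<^sub>M j\<in>{..<k}. lborel)"
    using Suc.prems(2) by (intro measurable_restrict) auto
  have ins: "{..<Suc k} = insert k {..<k}" by auto
  have upd [measurable]: "(\<lambda>(z, y). z(k := y)) \<in> measurable ((\<Pi>\<^sub>M j\<in>{..<k}. lborel) \<Otimes>\<^sub>M lborel) (\<Pi>\<^sub>M j\<in>{..<Suc k}. lborel :: 'a measure)"
    unfolding ins by (rule measurable_add_dim)
  have Y_Suc: "(\<lambda>j\<in>{..<Suc k}. Y X (\<sigma> j)) = (?Y X)(k := Y X ?i)" for X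
    by (auto simp: restrict_def)
  have \<psi>z [measurable]: "(\<lambda>(z, y). \<psi> (z(k := y))) \<in> borel_measurable ((\<Pi>\<^sub>M j\<in>{..<k}. lborel) \<Otimes>\<^sub>M lborel)"
    using measurable_compose[OF upd \<psi>] by (simp add: split_beta')
  have \<psi>Y [measurable]: "(\<lambda>(y, X). \<psi> ((?Y X)(k := y))) \<in> borel_measurable (lborel \<Otimes>\<^sub>M P)"
  proof -
    have "(\<lambda>(y, X). (?Y X, y)) \<in> measurable (lborel \<Otimes>\<^sub>M P) ((\<Pi>\<^sub>M j\<in>{..<k}. lborel) \<Otimes>\<^sub>M lborel)"
      by measurable
    from measurable_compose[OF this \<psi>z] show ?thesis by (simp add: split_beta')
  qed
  have yi [measurable]: "(\<lambda>X. Y X ?i) \<in> borel_measurable P" by (rule borel_measurable_Y[OF i])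
  define F where "F X = \<psi> ((?Y X)(k := Y X ?i)) * H X" for X
  have F_meas: "F \<in> borel_measurable P"
  proof -
    have "(\<lambda>X. (Y X ?i, X)) \<in> measurable P (lborel \<Otimes>\<^sub>M P)" by measurable
    from measurable_compose[OF this \<psi>Y] have "(\<lambda>X. \<psi> ((?Y X)(k := Y X ?i))) \<in> borel_measurable P"
      by simp
    then show ?thesis
      unfolding F_def by (rule borel_measurable_times_ennreal[OF _ H])
  qed
  have F_upd: "F (X(?i := X ?i - s *\<^sub>R u)) = \<psi> ((?Y X)(k := Y X ?i - u)) * H X" for X u
  proof -
    have "?Y (X(?i := X ?i - s *\<^sub>R u)) = ?Y X"
      using ne by (auto simp: restrict_def Y_update)
    moreover have "H (X(?i := X ?i - s *\<^sub>R u)) = H X"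
      by (rule Suc.prems(5)) simp
    ultimately show ?thesis by (simp add: F_def Y_update)
  qed
  define H' where "H' X = indicator ?B (Y X ?i) * H X" for X
  have H'_meas [measurable]: "H' \<in> borel_measurable P"
    unfolding H'_def by (rule borel_measurable_times_ennreal[OF borel_measurable_ind_Y[OF _ i] H]) simp
  have m1: "(\<lambda>(y, X). \<psi> ((?Y X)(k := y)) * H' X) \<in> borel_measurable (lborel \<Otimes>\<^sub>M P)"
    using \<psi>Y by measurable
  have sec: "(\<lambda>y. \<psi> (z(k := y))) \<in> borel_measurable lborel" if "z \<in> space (\<Pi>\<^sub>M j\<in>{..<k}. lborel :: 'a measure)" for z
    using measurable_compose_Pair1[OF that \<psi>z] by simp
  have "(\<integral>\<^sup>+X. F X \<partial>G) \<le> ennreal (exp K0) * (\<integral>\<^sup>+X. (\<integral>\<^sup>+u. F (X(?i := X ?i - s *\<^sub>R u)) * ennreal (moll u) \<partial>lborel) \<partial>G)"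
  proof -
    \<comment> \<open>Taking \<open>c = 0\<close> uses only that \<open>excess\<close> is
      nonnegative: no closeness of points is exploited here.\<close>
    have "ennreal (exp 0) * (\<integral>\<^sup>+X. F X \<partial>G) \<le>
      ennreal (exp K0) * (\<integral>\<^sup>+X. (\<integral>\<^sup>+u. F (X(?i := X ?i - s *\<^sub>R u)) * ennreal (moll u) \<partial>lborel) \<partial>G)"
    proof (rule move_one_point[OF i F_meas])
      fix X assume "F X \<noteq> 0"
      then have "\<psi> ((?Y X)(k := Y X ?i)) \<noteq> 0" by (auto simp: F_def)
      from Suc.prems(6)[OF this] have "Y X ?i \<in> ball 0 \<rho>" by auto
      then show "Y X ?i \<in> ball 0 (R - 1)" using \<rho> by simp
      assume ne: "\<And>j. j \<in> {..<N} - {?i} \<Longrightarrow> X j \<noteq> X ?i"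
      have "0 \<le> excess (Y X ?i - Y X j)" if "j \<in> {..<N} - {?i}" for j
        using ne[OF that] s by (intro excess_nonneg[OF dim]) (auto simp: Y_def)
      then show "0 \<le> \<beta> * (\<Sum>j\<in>{..<N} - {?i}. excess (Y X ?i - Y X j))"
        using \<beta> by (intro mult_nonneg_nonneg sum_nonneg) auto
    qed
    then show ?thesis by simp
  qed
  also have "(\<integral>\<^sup>+X. (\<integral>\<^sup>+u. F (X(?i := X ?i - s *\<^sub>R u)) * ennreal (moll u) \<partial>lborel) \<partial>G) \<le>
      (\<integral>\<^sup>+X. ennreal moll_max * (\<integral>\<^sup>+y. \<psi> ((?Y X)(k := y)) * H' X \<partial>lborel) \<partial>G)"
  proof (rule nn_integral_mono)
    fix X assume "X \<in> space G"
    then have z: "?Y X \<in> space (\<Pi>\<^sub>M j\<in>{..<k}. lborel :: 'a measure)" by (simp add: space_PiM)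
    have "(\<integral>\<^sup>+u. F (X(?i := X ?i - s *\<^sub>R u)) * ennreal (moll u) \<partial>lborel) \<le>
        (\<integral>\<^sup>+u. ennreal moll_max * (\<psi> ((?Y X)(k := Y X ?i + (- 1) *\<^sub>R u)) * H' X) \<partial>lborel)"
    proof (rule nn_integral_mono)
      fix u :: 'a
      show "F (X(?i := X ?i - s *\<^sub>R u)) * ennreal (moll u) \<le> ennreal moll_max * (\<psi> ((?Y X)(k := Y X ?i + (- 1) *\<^sub>R u)) * H' X)"
      proof (cases "\<psi> ((?Y X)(k := Y X ?i - u)) = 0 \<or> 1 \<le> norm u")
        case True
        then show ?thesis by (auto simp: F_upd moll_eq_0)
      next
        case False
        then have "\<psi> ((?Y X)(k := Y X ?i - u)) \<noteq> 0" "norm u < 1" by auto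
        with Suc.prems(6)[OF this(1)] have "Y X ?i - u \<in> ball 0 \<rho>" by auto
        then have "Y X ?i \<in> ?B"
          using \<open>norm u < 1\<close> norm_triangle_ineq[of "Y X ?i - u" u] by simp
        moreover have "ennreal (moll u) \<le> ennreal moll_max"
          using ennreal_moll_le[of u] \<open>norm u < 1\<close> by simp
        ultimately show ?thesis
          by (simp add: F_upd H'_def mult.commute) (intro mult_right_mono, simp_all)
      qed
    qed
    also have "\<dots> = ennreal moll_max * (\<integral>\<^sup>+u. \<psi> ((?Y X)(k := Y X ?i + (- 1) *\<^sub>R u)) * H' X \<partial>lborel)"
    proof (rule nn_integral_cmult)
      have "(\<lambda>u. Y X ?i + (- 1) *\<^sub>R u) \<in> borel_measurable lborel" by measurable
      moreover have "(\<lambda>y. \<psi> ((?Y X)(k := y))) \<in> borel_measurable borel"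
        using sec[OF z] by simp
      ultimately show "(\<lambda>u. \<psi> ((?Y X)(k := Y X ?i + (- 1) *\<^sub>R u)) * H' X) \<in> borel_measurable lborel"
        by (intro borel_measurable_times_ennreal borel_measurable_const) (rule measurable_compose)
    qed
    also have "(\<integral>\<^sup>+u. \<psi> ((?Y X)(k := Y X ?i + (- 1) *\<^sub>R u)) * H' X \<partial>lborel) = (\<integral>\<^sup>+y. \<psi> ((?Y X)(k := y)) * H' X \<partial>lborel)"
      using nn_integral_lborel_affine[of "\<lambda>y. \<psi> ((?Y X)(k := y)) * H' X" "-1" "Y X ?i"] sec[OF z] by simp
    finally show "(\<integral>\<^sup>+u. F (X(?i := X ?i - s *\<^sub>R u)) * ennreal (moll u) \<partial>lborel) \<le>
      ennreal moll_max * (\<integral>\<^sup>+y. \<psi> ((?Y X)(k := y)) * H' X \<partial>lborel)" .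
  qed
  also have "(\<integral>\<^sup>+X. ennreal moll_max * (\<integral>\<^sup>+y. \<psi> ((?Y X)(k := y)) * H' X \<partial>lborel) \<partial>G) =
      ennreal moll_max * (\<integral>\<^sup>+X. (\<integral>\<^sup>+y. \<psi> ((?Y X)(k := y)) * H' X \<partial>lborel) \<partial>G)"
  proof (rule nn_integral_cmult)
    have "(\<lambda>X. \<integral>\<^sup>+y. \<psi> ((?Y X)(k := y)) * H' X \<partial>lborel) \<in> borel_measurable P"
      using m1 by measurable
    then show "(\<lambda>X. \<integral>\<^sup>+y. \<psi> ((?Y X)(k := y)) * H' X \<partial>lborel) \<in> borel_measurable G"
      by (simp cong: measurable_cong_sets add: sets_G)
  qed
  also have "(\<integral>\<^sup>+X. (\<integral>\<^sup>+y. \<psi> ((?Y X)(k := y)) * H' X \<partial>lborel) \<partial>G) = (\<integral>\<^sup>+y. (\<integral>\<^sup>+X. \<psi> ((?Y X)(k := y)) * H' X \<partial>G) \<partial>lborel)"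
  proof (rule pair_sigma_finite.Fubini')
    show "pair_sigma_finite (lborel :: 'a measure) G"
      by (intro pair_sigma_finite.intro G.sigma_finite_measure_axioms sigma_finite_lborel)
    show "(\<lambda>(y, X). \<psi> ((?Y X)(k := y)) * H' X) \<in> borel_measurable (lborel \<Otimes>\<^sub>M G)"
      using m1 by (simp cong: measurable_cong_sets add: sets_pair_measure_cong[OF refl sets_G])
  qed
  also have "\<dots> \<le> (\<integral>\<^sup>+y. ennreal (exp K0 * moll_max) ^ k * (\<integral>\<^sup>+z. \<psi> (z(k := y)) \<partial>(\<Pi>\<^sub>M j\<in>{..<k}. lborel)) *
    (\<integral>\<^sup>+X. (\<Prod>j<k. indicator ?B (Y X (\<sigma> j))) * H' X \<partial>G) \<partial>(lborel :: 'a measure))"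
  proof (rule nn_integral_mono, rule Suc.IH)
    fix y :: 'a
    show "inj_on \<sigma> {..<k}" using Suc.prems(1) by (auto simp: inj_on_def)
    show "\<sigma> j < N" if "j < k" for j using that Suc.prems(2) by simp
    show "(\<lambda>z. \<psi> (z(k := y))) \<in> borel_measurable (\<Pi>\<^sub>M j\<in>{..<k}. lborel)"
    proof -
      have "(\<lambda>z. (z, y)) \<in> measurable (\<Pi>\<^sub>M j\<in>{..<k}. lborel) ((\<Pi>\<^sub>M j\<in>{..<k}. lborel :: 'a measure) \<Otimes>\<^sub>M lborel)"
        by simp
      from measurable_compose[OF this \<psi>z] show ?thesis by simp
    qed
    show "H' \<in> borel_measurable P" by simp
    show "H' (X(\<sigma> j := y)) = H' X" if "j < k" for X j y
    proof -
      have "H (X(\<sigma> j := y)) = H X"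
        by (rule Suc.prems(5)) (use that in simp)
      moreover have "Y (X(\<sigma> j := y)) ?i = Y X ?i"
        using ne[OF that] by (simp add: Y_def)
      ultimately show ?thesis by (simp only: H'_def)
    qed
    show "\<forall>j<k. z j \<in> ball 0 \<rho>" if "\<psi> (z(k := y)) \<noteq> 0" for z
    proof (intro allI impI)
      fix j assume "j < k"
      then show "z j \<in> ball 0 \<rho>" using Suc.prems(6)[OF that, rule_format, of j] by auto
    qed
  qed
  also have "\<dots> = ennreal (exp K0 * moll_max) ^ k * (\<integral>\<^sup>+y. (\<integral>\<^sup>+z. \<psi> (z(k := y)) \<partial>(\<Pi>\<^sub>M j\<in>{..<k}. lborel)) \<partial>(lborel :: 'a measure)) *
    (\<integral>\<^sup>+X. (\<Prod>j<k. indicator ?B (Y X (\<sigma> j))) * H' X \<partial>G)"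
  proof -
    have "(\<lambda>(y, z). \<psi> (z(k := y))) \<in> borel_measurable (lborel \<Otimes>\<^sub>M (\<Pi>\<^sub>M j\<in>{..<k}. lborel))"
      using measurable_pair_swap[OF \<psi>z] by (simp add: split_beta')
    then have "(\<lambda>y. \<integral>\<^sup>+z. \<psi> (z(k := y)) \<partial>(\<Pi>\<^sub>M j\<in>{..<k}. lborel)) \<in> borel_measurable (lborel :: 'a measure)"
      by (intro sigma_finite_measure.borel_measurable_nn_integral product.sigma_finite) auto
    then show ?thesis
      by (subst nn_integral_multc, simp, subst nn_integral_cmult, simp_all)
  qed
  also have "(\<integral>\<^sup>+y. (\<integral>\<^sup>+z. \<psi> (z(k := y)) \<partial>(\<Pi>\<^sub>M j\<in>{..<k}. lborel)) \<partial>(lborel :: 'a measure)) = (\<integral>\<^sup>+z. \<psi> z \<partial>(\<Pi>\<^sub>M j\<in>{..<Suc k}. lborel))"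
    using product.product_nn_integral_insert_rev[of "{..<k}" k \<psi>] \<psi> unfolding ins by simp
  also have "(\<integral>\<^sup>+X. (\<Prod>j<k. indicator ?B (Y X (\<sigma> j))) * H' X \<partial>G) = (\<integral>\<^sup>+X. (\<Prod>j<Suc k. indicator ?B (Y X (\<sigma> j))) * H X \<partial>G)"
    by (simp add: H'_def mult_ac)
  finally have "(\<integral>\<^sup>+X. F X \<partial>G) \<le> ennreal (exp K0) * (ennreal moll_max * (ennreal (exp K0 * moll_max) ^ k *
    (\<integral>\<^sup>+z. \<psi> z \<partial>(\<Pi>\<^sub>M j\<in>{..<Suc k}. lborel)) * (\<integral>\<^sup>+X. (\<Prod>j<Suc k. indicator ?B (Y X (\<sigma> j))) * H X \<partial>G)))"
    by (simp add: mult_left_mono)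
  moreover have c: "ennreal (exp K0 * moll_max) = ennreal (exp K0) * ennreal moll_max"
    by (simp add: ennreal_mult moll_max_nonneg)
  ultimately show ?case
    unfolding Y_Suc F_def power_Suc c by (simp only: mult_ac)
qed

text \<open>The product indicators left over by \<open>tuple_bound\<close>, summed over all index
  tuples, injective or not, multiply out to a power of the count.\<close>

lemma tuple_sum_bound:
  assumes \<psi>: "\<psi> \<in> borel_measurable (\<Pi>\<^sub>M j\<in>{..<k}. lborel :: 'a measure)"
    and supp: "\<And>z. \<psi> z \<noteq> 0 \<Longrightarrow> \<forall>j<k. z j \<in> ball 0 \<rho>" and \<rho>: "0 < \<rho>" "\<rho> + 1 \<le> R"
  shows "(\<Sum>\<sigma>\<in>tuples k {..<N}. \<integral>\<^sup>+X. \<psi> (\<lambda>j\<in>{..<k}. Y X (\<sigma> j)) \<partial>G) \<le>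
    ennreal (exp K0 * moll_max) ^ k * (\<integral>\<^sup>+z. \<psi> z \<partial>(\<Pi>\<^sub>M j\<in>{..<k}. lborel)) * (\<integral>\<^sup>+X. count (ball 0 (\<rho> + 1)) X ^ k \<partial>G)"
proof -
  let ?B = "ball (0::'a) (\<rho> + 1)"
  let ?c = "ennreal (exp K0 * moll_max) ^ k * (\<integral>\<^sup>+z. \<psi> z \<partial>(\<Pi>\<^sub>M j\<in>{..<k}. lborel))"
  have fin: "finite ({..<k} \<rightarrow>\<^sub>E {..<N})" by (intro finite_PiE) auto
  have "(\<Sum>\<sigma>\<in>tuples k {..<N}. \<integral>\<^sup>+X. \<psi> (\<lambda>j\<in>{..<k}. Y X (\<sigma> j)) \<partial>G) \<le>
      (\<Sum>\<sigma>\<in>tuples k {..<N}. ?c * (\<integral>\<^sup>+X. (\<Prod>j<k. indicator ?B (Y X (\<sigma> j))) \<partial>G))"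
  proof (rule sum_mono)
    fix \<sigma> assume "\<sigma> \<in> tuples k {..<N}"
    then have \<sigma>: "inj_on \<sigma> {..<k}" "\<And>j. j < k \<Longrightarrow> \<sigma> j < N"
      by (auto simp: tuples_def PiE_def Pi_def)
    show "(\<integral>\<^sup>+X. \<psi> (\<lambda>j\<in>{..<k}. Y X (\<sigma> j)) \<partial>G) \<le> ?c * (\<integral>\<^sup>+X. (\<Prod>j<k. indicator ?B (Y X (\<sigma> j))) \<partial>G)"
      using tuple_bound[OF \<sigma> \<psi>, of "\<lambda>_. 1" \<rho>] supp \<rho> by simp
  qed
  also have "\<dots> = ?c * (\<Sum>\<sigma>\<in>tuples k {..<N}. \<integral>\<^sup>+X. (\<Prod>j<k. indicator ?B (Y X (\<sigma> j))) \<partial>G)"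
    by (simp add: sum_distrib_left)
  finally have le: "(\<Sum>\<sigma>\<in>tuples k {..<N}. \<integral>\<^sup>+X. \<psi> (\<lambda>j\<in>{..<k}. Y X (\<sigma> j)) \<partial>G) \<le>
    ?c * (\<Sum>\<sigma>\<in>tuples k {..<N}. \<integral>\<^sup>+X. (\<Prod>j<k. indicator ?B (Y X (\<sigma> j))) \<partial>G)" .
  have "(\<Sum>\<sigma>\<in>tuples k {..<N}. \<integral>\<^sup>+X. (\<Prod>j<k. indicator ?B (Y X (\<sigma> j))) \<partial>G) \<le>
      (\<Sum>\<sigma>\<in>{..<k} \<rightarrow>\<^sub>E {..<N}. \<integral>\<^sup>+X. (\<Prod>j<k. indicator ?B (Y X (\<sigma> j))) \<partial>G)"
    using fin by (intro sum_mono2) (auto simp: tuples_def)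
  also have "\<dots> = (\<integral>\<^sup>+X. (\<Sum>\<sigma>\<in>{..<k} \<rightarrow>\<^sub>E {..<N}. (\<Prod>j<k. indicator ?B (Y X (\<sigma> j)))) \<partial>G)"
  proof (rule nn_integral_sum[symmetric])
    fix \<sigma> assume "\<sigma> \<in> {..<k} \<rightarrow>\<^sub>E {..<N}"
    then have \<sigma>: "\<And>j. j < k \<Longrightarrow> \<sigma> j < N" by (auto simp: PiE_def Pi_def)
    have "(\<lambda>X. \<Prod>j<k. indicator ?B (Y X (\<sigma> j)) :: ennreal) \<in> borel_measurable P"
      by (intro borel_measurable_prod_ennreal borel_measurable_ind_Y) (auto intro: \<sigma>)
    then show "(\<lambda>X. \<Prod>j<k. indicator ?B (Y X (\<sigma> j)) :: ennreal) \<in> borel_measurable G"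
      by (simp cong: measurable_cong_sets add: sets_G)
  qed
  also have "\<dots> = (\<integral>\<^sup>+X. count ?B X ^ k \<partial>G)"
  proof (rule nn_integral_cong)
    fix X
    show "(\<Sum>\<sigma>\<in>{..<k} \<rightarrow>\<^sub>E {..<N}. (\<Prod>j<k. indicator ?B (Y X (\<sigma> j)))) = count ?B X ^ k"
      using prod_sum_PiE[of "{..<k}" "\<lambda>_. {..<N}" "\<lambda>_ i. indicator ?B (Y X i) :: ennreal"]
      by (simp add: count_def)
  qed
  finally show ?thesis
    by (intro order_trans[OF le] mult_left_mono) simp_all
qed

end

section \<open>Bounds uniform in the number of points\<close>

text \<open>A ball is connected: meeting both \<open>S\<close> and its complement, it would meet the
  frontier.\<close>

lemma ball_subset_of_infdist_frontier:
  fixes S :: "'a::real_normed_vector set"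
  assumes x: "x \<in> S" and R: "0 < R" "R \<le> infdist x (frontier S)"
  shows "ball x R \<subseteq> S"
proof (rule ccontr)
  assume "\<not> ball x R \<subseteq> S"
  moreover have "x \<in> ball x R \<inter> S" using x R(1) by simp
  ultimately have "ball x R \<inter> frontier S \<noteq> {}"
    by (intro connected_Int_frontier convex_connected convex_ball) blast+
  then obtain z where "z \<in> frontier S" "dist x z < R" by auto
  then show False using infdist_le[of z "frontier S" x] R(2) by simp
qed

text \<open>The cost is that of \<open>smear_V\<close> with \<open>\<theta> * s^2 = \<beta>\<close>
  inserted, hence independent of \<open>N\<close>, \<open>x\<close> and \<open>R\<close>.\<close>

lemma gas_window_of_equilibrium:
  fixes V \<mu> :: "'a::euclidean_space \<Rightarrow> real" and x :: 'a
  assumes dim: "2 \<le> DIM('a)" and \<beta>: "0 < \<beta>" and N: "1 \<le> N" and V: "V \<in> borel_measurable borel"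
    and Z: "partition_function V \<beta> N < \<infinity>"
    and eq: "thermal_equilibrium (\<beta> * real N powr (2 / real DIM('a))) V \<mu>"
    and m: "0 < m" and R: "0 < R"
    and bounds: "\<And>y. y \<in> ball x R \<Longrightarrow> m \<le> blown_up N \<mu> y \<and> blown_up N \<mu> y \<le> \<Lambda>"
  shows "gas_window V \<beta> (real N powr (- 1 / real DIM('a))) R (ln (\<Lambda> / m) + \<beta> * \<Lambda> * (\<integral>y. excess (y::'a) \<partial>lborel)) N x"
proof -
  define s where "s = real N powr (- 1 / real DIM('a))"
  define \<theta> where "\<theta> = \<beta> * real N powr (2 / real DIM('a))"
  have s: "0 < s" and \<theta>: "0 < \<theta>" using N \<beta> by (simp_all add: s_def \<theta>_def)
  have \<theta>s: "\<theta> * s\<^sup>2 = \<beta>"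
  proof -
    have "s\<^sup>2 = real N powr (- 2 / real DIM('a))"
      using N by (simp add: s_def power2_eq_square powr_add[symmetric])
    then show ?thesis using N by (simp add: \<theta>_def powr_add[symmetric] mult.assoc)
  qed
  interpret equilibrium_on_ball \<theta> m \<Lambda> V \<mu> "s *\<^sub>R x" "s * R"
  proof unfold_locales
    show "0 < measure lborel (ball (s *\<^sub>R x) (s * R))"
      using s R by (intro content_ball_pos) simp
    show "emeasure lborel (ball (s *\<^sub>R x) (s * R)) < \<infinity>"
      by (rule emeasure_lborel_ball_finite)
    fix y assume y: "y \<in> ball (s *\<^sub>R x) (s * R)"
    have "s *\<^sub>R x - y = s *\<^sub>R (x - (1 / s) *\<^sub>R y)" using s by (simp add: scaleR_diff_right)
    then have "norm (s *\<^sub>R x - y) = s * norm (x - (1 / s) *\<^sub>R y)" using s by simp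
    then have "(1 / s) *\<^sub>R y \<in> ball x R" using y s by (simp add: dist_norm)
    from bounds[OF this] show "m \<le> \<mu> y \<and> \<mu> y \<le> \<Lambda>"
      unfolding blown_up_def s_def[symmetric] using s by simp
  qed (use dim \<theta> m V eq in \<open>simp_all add: \<theta>_def\<close>)
  show ?thesis
    unfolding s_def[symmetric]
  proof (unfold_locales, unfold \<theta>_def[symmetric])
    show "s = real N powr (- 1 / real DIM('a))" by (rule s_def)
    have *: "\<theta> * \<Lambda> * s\<^sup>2 = \<beta> * \<Lambda>" using \<theta>s by (simp add: mult_ac)
    show "AE y in lborel. y \<in> ball (s *\<^sub>R x) (s * (R - 1)) \<longrightarrow>
      integrable lborel (\<lambda>u. V (y + s *\<^sub>R u) * moll u) \<and>
      \<theta> * smear s V y \<le> \<theta> * V y + (ln (\<Lambda> / m) + \<beta> * \<Lambda> * (\<integral>y. excess (y::'a) \<partial>lborel))"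
      using smear_V[OF s] unfolding * by (simp add: right_diff_distrib add.assoc)
  qed (use dim \<beta> N V Z in simp_all)
qed

text \<open>The constants are chosen in the order \<open>A\<close>, \<open>T\<close>,
  \<open>r\<close>, \<open>F\<close>, each from the preceding ones and from \<open>\<beta>\<close>,
  \<open>K0\<close>, \<open>\<rho>\<close>, \<open>k\<close> and the dimension; this is what makes
  \<open>C\<close> uniform in the window. The condition on \<open>J\<close> provides enough room for
  \<open>J\<close> rounds of the moment iteration around every centre in \<open>F\<close>.\<close>

lemma ex_tuple_sum_constant:
  fixes \<beta> K0 \<rho> :: real and k :: nat
  assumes dim: "2 \<le> DIM('a::euclidean_space)" and \<beta>: "0 < \<beta>" and \<rho>: "0 < \<rho>" and k: "1 \<le> k"
  shows "\<exists>C::real. \<forall>V s R N (x::'a) J. gas_window V \<beta> s R K0 N x \<longrightarrow> \<rho> + 3 * real J + 3 \<le> R \<longrightarrow> real N ^ k \<le> 2 ^ J \<longrightarrow>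
    (\<forall>\<psi> \<in> borel_measurable (\<Pi>\<^sub>M j\<in>{..<k}. lborel). (\<forall>z. \<psi> z \<noteq> 0 \<longrightarrow> (\<forall>j<k. z j \<in> ball 0 \<rho>)) \<longrightarrow>
      (\<Sum>\<sigma>\<in>tuples k {..<N}. \<integral>\<^sup>+X. \<psi> (\<lambda>j\<in>{..<k}. (1 / s) *\<^sub>R X (\<sigma> j) - x) \<partial>gibbs_measure V \<beta> N) \<le>
        ennreal C * (\<integral>\<^sup>+z. \<psi> z \<partial>(\<Pi>\<^sub>M j\<in>{..<k}. lborel)))"
proof -
  obtain p where p: "k = Suc p" using k by (cases k) auto
  define c where "c = 1 / (\<integral>v. bump (v::'a) \<partial>lborel)"
  have c: "0 \<le> c" using bump_mass_pos[where 'a='a] by (simp add: c_def)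
  define A where "A = 2 ^ p * exp K0 * c * (2 * measure lborel (ball (0::'a) 3))"
  have A: "0 \<le> A" using c by (simp add: A_def)
  \<comment> \<open>This makes \<open>exp (\<beta> * T) / 2\<close> equal to \<open>A + 1/2\<close>;
    the summand \<open>1\<close> in the logarithm also gives \<open>T >= 0\<close>.\<close>
  define T where "T = ln (2 * A + 1) / \<beta>"
  have T: "0 \<le> T" using A \<beta> by (simp add: T_def)
  have q: "A \<le> exp (\<beta> * T) / 2"
    using A \<beta> by (simp add: T_def)
  obtain r\<^sub>0 where r\<^sub>0: "0 < r\<^sub>0" "r\<^sub>0 \<le> 1" "\<And>y::'a. 0 < norm y \<Longrightarrow> norm y < r\<^sub>0 \<Longrightarrow> T \<le> excess y"
    using excess_large[OF dim, of T] by auto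
  \<comment> \<open>Halved because two points of a ball of radius \<open>r\<close> may be at any
    distance below \<open>2 * r\<close>.\<close>
  define r where "r = r\<^sub>0 / 2"
  have r: "0 < r" "r \<le> 1" using r\<^sub>0 by (simp_all add: r_def)
  have excess: "T \<le> excess y" if "0 < norm y" "norm y < 2 * r" for y :: 'a
    using r\<^sub>0(3)[of y] that by (simp add: r_def)
  obtain F where F: "F \<subseteq> cball (0::'a) (\<rho> + 1)" "finite F" "cball 0 (\<rho> + 1) \<subseteq> (\<Union>c\<in>F. ball c r)"
  proof (rule compactE_image[OF compact_cball, of "cball 0 (\<rho> + 1)" "\<lambda>c. ball c r" "0::'a" "\<rho> + 1"])
    show "cball (0::'a) (\<rho> + 1) \<subseteq> (\<Union>c\<in>cball 0 (\<rho> + 1). ball c r)" using r(1) by force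
  qed auto
  have "(0::'a) \<in> cball 0 (\<rho> + 1)" using \<rho> by simp
  with F(3) have "F \<noteq> {}" by auto
  \<comment> \<open>The factor \<open>3\<close> is the bound \<open>2 + 1\<close> on the moments
    after \<open>J\<close> rounds, when \<open>N ^ k <= 2 ^ J\<close>; the powers of
    \<open>card F\<close> come from covering the ball of radius \<open>\<rho> + 1\<close>.\<close>
  define C where "C = (exp K0 * c) ^ k * (real (card F) ^ k * (real (card F) * 3))"
  show ?thesis
  proof (intro exI[of _ C] allI impI ballI)
    fix V s R N and x :: 'a and J and \<psi> :: "(nat \<Rightarrow> 'a) \<Rightarrow> ennreal"
    assume win: "gas_window V \<beta> s R K0 N x" and J: "\<rho> + 3 * real J + 3 \<le> R" "real N ^ k \<le> 2 ^ J"
      and \<psi>: "\<psi> \<in> borel_measurable (\<Pi>\<^sub>M j\<in>{..<k}. lborel :: 'a measure)" "\<forall>z. \<psi> z \<noteq> 0 \<longrightarrow> (\<forall>j<k. z j \<in> ball 0 \<rho>)"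
    interpret gas_window V \<beta> s R K0 N x by (rule win)
    have mc: "moll_max = c" by (simp add: moll_max_def c_def)
    have "moment k r y \<le> ennreal 3" if "y \<in> F" for y
    proof -
      have "norm y \<le> \<rho> + 1" using that F(1) by auto
      then have "moment (Suc p) r y \<le> ennreal (2 + real N ^ Suc p / 2 ^ J)"
        using q J(1) by (intro moment_iterate[OF r T excess]) (simp_all add: mc A_def)
      also have "\<dots> \<le> ennreal 3"
        using J(2) by (intro ennreal_leI) (simp add: p)
      finally show ?thesis by (simp add: p)
    qed
    then have cnt: "(\<integral>\<^sup>+X. count (ball 0 (\<rho> + 1)) X ^ k \<partial>G) \<le> of_nat (card F) ^ k * (of_nat (card F) * ennreal 3)"
      using F(2) \<open>F \<noteq> {}\<close> by (intro moment_bound_of_cover[where r=r] order_trans[OF ball_subset_cball F(3)]) simp_all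
    have "(\<Sum>\<sigma>\<in>tuples k {..<N}. \<integral>\<^sup>+X. \<psi> (\<lambda>j\<in>{..<k}. Y X (\<sigma> j)) \<partial>G) \<le>
        ennreal (exp K0 * moll_max) ^ k * (\<integral>\<^sup>+z. \<psi> z \<partial>(\<Pi>\<^sub>M j\<in>{..<k}. lborel)) * (\<integral>\<^sup>+X. count (ball 0 (\<rho> + 1)) X ^ k \<partial>G)"
      using \<psi> \<rho> J(1) by (intro tuple_sum_bound) auto
    also have "\<dots> \<le> ennreal (exp K0 * c) ^ k * (\<integral>\<^sup>+z. \<psi> z \<partial>(\<Pi>\<^sub>M j\<in>{..<k}. lborel)) * (of_nat (card F) ^ k * (of_nat (card F) * ennreal 3))"
      unfolding mc by (intro mult_left_mono cnt) simp
    also have "\<dots> = ennreal C * (\<integral>\<^sup>+z. \<psi> z \<partial>(\<Pi>\<^sub>M j\<in>{..<k}. lborel))"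
    proof -
      have "ennreal C = ennreal (exp K0 * c) ^ k * (of_nat (card F) ^ k * (of_nat (card F) * ennreal 3))"
      proof -
        define b where "b = exp K0 * c"
        have "0 \<le> b" using c by (simp add: b_def)
        then show ?thesis
          unfolding C_def b_def[symmetric] by (simp add: ennreal_mult ennreal_power[symmetric] ennreal_of_nat_eq_real_of_nat)
      qed
      then show ?thesis by (simp only: mult_ac)
    qed
    finally show "(\<Sum>\<sigma>\<in>tuples k {..<N}. \<integral>\<^sup>+X. \<psi> (\<lambda>j\<in>{..<k}. (1 / s) *\<^sub>R X (\<sigma> j) - x) \<partial>G) \<le>
        ennreal C * (\<integral>\<^sup>+z. \<psi> z \<partial>(\<Pi>\<^sub>M j\<in>{..<k}. lborel))"
      by (simp only: Y_def)
  qed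
qed

text \<open>The moment iteration gains a factor \<open>2\<close> per unit of distance to the boundary, which beats any
  power of \<open>N\<close> as soon as this distance is a positive power of \<open>N\<close>.\<close>

lemma eventually_ex_iterations:
  fixes a \<rho> :: real
  assumes a: "0 < a"
  shows "\<forall>\<^sub>F N in sequentially. \<exists>J. \<rho> + 3 * real J + 3 \<le> real N powr a \<and> real N ^ k \<le> 2 ^ J"
proof -
  have "\<forall>\<^sub>F N in sequentially. real N powr real k \<le> 2 powr ((real N powr a - \<rho> - 6) / 3)"
    using a by real_asymp
  moreover have "\<forall>\<^sub>F N in sequentially. \<rho> + 3 \<le> real N powr a"
    using a by real_asymp
  ultimately show ?thesis
    using eventually_gt_at_top[of 0]
  proof eventually_elim
    case (elim N)
    \<comment> \<open>Rounding down may lose one round, which accounts for \<open>6\<close> instead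
      of \<open>3\<close> in the exponent above.\<close>
    define J where "J = nat \<lfloor>(real N powr a - \<rho> - 3) / 3\<rfloor>"
    have "0 \<le> (real N powr a - \<rho> - 3) / 3" using elim(2) by simp
    then have J: "real J \<le> (real N powr a - \<rho> - 3) / 3" "(real N powr a - \<rho> - 3) / 3 - 1 \<le> real J"
      unfolding J_def by linarith+
    have "real N ^ k = real N powr real k" using elim(3) by (simp add: powr_realpow)
    also have "\<dots> \<le> 2 powr real J"
      using J(2) by (intro order_trans[OF elim(1)] powr_mono) (simp_all add: field_simps)
    also have "\<dots> = 2 ^ J" by (simp add: powr_realpow)
    finally have "real N ^ k \<le> 2 ^ J" .
    moreover have "\<rho> + 3 * real J + 3 \<le> real N powr a" using J(1) by (simp add: field_simps)
    ultimately show ?case by blast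
  qed
qed

section \<open>Skorohod representation\<close>

text \<open>Two bases occur. The value \<open>q = 1/2\<close> represents all numbers in
  \<open>[0, 1)\<close>, while \<open>q = 1/3\<close> maps bit sequences injectively onto a Cantor
  set.\<close>

definition expansion :: "real \<Rightarrow> (nat \<Rightarrow> bool) \<Rightarrow> real" where
  "expansion q b = (\<Sum>i. of_bool (b i) * q ^ Suc i)"

lemma
  assumes q: "0 < q" "q < 1"
  shows summable_expansion: "summable (\<lambda>i. of_bool (b i) * q ^ Suc i :: real)"
    and expansion_nonneg: "0 \<le> expansion q b"
    and expansion_le: "expansion q b \<le> q / (1 - q)"
proof -
  have g: "(\<lambda>i. q ^ Suc i) sums (q * (1 / (1 - q)))"
    using sums_mult[OF geometric_sums[of q], of q] q by simp
  show s: "summable (\<lambda>i. of_bool (b i) * q ^ Suc i :: real)"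
    by (rule summable_comparison_test'[OF sums_summable[OF g], of 0]) (use q in auto)
  show "0 \<le> expansion q b"
    unfolding expansion_def using q by (intro suminf_nonneg s) auto
  have "expansion q b \<le> (\<Sum>i. q ^ Suc i)"
    unfolding expansion_def using q by (intro suminf_le s sums_summable[OF g]) auto
  then show "expansion q b \<le> q / (1 - q)"
    using sums_unique[OF g] by simp
qed

lemma expansion_Suc:
  assumes q: "0 < q" "q < 1"
  shows "expansion q b = q * (of_bool (b 0) + expansion q (\<lambda>i. b (Suc i)))"
proof -
  have "expansion q b = (\<Sum>i. of_bool (b (Suc i)) * q ^ Suc (Suc i)) + of_bool (b 0) * q"
    unfolding expansion_def using suminf_split_head[OF summable_expansion[OF q, of b]] by simp
  also have "(\<Sum>i. of_bool (b (Suc i)) * q ^ Suc (Suc i)) = q * expansion q (\<lambda>i. b (Suc i))"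
    unfolding expansion_def using suminf_mult[OF summable_expansion[OF q, of "\<lambda>i. b (Suc i)"], of q]
    by (simp add: mult_ac)
  finally show ?thesis by (simp add: algebra_simps)
qed

lemma expansion_prefix:
  assumes q: "0 < q" "q < 1"
  shows "expansion q b = (\<Sum>i<k. of_bool (b i) * q ^ Suc i) + q ^ k * expansion q (\<lambda>i. b (k + i))"
proof (induction k)
  case (Suc k)
  show ?case
    by (subst Suc, subst expansion_Suc[OF q, of "\<lambda>i. b (k + i)"]) (simp add: algebra_simps)
qed simp

lemma expansion_close:
  assumes q: "0 < q" "q < 1" and eq: "\<And>i. i < k \<Longrightarrow> b i = b' i"
  shows "\<bar>expansion q b - expansion q b'\<bar> \<le> q ^ k * (q / (1 - q))"
proof -
  have "(\<Sum>i<k. of_bool (b i) * q ^ Suc i) = (\<Sum>i<k. of_bool (b' i) * q ^ Suc i :: real)"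
    by (rule sum.cong) (auto simp: eq)
  then have "expansion q b - expansion q b' = q ^ k * (expansion q (\<lambda>i. b (k + i)) - expansion q (\<lambda>i. b' (k + i)))"
    using expansion_prefix[OF q, of b k] expansion_prefix[OF q, of b' k] by (simp add: algebra_simps)
  moreover have "\<bar>expansion q (\<lambda>i. b (k + i)) - expansion q (\<lambda>i. b' (k + i))\<bar> \<le> q / (1 - q)"
    using expansion_nonneg[OF q, of "\<lambda>i. b (k + i)"] expansion_nonneg[OF q, of "\<lambda>i. b' (k + i)"]
      expansion_le[OF q, of "\<lambda>i. b (k + i)"] expansion_le[OF q, of "\<lambda>i. b' (k + i)"] by linarith
  then have "q ^ k * \<bar>expansion q (\<lambda>i. b (k + i)) - expansion q (\<lambda>i. b' (k + i))\<bar> \<le> q ^ k * (q / (1 - q))"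
    using q by (intro mult_left_mono) auto
  ultimately show ?thesis
    using q by (simp only: abs_mult abs_of_pos zero_less_power)
qed

lemma expansion_tendsto:
  assumes q: "0 < q" "q < 1" and ev: "\<And>i. \<forall>\<^sub>F n in sequentially. b n i = b' i"
  shows "(\<lambda>n. expansion q (b n)) \<longlonglongrightarrow> expansion q b'"
proof (rule metric_LIMSEQ_I)
  fix e :: real assume e: "0 < e"
  have "(\<lambda>k. q ^ k * (q / (1 - q))) \<longlonglongrightarrow> 0 * (q / (1 - q))"
    using q by (intro tendsto_mult_right LIMSEQ_power_zero) auto
  then have "\<forall>\<^sub>F k in sequentially. q ^ k * (q / (1 - q)) < e"
    using e by (intro order_tendstoD(2)) auto
  then obtain k where k: "q ^ k * (q / (1 - q)) < e"
    by (auto simp: eventually_sequentially)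
  have "\<forall>\<^sub>F n in sequentially. \<forall>i\<in>{..<k}. b n i = b' i"
    by (rule eventually_ball_finite) (auto intro: ev)
  then have "\<forall>\<^sub>F n in sequentially. dist (expansion q (b n)) (expansion q b') < e"
  proof eventually_elim
    case (elim n)
    then show ?case using expansion_close[OF q, of k "b n" b'] k by (auto simp: dist_real_def)
  qed
  then show "\<exists>no. \<forall>n\<ge>no. dist (expansion q (b n)) (expansion q b') < e"
    by (simp add: eventually_sequentially)
qed

section \<open>Digits, and the coding of a sequence of reals by one real\<close>

definition ternary_digit :: "real \<Rightarrow> nat \<Rightarrow> bool" where
  "ternary_digit c i \<longleftrightarrow> \<lfloor>3 ^ Suc i * c\<rfloor> mod 3 = 1"

definition binary_digit :: "real \<Rightarrow> nat \<Rightarrow> bool" where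
  "binary_digit v i \<longleftrightarrow> \<lfloor>2 ^ Suc i * v\<rfloor> mod 2 = 1"

text \<open>All tails of a ternary expansion with digits \<open>0\<close> and \<open>1\<close> are at most \<open>1/2\<close>, so that digits can
  be read off and depend continuously on the number.\<close>

lemma ternary_shift:
  "\<exists>K::int. 3 ^ Suc i * expansion (1/3) b = 3 * of_int K + of_bool (b i) + expansion (1/3) (\<lambda>j. b (Suc i + j))"
proof (induction i)
  case 0
  have "3 ^ Suc 0 * expansion (1/3) b = 3 * of_int 0 + of_bool (b 0) + expansion (1/3) (\<lambda>j. b (Suc 0 + j))"
    by (subst expansion_Suc) auto
  then show ?case by blast
next
  case (Suc i)
  then obtain K :: int where K: "3 ^ Suc i * expansion (1/3) b = 3 * of_int K + of_bool (b i) + expansion (1/3) (\<lambda>j. b (Suc i + j))"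
    by blast
  have "3 ^ Suc (Suc i) * expansion (1/3) b = 3 * (3 ^ Suc i * expansion (1/3) b)" by simp
  also have "\<dots> = 3 * of_int (3 * K + of_bool (b i)) + 3 * expansion (1/3) (\<lambda>j. b (Suc i + j))"
    unfolding K by simp
  also have "3 * expansion (1/3) (\<lambda>j. b (Suc i + j)) = of_bool (b (Suc i)) + expansion (1/3) (\<lambda>j. b (Suc (Suc i) + j))"
    by (subst expansion_Suc) auto
  finally show ?case by (intro exI[of _ "3 * K + of_bool (b i)"]) simp
qed

lemma
  shows ternary_digit_expansion: "ternary_digit (expansion (1/3) b) i = b i"
    and ternary_frac: "3 ^ Suc i * expansion (1/3) b - of_int \<lfloor>3 ^ Suc i * expansion (1/3) b\<rfloor> \<le> 1/2"
proof -
  obtain K :: int where K: "3 ^ Suc i * expansion (1/3) b = 3 * of_int K + of_bool (b i) + expansion (1/3) (\<lambda>j. b (Suc i + j))"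
    using ternary_shift[of i b] by blast
  have t: "0 \<le> expansion (1/3) (\<lambda>j. b (Suc i + j))" "expansion (1/3) (\<lambda>j. b (Suc i + j)) \<le> 1/2"
    using expansion_nonneg[of "1/3" "\<lambda>j. b (Suc i + j)"] expansion_le[of "1/3" "\<lambda>j. b (Suc i + j)"] by auto
  have fl: "\<lfloor>3 ^ Suc i * expansion (1/3) b\<rfloor> = 3 * K + of_bool (b i)"
    unfolding K using t by (intro floor_unique) auto
  show "ternary_digit (expansion (1/3) b) i = b i"
    unfolding ternary_digit_def fl by (cases "b i") auto
  show "3 ^ Suc i * expansion (1/3) b - of_int \<lfloor>3 ^ Suc i * expansion (1/3) b\<rfloor> \<le> 1/2"
    unfolding fl using t by (simp add: K del: power_Suc)
qed

text \<open>Fractional parts of at most \<open>1/2\<close> leave a gap below every integer: numbers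
  of this kind that differ by less than \<open>1/4\<close> have the same floor.\<close>

lemma ternary_digits_stabilize:
  assumes c: "c \<longlonglongrightarrow> l" and frac: "\<And>n i. 3 ^ Suc i * c n - of_int \<lfloor>3 ^ Suc i * c n\<rfloor> \<le> 1/2"
  shows "\<exists>b. \<forall>\<^sub>F n in sequentially. ternary_digit (c n) i = b"
proof -
  have "(\<lambda>n. 3 ^ Suc i * c n) \<longlonglongrightarrow> 3 ^ Suc i * l"
    by (intro tendsto_mult tendsto_const c)
  then have "\<forall>\<^sub>F n in sequentially. dist (3 ^ Suc i * c n) (3 ^ Suc i * l) < 1/8"
    by (rule tendstoD) simp
  then obtain n0 where n0: "\<And>n. n \<ge> n0 \<Longrightarrow> dist (3 ^ Suc i * c n) (3 ^ Suc i * l) < 1/8"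
    by (auto simp: eventually_sequentially)
  have "\<lfloor>3 ^ Suc i * c n\<rfloor> = \<lfloor>3 ^ Suc i * c n0\<rfloor>" if "n \<ge> n0" for n
  proof -
    let ?x = "3 ^ Suc i * c n" and ?y = "3 ^ Suc i * c n0"
    have "\<bar>?x - ?y\<bar> < 1/4"
      using n0[OF that] n0[of n0] unfolding dist_real_def by linarith
    moreover have "?x - of_int \<lfloor>?x\<rfloor> \<le> 1/2" "?y - of_int \<lfloor>?y\<rfloor> \<le> 1/2" by (rule frac)+
    moreover have "of_int \<lfloor>?x\<rfloor> \<le> ?x" "of_int \<lfloor>?y\<rfloor> \<le> ?y" by (rule of_int_floor_le)+
    ultimately have "\<bar>(of_int \<lfloor>?x\<rfloor> :: real) - of_int \<lfloor>?y\<rfloor>\<bar> < 1" by linarith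
    then show ?thesis by linarith
  qed
  then have "\<forall>\<^sub>F n in sequentially. ternary_digit (c n) i = ternary_digit (c n0) i"
    unfolding eventually_sequentially ternary_digit_def by metis
  then show ?thesis by blast
qed

text \<open>The partial sums are the dyadic approximations of \<open>v\<close> from below.\<close>

lemma binary_expansion:
  assumes v: "0 \<le> v" "v < 1"
  shows "expansion (1/2) (binary_digit v) = v"
proof -
  have partial: "(\<Sum>i<k. of_bool (binary_digit v i) * (1/2) ^ Suc i) = (of_int \<lfloor>2 ^ k * v\<rfloor> / 2 ^ k :: real)" for k
  proof (induction k)
    case 0
    have "\<lfloor>v\<rfloor> = 0" using v by (simp add: floor_eq_iff)
    then show ?case by simp
  next
    case (Suc k)
    let ?a = "\<lfloor>2 ^ Suc k * v\<rfloor>"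
    have "\<lfloor>2 ^ k * v\<rfloor> = \<lfloor>2 ^ Suc k * v / of_int 2\<rfloor>" by simp
    also have "\<dots> = ?a div 2" by (rule floor_divide_real_eq_div) simp
    finally have "\<lfloor>2 ^ k * v\<rfloor> = ?a div 2" .
    moreover have "of_bool (binary_digit v k) = (of_int (?a mod 2) :: real)"
    proof -
      have "?a mod 2 = 0 \<or> ?a mod 2 = 1" by presburger
      then show ?thesis unfolding binary_digit_def by auto
    qed
    moreover have "?a = 2 * (?a div 2) + ?a mod 2" by simp
    then have "real_of_int ?a = 2 * of_int (?a div 2) + of_int (?a mod 2)"
      by (metis of_int_add of_int_mult of_int_numeral)
    ultimately show ?case using Suc by (simp add: field_simps)
  qed
  have "(\<lambda>k. \<Sum>i<k. of_bool (binary_digit v i) * (1/2) ^ Suc i :: real) \<longlonglongrightarrow> expansion (1/2) (binary_digit v)"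
    unfolding expansion_def by (rule summable_LIMSEQ) (rule summable_expansion, auto)
  moreover have "(\<lambda>k. of_int \<lfloor>2 ^ k * v\<rfloor> / 2 ^ k) \<longlonglongrightarrow> v"
  proof (rule tendsto_sandwich[of "\<lambda>k. v - (1/2) ^ k" _ _ "\<lambda>_. v"])
    show "\<forall>\<^sub>F k in sequentially. v - (1/2) ^ k \<le> of_int \<lfloor>2 ^ k * v\<rfloor> / 2 ^ k"
    proof (rule always_eventually, rule allI)
      fix k :: nat
      have "2 ^ k * v - 1 \<le> of_int \<lfloor>2 ^ k * v\<rfloor>" by linarith
      then have "(2 ^ k * v - 1) / 2 ^ k \<le> of_int \<lfloor>2 ^ k * v\<rfloor> / 2 ^ k"
        by (rule divide_right_mono) simp
      then show "v - (1/2) ^ k \<le> of_int \<lfloor>2 ^ k * v\<rfloor> / 2 ^ k"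
        by (simp add: diff_divide_distrib power_divide)
    qed
    show "\<forall>\<^sub>F k in sequentially. of_int \<lfloor>2 ^ k * v\<rfloor> / 2 ^ k \<le> v"
    proof (rule always_eventually, rule allI)
      fix k :: nat
      have "of_int \<lfloor>2 ^ k * v\<rfloor> \<le> 2 ^ k * v" by linarith
      then show "of_int \<lfloor>2 ^ k * v\<rfloor> / 2 ^ k \<le> v" by (simp add: field_simps)
    qed
    have "(\<lambda>k. v - (1/2) ^ k) \<longlonglongrightarrow> v - 0"
      by (intro tendsto_diff tendsto_const LIMSEQ_power_zero) simp
    then show "(\<lambda>k. v - (1/2) ^ k) \<longlonglongrightarrow> v" by simp
  qed simp
  ultimately show ?thesis
    unfolding partial by (rule LIMSEQ_unique)
qed

lemma measurable_ternary_digit [measurable]: "Measurable.pred borel (\<lambda>c. ternary_digit c i)"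
  unfolding ternary_digit_def by measurable

lemma measurable_binary_digit [measurable]: "Measurable.pred borel (\<lambda>c. binary_digit c i)"
  unfolding binary_digit_def by measurable

text \<open>Codes countably many reals by one, so that compactness and Skorohod's theorem are needed
  on the real line only. The binary digits are written in base 3 because there they depend
  continuously on the code, which fails in base 2 at dyadic numbers.\<close>

definition encode_reals :: "(nat \<Rightarrow> real) \<Rightarrow> real" where
  "encode_reals u = expansion (1/3) (\<lambda>i. binary_digit (u (fst (prod_decode i))) (snd (prod_decode i)))"

definition decode_real :: "nat \<Rightarrow> real \<Rightarrow> real" where
  "decode_real m c = expansion (1/2) (\<lambda>j. ternary_digit c (prod_encode (m, j)))"

lemma decode_encode:
  assumes "0 \<le> u m" "u m < 1"
  shows "decode_real m (encode_reals u) = u m"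
  unfolding decode_real_def encode_reals_def ternary_digit_expansion using assms by (simp add: binary_expansion)

lemma borel_measurable_decode_real [measurable]: "decode_real m \<in> borel_measurable borel"
  unfolding decode_real_def expansion_def by measurable

lemma borel_measurable_encode_reals [measurable]:
  assumes [measurable]: "\<And>m. (\<lambda>x. u x m) \<in> borel_measurable M"
  shows "(\<lambda>x. encode_reals (u x)) \<in> borel_measurable M"
  unfolding encode_reals_def expansion_def by measurable

text \<open>Each digit of the codes is eventually constant, and an expansion depends continuously on
  its digits. The limit is not identified; its existence is what matters.\<close>

lemma decode_real_convergent:
  assumes c: "c \<longlonglongrightarrow> l" and frac: "\<And>n i. 3 ^ Suc i * c n - of_int \<lfloor>3 ^ Suc i * c n\<rfloor> \<le> 1/2"
  shows "convergent (\<lambda>n. decode_real m (c n))"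
proof -
  obtain b where b: "\<And>i. \<forall>\<^sub>F n in sequentially. ternary_digit (c n) i = b i"
    using ternary_digits_stabilize[OF c frac] by metis
  have "(\<lambda>n. decode_real m (c n)) \<longlonglongrightarrow> expansion (1/2) (\<lambda>j. b (prod_encode (m, j)))"
    unfolding decode_real_def by (rule expansion_tendsto) (auto intro: b)
  then show ?thesis by (auto simp: convergent_def)
qed

text \<open>The sequence \<open>u n\<close> is coded by the single real variable \<open>T n\<close>.
  A subsequence of the laws of the codes converges weakly, Skorohod's theorem realizes it by
  pointwise convergent variables, and decoding these restores the joint laws and keeps the
  convergence.\<close>

lemma skorohod_representation_reals:
  fixes M :: "nat \<Rightarrow> 's measure" and u :: "nat \<Rightarrow> nat \<Rightarrow> 's \<Rightarrow> real"
  assumes M: "\<And>n. prob_space (M n)" and u [measurable]: "\<And>n m. u n m \<in> borel_measurable (M n)"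
    and bounds: "\<And>n m x. 0 \<le> u n m x \<and> u n m x < 1"
  shows "\<exists>r (\<Omega> :: real measure) U. strict_mono (r :: nat \<Rightarrow> nat) \<and> prob_space \<Omega> \<and>
    (\<forall>n m. (U n m :: real \<Rightarrow> real) \<in> borel_measurable \<Omega>) \<and>
    (\<forall>n. distr \<Omega> (\<Pi>\<^sub>M m\<in>UNIV. borel) (\<lambda>\<omega> m. U n m \<omega>) = distr (M (r n)) (\<Pi>\<^sub>M m\<in>UNIV. borel) (\<lambda>x m. u (r n) m x)) \<and>
    (AE \<omega> in \<Omega>. \<forall>m. convergent (\<lambda>n. U n m \<omega>))"
proof -
  define T where "T n x = encode_reals (\<lambda>m. u n m x)" for n x
  have T_meas [measurable]: "T n \<in> borel_measurable (M n)" for n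
    unfolding T_def by measurable
  define \<mu> where "\<mu> n = distr (M n) borel (T n)" for n
  have rd: "real_distribution (\<mu> n)" for n
    unfolding \<mu>_def real_distribution_def real_distribution_axioms_def
    by (auto intro!: prob_space.prob_space_distr M)
  \<comment> \<open>Ternary expansions with digits \<open>0\<close> and \<open>1\<close> lie in
    \<open>[0, 1/2]\<close>, so one bounded interval carries all the laws; this is
    tightness.\<close>
  have "measure (\<mu> n) {-1<..1} = 1" for n
  proof -
    interpret real_distribution "\<mu> n" by (rule rd)
    have "T n x \<in> {-1<..1}" for x
      using expansion_nonneg[of "1/3"] expansion_le[of "1/3"] unfolding T_def encode_reals_def
      by (auto intro: less_le_trans[of "-1" 0] order_trans[of _ "1/2" 1])
    then have "AE x in \<mu> n. x \<in> {-1<..1}"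
      unfolding \<mu>_def by (subst AE_distr_iff) auto
    then show ?thesis by (subst prob_eq_1) auto
  qed
  then have "\<exists>a b::real. a < b \<and> (\<forall>n. measure (\<mu> n) {a<..b} > 1 - \<epsilon>)" if "0 < \<epsilon>" for \<epsilon>
    by (intro exI[where P="\<lambda>a. \<exists>b. a < b \<and> (\<forall>n. measure (\<mu> n) {a<..b} > 1 - \<epsilon>)" and x="-1"] exI[of _ 1])
      (use that in simp)
  then have "tight \<mu>"
    unfolding tight_def using rd by blast
  then obtain r M' where r: "strict_mono (r :: nat \<Rightarrow> nat)" "real_distribution M'" "weak_conv_m (\<mu> \<circ> id \<circ> r) M'"
    using tight_imp_convergent_subsubsequence[of \<mu> id] by (auto simp: strict_mono_def)
  obtain \<Omega> :: "real measure" and Ys :: "nat \<Rightarrow> real \<Rightarrow> real" and Y :: "real \<Rightarrow> real"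
    where sk: "prob_space \<Omega> \<and> (\<forall>n. Ys n \<in> measurable \<Omega> borel) \<and>
      (\<forall>n. distr \<Omega> borel (Ys n) = (\<mu> \<circ> id \<circ> r) n) \<and>
      Y \<in> measurable \<Omega> lborel \<and> distr \<Omega> borel Y = M' \<and> (\<forall>x \<in> space \<Omega>. (\<lambda>n. Ys n x) \<longlonglongrightarrow> Y x)"
    using Skorohod[of "\<mu> \<circ> id \<circ> r" M', OF _ r(2) r(3)] rd by (simp only: comp_def) blast
  have \<Omega>: "prob_space \<Omega>" and Ys [measurable]: "\<And>n. Ys n \<in> measurable \<Omega> borel"
    and law: "\<And>n. distr \<Omega> borel (Ys n) = \<mu> (r n)"
    and lim: "\<And>\<omega>. \<omega> \<in> space \<Omega> \<Longrightarrow> (\<lambda>n. Ys n \<omega>) \<longlonglongrightarrow> Y \<omega>"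
    using sk by auto
  define U where "U n m \<omega> = decode_real m (Ys n \<omega>)" for n m \<omega>
  have U_meas: "U n m \<in> borel_measurable \<Omega>" for n m
    unfolding U_def by measurable
  have dec: "(\<lambda>c m. decode_real m c) \<in> measurable borel (\<Pi>\<^sub>M m\<in>(UNIV::nat set). borel)"
    by (rule measurable_PiM_single') auto
  have "distr \<Omega> (\<Pi>\<^sub>M m\<in>UNIV. borel) (\<lambda>\<omega> m. U n m \<omega>) = distr (M (r n)) (\<Pi>\<^sub>M m\<in>UNIV. borel) (\<lambda>x m. u (r n) m x)" for n
  proof -
    have "distr \<Omega> (\<Pi>\<^sub>M m\<in>UNIV. borel) (\<lambda>\<omega> m. U n m \<omega>) = distr (distr \<Omega> borel (Ys n)) (\<Pi>\<^sub>M m\<in>UNIV. borel) (\<lambda>c m. decode_real m c)"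
      unfolding U_def by (subst distr_distr[OF dec]) (auto simp: comp_def)
    also have "\<dots> = distr (M (r n)) (\<Pi>\<^sub>M m\<in>UNIV. borel) ((\<lambda>c m. decode_real m c) \<circ> T (r n))"
      unfolding law \<mu>_def by (rule distr_distr[OF dec T_meas])
    also have "(\<lambda>c m. decode_real m c) \<circ> T (r n) = (\<lambda>x m. u (r n) m x)"
      using bounds by (auto simp: T_def decode_encode fun_eq_iff)
    finally show ?thesis .
  qed
  moreover have "AE \<omega> in \<Omega>. \<forall>m. convergent (\<lambda>n. U n m \<omega>)"
  proof -
    \<comment> \<open>The gap condition on fractional parts. The variables on
      \<open>\<Omega>\<close> share only the laws of the codes, so they satisfy it almost
      surely.\<close>
    let ?P = "\<lambda>c::real. \<forall>i. 3 ^ Suc i * c - of_int \<lfloor>3 ^ Suc i * c\<rfloor> \<le> 1/2"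
    have P_meas: "{c \<in> space borel. ?P c} \<in> sets borel" by measurable
    have "AE \<omega> in \<Omega>. ?P (Ys n \<omega>)" for n
    proof -
      have "AE c in \<mu> (r n). ?P c"
        unfolding \<mu>_def AE_distr_iff[OF T_meas P_meas] T_def encode_reals_def by (intro AE_I2 allI ternary_frac)
      then show ?thesis
        unfolding law[symmetric] AE_distr_iff[OF Ys P_meas] .
    qed
    then have "AE \<omega> in \<Omega>. \<forall>n. ?P (Ys n \<omega>)"
      by (subst AE_all_countable) auto
    then show ?thesis
    proof (rule AE_mp, intro AE_I2 impI allI)
      fix \<omega> m assume "\<omega> \<in> space \<Omega>" "\<forall>n. ?P (Ys n \<omega>)"
      then show "convergent (\<lambda>n. U n m \<omega>)"
        unfolding U_def by (intro decode_real_convergent[OF lim]) auto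
    qed
  qed
  ultimately show ?thesis
    using r(1) \<Omega> U_meas by blast
qed

text \<open>Combines the theorems of Prokhorov and Skorohod: on a countable product of bounded sets, tightness
  is automatic.\<close>

lemma skorohod_representation:
  fixes M :: "nat \<Rightarrow> 's measure" and w :: "nat \<Rightarrow> 'i::countable \<Rightarrow> 's \<Rightarrow> 'b::euclidean_space"
  assumes M: "\<And>n. prob_space (M n)" and w [measurable]: "\<And>n i. w n i \<in> borel_measurable (M n)"
    and bound: "\<And>n i x. norm (w n i x) \<le> B i"
  shows "\<exists>r (\<Omega> :: real measure) W. strict_mono (r :: nat \<Rightarrow> nat) \<and> prob_space \<Omega> \<and>
    (\<forall>n i. (W n i :: real \<Rightarrow> 'b) \<in> borel_measurable \<Omega>) \<and>
    (\<forall>n. distr \<Omega> (\<Pi>\<^sub>M i\<in>UNIV. borel) (\<lambda>\<omega> i. W n i \<omega>) = distr (M (r n)) (\<Pi>\<^sub>M i\<in>UNIV. borel) (\<lambda>x i. w (r n) i x)) \<and>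
    (AE \<omega> in \<Omega>. \<forall>i. convergent (\<lambda>n. W n i \<omega>))"
proof -
  define e where "e = from_nat_into (Basis :: 'b set)"
  define idx where "idx = to_nat_on (Basis :: 'b set)"
  have e_idx: "e (idx b) = b" if "b \<in> Basis" for b
    unfolding e_def idx_def using that by (simp add: countable_finite)
  \<comment> \<open>Dividing by \<open>D i\<close> and adding \<open>1/2\<close> brings the
    coordinates into \<open>[1/4, 3/4]\<close>, hence into \<open>[0, 1)\<close>, where the binary
    coding is exact.\<close>
  define D where "D i = 4 * (\<bar>B i\<bar> + 1)" for i
  have D: "0 < D i" for i by (simp add: D_def)
  define f where "f i b v = (v \<bullet> b) / D i + 1/2" for i and b v :: 'b
  \<comment> \<open>The index \<open>m\<close> stands for an element of the index type together with
    a number of a basis vector; where that number does not name a basis vector the value is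
    \<open>0\<close>. The map \<open>\<Psi>\<close> below undoes the rescaling and reassembles the
    vectors.\<close>
  define u where "u n m x = (if e (snd (prod_decode m)) \<in> Basis
      then f (from_nat (fst (prod_decode m))) (e (snd (prod_decode m))) (w n (from_nat (fst (prod_decode m))) x) else 0)"
    for n m x
  define \<Psi> where "\<Psi> v i = (\<Sum>b\<in>Basis. (D i * (v (prod_encode (to_nat i, idx b)) - 1/2)) *\<^sub>R b)"
    for v :: "nat \<Rightarrow> real" and i :: 'i
  have \<Psi>u: "\<Psi> (\<lambda>m. u n m x) i = w n i x" for n x i
  proof -
    have "\<Psi> (\<lambda>m. u n m x) i = (\<Sum>b\<in>Basis. (w n i x \<bullet> b) *\<^sub>R b)"
      unfolding \<Psi>_def by (rule sum.cong) (use D[of i] in \<open>auto simp: u_def f_def e_idx\<close>)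
    then show ?thesis by (simp add: euclidean_representation)
  qed
  have u_meas [measurable]: "u n m \<in> borel_measurable (M n)" for n m
    unfolding u_def f_def by measurable
  have u_bounds: "0 \<le> u n m x \<and> u n m x < 1" for n m x
  proof (cases "e (snd (prod_decode m)) \<in> Basis")
    case True
    let ?i = "from_nat (fst (prod_decode m)) :: 'i" and ?b = "e (snd (prod_decode m)) :: 'b"
    have "\<bar>w n ?i x \<bullet> ?b\<bar> \<le> norm (w n ?i x)" using True by (rule Basis_le_norm)
    also have "\<dots> \<le> B ?i" by (rule bound)
    also have "\<dots> \<le> D ?i * (1/4)" by (simp add: D_def)
    finally have "\<bar>(w n ?i x \<bullet> ?b) / D ?i\<bar> \<le> 1/4"
      using D[of ?i] by (simp add: abs_divide divide_le_eq mult.commute)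
    then have "- (1/4) \<le> (w n ?i x \<bullet> ?b) / D ?i \<and> (w n ?i x \<bullet> ?b) / D ?i \<le> 1/4"
      by linarith
    then show ?thesis
      unfolding u_def f_def if_P[OF True] by (intro conjI) linarith+
  qed (simp add: u_def)
  obtain r and \<Omega> :: "real measure" and U where r: "strict_mono (r :: nat \<Rightarrow> nat)" and \<Omega>: "prob_space \<Omega>"
    and U [measurable]: "\<And>n m. (U n m :: real \<Rightarrow> real) \<in> borel_measurable \<Omega>"
    and law: "\<And>n. distr \<Omega> (\<Pi>\<^sub>M m\<in>UNIV. borel) (\<lambda>\<omega> m. U n m \<omega>) = distr (M (r n)) (\<Pi>\<^sub>M m\<in>UNIV. borel) (\<lambda>x m. u (r n) m x)"
    and conv: "AE \<omega> in \<Omega>. \<forall>m. convergent (\<lambda>n. U n m \<omega>)"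
    using skorohod_representation_reals[of M u, OF M u_meas u_bounds] by blast
  define W where "W n i \<omega> = \<Psi> (\<lambda>m. U n m \<omega>) i" for n i \<omega>
  have \<Psi>_meas: "(\<lambda>v. \<Psi> v) \<in> measurable (\<Pi>\<^sub>M m\<in>UNIV. borel) (\<Pi>\<^sub>M i\<in>UNIV. borel)"
    by (rule measurable_PiM_single') (auto simp: \<Psi>_def)
  have W_meas: "W n i \<in> borel_measurable \<Omega>" for n i
    unfolding W_def \<Psi>_def by measurable
  have U_PiM: "(\<lambda>\<omega> m. U n m \<omega>) \<in> measurable \<Omega> (\<Pi>\<^sub>M m\<in>UNIV. borel)" for n
    by (rule measurable_PiM_single') auto
  have u_PiM: "(\<lambda>x m. u n m x) \<in> measurable (M n) (\<Pi>\<^sub>M m\<in>UNIV. borel)" for n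
    by (rule measurable_PiM_single') auto
  have "distr \<Omega> (\<Pi>\<^sub>M i\<in>UNIV. borel) (\<lambda>\<omega> i. W n i \<omega>) = distr (M (r n)) (\<Pi>\<^sub>M i\<in>UNIV. borel) (\<lambda>x i. w (r n) i x)" for n
  proof -
    have "distr \<Omega> (\<Pi>\<^sub>M i\<in>UNIV. borel) (\<lambda>\<omega> i. W n i \<omega>) = distr (distr \<Omega> (\<Pi>\<^sub>M m\<in>UNIV. borel) (\<lambda>\<omega> m. U n m \<omega>)) (\<Pi>\<^sub>M i\<in>UNIV. borel) \<Psi>"
      by (subst distr_distr[OF \<Psi>_meas U_PiM]) (simp add: W_def comp_def)
    also have "\<dots> = distr (M (r n)) (\<Pi>\<^sub>M i\<in>UNIV. borel) (\<lambda>x i. w (r n) i x)"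
    proof -
      have "\<Psi> (\<lambda>m. u (r n) m x) = (\<lambda>i. w (r n) i x)" for x
        by (rule ext) (rule \<Psi>u)
      then show ?thesis
        unfolding law by (subst distr_distr[OF \<Psi>_meas u_PiM]) (simp add: comp_def)
    qed
    finally show ?thesis .
  qed
  moreover have "AE \<omega> in \<Omega>. \<forall>i. convergent (\<lambda>n. W n i \<omega>)"
    using conv
  proof eventually_elim
    case (elim \<omega>)
    then obtain l where l: "\<And>m. (\<lambda>n. U n m \<omega>) \<longlonglongrightarrow> l m"
      unfolding convergent_def by metis
    show ?case
    proof
      fix i
      have "(\<lambda>n. W n i \<omega>) \<longlonglongrightarrow> \<Psi> l i"
        unfolding W_def \<Psi>_def by (intro tendsto_intros l)
      then show "convergent (\<lambda>n. W n i \<omega>)" by (auto simp: convergent_def)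
    qed
  qed
  ultimately show ?thesis using r \<Omega> W_meas by blast
qed

section \<open>The space of configurations\<close>

lemma emeasure_distr_count_space:
  fixes p :: "'i \<Rightarrow> 'a::euclidean_space"
  assumes S: "countable S" and fin: "\<And>x. finite {i\<in>S. p i = x}" and A: "A \<in> sets borel"
  shows "emeasure (distr (count_space S) borel p) A =
    (\<integral>\<^sup>+x. of_nat (card {i\<in>S. p i = x}) * indicator A x \<partial>count_space UNIV)"
proof -
  let ?I = "p ` S \<inter> A"
  have "emeasure (distr (count_space S) borel p) A = emeasure (count_space S) (p -` A \<inter> S)"
    using A by (subst emeasure_distr) auto
  also have "p -` A \<inter> S = (\<Union>x\<in>?I. {i\<in>S. p i = x})" by auto
  also have "emeasure (count_space S) \<dots> = (\<integral>\<^sup>+x. emeasure (count_space S) {i\<in>S. p i = x} \<partial>count_space ?I)"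
    using S by (intro emeasure_UN_countable) (auto simp: disjoint_family_on_def)
  also have "\<dots> = (\<integral>\<^sup>+x. of_nat (card {i\<in>S. p i = x}) \<partial>count_space ?I)"
    using fin by (intro nn_integral_cong) (auto simp: emeasure_count_space)
  also have "\<dots> = (\<integral>\<^sup>+x. of_nat (card {i\<in>S. p i = x}) * indicator ?I x \<partial>count_space UNIV)"
    by (rule nn_integral_count_space_indicator) simp
  also have "\<dots> = (\<integral>\<^sup>+x. of_nat (card {i\<in>S. p i = x}) * indicator A x \<partial>count_space UNIV)"
  proof (rule nn_integral_cong)
    fix x
    show "of_nat (card {i\<in>S. p i = x}) * indicator ?I x = (of_nat (card {i\<in>S. p i = x}) * indicator A x :: ennreal)"
    proof (cases "x \<in> p ` S")
      case False
      then have *: "{i\<in>S. p i = x} = {}" by auto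
      show ?thesis unfolding * by simp
    qed (auto simp: indicator_def)
  qed
  finally show ?thesis .
qed

text \<open>The analogue of \<open>configuration_of\<close> for an arbitrary index set. It is
  meaningful if the set is countable and each compact set contains only finitely many of the points,
  which \<open>Rep_points_configuration\<close> requires.\<close>

definition points_configuration :: "'i set \<Rightarrow> ('i \<Rightarrow> 'a) \<Rightarrow> 'a::euclidean_space configuration" where
  "points_configuration S p = Abs_configuration (distr (count_space S) borel p)"

lemma Rep_points_configuration:
  fixes p :: "'i \<Rightarrow> 'a::euclidean_space"
  assumes S: "countable S" and fin: "\<And>K. compact K \<Longrightarrow> finite {i\<in>S. p i \<in> K}"
  shows "Rep_configuration (points_configuration S p) = distr (count_space S) borel p"
proof -
  have fin1: "finite {i\<in>S. p i = x}" for x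
    using fin[of "{x}"] by simp
  have "emeasure (distr (count_space S) borel p) K < \<infinity>" if "compact K" for K
  proof -
    have "emeasure (distr (count_space S) borel p) K = emeasure (count_space S) (p -` K \<inter> S)"
      using that by (subst emeasure_distr) (auto simp: borel_compact)
    also have "p -` K \<inter> S = {i\<in>S. p i \<in> K}" by auto
    finally show ?thesis
      using fin[OF that] by (simp add: emeasure_count_space of_nat_less_top)
  qed
  then show ?thesis
    unfolding points_configuration_def
    using emeasure_distr_count_space[OF S fin1] by (subst Abs_configuration_inverse) (auto intro!: exI)
qed

lemma configuration_of_eq: "configuration_of N p = points_configuration {..<N} p"
  by (simp add: configuration_of_def points_configuration_def)

lemma sets_Rep_configuration [simp, measurable_cong]: "sets (Rep_configuration \<xi>) = sets borel"
  and emeasure_Rep_compact: "compact K \<Longrightarrow> emeasure (Rep_configuration \<xi>) K < \<infinity>"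
  and ex_multiplicity: "\<exists>m :: 'a::euclidean_space \<Rightarrow> nat. \<forall>A\<in>sets borel.
         emeasure (Rep_configuration \<xi>) A = (\<integral>\<^sup>+x. of_nat (m x) * indicator A x \<partial>count_space UNIV)"
  using Rep_configuration[of \<xi>] by auto

lemma space_Rep_configuration [simp]: "space (Rep_configuration \<xi>) = UNIV"
  using sets_eq_imp_space_eq[OF sets_Rep_configuration[of \<xi>]] by simp

lemma emeasure_Rep_bounded: "emeasure (Rep_configuration \<xi>) (A \<inter> ball 0 R) < \<infinity>"
proof -
  have "emeasure (Rep_configuration \<xi>) (A \<inter> ball 0 R) \<le> emeasure (Rep_configuration \<xi>) (cball 0 R)"
    by (intro emeasure_mono) (auto simp: borel_compact)
  also have "\<dots> < \<infinity>" by (intro emeasure_Rep_compact) simp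
  finally show ?thesis .
qed

text \<open>The multiplicities in the definition of the type are recovered as the masses of
  singletons, and integrals against a configuration become weighted sums.\<close>

lemma Rep_configuration_atoms:
  fixes \<xi> :: "'a::euclidean_space configuration"
  obtains m :: "'a \<Rightarrow> nat" where "\<And>x. emeasure (Rep_configuration \<xi>) {x} = of_nat (m x)"
    "\<And>f. f \<in> borel_measurable borel \<Longrightarrow>
      (\<integral>\<^sup>+x. f x \<partial>Rep_configuration \<xi>) = (\<integral>\<^sup>+x. of_nat (m x) * f x \<partial>count_space UNIV)"
proof -
  obtain m :: "'a \<Rightarrow> nat" where m: "\<And>A. A \<in> sets borel \<Longrightarrow>
      emeasure (Rep_configuration \<xi>) A = (\<integral>\<^sup>+x. of_nat (m x) * indicator A x \<partial>count_space UNIV)"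
    using ex_multiplicity[of \<xi>] by blast
  have "emeasure (Rep_configuration \<xi>) {x} = of_nat (m x)" for x
  proof -
    have "emeasure (Rep_configuration \<xi>) {x} = (\<integral>\<^sup>+y. of_nat (m y) * indicator {x} y \<partial>count_space UNIV)"
      by (rule m) simp
    also have "\<dots> = (\<Sum>y\<in>{x}. of_nat (m y) * indicator {x} y)"
      by (rule nn_integral_count_space') auto
    finally show ?thesis by simp
  qed
  moreover have "(\<integral>\<^sup>+x. f x \<partial>Rep_configuration \<xi>) = (\<integral>\<^sup>+x. of_nat (m x) * f x \<partial>count_space UNIV)"
    if f: "f \<in> borel_measurable borel" for f
  proof -
    have "Rep_configuration \<xi> = distr (density (count_space UNIV) (\<lambda>x. of_nat (m x))) borel (\<lambda>x. x)"
    proof (rule measure_eqI)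
      fix A assume "A \<in> sets (Rep_configuration \<xi>)"
      then have A: "A \<in> sets borel" by simp
      have "emeasure (distr (density (count_space UNIV) (\<lambda>x. of_nat (m x))) borel (\<lambda>x. x)) A =
          emeasure (density (count_space UNIV) (\<lambda>x. of_nat (m x))) A"
        using A by (subst emeasure_distr) auto
      also have "\<dots> = (\<integral>\<^sup>+x. of_nat (m x) * indicator A x \<partial>count_space UNIV)"
        by (subst emeasure_density) auto
      finally show "emeasure (Rep_configuration \<xi>) A =
          emeasure (distr (density (count_space UNIV) (\<lambda>x. of_nat (m x))) borel (\<lambda>x. x)) A"
        using m[OF A] by simp
    qed simp
    then have "(\<integral>\<^sup>+x. f x \<partial>Rep_configuration \<xi>) = (\<integral>\<^sup>+x. f x \<partial>distr (density (count_space UNIV) (\<lambda>x. of_nat (m x))) borel (\<lambda>x. x))"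
      by simp
    also have "\<dots> = (\<integral>\<^sup>+x. f x \<partial>density (count_space UNIV) (\<lambda>x. of_nat (m x)))"
      using f by (subst nn_integral_distr) auto
    also have "\<dots> = (\<integral>\<^sup>+x. of_nat (m x) * f x \<partial>count_space UNIV)"
      by (subst nn_integral_density) auto
    finally show ?thesis .
  qed
  ultimately show ?thesis by (rule that)
qed

lemma nn_integral_Rep_configuration:
  fixes \<xi> :: "'a::euclidean_space configuration"
  assumes "f \<in> borel_measurable borel"
  shows "(\<integral>\<^sup>+x. f x \<partial>Rep_configuration \<xi>) = (\<integral>\<^sup>+x. emeasure (Rep_configuration \<xi>) {x} * f x \<partial>count_space UNIV)"
proof (rule Rep_configuration_atoms[of \<xi>])
  fix m :: "'a \<Rightarrow> nat"
  assume m: "\<And>x. emeasure (Rep_configuration \<xi>) {x} = of_nat (m x)"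
    and int: "\<And>f. f \<in> borel_measurable borel \<Longrightarrow>
      (\<integral>\<^sup>+x. f x \<partial>Rep_configuration \<xi>) = (\<integral>\<^sup>+x. of_nat (m x) * f x \<partial>count_space UNIV)"
  show ?thesis unfolding int[OF assms] m ..
qed

lemma integral_points_configuration:
  fixes f :: "'a::euclidean_space \<Rightarrow> real"
  assumes S: "countable S" and fin: "\<And>K. compact K \<Longrightarrow> finite {i\<in>S. p i \<in> K}"
    and f: "f \<in> borel_measurable borel" and T: "finite T" "T \<subseteq> S" "\<And>i. i \<in> S - T \<Longrightarrow> f (p i) = 0"
  shows "(\<integral>x. f x \<partial>Rep_configuration (points_configuration S p)) = (\<Sum>i\<in>T. f (p i))"
proof -
  have sub: "{i\<in>S. f (p i) \<noteq> 0} \<subseteq> T" using T by auto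
  have "(\<integral>x. f x \<partial>Rep_configuration (points_configuration S p)) = (\<integral>i. f (p i) \<partial>count_space S)"
  proof -
    have rep: "Rep_configuration (points_configuration S p) = distr (count_space S) borel p"
      by (rule Rep_points_configuration[OF S]) (rule fin)
    show ?thesis
      unfolding rep using f by (subst integral_distr) auto
  qed
  also have "\<dots> = (\<Sum>i | i \<in> S \<and> f (p i) \<noteq> 0. f (p i))"
    using finite_subset[OF sub T(1)] by (intro lebesgue_integral_count_space_finite_support) auto
  also have "\<dots> = (\<Sum>i\<in>T. f (p i))"
    using T sub by (intro sum.mono_neutral_left) auto
  finally show ?thesis .
qed

definition test_function :: "('a::euclidean_space \<Rightarrow> real) \<Rightarrow> bool" where
  "test_function f \<longleftrightarrow> continuous_on UNIV f \<and> (\<exists>K. compact K \<and> (\<forall>x. x \<notin> K \<longrightarrow> f x = 0))"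

text \<open>The vague topology is generated by preimages of open sets under the integrals of test
  functions, and continuity can be checked on generators.\<close>

lemma continuous_on_into_configuration:
  fixes g :: "'b::topological_space \<Rightarrow> 'a::euclidean_space configuration"
  assumes "\<And>f. test_function f \<Longrightarrow> continuous_on D (\<lambda>u. \<integral>x. f x \<partial>Rep_configuration (g u))"
  shows "continuous_on D g"
proof (rule continuous_on_generate_topology[OF open_configuration_def])
  fix B :: "'a configuration set"
  assume "B \<in> {{\<xi>. (\<integral>x. f x \<partial>Rep_configuration \<xi>) \<in> U} | (f :: 'a \<Rightarrow> real) U.
          continuous_on UNIV f \<and> (\<exists>K. compact K \<and> (\<forall>x. x \<notin> K \<longrightarrow> f x = 0)) \<and> open U}"
  then obtain f U where f: "test_function f" "open U" and B: "B = {\<xi>. (\<integral>x. f x \<partial>Rep_configuration \<xi>) \<in> U}"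
    by (auto simp: test_function_def)
  have "\<exists>A. open A \<and> A \<inter> D = (\<lambda>u. \<integral>x. f x \<partial>Rep_configuration (g u)) -` U \<inter> D"
    using assms[OF f(1)] f(2) by (simp add: continuous_on_open_invariant)
  then show "\<exists>C. open C \<and> C \<inter> D = g -` B \<inter> D"
    unfolding B by (simp add: vimage_def)
qed

lemma continuous_on_integral_configuration:
  assumes f: "test_function f"
  shows "continuous_on UNIV (\<lambda>\<xi>. \<integral>x. f x \<partial>Rep_configuration \<xi>)"
proof -
  have "open {\<xi>. (\<integral>x. f x \<partial>Rep_configuration \<xi>) \<in> U}" if "open U" for U :: "real set"
    unfolding open_configuration_def
    by (rule generate_topology.Basis) (use f that in \<open>auto simp: test_function_def\<close>)
  then show ?thesis
    by (subst continuous_on_open_vimage) (auto simp: vimage_def)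
qed

section \<open>Measurability of masses and integrals in the configuration\<close>

lemma measurable_emeasure_open:
  fixes A :: "'a::euclidean_space set"
  assumes A: "open A" "bounded A"
  shows "(\<lambda>\<xi>. emeasure (Rep_configuration \<xi>) A) \<in> borel_measurable borel"
proof -
  \<comment> \<open>These functions vanish outside \<open>A\<close> and increase to its indicator.
    Hence the mass of \<open>A\<close> is a countable supremum of integrals of test functions, which
    are continuous in the configuration.\<close>
  define f where "f n x = min 1 (real n * infdist x (- A))" for n and x :: 'a
  have ne: "- A \<noteq> {}" using A(2) not_bounded_UNIV by (metis Compl_empty_eq double_complement)
  have cl: "closed (- A)" using A(1) by (rule closed_Compl)
  have f_cont: "continuous_on UNIV (f n)" for n
    unfolding f_def by (intro continuous_intros)
  have f0: "f n x = 0" if "x \<notin> A" for n x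
    using that by (simp add: f_def)
  have f_test: "test_function (f n)" for n
    unfolding test_function_def
  proof (intro conjI exI allI impI)
    show "compact (closure A)" using A(2) by (simp add: compact_closure)
    show "f n x = 0" if "x \<notin> closure A" for x
      using that closure_subset by (intro f0) auto
  qed (rule f_cont)
  have f_nonneg: "0 \<le> f n x" for n x by (simp add: f_def infdist_nonneg)
  have f_mono: "mono (\<lambda>n. f n x)" for x
    unfolding f_def by (intro monoI min.mono mult_right_mono infdist_nonneg) auto
  have f_sup: "(SUP n. ennreal (f n x)) = indicator A x" for x
  proof (cases "x \<in> A")
    case True
    then have "0 < infdist x (- A)"
      using in_closed_iff_infdist_zero[OF cl ne, of x] infdist_nonneg[of x "- A"] by auto
    then obtain n where "1 < real n * infdist x (- A)"
      using reals_Archimedean3 by blast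
    then have "f n x = 1" by (simp add: f_def)
    have "(SUP n. ennreal (f n x)) = 1"
    proof (rule antisym)
      show "(SUP n. ennreal (f n x)) \<le> 1"
        by (intro SUP_least) (simp add: f_def)
      show "1 \<le> (SUP n. ennreal (f n x))"
        using \<open>f n x = 1\<close> by (intro SUP_upper2[of n]) auto
    qed
    then show ?thesis using True by simp
  next
    case False
    then show ?thesis by (simp add: f0)
  qed
  have "emeasure (Rep_configuration \<xi>) A = (SUP n. ennreal (\<integral>x. f n x \<partial>Rep_configuration \<xi>))" for \<xi>
  proof -
    have fm [measurable]: "f n \<in> borel_measurable borel" for n
      by (rule borel_measurable_continuous_onI[OF f_cont])
    have A': "A \<in> sets borel" using A(1) by simp
    have fin: "emeasure (Rep_configuration \<xi>) A < \<infinity>"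
    proof -
      obtain R where "A \<subseteq> ball 0 R" using A(2) bounded_subset_ballD[OF A(2), of 0] by auto
      then have "A = A \<inter> ball 0 R" by auto
      then show ?thesis using emeasure_Rep_bounded[of \<xi> A R] by simp
    qed
    have "emeasure (Rep_configuration \<xi>) A = (\<integral>\<^sup>+x. indicator A x \<partial>Rep_configuration \<xi>)"
      using A' by simp
    also have "\<dots> = (\<integral>\<^sup>+x. (SUP n. ennreal (f n x)) \<partial>Rep_configuration \<xi>)"
      by (simp only: f_sup)
    also have "\<dots> = (SUP n. \<integral>\<^sup>+x. ennreal (f n x) \<partial>Rep_configuration \<xi>)"
      by (intro nn_integral_monotone_convergence_SUP)
        (use f_mono in \<open>auto simp: incseq_def le_fun_def mono_def intro: ennreal_leI\<close>)
    also have "\<dots> = (SUP n. ennreal (\<integral>x. f n x \<partial>Rep_configuration \<xi>))"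
    proof (intro SUP_cong refl nn_integral_eq_integral)
      fix n
      show "integrable (Rep_configuration \<xi>) (f n)"
      proof (rule Bochner_Integration.integrable_bound[of _ "indicator A :: 'a \<Rightarrow> real"])
        show "integrable (Rep_configuration \<xi>) (indicator A :: 'a \<Rightarrow> real)"
          using fin A' by (intro integrable_real_indicator) auto
        show "AE x in Rep_configuration \<xi>. norm (f n x) \<le> norm (indicator A x :: real)"
          using f_nonneg f0 by (intro AE_I2) (auto simp: indicator_def f_def)
      qed simp
    qed (auto intro: f_nonneg)
    finally show ?thesis .
  qed
  moreover have "(\<lambda>\<xi>. \<integral>x. f n x \<partial>Rep_configuration \<xi>) \<in> borel_measurable borel" for n
    by (intro borel_measurable_continuous_onI continuous_on_integral_configuration f_test)
  ultimately show ?thesis by simp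
qed

lemma SUP_emeasure_balls:
  fixes A :: "'a::euclidean_space set"
  assumes M: "sets M = sets borel" and A: "A \<in> sets borel"
  shows "emeasure M A = (SUP n. emeasure M (A \<inter> ball 0 (real n)))"
proof -
  have "(SUP n. emeasure M (A \<inter> ball 0 (real n))) = emeasure M (\<Union>n. A \<inter> ball 0 (real n))"
    using M A by (intro SUP_emeasure_incseq) (auto simp: incseq_def subset_eq)
  also have "(\<Union>n. A \<inter> ball 0 (real n)) = A"
    using reals_Archimedean2 by (auto simp: dist_norm)
  finally show ?thesis by simp
qed

text \<open>A Dynkin argument from the open sets. The intersection with a ball keeps all masses
  finite, so that complements can be treated by subtraction.\<close>

lemma measurable_emeasure_ball:
  fixes A :: "'a::euclidean_space set"
  assumes A: "A \<in> sets borel"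
  shows "(\<lambda>\<xi>. emeasure (Rep_configuration \<xi>) (A \<inter> ball 0 R)) \<in> borel_measurable borel"
proof -
  have "Int_stable {S :: 'a set. open S}" by (auto simp: Int_stable_def)
  moreover have "{S :: 'a set. open S} \<subseteq> Pow UNIV" by simp
  moreover have "A \<in> sigma_sets UNIV {S :: 'a set. open S}"
    using A by (simp add: borel_def)
  ultimately show ?thesis
  proof (induction rule: sigma_sets_induct_disjoint)
    case (basic A)
    then show ?case by (intro measurable_emeasure_open) (auto intro: bounded_subset[OF bounded_ball])
  next
    case empty
    then show ?case by simp
  next
    case (compl A)
    then have A: "A \<in> sets borel" by (simp add: borel_def)
    have eq: "emeasure (Rep_configuration \<xi>) ((UNIV - A) \<inter> ball 0 R) =
        emeasure (Rep_configuration \<xi>) (ball 0 R) - emeasure (Rep_configuration \<xi>) (A \<inter> ball 0 R)" for \<xi>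
    proof -
      have "(UNIV - A) \<inter> ball 0 R = ball 0 R - A \<inter> ball 0 R" by auto
      then show ?thesis
        using A emeasure_Rep_bounded[of \<xi> A R] by (simp add: emeasure_Diff less_top)
    qed
    have "(\<lambda>\<xi>. emeasure (Rep_configuration \<xi>) (ball 0 R)) \<in> borel_measurable borel"
      by (intro measurable_emeasure_open) auto
    then show ?case unfolding eq using compl(2) by measurable
  next
    case (union A)
    have A: "A i \<in> sets borel" for i
    proof -
      have "A i \<in> sigma_sets UNIV {S :: 'a set. open S}" using union(2) by blast
      then show ?thesis by (simp add: borel_def)
    qed
    have "emeasure (Rep_configuration \<xi>) (\<Union>(range A) \<inter> ball 0 R) = (\<Sum>i. emeasure (Rep_configuration \<xi>) (A i \<inter> ball 0 R))" for \<xi>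
    proof -
      have "\<Union>(range A) \<inter> ball 0 R = (\<Union>i. A i \<inter> ball 0 R)" by auto
      then show ?thesis
        using A union(1) by (subst suminf_emeasure) (auto simp: disjoint_family_on_def)
    qed
    then show ?case using union(3) by simp
  qed
qed

lemma measurable_emeasure_configuration:
  fixes A :: "'a::euclidean_space set"
  assumes A: "A \<in> sets borel"
  shows "(\<lambda>\<xi>. emeasure (Rep_configuration \<xi>) A) \<in> borel_measurable borel"
  by (subst SUP_emeasure_balls[OF sets_Rep_configuration A])
    (intro borel_measurable_SUP measurable_emeasure_ball A, simp)

text \<open>A configuration depending measurably on \<open>w\<close> is a kernel: the same Dynkin
  argument, now starting from rectangles, again with a ball to keep the masses finite.\<close>

lemma measurable_emeasure_section:
  fixes g :: "'n \<Rightarrow> 'a::euclidean_space configuration"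
  assumes g: "g \<in> measurable N borel" and Q: "Q \<in> sets (N \<Otimes>\<^sub>M borel)"
  shows "(\<lambda>w. emeasure (Rep_configuration (g w)) (Pair w -` Q \<inter> ball 0 R)) \<in> borel_measurable N"
proof -
  let ?G = "{a \<times> b | a b. a \<in> sets N \<and> b \<in> sets (borel :: 'a measure)}"
  have sec: "Pair w -` Q \<in> sets borel" if "Q \<in> sets (N \<Otimes>\<^sub>M borel)" for Q :: "('n \<times> 'a) set" and w
    using that by (rule sets_Pair1)
  have sig: "sigma_sets (space N \<times> space (borel :: 'a measure)) ?G = sets (N \<Otimes>\<^sub>M borel)"
    by (rule sets_pair_measure[symmetric])
  have "Int_stable ?G" by (rule Int_stable_pair_measure_generator)
  moreover have "?G \<subseteq> Pow (space N \<times> space borel)" by (rule pair_measure_closed)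
  moreover have "Q \<in> sigma_sets (space N \<times> space (borel :: 'a measure)) ?G"
    using Q by (simp only: sig)
  ultimately show ?thesis
  proof (induction rule: sigma_sets_induct_disjoint)
    case (basic Q)
    then obtain a b where ab: "Q = a \<times> b" "a \<in> sets N" "b \<in> sets (borel :: 'a measure)" by auto
    have "emeasure (Rep_configuration (g w)) (Pair w -` Q \<inter> ball 0 R) =
        indicator a w * emeasure (Rep_configuration (g w)) (b \<inter> ball 0 R)" for w
      unfolding ab by (cases "w \<in> a") auto
    then show ?case
      using measurable_compose[OF g measurable_emeasure_ball[OF ab(3), of R]] ab(2) by simp
  next
    case empty
    then show ?case by simp
  next
    case (compl Q)
    then have Q: "Q \<in> sets (N \<Otimes>\<^sub>M borel)" by (simp only: sig)
    have eq: "emeasure (Rep_configuration (g w)) (Pair w -` (space N \<times> space borel - Q) \<inter> ball 0 R) =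
        emeasure (Rep_configuration (g w)) (UNIV \<inter> ball 0 R) - emeasure (Rep_configuration (g w)) (Pair w -` Q \<inter> ball 0 R)"
      if "w \<in> space N" for w
    proof -
      have "Pair w -` (space N \<times> space borel - Q) \<inter> ball 0 R = UNIV \<inter> ball 0 R - Pair w -` Q \<inter> ball 0 R"
        using that by auto
      then show ?thesis
        using sec[OF Q, of w] emeasure_Rep_bounded[of "g w" "Pair w -` Q" R]
        by (simp only:) (subst emeasure_Diff, auto simp: less_top)
    qed
    have "(\<lambda>w. emeasure (Rep_configuration (g w)) (UNIV \<inter> ball 0 R)) \<in> borel_measurable N"
      by (rule measurable_compose[OF g measurable_emeasure_ball]) simp
    then show ?case
      using compl(2) by (subst measurable_cong[OF eq]) auto
  next
    case (union Q)
    have Q: "Q i \<in> sets (N \<Otimes>\<^sub>M borel)" for i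
      using union(2) unfolding sig by blast
    have "emeasure (Rep_configuration (g w)) (Pair w -` \<Union>(range Q) \<inter> ball 0 R) =
        (\<Sum>i. emeasure (Rep_configuration (g w)) (Pair w -` Q i \<inter> ball 0 R))" for w
    proof -
      have eq: "Pair w -` \<Union>(range Q) \<inter> ball 0 R = (\<Union>i. Pair w -` Q i \<inter> ball 0 R)" by auto
      have "disjoint_family (\<lambda>i. Pair w -` Q i \<inter> ball 0 R)"
        using union(1) unfolding disjoint_family_on_def by blast
      then show ?thesis
        unfolding eq using sec[OF Q] by (subst suminf_emeasure) auto
    qed
    then show ?case using union(3) by simp
  qed
qed

text \<open>The extension of \<open>measurable_emeasure_section\<close> from indicators to
  nonnegative functions. The integrand may depend on the parameter, which is what iterated integrals
  over tuples and multiplicities require.\<close>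

lemma measurable_nn_integral_configuration:
  fixes g :: "'n \<Rightarrow> 'a::euclidean_space configuration"
  assumes g: "g \<in> measurable N borel" and F: "F \<in> borel_measurable (N \<Otimes>\<^sub>M borel)"
  shows "(\<lambda>w. \<integral>\<^sup>+y. F (w, y) \<partial>Rep_configuration (g w)) \<in> borel_measurable N"
  using F
proof (induction rule: borel_measurable_induct)
  case (cong f h)
  have "(\<integral>\<^sup>+y. f (w, y) \<partial>Rep_configuration (g w)) = (\<integral>\<^sup>+y. h (w, y) \<partial>Rep_configuration (g w))" if "w \<in> space N" for w
    using that cong.hyps(3) by (intro nn_integral_cong) (auto simp: space_pair_measure)
  then show ?case using cong.IH by (simp cong: measurable_cong)
next
  case (set Q)
  have sec: "Pair w -` Q \<in> sets borel" for w using set by (rule sets_Pair1)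
  have "(\<integral>\<^sup>+y. indicator Q (w, y) \<partial>Rep_configuration (g w)) =
      (SUP n. emeasure (Rep_configuration (g w)) (Pair w -` Q \<inter> ball 0 (real n)))" for w
  proof -
    have "(\<integral>\<^sup>+y. indicator Q (w, y) \<partial>Rep_configuration (g w)) = (\<integral>\<^sup>+y. indicator (Pair w -` Q) y \<partial>Rep_configuration (g w))"
      by (intro nn_integral_cong) (auto simp: indicator_def)
    also have "\<dots> = emeasure (Rep_configuration (g w)) (Pair w -` Q)"
      using sec[of w] by (intro nn_integral_indicator) simp
    finally show ?thesis
      using SUP_emeasure_balls[OF sets_Rep_configuration sec] by simp
  qed
  then show ?case
    using measurable_emeasure_section[OF g set] by simp
next
  case (mult u c)
  have "(\<lambda>y. u (w, y)) \<in> borel_measurable borel" if "w \<in> space N" for w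
    using measurable_Pair2[OF mult.hyps(2) that] by simp
  then have "(\<integral>\<^sup>+y. c * u (w, y) \<partial>Rep_configuration (g w)) = c * (\<integral>\<^sup>+y. u (w, y) \<partial>Rep_configuration (g w))" if "w \<in> space N" for w
    using that by (intro nn_integral_cmult) (simp cong: measurable_cong_sets)
  then show ?case using mult.IH by (simp cong: measurable_cong)
next
  case (add u v)
  have "(\<lambda>y. u (w, y)) \<in> borel_measurable borel" "(\<lambda>y. v (w, y)) \<in> borel_measurable borel" if "w \<in> space N" for w
    using measurable_Pair2[OF add.hyps(1) that] measurable_Pair2[OF add.hyps(3) that] by simp_all
  then have "(\<integral>\<^sup>+y. v (w, y) + u (w, y) \<partial>Rep_configuration (g w)) =
      (\<integral>\<^sup>+y. v (w, y) \<partial>Rep_configuration (g w)) + (\<integral>\<^sup>+y. u (w, y) \<partial>Rep_configuration (g w))" if "w \<in> space N" for w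
    using that by (intro nn_integral_add) (simp_all cong: measurable_cong_sets)
  then show ?case using add.IH by (simp cong: measurable_cong)
next
  case (seq U)
  have m: "(\<lambda>y. U i (w, y)) \<in> borel_measurable borel" if "w \<in> space N" for i w
    using measurable_Pair2[OF seq.hyps(1) that] by simp
  have "(\<integral>\<^sup>+y. (SUP i. U i) (w, y) \<partial>Rep_configuration (g w)) = (SUP i. \<integral>\<^sup>+y. U i (w, y) \<partial>Rep_configuration (g w))" if "w \<in> space N" for w
    unfolding SUP_apply
    using seq.hyps(3) m[OF that] by (intro nn_integral_monotone_convergence_SUP)
      (auto simp: incseq_def le_fun_def cong: measurable_cong_sets)
  then show ?case using seq.IH by (simp cong: measurable_cong)
qed

section \<open>Encoding of configurations\<close>

text \<open>A configuration is encoded by its points, listed shell by shell: the slot \<open>(a, j)\<close> contains the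
  \<open>j\<close>-th point in the shell \<open>a \<le> norm y < a + 1\<close> together with the flag \<open>1\<close>, or \<open>(0, 0)\<close>.\<close>

definition shell :: "'a::euclidean_space \<Rightarrow> nat" where
  "shell y = nat \<lfloor>norm y\<rfloor>"

definition rank :: "(nat \<Rightarrow> 'a::euclidean_space) \<Rightarrow> nat \<Rightarrow> nat" where
  "rank p i = (\<Sum>i'<i. of_bool (shell (p i') = shell (p i)))"

definition slot :: "(nat \<Rightarrow> 'a::euclidean_space) \<Rightarrow> nat \<Rightarrow> nat \<times> nat" where
  "slot p i = (shell (p i), rank p i)"

text \<open>As \<open>slot p\<close> is injective, at most one summand differs from zero. Writing
  the content of a slot as a sum avoids choosing an index, gives \<open>(0, 0)\<close> for empty
  slots, and makes measurability in the points accessible.\<close>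

definition enc :: "nat \<Rightarrow> (nat \<Rightarrow> 'a::euclidean_space) \<Rightarrow> nat \<times> nat \<Rightarrow> 'a \<times> real" where
  "enc N p \<sigma> = (\<Sum>i<N. if slot p i = \<sigma> then (p i, 1) else 0)"

definition occupied :: "(nat \<times> nat \<Rightarrow> 'a \<times> real) \<Rightarrow> (nat \<times> nat) set" where
  "occupied w = {\<sigma>. snd (w \<sigma>) = 1}"

definition decode :: "(nat \<times> nat \<Rightarrow> 'a::euclidean_space \<times> real) \<Rightarrow> 'a configuration" where
  "decode w = points_configuration (occupied w) (\<lambda>\<sigma>. fst (w \<sigma>))"

text \<open>All conditions but the last survive limits; the last one, an empty slot in each shell,
  is what makes the shells finite. Of the shell only the inequality \<open>real a <= norm\<close> is
  kept: it suffices for local finiteness, while the strict upper bound would be lost in the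
  limit.\<close>

definition admissible :: "(nat \<times> nat \<Rightarrow> 'a::euclidean_space \<times> real) set" where
  "admissible = {w. (\<forall>\<sigma>. snd (w \<sigma>) = 0 \<or> snd (w \<sigma>) = 1) \<and>
     (\<forall>a j j'. j \<le> j' \<and> snd (w (a, j')) = 1 \<longrightarrow> snd (w (a, j)) = 1) \<and>
     (\<forall>a j. snd (w (a, j)) = 1 \<longrightarrow> real a \<le> norm (fst (w (a, j)))) \<and>
     (\<forall>a. \<exists>j. snd (w (a, j)) = 0)}"

lemma rank_eq_card: "rank p i = card {i'. i' < i \<and> shell (p i') = shell (p i)}"
proof -
  have "rank p i = card ({..<i} \<inter> {i'. shell (p i') = shell (p i)})"
    unfolding rank_def by (subst sum_of_bool_eq) auto
  also have "{..<i} \<inter> {i'. shell (p i') = shell (p i)} = {i'. i' < i \<and> shell (p i') = shell (p i)}" by auto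
  finally show ?thesis .
qed

lemma rank_less:
  assumes "i < i'" "shell (p i) = shell (p i')"
  shows "rank p i < rank p i'"
  unfolding rank_eq_card using assms by (intro psubset_card_mono) auto

lemma inj_slot: "inj (slot p)"
proof (rule linorder_injI)
  fix i i' :: nat assume "i < i'"
  then show "slot p i \<noteq> slot p i'"
    using rank_less[of i i' p] by (auto simp: slot_def)
qed

text \<open>Within a shell the ranks are distinct and smaller than the number of its points, hence
  they exhaust an initial segment. So slots are filled without gaps.\<close>

lemma rank_image:
  "rank p ` {i. i < N \<and> shell (p i) = a} = {..<card {i. i < N \<and> shell (p i) = a}}"
proof (rule card_subset_eq)
  let ?I = "{i. i < N \<and> shell (p i) = a}"
  show "rank p ` ?I \<subseteq> {..<card ?I}"
  proof
    fix j assume "j \<in> rank p ` ?I"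
    then obtain i where i: "i < N" "a = shell (p i)" and j: "j = rank p i" by auto
    have "{i'. i' < i \<and> shell (p i') = shell (p i)} \<subset> {i'. i' < N \<and> shell (p i') = shell (p i)}"
      using i by auto
    then have "rank p i < card {i'. i' < N \<and> shell (p i') = shell (p i)}"
      unfolding rank_eq_card by (intro psubset_card_mono) auto
    then show "j \<in> {..<card ?I}" by (simp add: i(2) j)
  qed
  have "inj_on (rank p) ?I"
    using rank_less[of _ _ p] by (intro linorder_inj_onI) (auto, metis less_irrefl)
  then show "card (rank p ` ?I) = card {..<card ?I}" by (simp add: card_image)
qed simp

lemma enc_slot:
  assumes "i < N"
  shows "enc N p (slot p i) = (p i, 1)"
proof -
  have "enc N p (slot p i) = (\<Sum>i'<N. if i' = i then (p i', 1) else 0)"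
    unfolding enc_def using inj_slot[of p] by (intro sum.cong) (auto simp: inj_eq)
  then show ?thesis using assms by simp
qed

lemma enc_empty: "\<sigma> \<notin> slot p ` {..<N} \<Longrightarrow> enc N p \<sigma> = 0"
  unfolding enc_def by (intro sum.neutral) auto

lemma occupied_enc: "occupied (enc N p) = slot p ` {..<N}"
proof safe
  fix a j assume "(a, j) \<in> occupied (enc N p)"
  then show "(a, j) \<in> slot p ` {..<N}"
    using enc_empty[of "(a, j)" p N] by (cases "(a, j) \<in> slot p ` {..<N}") (auto simp: occupied_def)
qed (simp add: occupied_def enc_slot)

lemma real_shell_le: "real (shell y) \<le> norm y"
  by (simp add: shell_def)

lemma norm_less_shell: "norm y < real (shell y) + 1"
  by (simp add: shell_def)

lemma snd_enc: "snd (enc N p \<sigma>) = of_bool (\<sigma> \<in> slot p ` {..<N})"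
  using enc_slot[of _ N p] enc_empty[of \<sigma> p N] by (cases "\<sigma> \<in> slot p ` {..<N}") auto

lemma slot_prefix:
  assumes "(a, j') \<in> slot p ` {..<N}" "j \<le> j'"
  shows "(a, j) \<in> slot p ` {..<N}"
proof -
  let ?I = "{i. i < N \<and> shell (p i) = a}"
  have "j' \<in> rank p ` ?I" using assms(1) by (auto simp: slot_def)
  then have "j \<in> rank p ` ?I" using assms(2) unfolding rank_image by simp
  then show ?thesis by (auto simp: slot_def image_iff)
qed

lemma enc_admissible: "enc N p \<in> admissible"
  unfolding admissible_def
proof (intro CollectI conjI allI impI)
  fix \<sigma> show "snd (enc N p \<sigma>) = 0 \<or> snd (enc N p \<sigma>) = 1" by (simp add: snd_enc)
next
  fix a j j' assume "j \<le> j' \<and> snd (enc N p (a, j')) = 1"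
  then show "snd (enc N p (a, j)) = 1"
    using slot_prefix[of a j' p N j] by (auto simp: snd_enc)
next
  fix a j assume "snd (enc N p (a, j)) = 1"
  then have "(a, j) \<in> slot p ` {..<N}" by (simp add: snd_enc split: if_splits)
  then obtain i where i: "i < N" "slot p i = (a, j)" by auto
  then have "enc N p (a, j) = (p i, 1)" using enc_slot[of i N p] by simp
  then show "real a \<le> norm (fst (enc N p (a, j)))"
    using i(2) real_shell_le[of "p i"] by (auto simp: slot_def)
next
  fix a
  have "finite (slot p ` {..<N})" by simp
  then have "finite (snd ` (slot p ` {..<N}))" by (rule finite_imageI)
  then obtain j where "j \<notin> snd ` (slot p ` {..<N})"
    using ex_new_if_finite[OF infinite_UNIV_nat] by blast
  then have "(a, j) \<notin> slot p ` {..<N}" by (metis imageI snd_conv)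
  then show "\<exists>j. snd (enc N p (a, j)) = 0" by (intro exI[of _ j]) (simp add: snd_enc)
qed

text \<open>The point contributes at most \<open>a + 1\<close> and the flag \<open>1\<close>. This
  bound puts the codes into a countable product of bounded sets, as
  \<open>skorohod_representation\<close> demands.\<close>

lemma norm_enc_le: "norm (enc N p (a, j)) \<le> real a + 2"
proof (cases "(a, j) \<in> slot p ` {..<N}")
  case True
  then obtain i where i: "i < N" "slot p i = (a, j)" by auto
  then have "enc N p (a, j) = (p i, 1)" using enc_slot[of i N p] by simp
  then show ?thesis
    using norm_Pair_le[of "p i" "1::real"] i(2) norm_less_shell[of "p i"] by (auto simp: slot_def)
qed (simp add: enc_empty)

lemma decode_enc: "decode (enc N p) = configuration_of N p"
proof -
  have bij: "bij_betw (slot p) {..<N} (slot p ` {..<N})"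
    using inj_slot[of p] by (intro inj_on_imp_bij_betw) (auto intro: inj_on_subset)
  have "distr (count_space (slot p ` {..<N})) borel (\<lambda>\<sigma>. fst (enc N p \<sigma>)) =
      distr (distr (count_space {..<N}) (count_space (slot p ` {..<N})) (slot p)) borel (\<lambda>\<sigma>. fst (enc N p \<sigma>))"
    using distr_bij_count_space[OF bij] by simp
  also have "\<dots> = distr (count_space {..<N}) borel ((\<lambda>\<sigma>. fst (enc N p \<sigma>)) \<circ> slot p)"
    by (rule distr_distr) auto
  also have "\<dots> = distr (count_space {..<N}) borel p"
    by (intro distr_cong) (auto simp: enc_slot)
  finally show ?thesis
    by (simp add: decode_def configuration_of_eq points_configuration_def occupied_enc)
qed

lemma borel_measurable_enc:
  assumes p [measurable]: "\<And>i. i < N \<Longrightarrow> (\<lambda>x. p x i) \<in> borel_measurable M"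
  shows "(\<lambda>x. enc N (p x) \<sigma>) \<in> borel_measurable M"
proof -
  have sh: "(\<lambda>x. shell (p x i)) \<in> measurable M (count_space UNIV)" if "i < N" for i
  proof -
    have [measurable]: "(\<lambda>y::'b. shell y) \<in> measurable borel (count_space UNIV)"
      unfolding shell_def by measurable
    show ?thesis by (rule measurable_compose[OF p[OF that]]) measurable
  qed
  have rk: "(\<lambda>x. rank (p x) i) \<in> measurable M (count_space UNIV)" if i: "i < N" for i
  proof -
    have "(\<lambda>x. of_bool (shell (p x i') = shell (p x i)) :: nat) \<in> measurable M (count_space UNIV)" if "i' < i" for i'
    proof -
      have "i' < N" using that i by simp
      show ?thesis
        by (rule measurable_compose_countable[where f="\<lambda>n x. of_bool (n = shell (p x i))" and g="\<lambda>x. shell (p x i')"],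
            rule measurable_compose[OF sh[OF i]]) (simp_all add: sh[OF \<open>i' < N\<close>])
    qed
    then show ?thesis
      unfolding rank_def by (intro measurable_sum_nat) auto
  qed
  have "Measurable.pred M (\<lambda>x. slot (p x) i = \<sigma>)" if "i < N" for i
  proof -
    note [measurable] = sh[OF that] rk[OF that]
    have "Measurable.pred M (\<lambda>x. shell (p x i) = fst \<sigma> \<and> rank (p x) i = snd \<sigma>)"
      by measurable
    moreover have "(\<lambda>x. slot (p x) i = \<sigma>) = (\<lambda>x. shell (p x i) = fst \<sigma> \<and> rank (p x) i = snd \<sigma>)"
      by (auto simp: slot_def prod_eq_iff)
    ultimately show ?thesis by simp
  qed
  then show ?thesis
    unfolding enc_def using p
    by (intro borel_measurable_sum measurable_If borel_measurable_Pair borel_measurable_const) auto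
qed

section \<open>Decoding as a continuous map\<close>

lemma admissibleD:
  assumes "w \<in> admissible"
  shows "snd (w \<sigma>) = 0 \<or> snd (w \<sigma>) = 1" "j \<le> j' \<Longrightarrow> snd (w (a, j)) = 0 \<Longrightarrow> snd (w (a, j')) = 0"
    "snd (w (a, j)) = 1 \<Longrightarrow> real a \<le> norm (fst (w (a, j)))" "\<exists>j. snd (w (a, j)) = 0"
proof -
  show *: "snd (w \<sigma>) = 0 \<or> snd (w \<sigma>) = 1" for \<sigma>
    using assms unfolding admissible_def by blast
  show "snd (w (a, j')) = 0" if "j \<le> j'" "snd (w (a, j)) = 0"
  proof (rule ccontr)
    assume "snd (w (a, j')) \<noteq> 0"
    then have "snd (w (a, j')) = 1" using *[of "(a, j')"] by simp
    then have "snd (w (a, j)) = 1" using assms that(1) unfolding admissible_def by blast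
    then show False using that by simp
  qed
  show "snd (w (a, j)) = 1 \<Longrightarrow> real a \<le> norm (fst (w (a, j)))" "\<exists>j. snd (w (a, j)) = 0"
    using assms by (auto simp: admissible_def)
qed

text \<open>The norm bound limits the shell, and an empty slot in each shell limits the position
  within it.\<close>

lemma finite_occupied_bounded:
  assumes w: "w \<in> admissible"
  shows "finite {\<sigma>\<in>occupied w. norm (fst (w \<sigma>)) \<le> R}"
proof -
  obtain J where J: "\<And>a. snd (w (a, J a)) = 0" using admissibleD(4)[OF w] by metis
  have "{\<sigma>\<in>occupied w. norm (fst (w \<sigma>)) \<le> R} \<subseteq> (SIGMA a:{..nat \<lfloor>R\<rfloor>}. {..<J a})"
  proof clarify
    fix a j assume aj: "(a, j) \<in> occupied w" "norm (fst (w (a, j))) \<le> R"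
    then have "real a \<le> R" using admissibleD(3)[OF w, of a j] by (auto simp: occupied_def)
    then have "a \<le> nat \<lfloor>R\<rfloor>" by linarith
    moreover have "j < J a"
      using aj(1) admissibleD(2)[OF w, of "J a" j a] J[of a] by (cases "j < J a") (auto simp: occupied_def)
    ultimately show "a \<in> {..nat \<lfloor>R\<rfloor>} \<and> j \<in> {..<J a}" by simp
  qed
  then show ?thesis by (rule finite_subset) auto
qed

lemma finite_occupied_compact:
  assumes w: "w \<in> admissible" and K: "compact K"
  shows "finite {\<sigma>\<in>occupied w. fst (w \<sigma>) \<in> K}"
proof -
  obtain R where "\<And>x. x \<in> K \<Longrightarrow> norm x \<le> R"
    using compact_imp_bounded[OF K] by (auto simp: bounded_iff)
  then have "{\<sigma>\<in>occupied w. fst (w \<sigma>) \<in> K} \<subseteq> {\<sigma>\<in>occupied w. norm (fst (w \<sigma>)) \<le> R}" by auto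
  then show ?thesis by (rule finite_subset) (rule finite_occupied_bounded[OF w])
qed

lemma Rep_decode:
  "w \<in> admissible \<Longrightarrow> Rep_configuration (decode w) = distr (count_space (occupied w)) borel (\<lambda>\<sigma>. fst (w \<sigma>))"
  unfolding decode_def by (intro Rep_points_configuration finite_occupied_compact) auto

text \<open>A test function sees only the shells up to \<open>?A\<close>. Near an admissible code
  each of these shells has the same slot \<open>J\<close> empty, so that the integral is a fixed
  finite sum of flags times values of the function, which is continuous in the coordinates.\<close>

lemma continuous_on_decode: "continuous_on admissible (decode :: _ \<Rightarrow> 'a::euclidean_space configuration)"
proof (rule continuous_on_into_configuration)
  fix f :: "'a \<Rightarrow> real" assume "test_function f"
  then obtain K where f: "continuous_on UNIV f" and K: "compact K" "\<And>x. x \<notin> K \<Longrightarrow> f x = 0"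
    by (auto simp: test_function_def)
  obtain R where R: "\<And>x. x \<in> K \<Longrightarrow> norm x \<le> R"
    using compact_imp_bounded[OF K(1)] by (auto simp: bounded_iff)
  have fR: "f x = 0" if "R < norm x" for x
    using K(2)[of x] R[of x] that by force
  have fm: "f \<in> borel_measurable borel" by (rule borel_measurable_continuous_onI[OF f])
  let ?A = "nat \<lfloor>R\<rfloor>"
  let ?g = "\<lambda>w. \<integral>x. f x \<partial>Rep_configuration (decode w)"
  have eq: "?g w = (\<Sum>\<sigma>\<in>{..?A} \<times> {..<J}. snd (w \<sigma>) * f (fst (w \<sigma>)))"
    if w: "w \<in> admissible" and J: "\<And>a. a \<le> ?A \<Longrightarrow> snd (w (a, J)) = 0" for w J
  proof -
    have "?g w = (\<Sum>\<sigma>\<in>({..?A} \<times> {..<J}) \<inter> occupied w. f (fst (w \<sigma>)))"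
      unfolding decode_def
    proof (rule integral_points_configuration[OF _ finite_occupied_compact[OF w] fm])
      fix \<sigma> assume "\<sigma> \<in> occupied w - {..?A} \<times> {..<J} \<inter> occupied w"
      then obtain a j where aj: "\<sigma> = (a, j)" "(a, j) \<in> occupied w" "\<not> (a \<le> ?A \<and> j < J)"
        by (cases \<sigma>) auto
      have "j < J" if "a \<le> ?A"
        using J[OF that] admissibleD(2)[OF w, of J j a] aj(2) by (cases "j < J") (auto simp: occupied_def)
      then have "\<not> a \<le> ?A" using aj(3) by blast
      then have "R < real a" by linarith
      then show "f (fst (w \<sigma>)) = 0"
        using admissibleD(3)[OF w, of a j] aj by (intro fR) (auto simp: occupied_def)
    qed auto
    also have "\<dots> = (\<Sum>\<sigma>\<in>{..?A} \<times> {..<J}. if \<sigma> \<in> occupied w then f (fst (w \<sigma>)) else 0)"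
      by (rule sum.inter_restrict) auto
    also have "\<dots> = (\<Sum>\<sigma>\<in>{..?A} \<times> {..<J}. snd (w \<sigma>) * f (fst (w \<sigma>)))"
    proof (rule sum.cong[OF refl])
      fix \<sigma> show "(if \<sigma> \<in> occupied w then f (fst (w \<sigma>)) else 0) = snd (w \<sigma>) * f (fst (w \<sigma>))"
        using admissibleD(1)[OF w, of \<sigma>] by (auto simp: occupied_def)
    qed
    finally show ?thesis .
  qed
  show "continuous_on admissible ?g"
    unfolding continuous_on_def
  proof
    fix w0 :: "nat \<times> nat \<Rightarrow> 'a \<times> real" assume w0: "w0 \<in> admissible"
    have coord: "((\<lambda>w. w \<sigma>) \<longlongrightarrow> w0 \<sigma>) (at w0 within admissible)" for \<sigma>
    proof (rule tendsto_within_subset[of _ _ _ UNIV])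
      show "((\<lambda>w. w \<sigma>) \<longlongrightarrow> w0 \<sigma>) (at w0)"
        using continuous_on_product_coordinates[of \<sigma>] unfolding continuous_on_def by blast
    qed simp
    obtain J0 where J0: "\<And>a. snd (w0 (a, J0 a)) = 0" using admissibleD(4)[OF w0] by metis
    \<comment> \<open>By monotonicity of the flags the slot \<open>J\<close> is empty in all shells
      up to \<open>?A\<close>. Flags being \<open>0\<close> or \<open>1\<close>, emptiness amounts
      to the open condition that the flag is below \<open>1/2\<close>, and so persists near
      \<open>w0\<close>.\<close>
    define J where "J = Max (J0 ` {..?A})"
    have J: "snd (w0 (a, J)) = 0" if "a \<le> ?A" for a
      using admissibleD(2)[OF w0 _ J0[of a]] that by (auto simp: J_def)
    have "\<forall>\<^sub>F w in at w0 within admissible. \<forall>a\<in>{..?A}. snd (w (a, J)) < 1/2"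
    proof (rule eventually_ball_finite, simp, rule ballI)
      fix a assume "a \<in> {..?A}"
      then show "\<forall>\<^sub>F w in at w0 within admissible. snd (w (a, J)) < 1/2"
        using J[of a] by (intro order_tendstoD(2)[OF tendsto_snd[OF coord]]) auto
    qed
    moreover have "\<forall>\<^sub>F w in at w0 within admissible. w \<in> admissible"
      by (auto simp: eventually_at_filter)
    ultimately have ev: "\<forall>\<^sub>F w in at w0 within admissible. (\<Sum>\<sigma>\<in>{..?A} \<times> {..<J}. snd (w \<sigma>) * f (fst (w \<sigma>))) = ?g w"
    proof eventually_elim
      case (elim w)
      have "snd (w (a, J)) = 0" if "a \<le> ?A" for a
        using elim(1)[rule_format, of a] that admissibleD(1)[OF elim(2), of "(a, J)"] by auto
      then show ?case using eq[OF elim(2), of J] by simp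
    qed
    have isC: "isCont f x" for x using f by (simp add: continuous_on_eq_continuous_at)
    have "((\<lambda>w. \<Sum>\<sigma>\<in>{..?A} \<times> {..<J}. snd (w \<sigma>) * f (fst (w \<sigma>))) \<longlongrightarrow>
        (\<Sum>\<sigma>\<in>{..?A} \<times> {..<J}. snd (w0 \<sigma>) * f (fst (w0 \<sigma>)))) (at w0 within admissible)"
      by (intro tendsto_sum tendsto_mult tendsto_snd coord isCont_tendsto_compose[OF isC] tendsto_fst)
    then have "((\<lambda>w. \<Sum>\<sigma>\<in>{..?A} \<times> {..<J}. snd (w \<sigma>) * f (fst (w \<sigma>))) \<longlongrightarrow> ?g w0) (at w0 within admissible)"
      using eq[OF w0 J] by simp
    then show "(?g \<longlongrightarrow> ?g w0) (at w0 within admissible)"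
      by (rule Lim_transform_eventually[OF _ ev])
  qed
qed

lemma admissible_sets: "(admissible :: (nat \<times> nat \<Rightarrow> 'a::euclidean_space \<times> real) set) \<in> sets borel"
proof -
  have [measurable]: "(\<lambda>w::nat \<times> nat \<Rightarrow> 'a \<times> real. snd (w \<sigma>)) \<in> borel_measurable borel"
      "(\<lambda>w::nat \<times> nat \<Rightarrow> 'a \<times> real. norm (fst (w \<sigma>))) \<in> borel_measurable borel" for \<sigma>
    by (intro borel_measurable_continuous_onI continuous_intros continuous_on_product_coordinates)+
  have "{w \<in> space (borel :: (nat \<times> nat \<Rightarrow> 'a \<times> real) measure). (\<forall>\<sigma>. snd (w \<sigma>) = 0 \<or> snd (w \<sigma>) = 1) \<and>
     (\<forall>a j j'. j \<le> j' \<and> snd (w (a, j')) = 1 \<longrightarrow> snd (w (a, j)) = 1) \<and>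
     (\<forall>a j. snd (w (a, j)) = 1 \<longrightarrow> real a \<le> norm (fst (w (a, j)))) \<and>
     (\<forall>a. \<exists>j. snd (w (a, j)) = 0)} \<in> sets borel"
    by measurable
  then show ?thesis by (simp add: admissible_def)
qed

text \<open>A Borel extension of \<open>decode\<close>, which is controlled only on admissible
  codes. All other codes are sent to the empty configuration.\<close>

definition decode' :: "(nat \<times> nat \<Rightarrow> 'a::euclidean_space \<times> real) \<Rightarrow> 'a configuration" where
  "decode' w = (if w \<in> admissible then decode w else decode (\<lambda>_. 0))"

lemma borel_measurable_decode': "(decode' :: _ \<Rightarrow> 'a::euclidean_space configuration) \<in> measurable borel borel"
proof -
  have "decode \<in> measurable (restrict_space borel admissible) (borel :: 'a configuration measure)"
    by (rule borel_measurable_continuous_on_restrict[OF continuous_on_decode])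
  then show ?thesis
    unfolding decode'_def using admissible_sets
    by (subst measurable_If_restrict_space_iff) auto
qed

lemma decode_tendsto:
  fixes w :: "nat \<Rightarrow> nat \<times> nat \<Rightarrow> 'a::euclidean_space \<times> real" and \<Phi> :: "'a configuration \<Rightarrow> real"
  assumes \<Phi>: "continuous_on UNIV \<Phi>" and w: "\<And>n. w n \<in> admissible" "w0 \<in> admissible"
    and lim: "\<And>\<sigma>. (\<lambda>n. w n \<sigma>) \<longlonglongrightarrow> w0 \<sigma>"
  shows "(\<lambda>n. \<Phi> (decode (w n))) \<longlonglongrightarrow> \<Phi> (decode w0)"
proof -
  have "w \<longlonglongrightarrow> w0" using lim limitin_componentwise[of "\<lambda>_. euclidean" UNIV w w0 sequentially]
    by (simp add: euclidean_product_topology limitin_canonical_iff)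
  moreover have "continuous_on admissible (\<lambda>w. \<Phi> (decode w))"
    by (rule continuous_on_compose2[OF \<Phi> continuous_on_decode]) auto
  ultimately show ?thesis
    using w by (intro continuous_on_tendsto_compose[of admissible "\<lambda>w. \<Phi> (decode w)"]) auto
qed

section \<open>Sums over tuples\<close>

lemma bij_betw_tuples:
  assumes f: "bij_betw f A B"
  shows "bij_betw (\<lambda>\<sigma>. \<lambda>j\<in>{..<k}. f (\<sigma> j)) (tuples k A) (tuples k B)"
proof -
  define g where "g = inv_into A f"
  have gf: "g (f x) = x" if "x \<in> A" for x
    using f that by (simp add: g_def bij_betw_inv_into_left)
  have fg: "f (g y) = y" and gA: "g y \<in> A" if "y \<in> B" for y
    using f that by (auto simp: g_def bij_betw_inv_into_right bij_betw_def inv_into_into)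
  have fA: "f x \<in> B" if "x \<in> A" for x using f that by (auto simp: bij_betw_def)
  have inj_f: "inj_on f A" and inj_g: "inj_on g B"
    using gf fg by (auto intro: inj_on_inverseI)
  show ?thesis
  proof (rule bij_betwI[where g="\<lambda>\<tau>. \<lambda>j\<in>{..<k}. g (\<tau> j)"])
    show "(\<lambda>\<sigma>. \<lambda>j\<in>{..<k}. f (\<sigma> j)) \<in> tuples k A \<rightarrow> tuples k B"
      using fA inj_f by (fastforce simp: tuples_def PiE_def Pi_def inj_on_def)
    show "(\<lambda>\<tau>. \<lambda>j\<in>{..<k}. g (\<tau> j)) \<in> tuples k B \<rightarrow> tuples k A"
      using gA inj_g by (fastforce simp: tuples_def PiE_def Pi_def inj_on_def)
    show "(\<lambda>j\<in>{..<k}. g ((\<lambda>j\<in>{..<k}. f (\<sigma> j)) j)) = \<sigma>" if "\<sigma> \<in> tuples k A" for \<sigma>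
      using that gf by (auto simp: tuples_def PiE_def Pi_def extensional_def fun_eq_iff)
    show "(\<lambda>j\<in>{..<k}. f ((\<lambda>j\<in>{..<k}. g (\<tau> j)) j)) = \<tau>" if "\<tau> \<in> tuples k B" for \<tau>
      using that fg by (auto simp: tuples_def PiE_def Pi_def extensional_def fun_eq_iff)
  qed
qed

lemma countable_tuples: "countable A \<Longrightarrow> countable (tuples k A)"
  unfolding tuples_def by (rule countable_subset[OF _ countable_PiE[of "{..<k}" "\<lambda>_. A"]]) auto

lemma nn_integral_count_space_PiE_Suc:
  fixes g :: "(nat \<Rightarrow> 'a) \<Rightarrow> ennreal"
  shows "(\<integral>\<^sup>+y. g y \<partial>count_space ({..<Suc k} \<rightarrow>\<^sub>E UNIV)) =
    (\<integral>\<^sup>+y. (\<integral>\<^sup>+z. g (y(k := z)) \<partial>count_space UNIV) \<partial>count_space ({..<k} \<rightarrow>\<^sub>E UNIV))"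
proof -
  let ?A = "{..<k} \<rightarrow>\<^sub>E (UNIV :: 'a set)"
  have bij: "bij_betw (\<lambda>(y, z). y(k := z)) (?A \<times> UNIV) ({..<Suc k} \<rightarrow>\<^sub>E (UNIV :: 'a set))"
    by (rule bij_betwI[where g="\<lambda>y. (y(k := undefined), y k)"])
      (auto simp: PiE_def extensional_def fun_eq_iff less_Suc_eq)
  have "(\<integral>\<^sup>+y. g y \<partial>count_space ({..<Suc k} \<rightarrow>\<^sub>E UNIV)) = (\<integral>\<^sup>+p. g ((\<lambda>(y, z). y(k := z)) p) \<partial>count_space (?A \<times> UNIV))"
    by (rule nn_integral_bij_count_space[OF bij, symmetric])
  also have "\<dots> = (\<integral>\<^sup>+p. g ((\<lambda>(y, z). y(k := z)) p) * indicator (?A \<times> UNIV) p \<partial>count_space UNIV)"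
    by (rule nn_integral_count_space_indicator) simp
  also have "\<dots> = (\<integral>\<^sup>+y. (\<integral>\<^sup>+z. g (y(k := z)) * indicator (?A \<times> UNIV) (y, z) \<partial>count_space UNIV) \<partial>count_space UNIV)"
    using nn_integral_fst_count_space[of "\<lambda>p. g ((\<lambda>(y, z). y(k := z)) p) * indicator (?A \<times> UNIV) p"] by simp
  also have "\<dots> = (\<integral>\<^sup>+y. (\<integral>\<^sup>+z. g (y(k := z)) \<partial>count_space UNIV) * indicator ?A y \<partial>count_space UNIV)"
    by (intro nn_integral_cong) (auto simp: indicator_def)
  also have "\<dots> = (\<integral>\<^sup>+y. (\<integral>\<^sup>+z. g (y(k := z)) \<partial>count_space UNIV) \<partial>count_space ?A)"
    by (rule nn_integral_count_space_indicator[symmetric]) simp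
  finally show ?thesis .
qed

text \<open>Weighted by the masses, the sum over the last coordinate is an integral against the
  configuration; this reduces the claim to one coordinate less.\<close>

lemma measurable_nn_integral_tuples:
  fixes F :: "'a::euclidean_space configuration \<times> (nat \<Rightarrow> 'a) \<Rightarrow> ennreal"
  assumes "F \<in> borel_measurable ((borel :: 'a::euclidean_space configuration measure) \<Otimes>\<^sub>M (\<Pi>\<^sub>M j\<in>{..<k}. borel))"
  shows "(\<lambda>\<xi>. \<integral>\<^sup>+y. (\<Prod>j<k. emeasure (Rep_configuration \<xi>) {y j}) * F (\<xi>, y) \<partial>count_space ({..<k} \<rightarrow>\<^sub>E UNIV)) \<in> borel_measurable borel"
  using assms
proof (induction k arbitrary: F)
  case 0
  have "(\<lambda>\<xi>. F (\<xi>, \<lambda>_. undefined)) \<in> borel_measurable borel"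
    by (rule measurable_compose[OF _ 0]) (auto simp: space_PiM)
  then show ?case
    by (simp add: nn_integral_count_space_finite)
next
  case (Suc k)
  let ?N = "(borel :: 'a configuration measure) \<Otimes>\<^sub>M (\<Pi>\<^sub>M j\<in>{..<k}. borel :: 'a measure)"
  define F' where "F' q = (\<integral>\<^sup>+z. F (fst q, (snd q)(k := z)) \<partial>Rep_configuration (fst q))" for q
  have ins: "{..<Suc k} = insert k {..<k}" by auto
  have "(\<lambda>p. (snd (fst p))(k := snd p)) \<in> measurable (?N \<Otimes>\<^sub>M borel) (\<Pi>\<^sub>M j\<in>{..<Suc k}. borel :: 'a measure)"
    unfolding ins by (rule measurable_fun_upd[where J="{..<k}"]) auto
  then have "(\<lambda>p. (fst (fst p), (snd (fst p))(k := snd p))) \<in> measurable (?N \<Otimes>\<^sub>M borel) (borel \<Otimes>\<^sub>M (\<Pi>\<^sub>M j\<in>{..<Suc k}. borel :: 'a measure))"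
    by measurable
  from measurable_compose[OF this Suc.prems]
  have F_upd: "(\<lambda>p. F (fst (fst p), (snd (fst p))(k := snd p))) \<in> borel_measurable (?N \<Otimes>\<^sub>M borel)" .
  have F'_meas: "F' \<in> borel_measurable ?N"
    unfolding F'_def using measurable_nn_integral_configuration[OF _ F_upd, of fst] by simp
  have "(\<integral>\<^sup>+y. (\<Prod>j<Suc k. emeasure (Rep_configuration \<xi>) {y j}) * F (\<xi>, y) \<partial>count_space ({..<Suc k} \<rightarrow>\<^sub>E UNIV)) =
      (\<integral>\<^sup>+y. (\<Prod>j<k. emeasure (Rep_configuration \<xi>) {y j}) * F' (\<xi>, y) \<partial>count_space ({..<k} \<rightarrow>\<^sub>E UNIV))" for \<xi>
    unfolding nn_integral_count_space_PiE_Suc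
  proof (rule nn_integral_cong)
    fix y assume "y \<in> space (count_space ({..<k} \<rightarrow>\<^sub>E (UNIV :: 'a set)))"
    then have y: "y \<in> space (\<Pi>\<^sub>M j\<in>{..<k}. borel :: 'a measure)" by (simp add: space_PiM)
    have m: "(\<lambda>z. F (\<xi>, y(k := z))) \<in> borel_measurable borel"
      using measurable_Pair2[OF F_upd, of "(\<xi>, y)"] y by (simp add: space_pair_measure)
    have "(\<integral>\<^sup>+z. (\<Prod>j<Suc k. emeasure (Rep_configuration \<xi>) {(y(k := z)) j}) * F (\<xi>, y(k := z)) \<partial>count_space UNIV) =
        (\<integral>\<^sup>+z. (\<Prod>j<k. emeasure (Rep_configuration \<xi>) {y j}) * (emeasure (Rep_configuration \<xi>) {z} * F (\<xi>, y(k := z))) \<partial>count_space UNIV)"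
      by (intro nn_integral_cong) (simp add: mult_ac)
    also have "\<dots> = (\<Prod>j<k. emeasure (Rep_configuration \<xi>) {y j}) * (\<integral>\<^sup>+z. emeasure (Rep_configuration \<xi>) {z} * F (\<xi>, y(k := z)) \<partial>count_space UNIV)"
      by (rule nn_integral_cmult) simp
    also have "(\<integral>\<^sup>+z. emeasure (Rep_configuration \<xi>) {z} * F (\<xi>, y(k := z)) \<partial>count_space UNIV) = F' (\<xi>, y)"
      unfolding F'_def by (subst nn_integral_Rep_configuration) (simp_all add: m)
    finally show "(\<integral>\<^sup>+z. (\<Prod>j<Suc k. emeasure (Rep_configuration \<xi>) {(y(k := z)) j}) * F (\<xi>, y(k := z)) \<partial>count_space UNIV) =
        (\<Prod>j<k. emeasure (Rep_configuration \<xi>) {y j}) * F' (\<xi>, y)" .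
  qed
  then show ?case using Suc.IH[OF F'_meas] by simp
qed

text \<open>With multiplicities at most one, the truncated subtraction kills every tuple with a
  repetition and changes nothing in the others.\<close>

lemma sum_over_tuples_simple:
  fixes \<xi> :: "'a::euclidean_space configuration"
  assumes simple: "\<And>x. emeasure (Rep_configuration \<xi>) {x} \<le> 1"
  shows "sum_over_tuples k \<phi> \<xi> =
    (\<integral>\<^sup>+y. (\<Prod>j<k. emeasure (Rep_configuration \<xi>) {y j}) * (\<phi> y * of_bool (inj_on y {..<k})) \<partial>count_space ({..<k} \<rightarrow>\<^sub>E UNIV))"
  unfolding sum_over_tuples_def
proof (rule nn_integral_cong)
  fix y :: "nat \<Rightarrow> 'a"
  show "(\<Prod>j<k. emeasure (Rep_configuration \<xi>) {y j} - of_nat (card {i. i < j \<and> y i = y j})) * \<phi> y =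
      (\<Prod>j<k. emeasure (Rep_configuration \<xi>) {y j}) * (\<phi> y * of_bool (inj_on y {..<k}))"
  proof (cases "inj_on y {..<k}")
    case True
    have none: "card {i. i < j \<and> y i = y j} = 0" if "j \<in> {..<k}" for j
    proof -
      have "{i. i < j \<and> y i = y j} = {}"
        using True that by (auto simp: inj_on_def)
      then show ?thesis by simp
    qed
    have "(\<Prod>j<k. emeasure (Rep_configuration \<xi>) {y j} - of_nat (card {i. i < j \<and> y i = y j})) = (\<Prod>j<k. emeasure (Rep_configuration \<xi>) {y j})"
      by (intro prod.cong refl) (simp only: none of_nat_0, simp)
    then show ?thesis using True by simp
  next
    case False
    then obtain i j where ij: "i < j" "j < k" "y i = y j"
      by (auto simp: inj_on_def) (metis linorder_neqE_nat)
    have "finite {i. i < j \<and> y i = y j}" by simp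
    moreover have "i \<in> {i. i < j \<and> y i = y j}" using ij by simp
    ultimately have "1 \<le> card {i. i < j \<and> y i = y j}"
      by (metis One_nat_def Suc_leI card_gt_0_iff empty_iff)
    then have "(1::ennreal) \<le> of_nat (card {i. i < j \<and> y i = y j})"
      by (metis of_nat_1 of_nat_le_iff)
    then have "emeasure (Rep_configuration \<xi>) {y j} \<le> of_nat (card {i. i < j \<and> y i = y j})"
      using simple[of "y j"] by (rule order_trans[rotated])
    then have "emeasure (Rep_configuration \<xi>) {y j} - of_nat (card {i. i < j \<and> y i = y j}) = 0"
      using simple[of "y j"] by (auto simp: diff_eq_0_iff_ennreal intro: le_less_trans)
    then have "(\<Prod>j<k. emeasure (Rep_configuration \<xi>) {y j} - of_nat (card {i. i < j \<and> y i = y j})) = 0"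
      using ij(2) by (intro prod_zero) auto
    then show ?thesis using False by simp
  qed
qed

lemma measurable_sum_over_tuples_simple:
  fixes k :: nat
  assumes \<phi>: "\<phi> \<in> borel_measurable (\<Pi>\<^sub>M j\<in>{..<k}. lborel :: 'a::euclidean_space measure)"
  shows "(\<lambda>\<xi>. \<integral>\<^sup>+y. (\<Prod>j<k. emeasure (Rep_configuration \<xi>) {y j}) * (\<phi> y * of_bool (inj_on y {..<k})) \<partial>count_space ({..<k} \<rightarrow>\<^sub>E UNIV))
    \<in> borel_measurable borel"
proof -
  let ?M = "\<Pi>\<^sub>M j\<in>{..<k}. borel :: 'a measure"
  have [measurable]: "\<phi> \<in> borel_measurable ?M"
    using \<phi> by (simp cong: measurable_cong_sets add: sets_PiM_cong[OF refl sets_lborel])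
  have "Measurable.pred ?M (\<lambda>y. y i - y j = 0 \<longrightarrow> i = j)" if "i \<in> {..<k}" "j \<in> {..<k}" for i j
    using that by measurable
  then have "Measurable.pred ?M (\<lambda>y. \<forall>i\<in>{..<k}. \<forall>j\<in>{..<k}. y i - y j = 0 \<longrightarrow> i = j)"
    by (intro pred_intros_finite) auto
  then have [measurable]: "Measurable.pred ?M (\<lambda>y. inj_on y {..<k})"
    by (simp add: inj_on_def)
  have "(\<lambda>q. \<phi> (snd q) * of_bool (inj_on (snd q) {..<k})) \<in> borel_measurable ((borel :: 'a configuration measure) \<Otimes>\<^sub>M ?M)"
    unfolding of_bool_def by measurable
  from measurable_nn_integral_tuples[OF this] show ?thesis by simp
qed

text \<open>The counterpart of \<open>sum_over_tuples\<close> on codes. Letting the flags enter as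
  factors, rather than summing over occupied slots, makes each term a continuous function of the
  code when \<open>\<phi>\<close> is continuous, and the index set independent of it.\<close>

definition slot_sum :: "nat \<Rightarrow> ((nat \<Rightarrow> 'a) \<Rightarrow> ennreal) \<Rightarrow> (nat \<times> nat \<Rightarrow> 'a::euclidean_space \<times> real) \<Rightarrow> ennreal" where
  "slot_sum k \<phi> w = (\<integral>\<^sup>+\<tau>. (\<Prod>j<k. ennreal (snd (w (\<tau> j)))) * \<phi> (\<lambda>j\<in>{..<k}. fst (w (\<tau> j))) \<partial>count_space (tuples k UNIV))"

lemma slot_sum_occupied:
  assumes w: "\<And>\<sigma>. snd (w \<sigma>) = 0 \<or> snd (w \<sigma>) = 1"
  shows "slot_sum k \<phi> w = (\<integral>\<^sup>+\<tau>. \<phi> (\<lambda>j\<in>{..<k}. fst (w (\<tau> j))) \<partial>count_space (tuples k (occupied w)))"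
proof -
  have sub: "tuples k (occupied w) \<subseteq> tuples k UNIV"
    by (auto simp: tuples_def PiE_def)
  have one: "(\<Prod>j<k. ennreal (snd (w (\<tau> j)))) = 1" if "\<tau> \<in> tuples k (occupied w)" for \<tau>
    using that by (intro prod.neutral) (auto simp: tuples_def PiE_def Pi_def occupied_def)
  have zero: "(\<Prod>j<k. ennreal (snd (w (\<tau> j)))) = 0" if "\<tau> \<in> tuples k UNIV - tuples k (occupied w)" for \<tau>
  proof -
    have "\<exists>j<k. \<tau> j \<notin> occupied w"
      using that by (auto simp: tuples_def PiE_iff)
    then obtain j where "j < k" "\<tau> j \<notin> occupied w" by blast
    then show ?thesis using w[of "\<tau> j"] by (intro prod_zero bexI[of _ j]) (auto simp: occupied_def)
  qed
  have "slot_sum k \<phi> w = (\<integral>\<^sup>+\<tau>. (\<Prod>j<k. ennreal (snd (w (\<tau> j)))) * \<phi> (\<lambda>j\<in>{..<k}. fst (w (\<tau> j))) \<partial>count_space (tuples k (occupied w)))"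
    unfolding slot_sum_def using sub zero by (intro nn_integral_count_space_eq) auto
  also have "\<dots> = (\<integral>\<^sup>+\<tau>. \<phi> (\<lambda>j\<in>{..<k}. fst (w (\<tau> j))) \<partial>count_space (tuples k (occupied w)))"
    using one by (intro nn_integral_cong) simp
  finally show ?thesis .
qed

lemma slot_sum_enc:
  "slot_sum k \<phi> (enc N p) = (\<Sum>\<sigma>\<in>tuples k {..<N}. \<phi> (\<lambda>j\<in>{..<k}. p (\<sigma> j)))"
proof -
  have bij: "bij_betw (slot p) {..<N} (slot p ` {..<N})"
    using inj_slot[of p] by (intro inj_on_imp_bij_betw) (auto intro: inj_on_subset)
  have fin: "finite (tuples k {..<N})"
    unfolding tuples_def by (rule finite_subset[OF _ finite_PiE[of "{..<k}" "\<lambda>_. {..<N}"]]) auto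
  have "slot_sum k \<phi> (enc N p) = (\<integral>\<^sup>+\<tau>. \<phi> (\<lambda>j\<in>{..<k}. fst (enc N p (\<tau> j))) \<partial>count_space (tuples k (slot p ` {..<N})))"
    unfolding occupied_enc[symmetric] by (rule slot_sum_occupied) (simp add: snd_enc)
  also have "\<dots> = (\<integral>\<^sup>+\<sigma>. \<phi> (\<lambda>j\<in>{..<k}. fst (enc N p ((\<lambda>j\<in>{..<k}. slot p (\<sigma> j)) j))) \<partial>count_space (tuples k {..<N}))"
    by (rule nn_integral_bij_count_space[OF bij_betw_tuples[OF bij], symmetric])
  also have "\<dots> = (\<integral>\<^sup>+\<sigma>. \<phi> (\<lambda>j\<in>{..<k}. p (\<sigma> j)) \<partial>count_space (tuples k {..<N}))"
  proof (rule nn_integral_cong)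
    fix \<sigma> assume "\<sigma> \<in> space (count_space (tuples k {..<N}))"
    then have "(\<lambda>j\<in>{..<k}. fst (enc N p ((\<lambda>j\<in>{..<k}. slot p (\<sigma> j)) j))) = (\<lambda>j\<in>{..<k}. p (\<sigma> j))"
      by (intro restrict_ext) (auto simp: tuples_def PiE_def Pi_def enc_slot)
    then show "\<phi> (\<lambda>j\<in>{..<k}. fst (enc N p ((\<lambda>j\<in>{..<k}. slot p (\<sigma> j)) j))) = \<phi> (\<lambda>j\<in>{..<k}. p (\<sigma> j))"
      by simp
  qed
  also have "\<dots> = (\<Sum>\<sigma>\<in>tuples k {..<N}. \<phi> (\<lambda>j\<in>{..<k}. p (\<sigma> j)))"
    by (rule nn_integral_count_space_finite[OF fin])
  finally show ?thesis .
qed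

lemma emeasure_decode_point:
  assumes w: "w \<in> admissible" and inj: "inj_on (\<lambda>\<sigma>. fst (w \<sigma>)) (occupied w)"
  shows "emeasure (Rep_configuration (decode w)) {x} = of_bool (x \<in> (\<lambda>\<sigma>. fst (w \<sigma>)) ` occupied w)"
proof -
  have "emeasure (Rep_configuration (decode w)) {x} = emeasure (count_space (occupied w)) ((\<lambda>\<sigma>. fst (w \<sigma>)) -` {x} \<inter> occupied w)"
    unfolding Rep_decode[OF w] by (subst emeasure_distr) auto
  also have "\<dots> = of_bool (x \<in> (\<lambda>\<sigma>. fst (w \<sigma>)) ` occupied w)"
  proof (cases "x \<in> (\<lambda>\<sigma>. fst (w \<sigma>)) ` occupied w")
    case True
    then obtain \<sigma> where \<sigma>: "\<sigma> \<in> occupied w" "x = fst (w \<sigma>)" by auto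
    then have "(\<lambda>\<sigma>. fst (w \<sigma>)) -` {x} \<inter> occupied w = {\<sigma>}"
      using inj by (auto simp: inj_on_def)
    then show ?thesis using True \<sigma>(1) by (simp add: emeasure_count_space)
  next
    case False
    then have "(\<lambda>\<sigma>. fst (w \<sigma>)) -` {x} \<inter> occupied w = {}" by auto
    then show ?thesis using False by simp
  qed
  finally show ?thesis .
qed

text \<open>If different slots hold different points, tuples of distinct occupied slots correspond
  to tuples of distinct locations, each of mass one.\<close>

lemma sum_over_tuples_decode:
  assumes w: "w \<in> admissible" and inj: "inj_on (\<lambda>\<sigma>. fst (w \<sigma>)) (occupied w)"
  shows "(\<integral>\<^sup>+y. (\<Prod>j<k. emeasure (Rep_configuration (decode w)) {y j}) * (\<phi> y * of_bool (inj_on y {..<k})) \<partial>count_space ({..<k} \<rightarrow>\<^sub>E UNIV)) =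
    slot_sum k \<phi> w"
proof -
  let ?f = "\<lambda>\<sigma>. fst (w \<sigma>)"
  let ?Y = "?f ` occupied w"
  have prod: "(\<Prod>j<k. emeasure (Rep_configuration (decode w)) {y j}) = of_bool (\<forall>j<k. y j \<in> ?Y)" for y
  proof (cases "\<forall>j<k. y j \<in> ?Y")
    case True
    then show ?thesis by (simp add: emeasure_decode_point[OF w inj])
  next
    case False
    then show ?thesis
      by (subst prod_zero) (auto simp: emeasure_decode_point[OF w inj])
  qed
  have bij: "bij_betw ?f (occupied w) ?Y" using inj by (rule inj_on_imp_bij_betw)
  have "(\<integral>\<^sup>+y. (\<Prod>j<k. emeasure (Rep_configuration (decode w)) {y j}) * (\<phi> y * of_bool (inj_on y {..<k})) \<partial>count_space ({..<k} \<rightarrow>\<^sub>E UNIV)) =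
      (\<integral>\<^sup>+y. (\<Prod>j<k. emeasure (Rep_configuration (decode w)) {y j}) * (\<phi> y * of_bool (inj_on y {..<k})) \<partial>count_space (tuples k ?Y))"
    unfolding prod by (rule nn_integral_count_space_eq) (auto simp: tuples_def PiE_def Pi_def)
  also have "\<dots> = (\<integral>\<^sup>+y. \<phi> y \<partial>count_space (tuples k ?Y))"
    unfolding prod by (rule nn_integral_cong) (auto simp: tuples_def PiE_def Pi_def)
  also have "\<dots> = (\<integral>\<^sup>+\<tau>. \<phi> (\<lambda>j\<in>{..<k}. ?f (\<tau> j)) \<partial>count_space (tuples k (occupied w)))"
    by (rule nn_integral_bij_count_space[OF bij_betw_tuples[OF bij], symmetric])
  also have "\<dots> = slot_sum k \<phi> w"
    by (rule slot_sum_occupied[symmetric]) (rule admissibleD(1)[OF w])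
  finally show ?thesis .
qed

lemma borel_measurable_slot_term:
  assumes \<phi>: "\<phi> \<in> borel_measurable (\<Pi>\<^sub>M j\<in>{..<k}. lborel :: 'a::euclidean_space measure)"
  shows "(\<lambda>w. (\<Prod>j<k. ennreal (snd (w (\<tau> j)))) * \<phi> (\<lambda>j\<in>{..<k}. fst (w (\<tau> j)))) \<in> borel_measurable (borel :: (nat \<times> nat \<Rightarrow> 'a \<times> real) measure)"
proof -
  have f: "(\<lambda>w::nat \<times> nat \<Rightarrow> 'a \<times> real. fst (w \<sigma>)) \<in> borel_measurable borel" for \<sigma>
    by (intro borel_measurable_continuous_onI continuous_intros continuous_on_product_coordinates)
  have s: "(\<lambda>w::nat \<times> nat \<Rightarrow> 'a \<times> real. snd (w \<sigma>)) \<in> borel_measurable borel" for \<sigma>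
    by (intro borel_measurable_continuous_onI continuous_intros continuous_on_product_coordinates)
  have "(\<lambda>w::nat \<times> nat \<Rightarrow> 'a \<times> real. \<lambda>j\<in>{..<k}. fst (w (\<tau> j))) \<in> measurable borel (\<Pi>\<^sub>M j\<in>{..<k}. lborel)"
    by (rule measurable_restrict) (simp add: f)
  from measurable_compose[OF this \<phi>] show ?thesis
    using s by (intro borel_measurable_times_ennreal borel_measurable_prod_ennreal measurable_compose[OF s measurable_ennreal]) auto
qed

lemma slot_sum_as_pair:
  assumes \<phi>: "\<phi> \<in> borel_measurable (\<Pi>\<^sub>M j\<in>{..<k}. lborel :: 'a::euclidean_space measure)"
    and L: "sets L = sets (borel :: (nat \<times> nat \<Rightarrow> 'a \<times> real) measure)"
  shows "(\<lambda>q. (\<Prod>j<k. ennreal (snd (snd q (fst q j)))) * \<phi> (\<lambda>j\<in>{..<k}. fst (snd q (fst q j)))) \<in>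
    borel_measurable (count_space (tuples k UNIV) \<Otimes>\<^sub>M L)"
proof (rule measurable_pair_measure_countable1)
  show "countable (tuples k (UNIV :: (nat \<times> nat) set))" by (rule countable_tuples) simp
  fix \<tau> :: "nat \<Rightarrow> nat \<times> nat"
  show "(\<lambda>w. (\<Prod>j<k. ennreal (snd (snd (\<tau>, w) (fst (\<tau>, w) j)))) * \<phi> (\<lambda>j\<in>{..<k}. fst (snd (\<tau>, w) (fst (\<tau>, w) j)))) \<in> borel_measurable L"
    using borel_measurable_slot_term[OF \<phi>, of \<tau>] by (simp cong: measurable_cong_sets add: L)
qed

lemma borel_measurable_slot_sum:
  assumes \<phi>: "\<phi> \<in> borel_measurable (\<Pi>\<^sub>M j\<in>{..<k}. lborel :: 'a::euclidean_space measure)"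
    and L: "sets L = sets (borel :: (nat \<times> nat \<Rightarrow> 'a \<times> real) measure)"
  shows "slot_sum k \<phi> \<in> borel_measurable L"
proof -
  interpret T: sigma_finite_measure "count_space (tuples k (UNIV :: (nat \<times> nat) set))"
    by (rule sigma_finite_measure_count_space_countable) (rule countable_tuples, simp)
  have "(\<lambda>(w, \<tau>). (\<Prod>j<k. ennreal (snd (w (\<tau> j)))) * \<phi> (\<lambda>j\<in>{..<k}. fst (w (\<tau> j)))) \<in> borel_measurable (L \<Otimes>\<^sub>M count_space (tuples k UNIV))"
    using measurable_pair_swap[OF slot_sum_as_pair[OF \<phi> L]] by (simp add: split_beta')
  from T.borel_measurable_nn_integral[OF this] show ?thesis
    unfolding slot_sum_def .
qed

lemma nn_integral_slot_sum:
  assumes \<phi>: "\<phi> \<in> borel_measurable (\<Pi>\<^sub>M j\<in>{..<k}. lborel :: 'a::euclidean_space measure)"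
    and L: "sets L = sets (borel :: (nat \<times> nat \<Rightarrow> 'a \<times> real) measure)" "prob_space L"
  shows "(\<integral>\<^sup>+w. slot_sum k \<phi> w \<partial>L) =
    (\<integral>\<^sup>+q. (\<Prod>j<k. ennreal (snd (snd q (fst q j)))) * \<phi> (\<lambda>j\<in>{..<k}. fst (snd q (fst q j))) \<partial>(count_space (tuples k UNIV) \<Otimes>\<^sub>M L))"
proof -
  interpret L: prob_space L by fact
  interpret T: sigma_finite_measure "count_space (tuples k (UNIV :: (nat \<times> nat) set))"
    by (rule sigma_finite_measure_count_space_countable) (rule countable_tuples, simp)
  interpret pair_sigma_finite "count_space (tuples k (UNIV :: (nat \<times> nat) set))" L ..
  show ?thesis
    unfolding slot_sum_def using nn_integral_snd[OF slot_sum_as_pair[OF \<phi> L(1)]] by simp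
qed

section \<open>Factorial moment measures\<close>

text \<open>Embeds the functions on \<open>{..<k}\<close>, which carry the product measure, into all
  sequences, which carry the product topology; test functions are continuous on the latter.\<close>

definition pad :: "nat \<Rightarrow> (nat \<Rightarrow> 'a::euclidean_space) \<Rightarrow> nat \<Rightarrow> 'a" where
  "pad k z j = (if j < k then z j else 0)"

text \<open>After padding, a continuous function squeezed between the indicators of
  \<open>polyball k R\<close> and \<open>polyball k (R + 1)\<close>.\<close>

definition cutoff :: "real \<Rightarrow> nat \<Rightarrow> (nat \<Rightarrow> 'a::euclidean_space) \<Rightarrow> real" where
  "cutoff R k v = (\<Prod>j<k. max 0 (min 1 (R + 1 - norm (v j))))"

definition polyball :: "nat \<Rightarrow> real \<Rightarrow> (nat \<Rightarrow> 'a::euclidean_space) set" where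
  "polyball k R = {..<k} \<rightarrow>\<^sub>E ball 0 R"

lemma continuous_on_cutoff: "continuous_on UNIV (cutoff R k)"
  unfolding cutoff_def by (intro continuous_intros continuous_on_product_coordinates)

lemma cutoff_nonneg: "0 \<le> cutoff R k v"
  unfolding cutoff_def by (intro prod_nonneg) auto

lemma cutoff_le_one: "cutoff R k v \<le> 1"
  unfolding cutoff_def by (intro prod_le_1) auto

lemma cutoff_support:
  assumes "cutoff R k v \<noteq> 0" "j < k"
  shows "v j \<in> ball 0 (R + 1)"
proof (rule ccontr)
  assume "v j \<notin> ball 0 (R + 1)"
  then have "max 0 (min 1 (R + 1 - norm (v j))) = 0" by simp
  then have "cutoff R k v = 0"
    unfolding cutoff_def using assms(2) by (intro prod_zero bexI[of _ j]) simp_all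
  with assms(1) show False by simp
qed

lemma cutoff_pad_eq_one: "z \<in> polyball k R \<Longrightarrow> cutoff R k (pad k z) = 1"
  unfolding cutoff_def polyball_def by (intro prod.neutral) (auto simp: pad_def PiE_def Pi_def)

lemma polyball_sets [measurable]: "polyball k R \<in> sets (\<Pi>\<^sub>M j\<in>{..<k}. lborel :: 'a::euclidean_space measure)"
  unfolding polyball_def by (intro sets_PiM_I_finite) auto

lemma pad_measurable [measurable]:
  "pad k \<in> measurable (\<Pi>\<^sub>M j\<in>{..<k}. lborel :: 'a::euclidean_space measure) (borel :: (nat \<Rightarrow> 'a) measure)"
proof -
  have "pad k \<in> measurable (\<Pi>\<^sub>M j\<in>{..<k}. lborel :: 'a measure) (\<Pi>\<^sub>M j\<in>UNIV. borel :: 'a measure)"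
  proof (rule measurable_PiM_single')
    fix i :: nat
    show "(\<lambda>z. pad k z i) \<in> measurable (\<Pi>\<^sub>M j\<in>{..<k}. lborel :: 'a measure) borel"
      unfolding pad_def by (cases "i < k") simp_all
  qed simp
  then show ?thesis by (simp cong: measurable_cong_sets add: sets_PiM_equal_borel)
qed

lemma emeasure_polyball_finite: "emeasure (\<Pi>\<^sub>M j\<in>{..<k}. lborel :: 'a::euclidean_space measure) (polyball k R) < \<infinity>"
proof -
  interpret product_sigma_finite "\<lambda>_::nat. lborel :: 'a measure" by standard
  have "emeasure (\<Pi>\<^sub>M j\<in>{..<k}. lborel :: 'a measure) (polyball k R) = (\<Prod>j<k. emeasure lborel (ball (0::'a) R))"
    unfolding polyball_def by (rule emeasure_PiM) auto
  also have "\<dots> < \<infinity>"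
    using emeasure_lborel_ball_finite[of "0::'a" R] by (simp add: power_less_top_ennreal)
  finally show ?thesis .
qed

lemma cutoff_le_indicator:
  fixes z :: "nat \<Rightarrow> 'a::euclidean_space"
  assumes z: "z \<in> space (\<Pi>\<^sub>M j\<in>{..<k}. lborel :: 'a measure)"
  shows "ennreal (cutoff R k (pad k z)) \<le> indicator (polyball k (R + 1)) z"
proof (cases "cutoff R k (pad k z) = 0")
  case False
  then have "z \<in> polyball k (R + 1)"
    using cutoff_support[OF False] z by (auto simp: polyball_def pad_def space_PiM PiE_def)
  then show ?thesis using cutoff_le_one[of R k "pad k z"] by simp
qed simp

text \<open>The law of the codes of a limit process. The bound says that all correlation functions
  are locally bounded, in the weak form that passes to the limit: for continuous test functions,
  with a constant depending on the order and the radius.\<close>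

locale encoded_process =
  fixes L :: "(nat \<times> nat \<Rightarrow> 'a::euclidean_space \<times> real) measure"
  assumes prob_L: "prob_space L" and sets_L: "sets L = sets borel"
    and AE_admissible: "AE w in L. w \<in> admissible"
    and bound: "\<And>k R. 1 \<le> k \<Longrightarrow> 0 < R \<Longrightarrow> \<exists>C::real. \<forall>\<Phi> :: (nat \<Rightarrow> 'a) \<Rightarrow> real. continuous_on UNIV \<Phi> \<longrightarrow> (\<forall>v. 0 \<le> \<Phi> v) \<longrightarrow>
      (\<forall>v. \<Phi> v \<noteq> 0 \<longrightarrow> (\<forall>j<k. v j \<in> ball 0 R)) \<longrightarrow>
      (\<integral>\<^sup>+w. slot_sum k (\<lambda>z. ennreal (\<Phi> (pad k z))) w \<partial>L) \<le> ennreal C * (\<integral>\<^sup>+z. ennreal (\<Phi> (pad k z)) \<partial>(\<Pi>\<^sub>M j\<in>{..<k}. lborel))"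
begin

sublocale L: prob_space L by (rule prob_L)

sublocale product: product_sigma_finite "\<lambda>_::nat. lborel :: 'a measure" by standard

abbreviation "Leb (k::nat) \<equiv> (\<Pi>\<^sub>M j\<in>{..<k}. lborel :: 'a measure)"

text \<open>Built from tuples of distinct slots and not from the decoded configuration, so that it
  is available before the points are known to be distinct. The identification with sums over tuples
  of points is \<open>nn_integral_sum_over_tuples_law\<close>.\<close>

definition factorial_moment :: "nat \<Rightarrow> (nat \<Rightarrow> 'a) measure" where
  "factorial_moment k = distr (density (count_space (tuples k UNIV) \<Otimes>\<^sub>M L) (\<lambda>q. \<Prod>j<k. ennreal (snd (snd q (fst q j)))))
     (Leb k) (\<lambda>q. \<lambda>j\<in>{..<k}. fst (snd q (fst q j)))"

lemma sets_factorial_moment [simp, measurable_cong]: "sets (factorial_moment k) = sets (Leb k)"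
  by (simp add: factorial_moment_def)

lemma space_factorial_moment [simp]: "space (factorial_moment k) = space (Leb k)"
  by (simp add: factorial_moment_def)

lemma nn_integral_factorial_moment:
  assumes \<phi>: "\<phi> \<in> borel_measurable (Leb k)"
  shows "(\<integral>\<^sup>+z. \<phi> z \<partial>factorial_moment k) = (\<integral>\<^sup>+w. slot_sum k \<phi> w \<partial>L)"
proof -
  let ?Q = "count_space (tuples k (UNIV :: (nat \<times> nat) set)) \<Otimes>\<^sub>M L"
  have ct: "countable (tuples k (UNIV :: (nat \<times> nat) set))" by (rule countable_tuples) simp
  have f: "(\<lambda>w. fst (w \<sigma>)) \<in> measurable L borel" and s: "(\<lambda>w. snd (w \<sigma>)) \<in> measurable L borel" for \<sigma>
  proof -
    have "(\<lambda>w::nat \<times> nat \<Rightarrow> 'a \<times> real. fst (w \<sigma>)) \<in> borel_measurable borel"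
        "(\<lambda>w::nat \<times> nat \<Rightarrow> 'a \<times> real. snd (w \<sigma>)) \<in> borel_measurable borel"
      by (intro borel_measurable_continuous_onI continuous_intros continuous_on_product_coordinates)+
    then show "(\<lambda>w. fst (w \<sigma>)) \<in> measurable L borel" "(\<lambda>w. snd (w \<sigma>)) \<in> measurable L borel"
      by (simp_all cong: measurable_cong_sets add: sets_L)
  qed
  have m1: "(\<lambda>q. \<lambda>j\<in>{..<k}. fst (snd q (fst q j))) \<in> measurable ?Q (Leb k)"
  proof (rule measurable_pair_measure_countable1[OF ct])
    fix \<tau> :: "nat \<Rightarrow> nat \<times> nat"
    show "(\<lambda>w. \<lambda>j\<in>{..<k}. fst (snd (\<tau>, w) (fst (\<tau>, w) j))) \<in> measurable L (Leb k)"
      by (rule measurable_restrict) (simp add: f)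
  qed
  have m2: "(\<lambda>q. \<Prod>j<k. ennreal (snd (snd q (fst q j)))) \<in> borel_measurable ?Q"
  proof (rule measurable_pair_measure_countable1[OF ct])
    fix \<tau> :: "nat \<Rightarrow> nat \<times> nat"
    show "(\<lambda>w. \<Prod>j<k. ennreal (snd (snd (\<tau>, w) (fst (\<tau>, w) j)))) \<in> borel_measurable L"
      by (intro borel_measurable_prod_ennreal measurable_compose[OF _ measurable_ennreal]) (simp add: s)
  qed
  have "(\<integral>\<^sup>+z. \<phi> z \<partial>factorial_moment k) =
      (\<integral>\<^sup>+q. \<phi> (\<lambda>j\<in>{..<k}. fst (snd q (fst q j))) \<partial>density ?Q (\<lambda>q. \<Prod>j<k. ennreal (snd (snd q (fst q j)))))"
    unfolding factorial_moment_def using m1 \<phi> by (subst nn_integral_distr) auto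
  also have "\<dots> = (\<integral>\<^sup>+q. (\<Prod>j<k. ennreal (snd (snd q (fst q j)))) * \<phi> (\<lambda>j\<in>{..<k}. fst (snd q (fst q j))) \<partial>?Q)"
    by (rule nn_integral_density[OF m2 measurable_compose[OF m1 \<phi>]])
  also have "\<dots> = (\<integral>\<^sup>+w. slot_sum k \<phi> w \<partial>L)"
    by (rule nn_integral_slot_sum[OF \<phi> sets_L prob_L, symmetric])
  finally show ?thesis .
qed

lemma ex_test_bound:
  assumes k: "1 \<le> k" and R: "0 \<le> R"
  shows "\<exists>C::real. \<forall>\<Phi> :: (nat \<Rightarrow> 'a) \<Rightarrow> real. continuous_on UNIV \<Phi> \<longrightarrow> (\<forall>v. 0 \<le> \<Phi> v) \<longrightarrow>
    (\<integral>\<^sup>+z. ennreal (\<Phi> (pad k z) * cutoff R k (pad k z)) \<partial>factorial_moment k) \<le>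
      ennreal C * (\<integral>\<^sup>+z. ennreal (\<Phi> (pad k z) * cutoff R k (pad k z)) \<partial>Leb k)"
proof -
  obtain C :: real where C: "\<And>\<Phi> :: (nat \<Rightarrow> 'a) \<Rightarrow> real. continuous_on UNIV \<Phi> \<Longrightarrow> (\<forall>v. 0 \<le> \<Phi> v) \<Longrightarrow>
      (\<forall>v. \<Phi> v \<noteq> 0 \<longrightarrow> (\<forall>j<k. v j \<in> ball 0 (R + 1))) \<Longrightarrow>
      (\<integral>\<^sup>+w. slot_sum k (\<lambda>z. ennreal (\<Phi> (pad k z))) w \<partial>L) \<le> ennreal C * (\<integral>\<^sup>+z. ennreal (\<Phi> (pad k z)) \<partial>Leb k)"
    using bound[OF k, of "R + 1"] R by auto
  show ?thesis
  proof (intro exI allI impI)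
    fix \<Phi> :: "(nat \<Rightarrow> 'a) \<Rightarrow> real" assume \<Phi>: "continuous_on UNIV \<Phi>" "\<forall>v. 0 \<le> \<Phi> v"
    let ?\<Psi> = "\<lambda>v. \<Phi> v * cutoff R k v"
    have c: "continuous_on UNIV ?\<Psi>"
      by (intro continuous_on_mult \<Phi> continuous_on_cutoff)
    have "(\<lambda>v. ennreal (?\<Psi> v)) \<in> borel_measurable borel"
      using borel_measurable_continuous_onI[OF c] by simp
    then have m: "(\<lambda>z. ennreal (?\<Psi> (pad k z))) \<in> borel_measurable (Leb k)"
      by (rule measurable_compose[OF pad_measurable])
    show "(\<integral>\<^sup>+z. ennreal (?\<Psi> (pad k z)) \<partial>factorial_moment k) \<le> ennreal C * (\<integral>\<^sup>+z. ennreal (?\<Psi> (pad k z)) \<partial>Leb k)"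
      unfolding nn_integral_factorial_moment[OF m]
    proof (rule C[OF c])
      show "\<forall>v. 0 \<le> ?\<Psi> v" using \<Phi>(2) cutoff_nonneg by (intro allI mult_nonneg_nonneg) blast+
      show "\<forall>v. ?\<Psi> v \<noteq> 0 \<longrightarrow> (\<forall>j<k. v j \<in> ball 0 (R + 1))"
        using cutoff_support by (metis mult_zero_right)
    qed
  qed
qed

lemma factorial_moment_polyball_finite:
  assumes k: "1 \<le> k" and R: "0 \<le> R"
  shows "emeasure (factorial_moment k) (polyball k R) < \<infinity>"
proof -
  obtain C where C: "\<And>\<Phi> :: (nat \<Rightarrow> 'a) \<Rightarrow> real. continuous_on UNIV \<Phi> \<Longrightarrow> (\<forall>v. 0 \<le> \<Phi> v) \<Longrightarrow>
    (\<integral>\<^sup>+z. ennreal (\<Phi> (pad k z) * cutoff R k (pad k z)) \<partial>factorial_moment k) \<le>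
      ennreal C * (\<integral>\<^sup>+z. ennreal (\<Phi> (pad k z) * cutoff R k (pad k z)) \<partial>Leb k)"
    using ex_test_bound[OF k R] by blast
  have "emeasure (factorial_moment k) (polyball k R) = (\<integral>\<^sup>+z. indicator (polyball k R) z \<partial>factorial_moment k)"
    by simp
  also have "\<dots> \<le> (\<integral>\<^sup>+z. ennreal (1 * cutoff R k (pad k z)) \<partial>factorial_moment k)"
    by (intro nn_integral_mono) (auto simp: indicator_def cutoff_pad_eq_one)
  also have "\<dots> \<le> ennreal C * (\<integral>\<^sup>+z. ennreal (1 * cutoff R k (pad k z)) \<partial>Leb k)"
    by (rule C) auto
  also have "(\<integral>\<^sup>+z. ennreal (1 * cutoff R k (pad k z)) \<partial>Leb k) \<le> (\<integral>\<^sup>+z. indicator (polyball k (R + 1)) z \<partial>Leb k)"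
    by (intro nn_integral_mono) (simp add: cutoff_le_indicator)
  also have "(\<integral>\<^sup>+z. indicator (polyball k (R + 1)) z \<partial>Leb k) = emeasure (Leb k) (polyball k (R + 1))"
    by simp
  finally have "emeasure (factorial_moment k) (polyball k R) \<le> ennreal C * emeasure (Leb k) (polyball k (R + 1))"
    by (simp add: mult_left_mono)
  also have "\<dots> < \<infinity>"
    using emeasure_polyball_finite[of k "R + 1", where 'a='a] by (simp add: ennreal_mult_less_top)
  finally show ?thesis .
qed

lemma restrict_measurable:
  "(\<lambda>v. restrict v {..<k}) \<in> measurable (borel :: (nat \<Rightarrow> 'a) measure) (Leb k)"
  by (rule measurable_restrict) (simp add: borel_measurable_continuous_onI continuous_on_product_coordinates)

lemma restrict_pad: "z \<in> space (Leb k) \<Longrightarrow> restrict (pad k z) {..<k} = z"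
  by (auto simp: space_PiM pad_def PiE_def extensional_def fun_eq_iff)

text \<open>Only continuous test functions pass to the limit, so inner regularity is needed to compare
  the factorial moment measures with the Lebesgue measure.\<close>

lemma factorial_moment_null_bounded:
  assumes k: "1 \<le> k" and R: "0 \<le> R" and A: "A \<in> sets (Leb k)" "A \<subseteq> polyball k R" and null: "emeasure (Leb k) A = 0"
  shows "emeasure (factorial_moment k) A = 0"
proof -
  obtain C where C: "\<And>\<Phi> :: (nat \<Rightarrow> 'a) \<Rightarrow> real. continuous_on UNIV \<Phi> \<Longrightarrow> (\<forall>v. 0 \<le> \<Phi> v) \<Longrightarrow>
    (\<integral>\<^sup>+z. ennreal (\<Phi> (pad k z) * cutoff R k (pad k z)) \<partial>factorial_moment k) \<le>
      ennreal C * (\<integral>\<^sup>+z. ennreal (\<Phi> (pad k z) * cutoff R k (pad k z)) \<partial>Leb k)"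
    using ex_test_bound[OF k R] by blast
  \<comment> \<open>Restricted to a polyball the factorial moment measure is finite; transported to
    the space of sequences it is a finite Borel measure and hence inner regular with respect to
    compact sets.\<close>
  define \<beta> where "\<beta> = distr (density (factorial_moment k) (indicator (polyball k R))) (borel :: (nat \<Rightarrow> 'a) measure) (pad k)"
  have em: "emeasure \<beta> B = emeasure (factorial_moment k) (polyball k R \<inter> (pad k -` B \<inter> space (Leb k)))" if B: "B \<in> sets borel" for B
  proof -
    have pB: "pad k -` B \<inter> space (Leb k) \<in> sets (Leb k)"
      using measurable_sets[OF pad_measurable B] .
    have "emeasure \<beta> B = emeasure (density (factorial_moment k) (indicator (polyball k R))) (pad k -` B \<inter> space (Leb k))"
      unfolding \<beta>_def using B by (subst emeasure_distr) (auto cong: measurable_cong_sets)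
    also have "\<dots> = (\<integral>\<^sup>+z. indicator (polyball k R) z * indicator (pad k -` B \<inter> space (Leb k)) z \<partial>factorial_moment k)"
      using pB by (intro emeasure_density) auto
    also have "\<dots> = (\<integral>\<^sup>+z. indicator (polyball k R \<inter> (pad k -` B \<inter> space (Leb k))) z \<partial>factorial_moment k)"
      by (intro nn_integral_cong) (auto simp: indicator_def)
    finally show ?thesis using pB by simp
  qed
  have \<beta>_finite: "emeasure \<beta> (space \<beta>) \<noteq> \<infinity>"
  proof -
    have "emeasure \<beta> (space \<beta>) \<le> emeasure (factorial_moment k) (polyball k R)"
      using em[of UNIV] by (auto simp: \<beta>_def intro!: emeasure_mono)
    then show ?thesis using factorial_moment_polyball_finite[OF k R] by (auto simp: top_unique)
  qed
  \<comment> \<open>A Borel set of sequences whose preimage under padding is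
    \<open>A\<close>.\<close>
  define B where "B = (\<lambda>v. restrict v {..<k}) -` A"
  have B: "B \<in> sets borel"
    using measurable_sets[OF restrict_measurable A(1)] by (simp add: B_def)
  have pad_B: "pad k z \<in> B \<longleftrightarrow> z \<in> A" if "z \<in> space (Leb k)" for z
    using restrict_pad[OF that] by (simp add: B_def)
  have A_space: "A \<subseteq> space (Leb k)" using A(1) by (rule sets.sets_into_space)
  have "emeasure \<beta> K = 0" if K: "K \<subseteq> B" "compact K" for K
  proof (cases "K = {}")
    case False
    have clK: "closed K" using K(2) by (rule compact_imp_closed)
    \<comment> \<open>Continuous functions decreasing to the indicator of \<open>K\<close>. The
      bound for each of them gives in the limit that the mass of \<open>K\<close> is at most a
      multiple of a Lebesgue measure, and this vanishes because \<open>K\<close> lies in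
      \<open>B\<close>.\<close>
    define \<Phi> where "\<Phi> n v = max 0 (1 - real n * infdist v K)" for n and v :: "nat \<Rightarrow> 'a"
    have \<Phi>_cont: "continuous_on UNIV (\<Phi> n)" for n
      unfolding \<Phi>_def by (intro continuous_intros)
    have \<Phi>_lim: "(\<lambda>n. \<Phi> n v) \<longlonglongrightarrow> of_bool (v \<in> K)" for v
    proof (cases "v \<in> K")
      case True
      then show ?thesis by (simp add: \<Phi>_def)
    next
      case F: False
      then have pos: "0 < infdist v K"
        using in_closed_iff_infdist_zero[OF clK False, of v] infdist_nonneg[of v K] by auto
      then obtain n0 where n0: "1 < real n0 * infdist v K"
        using reals_Archimedean3 by blast
      have "\<Phi> n v = 0" if "n \<ge> n0" for n
      proof -
        have "real n0 * infdist v K \<le> real n * infdist v K"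
          using that pos by (intro mult_right_mono) auto
        then show ?thesis using n0 by (simp add: \<Phi>_def)
      qed
      then have "\<forall>\<^sub>F n in sequentially. \<Phi> n v = of_bool (v \<in> K)"
        using F by (auto simp: eventually_sequentially)
      then show ?thesis by (rule tendsto_eventually)
    qed
    have \<Phi>_meas: "(\<lambda>z. ennreal (\<Phi> n (pad k z) * cutoff R k (pad k z))) \<in> borel_measurable (Leb k)" for n
    proof -
      have "continuous_on UNIV (\<lambda>v. \<Phi> n v * cutoff R k v)"
        by (intro continuous_on_mult \<Phi>_cont continuous_on_cutoff)
      from borel_measurable_continuous_onI[OF this]
      have "(\<lambda>v. ennreal (\<Phi> n v * cutoff R k v)) \<in> borel_measurable borel" by simp
      then show ?thesis by (rule measurable_compose[OF pad_measurable])
    qed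
    have le: "emeasure \<beta> K \<le> ennreal C * (\<integral>\<^sup>+z. ennreal (\<Phi> n (pad k z) * cutoff R k (pad k z)) \<partial>Leb k)" for n
    proof -
      have Kb: "K \<in> sets borel" using clK by simp
      have pK: "polyball k R \<inter> (pad k -` K \<inter> space (Leb k)) \<in> sets (factorial_moment k)"
        using measurable_sets[OF pad_measurable Kb] by auto
      have "emeasure \<beta> K = (\<integral>\<^sup>+z. indicator (polyball k R \<inter> (pad k -` K \<inter> space (Leb k))) z \<partial>factorial_moment k)"
        using em[OF Kb] pK by simp
      also have "\<dots> \<le> (\<integral>\<^sup>+z. ennreal (\<Phi> n (pad k z) * cutoff R k (pad k z)) \<partial>factorial_moment k)"
        by (intro nn_integral_mono) (auto simp: indicator_def cutoff_pad_eq_one \<Phi>_def)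
      also have "\<dots> \<le> ennreal C * (\<integral>\<^sup>+z. ennreal (\<Phi> n (pad k z) * cutoff R k (pad k z)) \<partial>Leb k)"
        by (rule C[OF \<Phi>_cont]) (simp add: \<Phi>_def)
      finally show ?thesis .
    qed
    have "(\<lambda>n. \<integral>\<^sup>+z. ennreal (\<Phi> n (pad k z) * cutoff R k (pad k z)) \<partial>Leb k) \<longlonglongrightarrow>
        (\<integral>\<^sup>+z. ennreal (of_bool (pad k z \<in> K) * cutoff R k (pad k z)) \<partial>Leb k)"
    proof (rule nn_integral_dominated_convergence[where w="indicator (polyball k (R + 1))"])
      show "(\<lambda>z. ennreal (of_bool (pad k z \<in> K) * cutoff R k (pad k z))) \<in> borel_measurable (Leb k)"
      proof -
        have [measurable]: "K \<in> sets borel" "cutoff R k \<in> borel_measurable (borel :: (nat \<Rightarrow> 'a) measure)"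
          using clK by (auto intro: borel_measurable_continuous_onI continuous_on_cutoff)
        have "(\<lambda>v. ennreal (of_bool (v \<in> K) * cutoff R k v)) \<in> borel_measurable borel"
          unfolding of_bool_def by measurable
        then show ?thesis by (rule measurable_compose[OF pad_measurable])
      qed
      show "(\<integral>\<^sup>+z. indicator (polyball k (R + 1)) z \<partial>Leb k) < \<infinity>"
        using emeasure_polyball_finite[of k "R + 1", where 'a='a] by simp
      show "AE z in Leb k. ennreal (\<Phi> n (pad k z) * cutoff R k (pad k z)) \<le> indicator (polyball k (R + 1)) z" for n
      proof (rule AE_I2)
        fix z assume z: "z \<in> space (Leb k)"
        have "\<Phi> n (pad k z) * cutoff R k (pad k z) \<le> cutoff R k (pad k z)"
          using cutoff_nonneg[of R k "pad k z"]
          by (intro mult_left_le_one_le) (auto simp: \<Phi>_def infdist_nonneg)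
        then show "ennreal (\<Phi> n (pad k z) * cutoff R k (pad k z)) \<le> indicator (polyball k (R + 1)) z"
          using cutoff_le_indicator[OF z, of R] by (blast intro: order_trans ennreal_leI)
      qed
      show "AE z in Leb k. (\<lambda>n. ennreal (\<Phi> n (pad k z) * cutoff R k (pad k z))) \<longlonglongrightarrow>
          ennreal (of_bool (pad k z \<in> K) * cutoff R k (pad k z))"
        by (intro AE_I2 tendsto_ennrealI tendsto_mult_right \<Phi>_lim)
    qed (use \<Phi>_meas in auto)
    moreover have "(\<integral>\<^sup>+z. ennreal (of_bool (pad k z \<in> K) * cutoff R k (pad k z)) \<partial>Leb k) = 0"
    proof -
      have "AE z in Leb k. z \<notin> A" using A(1) null by (intro AE_not_in) auto
      then have "AE z in Leb k. ennreal (of_bool (pad k z \<in> K) * cutoff R k (pad k z)) = 0"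
        by (rule AE_mp) (use K(1) pad_B in \<open>auto intro!: AE_I2\<close>)
      then show ?thesis by (subst nn_integral_cong_AE) auto
    qed
    ultimately have lim0: "(\<lambda>n. ennreal C * (\<integral>\<^sup>+z. ennreal (\<Phi> n (pad k z) * cutoff R k (pad k z)) \<partial>Leb k)) \<longlonglongrightarrow> ennreal C * 0"
      by (intro ennreal_tendsto_cmult) auto
    have "emeasure \<beta> K \<le> ennreal C * 0"
      by (rule LIMSEQ_le_const[OF lim0]) (use le in blast)
    then show ?thesis by simp
  qed simp
  then have "(SUP K \<in> {K. K \<subseteq> B \<and> compact K}. emeasure \<beta> K) = 0"
    by (auto simp: SUP_eq_iff bot_ennreal intro!: SUP_eqI)
  then have "emeasure \<beta> B = 0"
    using inner_regular[of \<beta> B] \<beta>_finite B by (simp add: \<beta>_def)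
  moreover have "polyball k R \<inter> (pad k -` B \<inter> space (Leb k)) = A"
    using A(2) A_space pad_B by auto
  ultimately show ?thesis using em[OF B] by simp
qed

lemma space_eq_polyballs: "space (Leb k) = (\<Union>n. polyball k (real n))"
proof
  show "space (Leb k) \<subseteq> (\<Union>n. polyball k (real n))"
  proof
    fix z assume z: "z \<in> space (Leb k)"
    obtain n where n: "Max (insert 0 ((\<lambda>j. norm (z j)) ` {..<k})) < real n"
      using reals_Archimedean2 by blast
    have "norm (z j) < real n" if "j < k" for j
      by (rule le_less_trans[OF Max_ge n]) (use that in auto)
    then show "z \<in> (\<Union>n. polyball k (real n))"
      using z by (auto simp: polyball_def space_PiM PiE_def Pi_def)
  qed
qed (auto simp: polyball_def space_PiM)

lemma absolutely_continuous_factorial_moment: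
  assumes k: "1 \<le> k"
  shows "absolutely_continuous (Leb k) (factorial_moment k)"
  unfolding absolutely_continuous_def
proof
  fix A assume A: "A \<in> null_sets (Leb k)"
  have "A \<inter> polyball k (real n) \<in> null_sets (factorial_moment k)" for n
  proof (rule null_setsI)
    have "emeasure (Leb k) (A \<inter> polyball k (real n)) \<le> emeasure (Leb k) A"
      using A by (intro emeasure_mono) auto
    then have "emeasure (Leb k) (A \<inter> polyball k (real n)) = 0" using A by (simp add: null_setsD1)
    then show "emeasure (factorial_moment k) (A \<inter> polyball k (real n)) = 0"
      using A by (intro factorial_moment_null_bounded[OF k, where R="real n"]) auto
  qed (use A in auto)
  then have "(\<Union>n. A \<inter> polyball k (real n)) \<in> null_sets (factorial_moment k)"
    by (rule null_sets_UN)
  moreover have "(\<Union>n. A \<inter> polyball k (real n)) = A"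
    using null_setsD2[OF A, THEN sets.sets_into_space] space_eq_polyballs[of k] by blast
  ultimately show "A \<in> null_sets (factorial_moment k)" by simp
qed

lemma sigma_finite_factorial_moment:
  assumes k: "1 \<le> k"
  shows "sigma_finite_measure (factorial_moment k)"
proof
  show "\<exists>A. countable A \<and> A \<subseteq> sets (factorial_moment k) \<and> \<Union>A = space (factorial_moment k) \<and>
      (\<forall>a\<in>A. emeasure (factorial_moment k) a \<noteq> \<infinity>)"
  proof (intro exI[of _ "range (\<lambda>n. polyball k (real n))"] conjI ballI)
    fix a assume "a \<in> range (\<lambda>n. polyball k (real n) :: (nat \<Rightarrow> 'a) set)"
    then show "emeasure (factorial_moment k) a \<noteq> \<infinity>"
      using factorial_moment_polyball_finite[OF k] by (auto simp: less_top)
  qed (use space_eq_polyballs in auto)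
qed

text \<open>The diagonal is a Lebesgue null set, hence a null set of the second factorial moment
  measure, whose mass of the diagonal is the expected number of pairs of distinct slots with the
  same point.\<close>

lemma AE_inj: "AE w in L. inj_on (\<lambda>\<sigma>. fst (w \<sigma>)) (occupied w)"
proof -
  let ?D = "{z \<in> space (Leb 2). z 0 - z 1 = 0}"
  have "(\<lambda>z. z 0 - z 1) \<in> borel_measurable (Leb 2)"
    by (intro borel_measurable_diff measurable_component_singleton[THEN measurable_compose, where g="\<lambda>x. x"]) simp_all
  from measurable_sets[OF this, of "{0}"] have D: "?D \<in> sets (Leb 2)"
    by (simp add: vimage_def Int_def conj_commute)
  have "emeasure (Leb 2) ?D = (\<integral>\<^sup>+z. indicator ?D z \<partial>Leb 2)"
    using D by simp
  also have "\<dots> = (\<integral>\<^sup>+x. (\<integral>\<^sup>+y. indicator ?D (x(1 := y)) \<partial>lborel) \<partial>(\<Pi>\<^sub>M j\<in>{0::nat}. lborel :: 'a measure))"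
  proof -
    have e: "{..<2::nat} = insert 1 {0}" by auto
    show ?thesis using D unfolding e by (intro product.product_nn_integral_insert) auto
  qed
  also have "\<dots> = (\<integral>\<^sup>+x. 0 \<partial>(\<Pi>\<^sub>M j\<in>{0::nat}. lborel :: 'a measure))"
  proof (rule nn_integral_cong)
    fix x :: "nat \<Rightarrow> 'a"
    have "AE y in lborel. indicator ?D (x(1 := y)) = (0::ennreal)"
      using AE_lborel_singleton[of "x 0"] by eventually_elim (auto simp: indicator_def)
    then show "(\<integral>\<^sup>+y. indicator ?D (x(1 := y)) \<partial>lborel) = 0"
      by (subst nn_integral_cong_AE[where v="\<lambda>_. 0"]) auto
  qed
  finally have "?D \<in> null_sets (Leb 2)" using D by (intro null_setsI) auto
  then have "?D \<in> null_sets (factorial_moment 2)"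
    using absolutely_continuous_factorial_moment[of 2] by (auto simp: absolutely_continuous_def)
  then have "(\<integral>\<^sup>+z. indicator ?D z \<partial>factorial_moment 2) = 0"
    using D by (simp add: null_setsD1)
  then have "(\<integral>\<^sup>+w. slot_sum 2 (indicator ?D) w \<partial>L) = 0"
    using D by (subst (asm) nn_integral_factorial_moment) auto
  then have "AE w in L. slot_sum 2 (indicator ?D) w = 0"
    using D by (subst (asm) nn_integral_0_iff_AE) (auto intro!: borel_measurable_slot_sum sets_L)
  then show ?thesis
    using AE_admissible
  proof eventually_elim
    case (elim w)
    have zero: "\<And>\<tau>. \<tau> \<in> tuples 2 (occupied w) \<Longrightarrow> indicator ?D (\<lambda>j\<in>{..<2}. fst (w (\<tau> j))) = (0::ennreal)"
      using elim(1) unfolding slot_sum_occupied[OF admissibleD(1)[OF elim(2)]]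
      by (subst (asm) nn_integral_0_iff_AE) (auto simp: AE_count_space)
    show ?case
    proof (rule inj_onI, rule ccontr)
      fix \<sigma> \<sigma>' assume \<sigma>: "\<sigma> \<in> occupied w" "\<sigma>' \<in> occupied w" "fst (w \<sigma>) = fst (w \<sigma>')" "\<sigma> \<noteq> \<sigma>'"
      let ?\<tau> = "\<lambda>j\<in>{..<2::nat}. if j = 0 then \<sigma> else \<sigma>'"
      have "?\<tau> \<in> tuples 2 (occupied w)"
        using \<sigma> by (auto simp: tuples_def inj_on_def)
      from zero[OF this] show False
        using \<sigma>(3) by (auto simp: indicator_def space_PiM split: if_splits)
    qed
  qed
qed

section \<open>The decoded process: simplicity and correlation functions\<close>

definition law :: "'a configuration measure" where
  "law = distr L borel decode'"

lemma decode'_measurable: "decode' \<in> measurable L (borel :: 'a configuration measure)"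
  using borel_measurable_decode' by (simp cong: measurable_cong_sets add: sets_L)

lemma point_process_law: "point_process law"
  unfolding point_process_def law_def using L.prob_space_distr[OF decode'_measurable] by simp

text \<open>Transferring an almost sure statement to an image law requires a measurable event. The
  set \<open>S\<close> serves: it compares the sums of \<open>m^2\<close> and of \<open>m\<close>
  over balls, \<open>m\<close> being the multiplicity, and since these sums of integers are locally
  finite the inequality forces \<open>m <= 1\<close>.\<close>

lemma AE_law_simple: "AE \<xi> in law. \<forall>y. emeasure (Rep_configuration \<xi>) {y} \<le> 1"
proof -
  let ?I = "\<lambda>n \<xi>. \<integral>\<^sup>+y. emeasure (Rep_configuration \<xi>) {y} * indicator (cball 0 (real n)) y \<partial>Rep_configuration \<xi>"
  define S where "S = {\<xi> :: 'a configuration. \<forall>n. ?I n \<xi> \<le> emeasure (Rep_configuration \<xi>) (cball 0 (real n))}"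
  have point: "(\<lambda>p. emeasure (Rep_configuration (fst p)) {snd p}) \<in> borel_measurable ((borel :: 'a configuration measure) \<Otimes>\<^sub>M (borel :: 'a measure))"
  proof -
    have m: "(\<lambda>q. indicator {0} (snd q - snd (fst q)) :: ennreal) \<in>
        borel_measurable (((borel :: 'a configuration measure) \<Otimes>\<^sub>M (borel :: 'a measure)) \<Otimes>\<^sub>M borel)"
      by measurable
    have "(\<integral>\<^sup>+z. indicator {0} (z - snd p) \<partial>Rep_configuration (fst p)) = emeasure (Rep_configuration (fst p)) {snd p}"
      for p :: "'a configuration \<times> 'a"
    proof -
      have "(\<integral>\<^sup>+z. indicator {0} (z - snd p) \<partial>Rep_configuration (fst p)) = (\<integral>\<^sup>+z. indicator {snd p} z \<partial>Rep_configuration (fst p))"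
        by (intro nn_integral_cong) (auto simp: indicator_def)
      then show ?thesis by simp
    qed
    then show ?thesis
      using measurable_nn_integral_configuration[OF _ m, of fst] by simp
  qed
  have [measurable]: "(\<lambda>\<xi>. ?I n \<xi>) \<in> borel_measurable (borel :: 'a configuration measure)" for n
  proof -
    have "(\<lambda>p. emeasure (Rep_configuration (fst p)) {snd p} * indicator (cball 0 (real n)) (snd p)) \<in>
        borel_measurable ((borel :: 'a configuration measure) \<Otimes>\<^sub>M (borel :: 'a measure))"
      by (intro borel_measurable_times_ennreal point measurable_compose[OF measurable_snd] borel_measurable_indicator) simp
    from measurable_nn_integral_configuration[OF _ this, of "\<lambda>\<xi>. \<xi>"] show ?thesis by simp
  qed
  have [measurable]: "(\<lambda>\<xi>. emeasure (Rep_configuration \<xi>) (cball 0 (real n))) \<in> borel_measurable (borel :: 'a configuration measure)" for n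
    by (rule measurable_emeasure_configuration) simp
  have "{\<xi> \<in> space (borel :: 'a configuration measure). \<forall>n. ?I n \<xi> \<le> emeasure (Rep_configuration \<xi>) (cball 0 (real n))} \<in> sets borel"
    by measurable
  then have S_sets: "{\<xi> \<in> space (borel :: 'a configuration measure). \<xi> \<in> S} \<in> sets borel"
    by (simp add: S_def)
  have "AE w in L. decode' w \<in> S"
    using AE_admissible AE_inj
  proof eventually_elim
    case (elim w)
    have le1: "emeasure (Rep_configuration (decode w)) {y} \<le> 1" for y
      using emeasure_decode_point[OF elim] by simp
    have "?I n (decode w) \<le> (\<integral>\<^sup>+y. indicator (cball 0 (real n)) y \<partial>Rep_configuration (decode w))" for n
      using le1 by (intro nn_integral_mono) (auto simp: indicator_def)
    then show ?case using elim(1) by (simp add: S_def decode'_def)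
  qed
  then have "AE \<xi> in law. \<xi> \<in> S"
    unfolding law_def by (subst AE_distr_iff[OF decode'_measurable S_sets])
  moreover have "\<forall>y. emeasure (Rep_configuration \<xi>) {y} \<le> 1" if S: "\<xi> \<in> S" for \<xi>
  proof (intro allI, rule ccontr)
    fix y assume not: "\<not> emeasure (Rep_configuration \<xi>) {y} \<le> 1"
    obtain m :: "'a \<Rightarrow> nat" where m: "\<And>x. emeasure (Rep_configuration \<xi>) {x} = of_nat (m x)"
      and int: "\<And>f. f \<in> borel_measurable borel \<Longrightarrow> (\<integral>\<^sup>+x. f x \<partial>Rep_configuration \<xi>) = (\<integral>\<^sup>+x. of_nat (m x) * f x \<partial>count_space UNIV)"
      by (rule Rep_configuration_atoms[of \<xi>]) blast
    obtain n where n: "norm y < real n" using reals_Archimedean2 by blast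
    let ?B = "cball (0::'a) (real n)"
    have my: "2 \<le> m y" using not unfolding m by (cases "m y"; cases "m y - 1") (auto simp: not_le)
    have fin: "emeasure (Rep_configuration \<xi>) ?B < \<infinity>"
      by (rule emeasure_Rep_compact) simp
    have emB: "emeasure (Rep_configuration \<xi>) ?B = (\<integral>\<^sup>+x. of_nat (m x) * indicator ?B x \<partial>count_space UNIV)"
      using int[of "indicator ?B"] by (simp add: borel_measurable_indicator)
    have I: "?I n \<xi> = (\<integral>\<^sup>+x. of_nat (m x) * (of_nat (m x) * indicator ?B x) \<partial>count_space UNIV)"
    proof -
      have "(\<lambda>y. emeasure (Rep_configuration \<xi>) {y} * indicator ?B y) \<in> borel_measurable borel"
        using measurable_Pair2[OF point, of \<xi>] by (intro borel_measurable_times_ennreal borel_measurable_indicator) simp_all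
      from int[OF this] show ?thesis by (simp add: m)
    qed
    \<comment> \<open>A multiplicity of at least two at \<open>y\<close> makes \<open>m^2\<close>
      exceed \<open>m\<close> there by at least one, and nowhere is \<open>m^2\<close> smaller than
      \<open>m\<close>; as the ball has finite mass, this contradicts membership in
      \<open>S\<close>.\<close>
    have "emeasure (Rep_configuration \<xi>) ?B + 1 = (\<integral>\<^sup>+x. of_nat (m x) * indicator ?B x + indicator {y} x \<partial>count_space UNIV)"
      by (subst nn_integral_add) (simp_all add: emB emeasure_count_space)
    also have "\<dots> \<le> ?I n \<xi>"
      unfolding I
    proof (rule nn_integral_mono)
      fix x
      show "of_nat (m x) * indicator ?B x + indicator {y} x \<le> (of_nat (m x) * (of_nat (m x) * indicator ?B x) :: ennreal)"
      proof (cases "x = y")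
        case True
        have "m y + 1 \<le> m y * m y" using my mult_le_mono1[OF my, of "m y"] by linarith
        then have "(of_nat (m y + 1) :: ennreal) \<le> of_nat (m y * m y)" by (simp only: of_nat_le_iff)
        then show ?thesis using True n by (simp add: add.commute)
      next
        case False
        have "m x \<le> m x * m x" by (cases "m x") auto
        then have "(of_nat (m x) :: ennreal) \<le> of_nat (m x * m x)" by (simp only: of_nat_le_iff)
        then show ?thesis using False by (auto simp: indicator_def)
      qed
    qed
    also have "\<dots> \<le> emeasure (Rep_configuration \<xi>) ?B" using S by (auto simp: S_def)
    finally show False using fin by (auto simp: less_top ennreal_add_left_cancel_le[of _ 1 0, simplified])
  qed
  ultimately show ?thesis by (auto elim!: eventually_mono)
qed

text \<open>As the process is almost surely simple, the sum over tuples can be replaced by its form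
  for simple configurations, which is measurable and equals \<open>slot_sum\<close> after
  decoding.\<close>

lemma nn_integral_sum_over_tuples_law:
  assumes \<phi>: "\<phi> \<in> borel_measurable (Leb k)"
  shows "(\<integral>\<^sup>+\<xi>. sum_over_tuples k \<phi> \<xi> \<partial>law) = (\<integral>\<^sup>+z. \<phi> z \<partial>factorial_moment k)"
proof -
  let ?J = "\<lambda>\<xi>. \<integral>\<^sup>+y. (\<Prod>j<k. emeasure (Rep_configuration \<xi>) {y j}) * (\<phi> y * of_bool (inj_on y {..<k})) \<partial>count_space ({..<k} \<rightarrow>\<^sub>E UNIV)"
  have J: "?J \<in> borel_measurable (borel :: 'a configuration measure)"
    by (rule measurable_sum_over_tuples_simple[OF \<phi>])
  have "(\<integral>\<^sup>+\<xi>. sum_over_tuples k \<phi> \<xi> \<partial>law) = (\<integral>\<^sup>+\<xi>. ?J \<xi> \<partial>law)"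
    by (rule nn_integral_cong_AE, use AE_law_simple in eventually_elim) (rule sum_over_tuples_simple, simp)
  also have "\<dots> = (\<integral>\<^sup>+w. ?J (decode' w) \<partial>L)"
    unfolding law_def by (rule nn_integral_distr[OF decode'_measurable]) (use J in simp)
  also have "\<dots> = (\<integral>\<^sup>+w. slot_sum k \<phi> w \<partial>L)"
  proof (rule nn_integral_cong_AE, use AE_admissible AE_inj in eventually_elim)
    fix w :: "nat \<times> nat \<Rightarrow> 'a \<times> real"
    assume w: "w \<in> admissible" "inj_on (\<lambda>\<sigma>. fst (w \<sigma>)) (occupied w)"
    then show "?J (decode' w) = slot_sum k \<phi> w"
      using sum_over_tuples_decode[OF w, of k \<phi>] by (simp add: decode'_def)
  qed
  also have "\<dots> = (\<integral>\<^sup>+z. \<phi> z \<partial>factorial_moment k)"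
    by (rule nn_integral_factorial_moment[OF \<phi>, symmetric])
  finally show ?thesis .
qed

lemma finite_correlation_functions_law: "finite_correlation_functions law"
  unfolding finite_correlation_functions_def
proof (intro allI impI)
  fix k :: nat assume k: "1 \<le> k"
  interpret Leb: sigma_finite_measure "Leb k" by (rule product.sigma_finite) simp
  note ac = absolutely_continuous_factorial_moment[OF k]
  define \<rho> where "\<rho> = RN_deriv (Leb k) (factorial_moment k)"
  \<comment> \<open>By sigma-finiteness the derivative is finite almost everywhere; the remaining
    values are reset to \<open>0\<close> so that finiteness holds at every point.\<close>
  define \<rho>' where "\<rho>' z = (if \<rho> z = \<infinity> then 0 else \<rho> z)" for z
  have \<rho>_meas [measurable]: "\<rho> \<in> borel_measurable (Leb k)" by (simp add: \<rho>_def)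
  have \<rho>'_meas [measurable]: "\<rho>' \<in> borel_measurable (Leb k)"
    unfolding \<rho>'_def by measurable
  have "AE z in Leb k. \<rho> z \<noteq> \<infinity>"
    unfolding \<rho>_def by (rule Leb.RN_deriv_finite[OF sigma_finite_factorial_moment[OF k] ac]) simp
  then have \<rho>_eq: "AE z in Leb k. \<rho> z = \<rho>' z"
    by eventually_elim (simp add: \<rho>'_def)
  have dens: "density (Leb k) \<rho> = factorial_moment k"
    unfolding \<rho>_def by (rule Leb.density_RN_deriv[OF ac]) simp
  have int: "(\<integral>\<^sup>+z. \<phi> z \<partial>factorial_moment k) = (\<integral>\<^sup>+z. \<phi> z * \<rho>' z \<partial>Leb k)" if \<phi>: "\<phi> \<in> borel_measurable (Leb k)" for \<phi>
  proof -
    have "(\<integral>\<^sup>+z. \<phi> z \<partial>factorial_moment k) = (\<integral>\<^sup>+z. \<rho> z * \<phi> z \<partial>Leb k)"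
      unfolding dens[symmetric] by (rule nn_integral_density[OF \<rho>_meas \<phi>])
    also have "\<dots> = (\<integral>\<^sup>+z. \<phi> z * \<rho>' z \<partial>Leb k)"
      by (rule nn_integral_cong_AE, use \<rho>_eq in eventually_elim) (simp add: mult.commute)
    finally show ?thesis .
  qed
  show "\<exists>\<rho>. correlation_function law k \<rho> \<and> (\<forall>y. \<rho> y < \<infinity>) \<and>
        (\<forall>K. compact K \<longrightarrow> (\<integral>\<^sup>+y. \<rho> y * indicator ({..<k} \<rightarrow>\<^sub>E K) y \<partial>Leb k) < \<infinity>)"
  proof (intro exI[of _ \<rho>'] conjI allI impI)
    show "correlation_function law k \<rho>'"
      unfolding correlation_function_def
      using \<rho>'_meas nn_integral_sum_over_tuples_law int by simp
    show "\<rho>' z < \<infinity>" for z by (simp add: \<rho>'_def less_top)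
    fix K :: "'a set" assume K: "compact K"
    obtain R where R: "0 \<le> R" "K \<subseteq> ball 0 R"
      using bounded_subset_ballD[OF compact_imp_bounded[OF K], of 0] by (blast intro: less_imp_le)
    have "{..<k} \<rightarrow>\<^sub>E K \<in> sets (Leb k)"
      using K by (intro sets_PiM_I_finite) (auto simp: borel_compact)
    then have m: "indicator ({..<k} \<rightarrow>\<^sub>E K) \<in> borel_measurable (Leb k)" by simp
    have "(\<integral>\<^sup>+y. \<rho>' y * indicator ({..<k} \<rightarrow>\<^sub>E K) y \<partial>Leb k) = (\<integral>\<^sup>+z. indicator ({..<k} \<rightarrow>\<^sub>E K) z \<partial>factorial_moment k)"
      unfolding int[OF m] by (simp add: mult.commute)
    also have "\<dots> \<le> (\<integral>\<^sup>+z. indicator (polyball k R) z \<partial>factorial_moment k)"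
      using R(2) by (intro nn_integral_mono) (auto simp: indicator_def polyball_def PiE_def Pi_def)
    also have "\<dots> = emeasure (factorial_moment k) (polyball k R)" by simp
    also have "\<dots> < \<infinity>" by (rule factorial_moment_polyball_finite[OF k R(1)])
    finally show "(\<integral>\<^sup>+y. \<rho>' y * indicator ({..<k} \<rightarrow>\<^sub>E K) y \<partial>Leb k) < \<infinity>" .
  qed
qed

end

section \<open>The limit process\<close>

lemma tendsto_function:
  fixes f :: "nat \<Rightarrow> 'i \<Rightarrow> 'b::topological_space"
  assumes "\<And>i. (\<lambda>n. f n i) \<longlonglongrightarrow> l i"
  shows "f \<longlonglongrightarrow> l"
  using assms limitin_componentwise[of "\<lambda>_. euclidean" UNIV f l sequentially]
  by (simp add: euclidean_product_topology limitin_canonical_iff)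

lemma flag_limit:
  fixes u :: "nat \<Rightarrow> real"
  assumes u: "\<And>n. u n = 0 \<or> u n = 1" and lim: "u \<longlonglongrightarrow> l"
  shows "\<forall>\<^sub>F n in sequentially. u n = l"
proof -
  have "Cauchy u" using lim by (rule LIMSEQ_imp_Cauchy)
  from metric_CauchyD[OF this, of 1] obtain n0 where n0: "\<And>m n. n0 \<le> m \<Longrightarrow> n0 \<le> n \<Longrightarrow> dist (u m) (u n) < 1"
    by auto
  have const: "u n = u n0" if "n0 \<le> n" for n
    using n0[OF that order.refl] u[of n] u[of n0] by (auto simp: dist_real_def)
  have ev: "\<forall>\<^sub>F n in sequentially. u n = u n0"
    by (rule eventually_sequentiallyI) (rule const)
  then have "u \<longlonglongrightarrow> u n0" by (rule tendsto_eventually)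
  with lim have "l = u n0" by (rule LIMSEQ_unique)
  with ev show ?thesis by simp
qed

text \<open>Fatou's lemma for the counting measure on tuples of slots, each term being continuous in
  the code.\<close>

lemma slot_sum_liminf:
  fixes w :: "nat \<Rightarrow> nat \<times> nat \<Rightarrow> 'a::euclidean_space \<times> real" and \<Phi> :: "(nat \<Rightarrow> 'a) \<Rightarrow> real"
  assumes \<Phi>: "continuous_on UNIV \<Phi>" "\<And>v. 0 \<le> \<Phi> v"
    and flags: "\<And>n \<sigma>. 0 \<le> snd (w n \<sigma>)"
    and lim: "\<And>\<sigma>. (\<lambda>n. w n \<sigma>) \<longlonglongrightarrow> w0 \<sigma>"
  shows "slot_sum k (\<lambda>z. ennreal (\<Phi> (pad k z))) w0 \<le> liminf (\<lambda>n. slot_sum k (\<lambda>z. ennreal (\<Phi> (pad k z))) (w n))"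
proof -
  let ?z = "\<lambda>w \<tau>. pad k (\<lambda>j\<in>{..<k}. fst (w (\<tau> j)))"
  let ?t = "\<lambda>w \<tau>. (\<Prod>j<k. ennreal (snd (w (\<tau> j)))) * ennreal (\<Phi> (?z w \<tau>))"
  have t: "?t w \<tau> = ennreal ((\<Prod>j<k. snd (w (\<tau> j))) * \<Phi> (?z w \<tau>))"
    if "\<And>\<sigma>. 0 \<le> snd (w \<sigma>)" for w :: "nat \<times> nat \<Rightarrow> 'a \<times> real" and \<tau>
    using that \<Phi>(2) by (simp add: prod_ennreal ennreal_mult prod_nonneg)
  have flags0: "0 \<le> snd (w0 \<sigma>)" for \<sigma>
    by (rule LIMSEQ_le_const[OF tendsto_snd[OF lim]]) (use flags in blast)
  have "(\<lambda>n. ?t (w n) \<tau>) \<longlonglongrightarrow> ?t w0 \<tau>" for \<tau>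
  proof -
    have "(\<lambda>n. pad k (\<lambda>j\<in>{..<k}. fst (w n (\<tau> j))) i) \<longlonglongrightarrow> pad k (\<lambda>j\<in>{..<k}. fst (w0 (\<tau> j))) i" for i
      by (cases "i < k") (simp_all add: pad_def tendsto_fst[OF lim])
    then have "(\<lambda>n. ?z (w n) \<tau>) \<longlonglongrightarrow> ?z w0 \<tau>" by (rule tendsto_function)
    then have "(\<lambda>n. \<Phi> (?z (w n) \<tau>)) \<longlonglongrightarrow> \<Phi> (?z w0 \<tau>)"
      by (rule continuous_on_tendsto_compose[OF \<Phi>(1)]) auto
    moreover have "(\<lambda>n. \<Prod>j<k. snd (w n (\<tau> j))) \<longlonglongrightarrow> (\<Prod>j<k. snd (w0 (\<tau> j)))"
      by (intro tendsto_prod tendsto_snd[OF lim])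
    ultimately have "(\<lambda>n. ennreal ((\<Prod>j<k. snd (w n (\<tau> j))) * \<Phi> (?z (w n) \<tau>))) \<longlonglongrightarrow>
        ennreal ((\<Prod>j<k. snd (w0 (\<tau> j))) * \<Phi> (?z w0 \<tau>))"
      by (intro tendsto_ennrealI tendsto_mult)
    moreover have "?t (w n) \<tau> = ennreal ((\<Prod>j<k. snd (w n (\<tau> j))) * \<Phi> (?z (w n) \<tau>))" for n
      by (rule t) (rule flags)
    moreover have "?t w0 \<tau> = ennreal ((\<Prod>j<k. snd (w0 (\<tau> j))) * \<Phi> (?z w0 \<tau>))"
      by (rule t) (rule flags0)
    ultimately show ?thesis by simp
  qed
  then have "?t w0 \<tau> = liminf (\<lambda>n. ?t (w n) \<tau>)" for \<tau>
    by (intro lim_imp_Liminf[symmetric]) auto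
  then have "slot_sum k (\<lambda>z. ennreal (\<Phi> (pad k z))) w0 = (\<integral>\<^sup>+\<tau>. liminf (\<lambda>n. ?t (w n) \<tau>) \<partial>count_space (tuples k UNIV))"
    by (simp add: slot_sum_def)
  also have "\<dots> \<le> liminf (\<lambda>n. \<integral>\<^sup>+\<tau>. ?t (w n) \<tau> \<partial>count_space (tuples k UNIV))"
    by (rule nn_integral_liminf) simp
  finally show ?thesis by (simp add: slot_sum_def)
qed

lemma slot_sum_one:
  assumes w: "\<And>\<sigma>. snd (w \<sigma>) = 0 \<or> snd (w \<sigma>) = 1"
  shows "slot_sum 1 (\<lambda>z. g (z 0)) w = (\<integral>\<^sup>+\<sigma>. g (fst (w \<sigma>)) \<partial>count_space (occupied w))"
proof -
  have bij: "bij_betw (\<lambda>\<sigma>. \<lambda>j\<in>{..<1::nat}. \<sigma>) (occupied w) (tuples 1 (occupied w))"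
    by (rule bij_betwI[where g="\<lambda>\<tau>. \<tau> 0"])
      (auto simp: tuples_def inj_on_def PiE_def extensional_def fun_eq_iff)
  show ?thesis
    unfolding slot_sum_occupied[OF w]
    using nn_integral_bij_count_space[OF bij, of "\<lambda>\<tau>. g ((\<lambda>j\<in>{..<1}. fst (w (\<tau> j))) 0)"] by simp
qed

text \<open>The shell \<open>a\<close> of the limit has an empty slot because the expected number of its points is
  finite.\<close>

lemma admissible_limit:
  fixes w :: "nat \<Rightarrow> nat \<times> nat \<Rightarrow> 'a::euclidean_space \<times> real"
  assumes w: "\<And>n. w n \<in> admissible" "\<And>n a j. norm (w n (a, j)) \<le> real a + 2"
    and lim: "\<And>\<sigma>. (\<lambda>n. w n \<sigma>) \<longlonglongrightarrow> w0 \<sigma>"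
    and fin: "\<And>a. slot_sum 1 (\<lambda>z. ennreal (cutoff (real a + 2) 1 (pad 1 z))) w0 \<noteq> \<infinity>"
  shows "w0 \<in> admissible"
proof -
  have ev: "\<forall>\<^sub>F n in sequentially. snd (w n \<sigma>) = snd (w0 \<sigma>)" for \<sigma>
    by (rule flag_limit[OF admissibleD(1)[OF w(1)] tendsto_snd[OF lim]])
  have flags: "snd (w0 \<sigma>) = 0 \<or> snd (w0 \<sigma>) = 1" for \<sigma>
  proof -
    obtain n where "snd (w n \<sigma>) = snd (w0 \<sigma>)"
      using eventually_happens[OF ev[of \<sigma>]] by auto
    then show ?thesis using admissibleD(1)[OF w(1), of n \<sigma>] by auto
  qed
  have mono: "snd (w0 (a, j)) = 1" if "j \<le> j'" "snd (w0 (a, j')) = 1" for a j j'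
  proof -
    obtain n where "snd (w n (a, j)) = snd (w0 (a, j)) \<and> snd (w n (a, j')) = snd (w0 (a, j'))"
      using eventually_happens[OF eventually_conj[OF ev[of "(a, j)"] ev[of "(a, j')"]]] by auto
    then show ?thesis
      using admissibleD(2)[OF w(1), of j j' n a] that flags[of "(a, j)"] by auto
  qed
  have norm_ge: "real a \<le> norm (fst (w0 (a, j)))" if "snd (w0 (a, j)) = 1" for a j
  proof (rule tendsto_lowerbound)
    show "(\<lambda>n. norm (fst (w n (a, j)))) \<longlonglongrightarrow> norm (fst (w0 (a, j)))"
      by (intro tendsto_norm tendsto_fst lim)
    show "\<forall>\<^sub>F n in sequentially. real a \<le> norm (fst (w n (a, j)))"
      using ev[of "(a, j)"] by eventually_elim (use that admissibleD(3)[OF w(1)] in auto)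
  qed simp
  have norm_le: "norm (fst (w0 (a, j))) \<le> real a + 2" for a j
  proof (rule tendsto_upperbound)
    show "(\<lambda>n. norm (fst (w n (a, j)))) \<longlonglongrightarrow> norm (fst (w0 (a, j)))"
      by (intro tendsto_norm tendsto_fst lim)
    show "\<forall>\<^sub>F n in sequentially. norm (fst (w n (a, j))) \<le> real a + 2"
    proof (intro always_eventually allI)
      fix n
      show "norm (fst (w n (a, j))) \<le> real a + 2"
        using norm_fst_le[of "fst (w n (a, j))" "snd (w n (a, j))"] w(2)[of n a j] by simp
    qed
  qed simp
  have "\<exists>j. snd (w0 (a, j)) = 0" for a
  proof (rule ccontr)
    assume "\<nexists>j. snd (w0 (a, j)) = 0"
    then have full: "snd (w0 (a, j)) = 1" for j using flags by blast
    \<comment> \<open>The cutoff at radius \<open>a + 2\<close> equals \<open>1\<close> at every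
      point that a slot of the shell \<open>a\<close> can contain, so a shell without an empty slot
      would make the sum infinite.\<close>
    define g where "g y = ennreal (max 0 (min 1 (real a + 2 + 1 - norm y)))" for y :: 'a
    have "(\<lambda>z. ennreal (cutoff (real a + 2) 1 (pad 1 z))) = (\<lambda>z :: nat \<Rightarrow> 'a. g (z 0))"
      by (simp add: fun_eq_iff cutoff_def pad_def g_def)
    then have "slot_sum 1 (\<lambda>z. ennreal (cutoff (real a + 2) 1 (pad 1 z))) w0 =
        (\<integral>\<^sup>+\<sigma>. g (fst (w0 \<sigma>)) \<partial>count_space (occupied w0))"
      using slot_sum_one[of w0 g] flags by simp
    also have "\<dots> \<ge> (\<integral>\<^sup>+\<sigma>. indicator (range (Pair a)) \<sigma> \<partial>count_space (occupied w0))"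
    proof (rule nn_integral_mono)
      fix \<sigma>
      show "indicator (range (Pair a)) \<sigma> \<le> g (fst (w0 \<sigma>))"
      proof (cases "\<sigma> \<in> range (Pair a)")
        case True
        then obtain j where "\<sigma> = (a, j)" by auto
        with norm_le[of a j] show ?thesis by (simp add: g_def indicator_def)
      qed simp
    qed
    also have "(\<integral>\<^sup>+\<sigma>. indicator (range (Pair a)) \<sigma> \<partial>count_space (occupied w0)) =
        emeasure (count_space (occupied w0)) (range (Pair a))"
      using full by (intro nn_integral_indicator) (auto simp: occupied_def)
    also have "\<dots> = \<infinity>"
      using full range_inj_infinite[of "Pair a :: nat \<Rightarrow> nat \<times> nat"]
      by (subst emeasure_count_space_infinite) (auto simp: occupied_def inj_def)
    finally show False using fin[of a] by (simp add: top_unique)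
  qed
  then show ?thesis
    unfolding admissible_def using flags mono norm_ge by blast
qed

lemma admissible_norm_sets:
  "{w \<in> admissible. \<forall>a j. norm (w (a, j)) \<le> real a + 2} \<in> sets (borel :: (nat \<times> nat \<Rightarrow> 'a::euclidean_space \<times> real) measure)"
proof -
  have [measurable]: "(\<lambda>w::nat \<times> nat \<Rightarrow> 'a \<times> real. norm (w \<sigma>)) \<in> borel_measurable borel" for \<sigma>
    by (intro borel_measurable_continuous_onI continuous_intros continuous_on_product_coordinates)
  have "{w \<in> space (borel :: (nat \<times> nat \<Rightarrow> 'a \<times> real) measure). \<forall>a j. norm (w (a, j)) \<le> real a + 2} \<in> sets borel"
    by measurable
  then have "admissible \<inter> {w \<in> space (borel :: (nat \<times> nat \<Rightarrow> 'a \<times> real) measure). \<forall>a j. norm (w (a, j)) \<le> real a + 2} \<in> sets borel"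
    by (intro sets.Int admissible_sets)
  then show ?thesis by (simp add: Int_def)
qed

text \<open>Compactness for arbitrary random finite point sets whose correlation functions are
  eventually locally bounded; nothing about the gas enters any more. The bound has two uses: in the
  limit it excludes infinitely many points in a shell, and it bounds the factorial moment
  measures.\<close>

lemma ex_limit_process:
  fixes M :: "nat \<Rightarrow> 's measure" and N :: "nat \<Rightarrow> nat" and p :: "nat \<Rightarrow> 's \<Rightarrow> nat \<Rightarrow> 'a::euclidean_space"
  assumes M: "\<And>n. prob_space (M n)"
    and p: "\<And>n i. i < N n \<Longrightarrow> (\<lambda>x. p n x i) \<in> borel_measurable (M n)"
    and bound: "\<And>k R. 1 \<le> k \<Longrightarrow> 0 < R \<Longrightarrow> \<exists>C::real. \<forall>\<^sub>F n in sequentially.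
      \<forall>\<psi> \<in> borel_measurable (\<Pi>\<^sub>M j\<in>{..<k}. lborel :: 'a measure). (\<forall>z. \<psi> z \<noteq> 0 \<longrightarrow> (\<forall>j<k. z j \<in> ball 0 R)) \<longrightarrow>
        (\<Sum>\<sigma>\<in>tuples k {..<N n}. \<integral>\<^sup>+x. \<psi> (\<lambda>j\<in>{..<k}. p n x (\<sigma> j)) \<partial>M n) \<le>
          ennreal C * (\<integral>\<^sup>+z. \<psi> z \<partial>(\<Pi>\<^sub>M j\<in>{..<k}. lborel))"
  shows "\<exists>r P. strict_mono r \<and> point_process P \<and>
    weakly_converges (\<lambda>n. distr (M (r n)) borel (\<lambda>x. configuration_of (N (r n)) (p (r n) x))) P \<and>
    simple_process P \<and> finite_correlation_functions P"
proof -
  let ?B = "borel :: (nat \<times> nat \<Rightarrow> 'a \<times> real) measure"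
  let ?S = "{w \<in> admissible. \<forall>a j. norm (w (a, j)) \<le> real a + 2} :: (nat \<times> nat \<Rightarrow> 'a \<times> real) set"
  define e where "e n x = enc (N n) (p n x)" for n x
  have e_meas: "(\<lambda>x. e n x \<sigma>) \<in> borel_measurable (M n)" for n \<sigma>
    unfolding e_def by (rule borel_measurable_enc[OF p])
  have "norm (e n x \<sigma>) \<le> real (fst \<sigma>) + 2" for n \<sigma> x
    using norm_enc_le[of "N n" "p n x" "fst \<sigma>" "snd \<sigma>"] by (simp add: e_def)
  then obtain r \<Omega> W where r: "strict_mono (r :: nat \<Rightarrow> nat)" and \<Omega>: "prob_space (\<Omega> :: real measure)"
    and W: "\<And>n \<sigma>. (W n \<sigma> :: real \<Rightarrow> 'a \<times> real) \<in> borel_measurable \<Omega>"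
    and law: "\<And>n. distr \<Omega> (\<Pi>\<^sub>M i\<in>UNIV. borel) (\<lambda>\<omega> \<sigma>. W n \<sigma> \<omega>) = distr (M (r n)) (\<Pi>\<^sub>M i\<in>UNIV. borel) (\<lambda>x \<sigma>. e (r n) x \<sigma>)"
    and conv: "AE \<omega> in \<Omega>. \<forall>\<sigma>. convergent (\<lambda>n. W n \<sigma> \<omega>)"
    using skorohod_representation[of M "\<lambda>n \<sigma> x. e n x \<sigma>" "\<lambda>\<sigma>. real (fst \<sigma>) + 2", OF M e_meas] by auto
  interpret \<Omega>: prob_space \<Omega> by (rule \<Omega>)
  define w where "w n \<omega> = (\<lambda>\<sigma>. W n \<sigma> \<omega>)" for n \<omega>
  \<comment> \<open>The coordinatewise limit, which exists almost surely; \<open>lim\<close> is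
    Borel measurable everywhere, whatever its value where there is no limit.\<close>
  define w0 where "w0 \<omega> = (\<lambda>\<sigma>. lim (\<lambda>n. W n \<sigma> \<omega>))" for \<omega>
  have to_borel: "f \<in> measurable M' ?B" if "\<And>\<sigma>. (\<lambda>x. f x \<sigma>) \<in> borel_measurable M'"
    for f :: "'c \<Rightarrow> nat \<times> nat \<Rightarrow> 'a \<times> real" and M' :: "'c measure"
  proof -
    have "f \<in> measurable M' (\<Pi>\<^sub>M i\<in>UNIV. borel)"
      using that by (intro measurable_PiM_single') auto
    then show ?thesis by (simp cong: measurable_cong_sets add: sets_PiM_equal_borel)
  qed
  have e_borel: "e n \<in> measurable (M n) ?B" for n by (rule to_borel[OF e_meas])
  have w_borel: "w n \<in> measurable \<Omega> ?B" for n unfolding w_def by (rule to_borel) (rule W)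
  have w0_borel: "w0 \<in> measurable \<Omega> ?B"
    unfolding w0_def by (rule to_borel) (rule borel_measurable_lim_metric[OF W])
  have law_borel: "distr \<Omega> ?B (w n) = distr (M (r n)) ?B (e (r n))" for n
  proof -
    have "distr \<Omega> ?B (w n) = distr \<Omega> (\<Pi>\<^sub>M i\<in>UNIV. borel) (\<lambda>\<omega> \<sigma>. W n \<sigma> \<omega>)"
      by (rule distr_cong) (simp_all add: sets_PiM_equal_borel w_def)
    also have "\<dots> = distr (M (r n)) ?B (e (r n))"
      unfolding law by (rule distr_cong) (simp_all add: sets_PiM_equal_borel)
    finally show ?thesis .
  qed
  have e_S: "e n x \<in> ?S" for n x
    using norm_enc_le by (auto simp: e_def enc_admissible)
  \<comment> \<open>Being a code is a Borel property and is transferred from \<open>e (r n)\<close>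
    to \<open>w n\<close> by the equality of laws, hence almost surely only.\<close>
  have "AE \<omega> in \<Omega>. w n \<omega> \<in> ?S" for n
  proof -
    have S: "{w \<in> space ?B. w \<in> ?S} \<in> sets ?B" using admissible_norm_sets by simp
    have "AE w in distr (M (r n)) ?B (e (r n)). w \<in> ?S"
      unfolding AE_distr_iff[OF e_borel S] using e_S by (intro AE_I2)
    then show ?thesis
      unfolding law_borel[symmetric] AE_distr_iff[OF w_borel S] .
  qed
  then have "AE \<omega> in \<Omega>. \<forall>n. w n \<omega> \<in> ?S" by (simp add: AE_all_countable)
  then have good: "AE \<omega> in \<Omega>. (\<forall>n. w n \<omega> \<in> admissible) \<and> (\<forall>n a j. norm (w n \<omega> (a, j)) \<le> real a + 2) \<and>
      (\<forall>\<sigma>. (\<lambda>n. w n \<omega> \<sigma>) \<longlonglongrightarrow> w0 \<omega> \<sigma>)"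
    using conv by eventually_elim (auto simp: w_def w0_def convergent_LIMSEQ_iff)
  have slot_w0: "\<exists>C::real. \<forall>\<Phi> :: (nat \<Rightarrow> 'a) \<Rightarrow> real. continuous_on UNIV \<Phi> \<longrightarrow> (\<forall>v. 0 \<le> \<Phi> v) \<longrightarrow>
      (\<forall>v. \<Phi> v \<noteq> 0 \<longrightarrow> (\<forall>j<k. v j \<in> ball 0 R)) \<longrightarrow>
      (\<integral>\<^sup>+\<omega>. slot_sum k (\<lambda>z. ennreal (\<Phi> (pad k z))) (w0 \<omega>) \<partial>\<Omega>) \<le> ennreal C * (\<integral>\<^sup>+z. ennreal (\<Phi> (pad k z)) \<partial>(\<Pi>\<^sub>M j\<in>{..<k}. lborel))"
    if k: "1 \<le> k" and R: "0 < R" for k :: nat and R :: real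
  proof -
    obtain C :: real where C: "\<forall>\<^sub>F n in sequentially.
      \<forall>\<psi> \<in> borel_measurable (\<Pi>\<^sub>M j\<in>{..<k}. lborel :: 'a measure). (\<forall>z. \<psi> z \<noteq> 0 \<longrightarrow> (\<forall>j<k. z j \<in> ball 0 R)) \<longrightarrow>
        (\<Sum>\<sigma>\<in>tuples k {..<N n}. \<integral>\<^sup>+x. \<psi> (\<lambda>j\<in>{..<k}. p n x (\<sigma> j)) \<partial>M n) \<le>
          ennreal C * (\<integral>\<^sup>+z. \<psi> z \<partial>(\<Pi>\<^sub>M j\<in>{..<k}. lborel))"
      using bound[OF k R] by blast
    show ?thesis
    proof (intro exI allI impI)
      fix \<Phi> :: "(nat \<Rightarrow> 'a) \<Rightarrow> real"
      assume \<Phi>: "continuous_on UNIV \<Phi>" "\<forall>v. 0 \<le> \<Phi> v" "\<forall>v. \<Phi> v \<noteq> 0 \<longrightarrow> (\<forall>j<k. v j \<in> ball 0 R)"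
      let ?\<psi> = "\<lambda>z. ennreal (\<Phi> (pad k z))"
      let ?K = "ennreal C * (\<integral>\<^sup>+z. ?\<psi> z \<partial>(\<Pi>\<^sub>M j\<in>{..<k}. lborel))"
      have "(\<lambda>v. ennreal (\<Phi> v)) \<in> borel_measurable borel"
        using borel_measurable_continuous_onI[OF \<Phi>(1)] by simp
      then have \<psi>: "?\<psi> \<in> borel_measurable (\<Pi>\<^sub>M j\<in>{..<k}. lborel :: 'a measure)"
        by (rule measurable_compose[OF pad_measurable])
      have supp: "\<forall>z. ?\<psi> z \<noteq> 0 \<longrightarrow> (\<forall>j<k. z j \<in> ball 0 R)"
      proof (intro allI impI)
        fix z j assume "?\<psi> z \<noteq> 0" "j < k"
        then have "pad k z j \<in> ball 0 R" using \<Phi>(3) by (metis ennreal_0)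
        then show "z j \<in> ball 0 R" using \<open>j < k\<close> by (simp add: pad_def)
      qed
      have sm: "slot_sum k ?\<psi> \<in> borel_measurable ?B"
        by (rule borel_measurable_slot_sum[OF \<psi>]) simp
      have le: "\<forall>\<^sub>F n in sequentially. (\<integral>\<^sup>+\<omega>. slot_sum k ?\<psi> (w n \<omega>) \<partial>\<Omega>) \<le> ?K"
        using eventually_subseq[OF r C]
      proof eventually_elim
        case (elim n)
        have "(\<integral>\<^sup>+\<omega>. slot_sum k ?\<psi> (w n \<omega>) \<partial>\<Omega>) = (\<integral>\<^sup>+u. slot_sum k ?\<psi> u \<partial>distr \<Omega> ?B (w n))"
          by (rule nn_integral_distr[OF w_borel, symmetric]) (use sm in simp)
        also have "\<dots> = (\<integral>\<^sup>+x. slot_sum k ?\<psi> (e (r n) x) \<partial>M (r n))"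
          unfolding law_borel by (rule nn_integral_distr[OF e_borel]) (use sm in simp)
        also have "\<dots> = (\<integral>\<^sup>+x. (\<Sum>\<sigma>\<in>tuples k {..<N (r n)}. ?\<psi> (\<lambda>j\<in>{..<k}. p (r n) x (\<sigma> j))) \<partial>M (r n))"
          by (simp only: e_def slot_sum_enc)
        also have "\<dots> = (\<Sum>\<sigma>\<in>tuples k {..<N (r n)}. \<integral>\<^sup>+x. ?\<psi> (\<lambda>j\<in>{..<k}. p (r n) x (\<sigma> j)) \<partial>M (r n))"
        proof (rule nn_integral_sum)
          fix \<sigma> assume "\<sigma> \<in> tuples k {..<N (r n)}"
          then have \<sigma>: "\<And>j. j < k \<Longrightarrow> \<sigma> j < N (r n)" by (auto simp: tuples_def PiE_def Pi_def)
          have "(\<lambda>x. \<lambda>j\<in>{..<k}. p (r n) x (\<sigma> j)) \<in> measurable (M (r n)) (\<Pi>\<^sub>M j\<in>{..<k}. lborel)"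
            by (rule measurable_restrict) (simp add: p \<sigma>)
          then show "(\<lambda>x. ?\<psi> (\<lambda>j\<in>{..<k}. p (r n) x (\<sigma> j))) \<in> borel_measurable (M (r n))"
            by (rule measurable_compose[OF _ \<psi>])
        qed
        also have "\<dots> \<le> ?K" by (rule bspec[OF elim \<psi>, THEN mp, OF supp])
        finally show ?case .
      qed
      have "(\<integral>\<^sup>+\<omega>. slot_sum k ?\<psi> (w0 \<omega>) \<partial>\<Omega>) \<le> (\<integral>\<^sup>+\<omega>. liminf (\<lambda>n. slot_sum k ?\<psi> (w n \<omega>)) \<partial>\<Omega>)"
      proof (rule nn_integral_mono_AE, use good in eventually_elim)
        fix \<omega> assume g: "(\<forall>n. w n \<omega> \<in> admissible) \<and> (\<forall>n a j. norm (w n \<omega> (a, j)) \<le> real a + 2) \<and>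
          (\<forall>\<sigma>. (\<lambda>n. w n \<omega> \<sigma>) \<longlonglongrightarrow> w0 \<omega> \<sigma>)"
        show "slot_sum k ?\<psi> (w0 \<omega>) \<le> liminf (\<lambda>n. slot_sum k ?\<psi> (w n \<omega>))"
        proof (rule slot_sum_liminf[OF \<Phi>(1)])
          show "0 \<le> \<Phi> v" for v using \<Phi>(2) by simp
          show "0 \<le> snd (w n \<omega> \<sigma>)" for n \<sigma>
            using admissibleD(1)[of "w n \<omega>" \<sigma>] g by auto
          show "(\<lambda>n. w n \<omega> \<sigma>) \<longlonglongrightarrow> w0 \<omega> \<sigma>" for \<sigma> using g by blast
        qed
      qed
      also have "\<dots> \<le> liminf (\<lambda>n. \<integral>\<^sup>+\<omega>. slot_sum k ?\<psi> (w n \<omega>) \<partial>\<Omega>)"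
        by (rule nn_integral_liminf) (rule measurable_compose[OF w_borel sm])
      also have "\<dots> \<le> ?K" by (rule Liminf_le[OF _ le]) simp
      finally show "(\<integral>\<^sup>+\<omega>. slot_sum k ?\<psi> (w0 \<omega>) \<partial>\<Omega>) \<le> ?K" .
    qed
  qed
  have "AE \<omega> in \<Omega>. slot_sum 1 (\<lambda>z. ennreal (cutoff (real a + 2) 1 (pad 1 z))) (w0 \<omega>) \<noteq> \<infinity>" for a
  proof (rule nn_integral_PInf_AE)
    let ?\<psi> = "\<lambda>z :: nat \<Rightarrow> 'a. ennreal (cutoff (real a + 2) 1 (pad 1 z))"
    let ?L = "\<Pi>\<^sub>M j\<in>{..<1::nat}. lborel :: 'a measure"
    have c: "continuous_on UNIV (cutoff (real a + 2) 1 :: (nat \<Rightarrow> 'a) \<Rightarrow> real)" by (rule continuous_on_cutoff)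
    have "(\<lambda>v :: nat \<Rightarrow> 'a. ennreal (cutoff (real a + 2) 1 v)) \<in> borel_measurable borel"
      using borel_measurable_continuous_onI[OF c] by simp
    then have "?\<psi> \<in> borel_measurable ?L"
      by (rule measurable_compose[OF pad_measurable])
    then have "slot_sum 1 ?\<psi> \<in> borel_measurable ?B"
      by (rule borel_measurable_slot_sum) simp
    then show "(\<lambda>\<omega>. slot_sum 1 ?\<psi> (w0 \<omega>)) \<in> borel_measurable \<Omega>"
      by (rule measurable_compose[OF w0_borel])
    obtain C :: real where C: "\<And>\<Phi> :: (nat \<Rightarrow> 'a) \<Rightarrow> real. continuous_on UNIV \<Phi> \<Longrightarrow> (\<forall>v. 0 \<le> \<Phi> v) \<Longrightarrow>
      (\<forall>v. \<Phi> v \<noteq> 0 \<longrightarrow> (\<forall>j<1. v j \<in> ball 0 (real a + 2 + 1))) \<Longrightarrow>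
      (\<integral>\<^sup>+\<omega>. slot_sum 1 (\<lambda>z. ennreal (\<Phi> (pad 1 z))) (w0 \<omega>) \<partial>\<Omega>) \<le> ennreal C * (\<integral>\<^sup>+z. ennreal (\<Phi> (pad 1 z)) \<partial>?L)"
      using slot_w0[of 1 "real a + 2 + 1"] by auto
    have "(\<integral>\<^sup>+\<omega>. slot_sum 1 ?\<psi> (w0 \<omega>) \<partial>\<Omega>) \<le> ennreal C * (\<integral>\<^sup>+z. ?\<psi> z \<partial>?L)"
    proof (rule C[OF c])
      show "\<forall>v :: nat \<Rightarrow> 'a. 0 \<le> cutoff (real a + 2) 1 v"
        by (intro allI cutoff_nonneg)
      show "\<forall>v :: nat \<Rightarrow> 'a. cutoff (real a + 2) 1 v \<noteq> 0 \<longrightarrow> (\<forall>j<1. v j \<in> ball 0 (real a + 2 + 1))"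
        by (intro allI impI cutoff_support)
    qed
    also have "\<dots> \<le> ennreal C * (\<integral>\<^sup>+z. indicator (polyball 1 (real a + 2 + 1)) z \<partial>?L)"
    proof (intro mult_left_mono nn_integral_mono)
      fix z assume z: "z \<in> space ?L"
      show "?\<psi> z \<le> indicator (polyball 1 (real a + 2 + 1)) z"
        by (rule cutoff_le_indicator[OF z])
    qed simp
    also have "\<dots> < \<infinity>"
      using emeasure_polyball_finite[of 1 "real a + 2 + 1", where 'a='a] by (simp add: ennreal_mult_less_top)
    finally show "(\<integral>\<^sup>+\<omega>. slot_sum 1 ?\<psi> (w0 \<omega>) \<partial>\<Omega>) \<noteq> \<infinity>" by simp
  qed
  then have "AE \<omega> in \<Omega>. \<forall>a. slot_sum 1 (\<lambda>z. ennreal (cutoff (real a + 2) 1 (pad 1 z))) (w0 \<omega>) \<noteq> \<infinity>"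
    by (simp add: AE_all_countable)
  then have adm0: "AE \<omega> in \<Omega>. w0 \<omega> \<in> admissible"
    using good
  proof eventually_elim
    case (elim \<omega>)
    show ?case by (rule admissible_limit[where w="\<lambda>n. w n \<omega>"]; use elim in blast)
  qed
  have sa: "{u \<in> space ?B. u \<in> admissible} \<in> sets ?B" using admissible_sets by simp
  interpret L: encoded_process "distr \<Omega> ?B w0"
  proof (rule encoded_process.intro)
    show "prob_space (distr \<Omega> ?B w0)" by (rule \<Omega>.prob_space_distr[OF w0_borel])
    show "sets (distr \<Omega> ?B w0) = sets borel" by simp
    show "AE u in distr \<Omega> ?B w0. u \<in> admissible"
      unfolding AE_distr_iff[OF w0_borel sa] by (rule adm0)
    fix k :: nat and R :: real assume kR: "1 \<le> k" "0 < R"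
    have distr: "(\<integral>\<^sup>+u. slot_sum k (\<lambda>z. ennreal (\<Phi> (pad k z))) u \<partial>distr \<Omega> ?B w0) =
        (\<integral>\<^sup>+\<omega>. slot_sum k (\<lambda>z. ennreal (\<Phi> (pad k z))) (w0 \<omega>) \<partial>\<Omega>)"
      if "continuous_on UNIV \<Phi>" for \<Phi> :: "(nat \<Rightarrow> 'a) \<Rightarrow> real"
    proof (rule nn_integral_distr[OF w0_borel])
      have "(\<lambda>v. ennreal (\<Phi> v)) \<in> borel_measurable borel"
        using borel_measurable_continuous_onI[OF that] by simp
      then have "(\<lambda>z. ennreal (\<Phi> (pad k z))) \<in> borel_measurable (\<Pi>\<^sub>M j\<in>{..<k}. lborel :: 'a measure)"
        by (rule measurable_compose[OF pad_measurable])
      then show "slot_sum k (\<lambda>z. ennreal (\<Phi> (pad k z))) \<in> borel_measurable (distr \<Omega> ?B w0)"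
        by (rule borel_measurable_slot_sum) simp
    qed
    show "\<exists>C::real. \<forall>\<Phi> :: (nat \<Rightarrow> 'a) \<Rightarrow> real. continuous_on UNIV \<Phi> \<longrightarrow> (\<forall>v. 0 \<le> \<Phi> v) \<longrightarrow>
      (\<forall>v. \<Phi> v \<noteq> 0 \<longrightarrow> (\<forall>j<k. v j \<in> ball 0 R)) \<longrightarrow>
      (\<integral>\<^sup>+u. slot_sum k (\<lambda>z. ennreal (\<Phi> (pad k z))) u \<partial>distr \<Omega> ?B w0) \<le> ennreal C * (\<integral>\<^sup>+z. ennreal (\<Phi> (pad k z)) \<partial>(\<Pi>\<^sub>M j\<in>{..<k}. lborel))"
      using slot_w0[OF kR] by (simp only: distr cong: imp_cong)
  qed
  have "weakly_converges (\<lambda>n. distr (M (r n)) borel (\<lambda>x. configuration_of (N (r n)) (p (r n) x))) L.law"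
    unfolding weakly_converges_def
  proof (intro allI impI, elim conjE)
    fix \<Phi> :: "'a configuration \<Rightarrow> real" assume \<Phi>: "continuous_on UNIV \<Phi>" "bounded (range \<Phi>)"
    have \<Phi>_meas: "\<Phi> \<in> borel_measurable borel" by (rule borel_measurable_continuous_onI[OF \<Phi>(1)])
    obtain c where c: "\<And>\<xi>. \<bar>\<Phi> \<xi>\<bar> \<le> c" using \<Phi>(2) by (auto simp: bounded_iff)
    have \<Phi>d: "(\<lambda>u. \<Phi> (decode' u)) \<in> borel_measurable ?B"
      by (rule measurable_compose[OF borel_measurable_decode' \<Phi>_meas])
    have conf: "(\<lambda>x. configuration_of (N n) (p n x)) = (\<lambda>x. decode' (e n x))" for n
      by (simp add: fun_eq_iff decode'_def e_def enc_admissible decode_enc)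
    have "(\<integral>\<xi>. \<Phi> \<xi> \<partial>distr (M (r n)) borel (\<lambda>x. configuration_of (N (r n)) (p (r n) x))) = (\<integral>\<omega>. \<Phi> (decode' (w n \<omega>)) \<partial>\<Omega>)" for n
    proof -
      have "(\<integral>\<xi>. \<Phi> \<xi> \<partial>distr (M (r n)) borel (\<lambda>x. configuration_of (N (r n)) (p (r n) x))) = (\<integral>x. \<Phi> (decode' (e (r n) x)) \<partial>M (r n))"
        unfolding conf by (rule integral_distr[OF measurable_compose[OF e_borel borel_measurable_decode'] \<Phi>_meas])
      also have "\<dots> = (\<integral>u. \<Phi> (decode' u) \<partial>distr (M (r n)) ?B (e (r n)))"
        by (rule integral_distr[OF e_borel \<Phi>d, symmetric])
      also have "\<dots> = (\<integral>\<omega>. \<Phi> (decode' (w n \<omega>)) \<partial>\<Omega>)"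
        unfolding law_borel[symmetric] by (rule integral_distr[OF w_borel \<Phi>d])
      finally show ?thesis .
    qed
    moreover have "(\<integral>\<xi>. \<Phi> \<xi> \<partial>L.law) = (\<integral>\<omega>. \<Phi> (decode' (w0 \<omega>)) \<partial>\<Omega>)"
    proof -
      have "(\<integral>\<xi>. \<Phi> \<xi> \<partial>L.law) = (\<integral>u. \<Phi> (decode' u) \<partial>distr \<Omega> ?B w0)"
        unfolding L.law_def by (rule integral_distr[OF L.decode'_measurable \<Phi>_meas])
      also have "\<dots> = (\<integral>\<omega>. \<Phi> (decode' (w0 \<omega>)) \<partial>\<Omega>)"
        by (rule integral_distr[OF w0_borel \<Phi>d])
      finally show ?thesis .
    qed
    moreover have "(\<lambda>n. \<integral>\<omega>. \<Phi> (decode' (w n \<omega>)) \<partial>\<Omega>) \<longlonglongrightarrow> (\<integral>\<omega>. \<Phi> (decode' (w0 \<omega>)) \<partial>\<Omega>)"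
    proof (rule integral_dominated_convergence[where w="\<lambda>_. c"])
      show "(\<lambda>\<omega>. \<Phi> (decode' (w0 \<omega>))) \<in> borel_measurable \<Omega>" by (rule measurable_compose[OF w0_borel \<Phi>d])
      show "(\<lambda>\<omega>. \<Phi> (decode' (w n \<omega>))) \<in> borel_measurable \<Omega>" for n by (rule measurable_compose[OF w_borel \<Phi>d])
      show "AE \<omega> in \<Omega>. (\<lambda>n. \<Phi> (decode' (w n \<omega>))) \<longlonglongrightarrow> \<Phi> (decode' (w0 \<omega>))"
        using good adm0
      proof eventually_elim
        case (elim \<omega>)
        have "(\<lambda>n. \<Phi> (decode (w n \<omega>))) \<longlonglongrightarrow> \<Phi> (decode (w0 \<omega>))"
          by (rule decode_tendsto[OF \<Phi>(1)]; use elim in blast)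
        then show ?case using elim by (simp add: decode'_def)
      qed
    qed (use c in auto)
    ultimately show "(\<lambda>n. \<integral>\<xi>. \<Phi> \<xi> \<partial>distr (M (r n)) borel (\<lambda>x. configuration_of (N (r n)) (p (r n) x))) \<longlonglongrightarrow> (\<integral>\<xi>. \<Phi> \<xi> \<partial>L.law)"
      by simp
  qed
  then show ?thesis
    using r L.point_process_law L.AE_law_simple L.finite_correlation_functions_law
    unfolding simple_process_def by blast
qed

theorem corollary1p1:
  fixes V :: "'a::euclidean_space \<Rightarrow> real"
    and \<beta> m \<Lambda> C\<^sub>1 :: real
    and \<theta> :: "nat \<Rightarrow> real"
    and \<mu>\<^sub>\<theta> \<mu> :: "nat \<Rightarrow> 'a \<Rightarrow> real"
    and \<Sigma> :: "nat \<Rightarrow> 'a set"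
  assumes "2 \<le> DIM('a)"
    and "0 < \<beta>"
    and "\<And>N. \<theta> N = \<beta> * real N powr (2 / real DIM('a))"
    and "V \<in> borel_measurable borel"
    and "\<And>N. 1 \<le> N \<Longrightarrow> integrable lborel (\<lambda>x. exp (- (min 1 (\<theta> N) * V x)))"
    and "filterlim (\<lambda>x. V x + coulomb_kernel x) at_top at_infinity"
    and "\<And>N. 1 \<le> N \<Longrightarrow> partition_function V \<beta> N < \<infinity>"
    and "\<And>N. 1 \<le> N \<Longrightarrow> thermal_equilibrium (\<theta> N) V (\<mu>\<^sub>\<theta> N)"
    and "\<And>N. \<mu> N = blown_up N (\<mu>\<^sub>\<theta> N)"
    and "0 < m"
    and "\<And>N x. 1 \<le> N \<Longrightarrow> x \<in> \<Sigma> N \<Longrightarrow> m \<le> \<mu> N x \<and> \<mu> N x \<le> \<Lambda>"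
    and "\<And>N. DIM('a) = 2 \<Longrightarrow> 2 \<le> N \<Longrightarrow>
           \<Sigma> N \<in> sets borel \<and>
           measure (density lborel (\<lambda>x. ennreal (\<mu> N x))) (- \<Sigma> N) \<le> C\<^sub>1 * real N / ln (real N)"
    and "\<And>N. DIM('a) = 2 \<Longrightarrow> 2 \<le> N \<Longrightarrow>
           interaction_energy (\<mu> N) \<ge> - C\<^sub>1 * (real N)\<^sup>2 * ln (real N)"
    and "\<And>N. DIM('a) = 2 \<Longrightarrow> 1 \<le> N \<Longrightarrow>
           (\<integral>\<^sup>+z. ennreal (ln (norm z) * \<mu> N z) \<partial>lborel) < \<infinity>"
  shows "\<exists>C>0. \<forall>x :: nat \<Rightarrow> 'a.
           (\<forall>\<^sub>F N in sequentially.
              x N \<in> \<Sigma> N \<and>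
              C * real N powr (1 / (real DIM('a) + 2)) \<le> infdist (x N) (frontier (\<Sigma> N))) \<longrightarrow>
           (\<exists>r P. strict_mono r \<and> point_process P \<and>
              weakly_converges (\<lambda>n. local_law V \<beta> (r n) (x (r n))) P \<and>
              simple_process P \<and> finite_correlation_functions P)"
proof (intro exI[of _ 1] conjI allI impI)
  let ?d = "real DIM('a)"
  \<comment> \<open>The constant \<open>1\<close> is chosen for \<open>C\<close>, so that the window
    about the centre has radius \<open>N powr a\<close>, a positive power of
    \<open>N\<close>.\<close>
  define a where "a = 1 / (?d + 2)"
  define K0 where "K0 = ln (\<Lambda> / m) + \<beta> * \<Lambda> * (\<integral>y. excess (y::'a) \<partial>lborel)"
  have a: "0 < a" by (simp add: a_def)
  fix x :: "nat \<Rightarrow> 'a"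
  assume "\<forall>\<^sub>F N in sequentially. x N \<in> \<Sigma> N \<and> 1 * real N powr (1 / (?d + 2)) \<le> infdist (x N) (frontier (\<Sigma> N))"
  then obtain n\<^sub>0 where n\<^sub>0: "\<And>N. n\<^sub>0 \<le> N \<Longrightarrow> x N \<in> \<Sigma> N \<and> real N powr a \<le> infdist (x N) (frontier (\<Sigma> N))"
    by (auto simp: eventually_sequentially a_def)
  \<comment> \<open>The assumption on the centres holds eventually; after this shift it holds for
    all indices, and \<open>1 <= M n\<close>. Composing the shift with the extracted subsequence
    gives the subsequence of the statement.\<close>
  define M where "M n = n + Suc n\<^sub>0" for n
  define s where "s N = real N powr (- 1 / ?d)" for N :: nat
  have M: "1 \<le> M n" "n\<^sub>0 \<le> M n" for n by (simp_all add: M_def)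
  have window: "gas_window V \<beta> (s (M n)) (real (M n) powr a) K0 (M n) (x (M n))" for n
    unfolding s_def K0_def
  proof (rule gas_window_of_equilibrium)
    show R: "0 < real (M n) powr a" using M(1)[of n] by simp
    show "thermal_equilibrium (\<beta> * real (M n) powr (2 / ?d)) V (\<mu>\<^sub>\<theta> (M n))"
      using assms(8)[OF M(1)] unfolding assms(3) .
    fix y assume "y \<in> ball (x (M n)) (real (M n) powr a)"
    then have "y \<in> \<Sigma> (M n)"
      using ball_subset_of_infdist_frontier[OF _ R] n\<^sub>0[OF M(2)] by blast
    from assms(11)[OF M(1) this] show "m \<le> blown_up (M n) (\<mu>\<^sub>\<theta> (M n)) y \<and> blown_up (M n) (\<mu>\<^sub>\<theta> (M n)) y \<le> \<Lambda>"
      unfolding assms(9) .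
  qed (use assms M(1) in auto)
  have scale: "1 / s N = real N powr (1 / ?d)" for N
    by (simp add: s_def powr_minus_divide)
  have "\<exists>r P. strict_mono r \<and> point_process P \<and>
    weakly_converges (\<lambda>n. distr (gibbs_measure V \<beta> (M (r n))) borel
      (\<lambda>X. configuration_of (M (r n)) (\<lambda>i. (1 / s (M (r n))) *\<^sub>R X i - x (M (r n))))) P \<and>
    simple_process P \<and> finite_correlation_functions P"
  proof (rule ex_limit_process)
    fix n
    interpret gas_window V \<beta> "s (M n)" "real (M n) powr a" K0 "M n" "x (M n)" by (rule window)
    show "prob_space (gibbs_measure V \<beta> (M n))" by (rule prob_space_G)
    show "(\<lambda>X. (1 / s (M n)) *\<^sub>R X i - x (M n)) \<in> borel_measurable (gibbs_measure V \<beta> (M n))" if "i < M n" for i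
      using borel_measurable_Y[OF that] by (simp cong: measurable_cong_sets add: sets_G Y_def)
  next
    fix k :: nat and \<rho> :: real assume k: "1 \<le> k" and \<rho>: "0 < \<rho>"
    from ex_tuple_sum_constant[OF assms(1,2) \<rho> k, of K0]
    obtain C :: real where C: "\<forall>V s R N (x::'a) J. gas_window V \<beta> s R K0 N x \<longrightarrow> \<rho> + 3 * real J + 3 \<le> R \<longrightarrow> real N ^ k \<le> 2 ^ J \<longrightarrow>
      (\<forall>\<psi> \<in> borel_measurable (\<Pi>\<^sub>M j\<in>{..<k}. lborel). (\<forall>z. \<psi> z \<noteq> 0 \<longrightarrow> (\<forall>j<k. z j \<in> ball 0 \<rho>)) \<longrightarrow>
        (\<Sum>\<sigma>\<in>tuples k {..<N}. \<integral>\<^sup>+X. \<psi> (\<lambda>j\<in>{..<k}. (1 / s) *\<^sub>R X (\<sigma> j) - x) \<partial>gibbs_measure V \<beta> N) \<le>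
          ennreal C * (\<integral>\<^sup>+z. \<psi> z \<partial>(\<Pi>\<^sub>M j\<in>{..<k}. lborel)))" ..
    have ev: "\<forall>\<^sub>F n in sequentially. \<exists>J. \<rho> + 3 * real J + 3 \<le> real (M n) powr a \<and> real (M n) ^ k \<le> 2 ^ J"
      unfolding M_def by (rule sequentially_offset) (rule eventually_ex_iterations[OF a])
    show "\<exists>C::real. \<forall>\<^sub>F n in sequentially.
      \<forall>\<psi> \<in> borel_measurable (\<Pi>\<^sub>M j\<in>{..<k}. lborel :: 'a measure). (\<forall>z. \<psi> z \<noteq> 0 \<longrightarrow> (\<forall>j<k. z j \<in> ball 0 \<rho>)) \<longrightarrow>
        (\<Sum>\<sigma>\<in>tuples k {..<M n}. \<integral>\<^sup>+X. \<psi> (\<lambda>j\<in>{..<k}. (1 / s (M n)) *\<^sub>R X (\<sigma> j) - x (M n)) \<partial>gibbs_measure V \<beta> (M n)) \<le>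
          ennreal C * (\<integral>\<^sup>+z. \<psi> z \<partial>(\<Pi>\<^sub>M j\<in>{..<k}. lborel))"
    proof (rule exI[of _ C], use ev in eventually_elim)
      fix n assume "\<exists>J. \<rho> + 3 * real J + 3 \<le> real (M n) powr a \<and> real (M n) ^ k \<le> 2 ^ J"
      then obtain J where "\<rho> + 3 * real J + 3 \<le> real (M n) powr a" "real (M n) ^ k \<le> 2 ^ J" by blast
      note C[THEN spec, THEN spec, THEN spec, THEN spec, THEN spec, THEN spec, THEN mp, THEN mp, THEN mp, OF window this]
      then show "\<forall>\<psi> \<in> borel_measurable (\<Pi>\<^sub>M j\<in>{..<k}. lborel :: 'a measure). (\<forall>z. \<psi> z \<noteq> 0 \<longrightarrow> (\<forall>j<k. z j \<in> ball 0 \<rho>)) \<longrightarrow>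
        (\<Sum>\<sigma>\<in>tuples k {..<M n}. \<integral>\<^sup>+X. \<psi> (\<lambda>j\<in>{..<k}. (1 / s (M n)) *\<^sub>R X (\<sigma> j) - x (M n)) \<partial>gibbs_measure V \<beta> (M n)) \<le>
          ennreal C * (\<integral>\<^sup>+z. \<psi> z \<partial>(\<Pi>\<^sub>M j\<in>{..<k}. lborel))" .
    qed
  qed
  then obtain r P where r: "strict_mono (r :: nat \<Rightarrow> nat)" and P: "point_process P"
    "weakly_converges (\<lambda>n. local_law V \<beta> (M (r n)) (x (M (r n)))) P" "simple_process P" "finite_correlation_functions P"
    unfolding scale local_law_def by blast
  have "strict_mono (\<lambda>n. M (r n))" using r by (simp add: strict_mono_def M_def)
  with P show "\<exists>r P. strict_mono r \<and> point_process P \<and>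
      weakly_converges (\<lambda>n. local_law V \<beta> (r n) (x (r n))) P \<and>
      simple_process P \<and> finite_correlation_functions P"
    by (intro exI[of _ "\<lambda>n. M (r n)"] exI[of _ P] conjI)
qed simp

end
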